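(* Let $c_v > \frac 12$ and let the Riemann initial data be such that the 1D Riemann solution consists either of a 1-shock and a 3-shock, or of a 1-shock, a 2-contact discontinuity and a 3-shock. Then there exist infinitely many admissible weak solutions to the Riemann problem for the full Euler system described below. These solutions are all $2$-fan solutions.
   Context: Consider the full compressible Euler system in $\mathbb{R}^2$: $\partial_t \varrho + \operatorname{div}(\varrho\mathbf{v}) = 0$, $\partial_t(\varrho\mathbf{v}) + \operatorname{div}(\varrho\mathbf{v}\otimes\mathbf{v}) + \nabla_x p = 0$, $\partial_t\big(\tfrac12\varrho|\mathbf{v}|^2 + \varrho e(\varrho,p)\big) + \operatorname{div}\big[\big(\tfrac12\varrho|\mathbf{v}|^2 + \varrho e(\varrho,p) + p\big)\mathbf{v}\big] = 0$, with unknowns density $\varrho>0$, velocity $\mathbf{v}\in\mathbb{R}^2$, pressure $p>0$, for an ideal gas $e(\varrho,p) = c_v\,p/\varrho$ with constant $c_v>0$, supplemented by the entropy inequality $\partial_t(\varrho s(\varrho,p)) + \operatorname{div}(\varrho s(\varrho,p)\mathbf{v}) \geq 0$ with $s(\varrho,p) = \log\big(p^{c_v}/\varrho^{c_v+1}\big)$. The initial data are Riemann data $(\varrho^0,\mathbf{v}^0,p^0)(x) = (\varrho_-,\mathbf{v}_-,p_-)$ for $x_2<0$ and $(\varrho_+,\mathbf{v}_+,p_+)$ for $x_2>0$, with constants $\varrho_\pm,p_\pm>0$, $\mathbf{v}_\pm\in\mathbb{R}^2$, and first velocity components $v_{-,1}=v_{+,1}=0$. The 1D Riemann solution is the unique self-similar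 BV solution of the corresponding 1D Riemann problem in the variable $x_2$ (with $v_1\equiv 0$), consisting of a 1-wave (shock or rarefaction), a 2-contact discontinuity (possibly absent), and a 3-wave (shock or rarefaction). An admissible weak solution is a triple $(\varrho,\mathbf{v},p)\in L^\infty$ satisfying the three conservation laws with the initial data in the sense of distributions and the entropy inequality in the distributional sense against nonnegative test functions (including initial data term). A $2$-fan solution is an admissible weak solution for which there exist real numbers $\mu_0<\mu_1<\mu_2$ defining the open sets $\Omega_- = \{t>0, x_2<\mu_0 t\}$, $\Omega_1=\{t>0,\mu_0 t<x_2<\mu_1 t\}$, $\Omega_2=\{t>0,\mu_1 t<x_2<\mu_2 t\}$, $\Omega_+=\{t>0, x_2>\mu_2 t\}$, such that $(\varrho,p)$ and $|\mathbf{v}|^2$ are constant on each of these sets and $(\varrho,\mathbf{v},p) = (\varrho_\pm,\mathbf{v}_\pm,p_\pm)$ on $\Omega_\pm$. *)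

theory Defs
  imports "HOL-Analysis.Analysis"
begin

(* Space-time points y = (t, x1, x2). *)
type_synonym pt = "real \<times> real \<times> real"


definition Hplus :: "pt set" where "Hplus = {y. fst y > 0}"

definition e_dir :: "nat \<Rightarrow> pt" where
  "e_dir i = (if i = 0 then (1,0,0) else if i = 1 then (0,1,0) else (0,0,1))"

definition pd :: "nat \<Rightarrow> (pt \<Rightarrow> real) \<Rightarrow> pt \<Rightarrow> real" where
  "pd i g = (\<lambda>y. frechet_derivative g (at y) (e_dir i))"

definition smooth3 :: "(pt \<Rightarrow> real) \<Rightarrow> bool" where
  "smooth3 g \<longleftrightarrow> (\<forall>is. \<forall>y. (fold pd is g) differentiable (at y))"

(* test functions C_c^\<infinity>([0,\<infinity>) x R^2): restrictions of C_c^\<infinity>(R^3) functions *)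
definition test_fun :: "(pt \<Rightarrow> real) \<Rightarrow> bool" where
  "test_fun \<phi> \<longleftrightarrow> smooth3 \<phi> \<and> compact (closure {y. \<phi> y \<noteq> 0})"

(* integrand and initial term of the weak form of  d_t eta + div_x (F1,F2) = 0  with eta(0) = eta0 *)
definition wf_int :: "(pt \<Rightarrow> real) \<Rightarrow> (pt \<Rightarrow> real) \<Rightarrow> (pt \<Rightarrow> real) \<Rightarrow> (pt \<Rightarrow> real) \<Rightarrow> pt \<Rightarrow> real" where
  "wf_int \<eta> F1 F2 \<phi> y = \<eta> y * pd 0 \<phi> y + F1 y * pd 1 \<phi> y + F2 y * pd 2 \<phi> y"

definition wf_init :: "(real \<times> real \<Rightarrow> real) \<Rightarrow> (pt \<Rightarrow> real) \<Rightarrow> real \<times> real \<Rightarrow> real" where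
  "wf_init \<eta>0 \<phi> x = \<eta>0 x * \<phi> (0, fst x, snd x)"

definition wf_value :: "(pt \<Rightarrow> real) \<Rightarrow> (pt \<Rightarrow> real) \<Rightarrow> (pt \<Rightarrow> real) \<Rightarrow> (real \<times> real \<Rightarrow> real) \<Rightarrow> (pt \<Rightarrow> real) \<Rightarrow> real" where
  "wf_value \<eta> F1 F2 \<eta>0 \<phi> =
     (LINT y:Hplus|lborel. wf_int \<eta> F1 F2 \<phi> y) + (LINT x|lborel. wf_init \<eta>0 \<phi> x)"

definition wf_integrable :: "(pt \<Rightarrow> real) \<Rightarrow> (pt \<Rightarrow> real) \<Rightarrow> (pt \<Rightarrow> real) \<Rightarrow> (real \<times> real \<Rightarrow> real) \<Rightarrow> (pt \<Rightarrow> real) \<Rightarrow> bool" where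
  "wf_integrable \<eta> F1 F2 \<eta>0 \<phi> \<longleftrightarrow>
     set_integrable lborel Hplus (wf_int \<eta> F1 F2 \<phi>) \<and> integrable lborel (wf_init \<eta>0 \<phi>)"

definition distr_eq :: "(pt \<Rightarrow> real) \<Rightarrow> (pt \<Rightarrow> real) \<Rightarrow> (pt \<Rightarrow> real) \<Rightarrow> (real \<times> real \<Rightarrow> real) \<Rightarrow> bool" where
  "distr_eq \<eta> F1 F2 \<eta>0 \<longleftrightarrow>
     (\<forall>\<phi>. test_fun \<phi> \<longrightarrow> wf_integrable \<eta> F1 F2 \<eta>0 \<phi> \<and> wf_value \<eta> F1 F2 \<eta>0 \<phi> = 0)"

definition distr_ge :: "(pt \<Rightarrow> real) \<Rightarrow> (pt \<Rightarrow> real) \<Rightarrow> (pt \<Rightarrow> real) \<Rightarrow> (real \<times> real \<Rightarrow> real) \<Rightarrow> bool" where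
  "distr_ge \<eta> F1 F2 \<eta>0 \<longleftrightarrow>
     (\<forall>\<phi>. test_fun \<phi> \<and> (\<forall>y. \<phi> y \<ge> 0) \<longrightarrow>
        wf_integrable \<eta> F1 F2 \<eta>0 \<phi> \<and> wf_value \<eta> F1 F2 \<eta>0 \<phi> \<le> 0)"

definition entr :: "real \<Rightarrow> real \<Rightarrow> real \<Rightarrow> real" where
  "entr cv r q = ln (q powr cv / r powr (cv + 1))"

(* total energy density 1/2 rho |v|^2 + rho e(rho,p),  rho e = cv p *)
definition energy :: "real \<Rightarrow> real \<Rightarrow> real \<Rightarrow> real \<Rightarrow> real \<Rightarrow> real" where
  "energy cv r w1 w2 q = r * (w1\<^sup>2 + w2\<^sup>2) / 2 + cv * q"

definition riem :: "real \<Rightarrow> real \<Rightarrow> real \<times> real \<Rightarrow> real" where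
  "riem a b x = (if snd x < 0 then a else b)"

definition admissible_sol ::
  "real \<Rightarrow> real \<Rightarrow> real \<times> real \<Rightarrow> real \<Rightarrow> real \<Rightarrow> real \<times> real \<Rightarrow> real \<Rightarrow>
   (pt \<Rightarrow> real) \<Rightarrow> (pt \<Rightarrow> real) \<Rightarrow> (pt \<Rightarrow> real) \<Rightarrow> (pt \<Rightarrow> real) \<Rightarrow> bool" where
  "admissible_sol cv rl vl pl rr vr pr \<rho> v1 v2 p \<longleftrightarrow>
     (let \<rho>0 = riem rl rr; u1 = riem (fst vl) (fst vr); u2 = riem (snd vl) (snd vr); p0 = riem pl pr;
          E = (\<lambda>y. energy cv (\<rho> y) (v1 y) (v2 y) (p y));
          E0 = (\<lambda>x. energy cv (\<rho>0 x) (u1 x) (u2 x) (p0 x));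
          S = (\<lambda>y. \<rho> y * entr cv (\<rho> y) (p y));
          S0 = (\<lambda>x. \<rho>0 x * entr cv (\<rho>0 x) (p0 x))
      in \<rho> \<in> borel_measurable lborel \<and> v1 \<in> borel_measurable lborel \<and>
         v2 \<in> borel_measurable lborel \<and> p \<in> borel_measurable lborel \<and>
         (\<exists>M. \<forall>y\<in>Hplus. \<bar>\<rho> y\<bar> \<le> M \<and> \<bar>v1 y\<bar> \<le> M \<and> \<bar>v2 y\<bar> \<le> M \<and> \<bar>p y\<bar> \<le> M) \<and>
         (\<forall>y\<in>Hplus. \<rho> y > 0 \<and> p y > 0) \<and>
         distr_eq \<rho> (\<lambda>y. \<rho> y * v1 y) (\<lambda>y. \<rho> y * v2 y) \<rho>0 \<and>
         distr_eq (\<lambda>y. \<rho> y * v1 y) (\<lambda>y. \<rho> y * v1 y * v1 y + p y) (\<lambda>y. \<rho> y * v1 y * v2 y)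
                  (\<lambda>x. \<rho>0 x * u1 x) \<and>
         distr_eq (\<lambda>y. \<rho> y * v2 y) (\<lambda>y. \<rho> y * v2 y * v1 y) (\<lambda>y. \<rho> y * v2 y * v2 y + p y)
                  (\<lambda>x. \<rho>0 x * u2 x) \<and>
         distr_eq E (\<lambda>y. (E y + p y) * v1 y) (\<lambda>y. (E y + p y) * v2 y) E0 \<and>
         distr_ge S (\<lambda>y. S y * v1 y) (\<lambda>y. S y * v2 y) S0)"

definition fan_region :: "real \<Rightarrow> real \<Rightarrow> pt set" where
  "fan_region a b = {y. fst y > 0 \<and> a * fst y < snd (snd y) \<and> snd (snd y) < b * fst y}"

definition is_2fan ::
  "real \<Rightarrow> real \<times> real \<Rightarrow> real \<Rightarrow> real \<Rightarrow> real \<times> real \<Rightarrow> real \<Rightarrow>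
   (pt \<Rightarrow> real) \<Rightarrow> (pt \<Rightarrow> real) \<Rightarrow> (pt \<Rightarrow> real) \<Rightarrow> (pt \<Rightarrow> real) \<Rightarrow> bool" where
  "is_2fan rl vl pl rr vr pr \<rho> v1 v2 p \<longleftrightarrow>
     (\<exists>\<mu>0 \<mu>1 \<mu>2. \<mu>0 < \<mu>1 \<and> \<mu>1 < \<mu>2 \<and>
        (\<forall>y. fst y > 0 \<and> snd (snd y) < \<mu>0 * fst y \<longrightarrow>
              \<rho> y = rl \<and> v1 y = fst vl \<and> v2 y = snd vl \<and> p y = pl) \<and>
        (\<forall>y. fst y > 0 \<and> snd (snd y) > \<mu>2 * fst y \<longrightarrow>
              \<rho> y = rr \<and> v1 y = fst vr \<and> v2 y = snd vr \<and> p y = pr) \<and>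
        (\<exists>r q w. \<forall>y\<in>fan_region \<mu>0 \<mu>1. \<rho> y = r \<and> p y = q \<and> (v1 y)\<^sup>2 + (v2 y)\<^sup>2 = w) \<and>
        (\<exists>r q w. \<forall>y\<in>fan_region \<mu>1 \<mu>2. \<rho> y = r \<and> p y = q \<and> (v1 y)\<^sup>2 + (v2 y)\<^sup>2 = w))"

(* ---- 1D Riemann problem (in x2, normal velocity u = v2, v1 = 0) ---- *)

(* sound speed, gamma = 1 + 1/cv *)
definition sound :: "real \<Rightarrow> real \<Rightarrow> real \<Rightarrow> real" where
  "sound cv r q = sqrt ((1 + 1 / cv) * q / r)"

definition RH1D :: "real \<Rightarrow> real \<times> real \<times> real \<Rightarrow> real \<times> real \<times> real \<Rightarrow> real \<Rightarrow> bool" where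
  "RH1D cv L R \<sigma> \<longleftrightarrow>
     (case L of (rL, uL, qL) \<Rightarrow> case R of (rR, uR, qR) \<Rightarrow>
        \<sigma> * (rR - rL) = rR * uR - rL * uL \<and>
        \<sigma> * (rR * uR - rL * uL) = (rR * uR\<^sup>2 + qR) - (rL * uL\<^sup>2 + qL) \<and>
        \<sigma> * (energy cv rR 0 uR qR - energy cv rL 0 uL qL) =
           (energy cv rR 0 uR qR + qR) * uR - (energy cv rL 0 uL qL + qL) * uL)"

definition shock1 :: "real \<Rightarrow> real \<times> real \<times> real \<Rightarrow> real \<times> real \<times> real \<Rightarrow> real \<Rightarrow> bool" where
  "shock1 cv L R \<sigma> \<longleftrightarrow> RH1D cv L R \<sigma> \<and>
     (case L of (rL, uL, qL) \<Rightarrow> case R of (rR, uR, qR) \<Rightarrow>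
        uR - sound cv rR qR < \<sigma> \<and> \<sigma> < uL - sound cv rL qL \<and> \<sigma> < uR)"

definition shock3 :: "real \<Rightarrow> real \<times> real \<times> real \<Rightarrow> real \<times> real \<times> real \<Rightarrow> real \<Rightarrow> bool" where
  "shock3 cv L R \<sigma> \<longleftrightarrow> RH1D cv L R \<sigma> \<and>
     (case L of (rL, uL, qL) \<Rightarrow> case R of (rR, uR, qR) \<Rightarrow>
        uR + sound cv rR qR < \<sigma> \<and> \<sigma> < uL + sound cv rL qL \<and> uL < \<sigma>)"

(* The 1D Riemann solution consists of a 1-shock, a (possibly absent) 2-contact and a 3-shock:
   U_- --1-shock--> (ra, um, pm) --contact (absent iff ra = rb)--> (rb, um, pm) --3-shock--> U_+ *)
definition riemann_shock_shock ::
  "real \<Rightarrow> real \<Rightarrow> real \<times> real \<Rightarrow> real \<Rightarrow> real \<Rightarrow> real \<times> real \<Rightarrow> real \<Rightarrow> bool" where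
  "riemann_shock_shock cv rl vl pl rr vr pr \<longleftrightarrow>
     (\<exists>ra rb um pm \<sigma>1 \<sigma>3. ra > 0 \<and> rb > 0 \<and> pm > 0 \<and>
        shock1 cv (rl, snd vl, pl) (ra, um, pm) \<sigma>1 \<and>
        shock3 cv (rb, um, pm) (rr, snd vr, pr) \<sigma>3)"

definition qval :: "(pt \<Rightarrow> real) \<times> (pt \<Rightarrow> real) \<times> (pt \<Rightarrow> real) \<times> (pt \<Rightarrow> real) \<Rightarrow> pt \<Rightarrow> real \<times> real \<times> real \<times> real" where
  "qval U y = (case U of (a, b, c, d) \<Rightarrow> (a y, b y, c y, d y))"

end

theory Submission
  imports Defs
begin

text \<open>Lower the intermediate pressure \<open>p\<^sub>m\<close> of the 1D solution slightly, keeping the intermediate velocity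
  \<open>\<beta> = u\<^sub>m\<close>, and adjust the densities and the two shock speeds so that mass and momentum are still
  conserved across the shocks. The weaker shocks leave a surplus of energy, which is assigned to velocity
  fluctuations: \<open>(\<rho>, (0, \<beta>), p)\<close> becomes a strict subsolution of the incompressible Euler system in each
  of the two fan regions, with prescribed kinetic energy. The entropy inequality is strict for the
  original shocks, hence it survives the perturbation. Convex integration with localized potential
  plane waves supplies fluctuations with vanishing weak divergence (and momentum balance) that attain the
  prescribed \<open>|v|\<^sup>2\<close>; since density and pressure are constant in each region, adding them solves all
  equations. The increments are chosen almost orthogonal in \<open>L\<^sup>2\<close> to everything built before, which
  yields strong convergence, and also separates the limits that start from disjointly supported waves.\<close>

section \<open>Compactly supported oscillating profiles\<close>

text \<open>The obstacle on the gas dynamics side is that the 1D solution lies on the boundary of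
  the relaxation set: its velocity variances are zero, and both must become positive on both sides
  of the contact at once. With the velocity kept and a total normal pressure P < \<open>pm\<close>
  prescribed, mass and momentum fix density and shock speed, and the energy balance then yields the
  tangential variance. As a function of P it vanishes at \<open>pm\<close> and decreases strictly,
  hence it is positive below \<open>pm\<close>. A second, much smaller parameter \<delta> moves part
  of P from the gas pressure into the normal variance. Sharing \<delta> between the two sides
  balances normal momentum on the central line, whose speed is the mean velocity, so that mass,
  energy and entropy balance there for any two densities. On the convex integration side the fan
  regions have infinite measure, so energies carry an integrable weight, and the gain of a step must
  be bounded below by the squared energy gap with a constant that ignores the current state; this is
  why the speeds of the plane waves are bounded in terms of C alone.\<close>

definition prof :: "nat \<Rightarrow> real \<Rightarrow> real" where
  "prof k x = (10 * sin (x + k * pi / 2) - 5 * 3^k * sin (3 * x + k * pi / 2)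
     + 5^k * sin (5 * x + k * pi / 2)) / 16"

text \<open>From 16 sin^5 x = 10 sin x - 5 sin 3x + sin 5x, \<open>prof 0\<close> is sin^5. Each
  derivative multiplies a term by its frequency and advances the phase by pi/2, so
  \<open>prof k\<close> is the k-th derivative of sin^5 in closed form.\<close>

lemma prof_deriv: "(prof k has_real_derivative prof (Suc k) x) (at x)"
proof -
  have e: "sin (y + (1 + real k) * pi / 2) = cos (y + k * pi / 2)" for y
  proof -
    have "y + (1 + real k) * pi / 2 = (y + k * pi / 2) + pi / 2" by (simp add: field_simps)
    then show ?thesis by (simp only: sin_add) simp
  qed
  show ?thesis
    unfolding prof_def [abs_def] of_nat_Suc e
    by (auto intro!: derivative_eq_intros simp: field_simps)
qed

lemma prof_cont: "continuous_on UNIV (prof k)"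
  using prof_deriv by (meson DERIV_isCont continuous_at_imp_continuous_on)

text \<open>For even k every sine vanishes. For odd k the three cosines agree up to a sign pattern
  that leaves the factor 10 - 5 3^k + 5^k, which is zero for k = 1 and k = 3 and no longer for k =
  5.\<close>

lemma prof_zero: assumes "k \<le> 4" shows "prof k (pi * real N) = 0"
proof -
  have s: "sin (real m * (pi * real N)) = 0" for m
    by (metis mult.assoc mult.commute of_nat_mult sin_npi)
  have c: "cos (3 * (pi * real N)) = cos (pi * real N)" "cos (5 * (pi * real N)) = cos (pi * real N)"
    using cos_npi[of N] cos_npi[of "3*N"] cos_npi[of "5*N"]
    by (auto simp: mult_ac power_mult power3_eq_cube) (auto simp: eval_nat_numeral)
  have s3: "sin (3 * (pi * real N)) = 0" "sin (5 * (pi * real N)) = 0" "sin (pi * real N) = 0"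
    using s[of 3] s[of 5] s[of 1] by auto
  have k: "k = 0 \<or> k = 1 \<or> k = 2 \<or> k = 3 \<or> k = 4" using assms by auto
  show ?thesis unfolding prof_def sin_add s3 c using k by auto
qed

text \<open>The constant exceeds (10 + 5 27 + 125) / 16, the sum of the amplitudes at k = 3.\<close>

lemma prof_bound: assumes "k \<le> 3" shows "\<bar>prof k x\<bar> \<le> 17"
proof -
  have p: "(3::real)^k \<le> 27" "(5::real)^k \<le> 125"
    using power_increasing[OF assms, of "3::real"] power_increasing[OF assms, of "5::real"] by auto
  have a: "\<bar>10 * sin (x + k * pi / 2)\<bar> \<le> 10" by (simp add: abs_mult)
  have b: "\<bar>5 * 3^k * sin (3 * x + k * pi / 2)\<bar> \<le> 5 * 27 * 1"
    unfolding abs_mult by (intro mult_mono) (use p in auto)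
  have c: "\<bar>5^k * sin (5 * x + k * pi / 2)\<bar> \<le> 125 * 1"
    unfolding abs_mult by (intro mult_mono) (use p in auto)
  show ?thesis unfolding prof_def using abs_triangle_ineq4 [of "10 * sin (x + k * pi / 2)" "5 * 3^k * sin (3 * x + k * pi / 2)"]
      abs_triangle_ineq [of "10 * sin (x + k * pi / 2) - 5 * 3^k * sin (3 * x + k * pi / 2)" "5^k * sin (5 * x + k * pi / 2)"]
      a b c by simp
qed

text \<open>The three sines are orthogonal over the interval, so only half the sum of the squared
  amplitudes 10, 5 3^k, 5^k remains. Sums and differences of the odd frequencies 1, 3, 5 are even,
  so N half periods are whole periods of all products and the parity of N does not matter. An
  explicit antiderivative \<open>G\<close> carries this out.\<close>

lemma prof_sq_integral:
  assumes N: "N > 0"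
  shows "(\<integral>\<^sup>+s. ennreal ((prof k (pi * real N * s))\<^sup>2) * indicator {0..1} s \<partial>lborel)
    = ennreal ((100 + 25 * 9^k + 25^k) / 512)"
proof -
  define f where "f = real k * pi / 2"
  define A B C where "A = (10::real)" and "B = - 5 * (3::real)^k" and "C = (5::real)^k"
  define a where "a = pi * real N"
  have a0: "a > 0" using N by (simp add: a_def)
  define K where "K c m x = sin (m * a * x + c) / (m * a)" for c m x
  have K: "(K c m has_real_derivative cos (m * a * x + c)) (at x)" if "m \<noteq> 0" for c m x
    unfolding K_def [abs_def] using a0 that by (auto intro!: derivative_eq_intros)
  define G where "G x = ((A\<^sup>2 + B\<^sup>2 + C\<^sup>2) * x / 2
      - A\<^sup>2 * K (2*f) 2 x / 2 - B\<^sup>2 * K (2*f) 6 x / 2 - C\<^sup>2 * K (2*f) 10 x / 2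
      + A*B*(K 0 2 x - K (2*f) 4 x) + A*C*(K 0 4 x - K (2*f) 6 x) + B*C*(K 0 2 x - K (2*f) 8 x)) / 256" for x
  have ss: "sin y * sin z = (cos (y - z) - cos (y + z)) / 2" for y z :: real
    by (simp add: cos_diff cos_add)
  have pr: "(prof k (a * x))\<^sup>2 = (A\<^sup>2 * (1 - cos (2*a*x+2*f))/2 + B\<^sup>2 * (1 - cos (6*a*x+2*f))/2
       + C\<^sup>2 * (1 - cos (10*a*x+2*f))/2
       + A*B*(cos (2*a*x) - cos (4*a*x+2*f)) + A*C*(cos (4*a*x) - cos (6*a*x+2*f))
       + B*C*(cos (2*a*x) - cos (8*a*x+2*f))) / 256" for x
  proof -
    define X Y Z where "X = a*x + f" and "Y = 3*(a*x) + f" and "Z = 5*(a*x) + f"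
    have p: "prof k (a*x) = (A * sin X + B * sin Y + C * sin Z) / 16"
      by (simp add: prof_def A_def B_def C_def X_def Y_def Z_def f_def)
    have "X + X = 2*a*x+2*f" "Y + Y = 6*a*x+2*f" "Z + Z = 10*a*x+2*f"
       "Y - X = 2*a*x" "Z - X = 4*a*x" "Z - Y = 2*a*x" "Y + X = 4*a*x+2*f" "Z+X = 6*a*x+2*f" "Z+Y=8*a*x+2*f"
      by (auto simp: X_def Y_def Z_def)
    note angles = this
    have q: "sin X * sin X = (1 - cos (2*a*x+2*f)) / 2" "sin Y * sin Y = (1 - cos (6*a*x+2*f)) / 2"
      "sin Z * sin Z = (1 - cos (10*a*x+2*f)) / 2" "sin Y * sin X = (cos (2*a*x) - cos (4*a*x+2*f)) / 2"
      "sin Z * sin X = (cos (4*a*x) - cos (6*a*x+2*f)) / 2" "sin Z * sin Y = (cos (2*a*x) - cos (8*a*x+2*f)) / 2"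
      unfolding ss angles by simp_all
    have "(prof k (a*x))\<^sup>2 = (A\<^sup>2 * (sin X * sin X) + B\<^sup>2 * (sin Y * sin Y) + C\<^sup>2 * (sin Z * sin Z)
       + 2 * A*B*(sin Y * sin X) + 2*A*C*(sin Z * sin X) + 2*B*C*(sin Z * sin Y)) / 256"
      unfolding p by (simp add: power2_eq_square algebra_simps)
    then show ?thesis unfolding q by simp
  qed
  have D: "(G has_real_derivative (prof k (a*x))\<^sup>2) (at x)" for x
    unfolding pr unfolding G_def [abs_def]
    by (auto intro!: derivative_eq_intros K simp: field_simps)
  have sn: "sin (real m * a) = 0" "cos (real m * a) = (-1)^(m*N)" for m
    using sin_npi[of "m*N"] cos_npi[of "m*N"] by (simp_all add: a_def mult_ac)
  have sf: "sin (real (2*m) * a + g) = sin g" for m g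
    by (simp add: sin_add sn[of "2*m", simplified])
  have "sin (2*a+g) = sin g" "sin (4*a+g) = sin g" "sin (6*a+g) = sin g" "sin (8*a+g) = sin g" "sin (10*a+g) = sin g" for g
    using sf[of 1] sf[of 2] sf[of 3] sf[of 4] sf[of 5] by simp_all
  note per = this
  have "K c 2 1 = K c 2 0" "K c 4 1 = K c 4 0" "K c 6 1 = K c 6 0" "K c 8 1 = K c 8 0" "K c 10 1 = K c 10 0" for c
    using per[of c] by (simp_all add: K_def)
  then have G: "G 1 - G 0 = (A\<^sup>2+B\<^sup>2+C\<^sup>2)/512"
    unfolding G_def by (simp add: field_simps)
  have "(\<integral>\<^sup>+s. ennreal ((prof k (a * s))\<^sup>2) * indicator {0..1} s \<partial>lborel) = ennreal (G 1 - G 0)"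
    by (rule nn_integral_FTC_Icc) (use D in \<open>auto intro!: borel_measurable_continuous_onI
      continuous_intros continuous_on_compose2[OF prof_cont]\<close>)
  moreover have "A\<^sup>2+B\<^sup>2+C\<^sup>2 = 100 + 25 * 9^k + 25^k"
    by (simp add: A_def B_def C_def power_mult_distrib power2_eq_square flip: power_mult_distrib)
  ultimately show ?thesis unfolding G a_def by simp
qed

text \<open>\<open>sin\<^sup>5\<close> vanishes to fourth order at its zeros, so its restriction to a union of periods is \<open>C\<^sup>4\<close>.\<close>

definition bump :: "nat \<Rightarrow> nat \<Rightarrow> real \<Rightarrow> real" where
  "bump N k s = (if s \<in> {0..1} then (pi * N)^k * prof k (pi * N * s) else 0)"

lemma bump_deriv:
  assumes k: "k \<le> 3"
  shows "(bump N k has_real_derivative bump N (Suc k) s) (at s)"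
proof -
  define g where "g k s = (pi * N)^k * prof k (pi * N * s)" for k and s :: real
  have g: "(g k has_real_derivative g (Suc k) s) (at s within S)" for k s S
    unfolding g_def [abs_def]
    by (auto intro!: derivative_eq_intros DERIV_chain2[OF prof_deriv] simp: mult_ac)
  have z: "g j 0 = 0" "g j 1 = 0" if "j \<le> 4" for j
    using prof_zero[OF that, of 0] prof_zero[OF that, of N] by (auto simp: g_def)
  have e: "bump N j = (\<lambda>s. if s \<in> {0..1} then g j s else 0)" for j
    by (auto simp: bump_def g_def fun_eq_iff)
  have cl: "closure {0..1::real} = {0..1}" by simp
  have cl2: "closure (- {0..1::real}) = - {0<..<1}" by (simp add: closure_complement)
  have "((\<lambda>s. if s \<in> {0..1} then g k s else 0) has_vector_derivative
      (if s \<in> {0..1} then g (Suc k) s else 0)) (at s within UNIV)"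
  proof (rule has_vector_derivative_If_within_closures[where T = "- {0..1}"])
    have "s = 0 \<or> s = 1" if "s \<in> closure {0..1}" "s \<in> closure (- {0..1})"
      using that unfolding cl cl2 by auto
    then show "s \<in> closure {0..1} \<Longrightarrow> s \<in> closure (- {0..1}) \<Longrightarrow> g k s = 0"
      "s \<in> closure {0..1} \<Longrightarrow> s \<in> closure (- {0..1}) \<Longrightarrow> g (Suc k) s = 0"
      using z[of k] z[of "Suc k"] k by auto
    show "(g k has_vector_derivative g (Suc k) s) (at s within S)" for S
      using g by (simp add: has_real_derivative_iff_has_vector_derivative)
  qed simp_all
  then show ?thesis unfolding e by (simp add: has_real_derivative_iff_has_vector_derivative)
qed

lemma bump_cont: assumes k: "k \<le> 4" shows "continuous_on UNIV (bump N k)"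
proof -
  define g where "g s = (pi * N)^k * prof k (pi * N * s)" for s :: real
  have g: "continuous_on S g" for S
    unfolding g_def [abs_def]
    by (intro continuous_intros continuous_on_compose2[OF prof_cont]) auto
  have z: "g 0 = 0" "g 1 = 0"
    using prof_zero[OF k, of 0] prof_zero[OF k, of N] by (auto simp: g_def)
  have "continuous_on ({0..1} \<union> (- {0<..<1})) (\<lambda>s. if s \<in> {0..1} then g s else 0)"
  proof (intro continuous_on_If g)
    fix x :: real assume "x \<in> - {0<..<1}" "x \<in> {0..1}"
    then have "x = 0 \<or> x = 1" by auto
    then show "g x = 0" using z by auto
  qed auto
  moreover have "{0..1} \<union> (- {0<..<1::real}) = UNIV" by auto
  moreover have "bump N k = (\<lambda>s. if s \<in> {0..1} then g s else 0)"
    by (auto simp: bump_def g_def fun_eq_iff)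
  ultimately show ?thesis by (simp only:)
qed

lemma bump_bound: assumes "k \<le> 3" shows "\<bar>bump N k s\<bar> \<le> 17 * (pi * N)^k"
  using prof_bound[OF assms, of "pi * N * s"]
    mult_left_mono[of "\<bar>prof k (pi * N * s)\<bar>" 17 "(pi*N)^k"]
  by (auto simp: bump_def abs_mult)

lemma bump_outside: "s \<notin> {0..1} \<Longrightarrow> bump N k s = 0" by (auto simp: bump_def)

text \<open>Dividing by \<open>(pi*N)^k\<close> removes the growth of the k-th derivative, so the
  value is the same for every frequency N; this keeps the energy of the waves away from zero as N
  grows.\<close>

lemma bump_sq_integral:
  assumes "N > 0"
  shows "(\<integral>\<^sup>+s. ennreal ((bump N k s / (pi*N)^k)\<^sup>2) \<partial>lborel) = ennreal ((100 + 25 * 9^k + 25^k) / 512)"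
proof -
  have "(\<integral>\<^sup>+s. ennreal ((bump N k s / (pi*N)^k)\<^sup>2) \<partial>lborel)
     = (\<integral>\<^sup>+s. ennreal ((prof k (pi * real N * s))\<^sup>2) * indicator {0..1} s \<partial>lborel)"
    using assms by (intro nn_integral_cong) (auto simp: bump_def indicator_def)
  then show ?thesis using prof_sq_integral[OF assms, of k] by simp
qed

text \<open>The rotation is split into two affine substitutions on the line: for fixed second
  coordinate the first is replaced by r, then, after exchanging the integrals, the second by s, with
  Jacobians 1/b1 and b1. If b1 = 0 the coordinates merely swap up to sign.\<close>

lemma nn_integral_rotate:
  fixes f g :: "real \<Rightarrow> ennreal"
  assumes [measurable]: "f \<in> borel_measurable borel" "g \<in> borel_measurable borel"
    and b: "b1\<^sup>2 + b2\<^sup>2 = (1::real)"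
  shows "(\<integral>\<^sup>+x. f (b1 * fst x + b2 * snd x) * g (- b2 * fst x + b1 * snd x - c) \<partial>(lborel :: (real \<times> real) measure))
     = (\<integral>\<^sup>+r. f r \<partial>lborel) * (\<integral>\<^sup>+s. g s \<partial>lborel)"
proof -
  have M [measurable]: "(\<lambda>x::real\<times>real. f (b1 * fst x + b2 * snd x) * g (- b2 * fst x + b1 * snd x - c)) \<in> borel_measurable borel"
    unfolding borel_prod[symmetric] by measurable
  have P: "(\<integral>\<^sup>+x. h x \<partial>(lborel :: (real \<times> real) measure)) = (\<integral>\<^sup>+y. (\<integral>\<^sup>+x. h (x, y) \<partial>lborel) \<partial>lborel)"
    "(\<integral>\<^sup>+x. h x \<partial>(lborel :: (real \<times> real) measure)) = (\<integral>\<^sup>+x. (\<integral>\<^sup>+y. h (x, y) \<partial>lborel) \<partial>lborel)"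
    if [measurable]: "h \<in> borel_measurable borel" for h :: "real \<times> real \<Rightarrow> ennreal"
    by (subst lborel_prod[symmetric], subst lborel_pair.nn_integral_snd[symmetric], simp_all add: lborel_prod)
       (subst lborel_prod[symmetric], subst lborel.nn_integral_fst[symmetric], simp_all add: lborel_prod)
  have S: "(\<integral>\<^sup>+x. h x \<partial>lborel) = ennreal \<bar>d\<bar> * (\<integral>\<^sup>+x. h (t + d * x) \<partial>lborel)"
    if "h \<in> borel_measurable borel" "d \<noteq> 0" for h :: "real \<Rightarrow> ennreal" and d t
    using nn_integral_real_affine[OF that, of t] .
  have T: "ennreal \<bar>d\<bar> * (ennreal \<bar>1/d\<bar> * X) = X" if "d \<noteq> 0" for d X
    using that by (simp add: mult.assoc[symmetric] ennreal_mult[symmetric] abs_mult[symmetric])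
  show ?thesis
  proof (cases "b1 = 0")
    case False
    have "(\<integral>\<^sup>+x. f (b1 * fst x + b2 * snd x) * g (- b2 * fst x + b1 * snd x - c) \<partial>(lborel :: (real \<times> real) measure))
       = (\<integral>\<^sup>+y. (\<integral>\<^sup>+x. f (b1 * x + b2 * y) * g (- b2 * x + b1 * y - c) \<partial>lborel) \<partial>lborel)"
      by (subst P(1)[OF M]) simp
    also have "\<dots> = (\<integral>\<^sup>+y. (ennreal \<bar>1/b1\<bar> * (\<integral>\<^sup>+r. f r * g (y / b1 - b2 * r / b1 - c) \<partial>lborel)) \<partial>lborel)"
    proof (rule nn_integral_cong)
      fix y
      have e: "- b2 * (- b2 * y / b1 + 1/b1 * r) + b1 * y - c = y / b1 - b2 * r / b1 - c" for r
      proof -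
        have "b2*b2*y + b1*b1*y = y" using b by (simp add: power2_eq_square flip: distrib_right)
        then show ?thesis using False by (simp add: field_simps)
      qed
      have e': "b1 * (- b2 * y / b1 + 1/b1 * r) + b2 * y = r" for r
        using False by (simp add: field_simps)
      show "(\<integral>\<^sup>+x. f (b1 * x + b2 * y) * g (- b2 * x + b1 * y - c) \<partial>lborel) =
        ennreal \<bar>1/b1\<bar> * (\<integral>\<^sup>+r. f r * g (y / b1 - b2 * r / b1 - c) \<partial>lborel)"
        apply (subst S[where d = "1/b1" and t = "- b2 * y / b1"])
        using False by (simp, simp, subst e, subst e', simp)
    qed
    also have "\<dots> = ennreal \<bar>1/b1\<bar> * (\<integral>\<^sup>+y. (\<integral>\<^sup>+r. f r * g (y / b1 - b2 * r / b1 - c) \<partial>lborel) \<partial>lborel)"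
      by (rule nn_integral_cmult) measurable
    also have "(\<integral>\<^sup>+y. (\<integral>\<^sup>+r. f r * g (y / b1 - b2 * r / b1 - c) \<partial>lborel) \<partial>lborel)
       = (\<integral>\<^sup>+r. (\<integral>\<^sup>+y. f r * g (y / b1 - b2 * r / b1 - c) \<partial>lborel) \<partial>lborel)"
      by (rule lborel_pair.Fubini') measurable
    also have "\<dots> = (\<integral>\<^sup>+r. f r * (ennreal \<bar>b1\<bar> * (\<integral>\<^sup>+s. g s \<partial>lborel)) \<partial>lborel)"
    proof (rule nn_integral_cong)
      fix r
      have "(\<integral>\<^sup>+y. g (y / b1 - b2 * r / b1 - c) \<partial>lborel) = ennreal \<bar>b1\<bar> * (\<integral>\<^sup>+s. g s \<partial>lborel)"
        apply (subst S[where d = "b1" and t = "b2 * r + b1 * c"])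
        using False by (simp_all add: field_simps)
      then show "(\<integral>\<^sup>+y. f r * g (y / b1 - b2 * r / b1 - c) \<partial>lborel) = f r * (ennreal \<bar>b1\<bar> * (\<integral>\<^sup>+s. g s \<partial>lborel))"
        by (subst nn_integral_cmult) simp_all
    qed
    also have "ennreal \<bar>1/b1\<bar> * \<dots> = (\<integral>\<^sup>+r. f r \<partial>lborel) * (\<integral>\<^sup>+s. g s \<partial>lborel)"
      apply (subst nn_integral_multc, simp)
      using T[OF False, of "(\<integral>\<^sup>+r. f r \<partial>lborel) * (\<integral>\<^sup>+s. g s \<partial>lborel)"] by (simp only: mult_ac)
    finally show ?thesis .
  next
    case True
    then have b2: "b2 * b2 = 1" "b2 \<noteq> 0" "\<bar>b2\<bar> = 1" using b by (auto simp: power2_eq_square square_eq_1_iff)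
    have "(\<integral>\<^sup>+x. f (b1 * fst x + b2 * snd x) * g (- b2 * fst x + b1 * snd x - c) \<partial>(lborel :: (real \<times> real) measure))
       = (\<integral>\<^sup>+y. (\<integral>\<^sup>+x. f (b2 * y) * g (- b2 * x - c) \<partial>lborel) \<partial>lborel)"
      using True by (subst P(1)[OF M]) simp
    also have "\<dots> = (\<integral>\<^sup>+y. f (b2 * y) * (\<integral>\<^sup>+s. g s \<partial>lborel) \<partial>lborel)"
    proof (rule nn_integral_cong)
      fix y
      have "(\<integral>\<^sup>+x. g (- b2 * x - c) \<partial>lborel) = (\<integral>\<^sup>+s. g s \<partial>lborel)"
      proof -
        have e: "g (- b2 * x - c) = g (- c + - b2 * x)" for x by (rule arg_cong[where f = g]) simp
        show ?thesis unfolding e using S[of g "-b2" "-c"] b2 by simp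
      qed
      then show "(\<integral>\<^sup>+x. f (b2 * y) * g (- b2 * x - c) \<partial>lborel) = f (b2 * y) * (\<integral>\<^sup>+s. g s \<partial>lborel)"
        by (subst nn_integral_cmult) simp_all
    qed
    also have "\<dots> = (\<integral>\<^sup>+r. f r \<partial>lborel) * (\<integral>\<^sup>+s. g s \<partial>lborel)"
      using S[of f b2 0] b2 by (simp add: nn_integral_multc)
    finally show ?thesis .
  qed
qed

section \<open>Localized potential waves\<close>

text \<open>The partial derivatives are arguments rather than extracted from the function, so that
  sums, products and substitutions compute them symbolically. The class serves both for the waves,
  whose profiles are only finitely often differentiable, and for the test functions.\<close>

definition C1 :: "(pt \<Rightarrow> real) \<Rightarrow> (pt \<Rightarrow> real) \<Rightarrow> (pt \<Rightarrow> real) \<Rightarrow> (pt \<Rightarrow> real) \<Rightarrow> bool" where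
  "C1 f f0 f1 f2 \<longleftrightarrow>
     (\<forall>y. (f has_derivative (\<lambda>h. f0 y * fst h + f1 y * fst (snd h) + f2 y * snd (snd h))) (at y)) \<and>
     continuous_on UNIV f0 \<and> continuous_on UNIV f1 \<and> continuous_on UNIV f2"

lemma C1_I:
  assumes "\<And>y. (f has_derivative (\<lambda>h. f0 y * fst h + f1 y * fst (snd h) + f2 y * snd (snd h))) (at y)"
    "continuous_on UNIV f0" "continuous_on UNIV f1" "continuous_on UNIV f2"
  shows "C1 f f0 f1 f2"
  using assms unfolding C1_def by blast

lemma C1_D:
  assumes "C1 f f0 f1 f2"
  shows "(f has_derivative (\<lambda>h. f0 y * fst h + f1 y * fst (snd h) + f2 y * snd (snd h))) (at y within S)"
    "continuous_on T f0" "continuous_on T f1" "continuous_on T f2"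
proof -
  note d = assms[unfolded C1_def, THEN conjunct1, rule_format]
    and c = assms[unfolded C1_def, THEN conjunct2]
  show "(f has_derivative (\<lambda>h. f0 y * fst h + f1 y * fst (snd h) + f2 y * snd (snd h))) (at y within S)"
    by (rule has_derivative_at_withinI[OF d])
  show "continuous_on T f0" "continuous_on T f1" "continuous_on T f2"
    using c by (auto intro: continuous_on_subset[of UNIV])
qed

lemma C1_cont: assumes "C1 f f0 f1 f2" shows "continuous_on T f"
  by (rule has_derivative_continuous_on) (rule C1_D(1)[OF assms])

lemma C1_add: assumes "C1 f f0 f1 f2" "C1 g g0 g1 g2"
  shows "C1 (\<lambda>y. f y + g y) (\<lambda>y. f0 y + g0 y) (\<lambda>y. f1 y + g1 y) (\<lambda>y. f2 y + g2 y)"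
  by (rule C1_I, rule has_derivative_add[OF C1_D(1)[OF assms(1)] C1_D(1)[OF assms(2)], THEN has_derivative_eq_rhs])
    (use C1_D(2-4)[OF assms(1), of UNIV] C1_D(2-4)[OF assms(2), of UNIV]
      in \<open>auto intro!: continuous_intros simp: algebra_simps\<close>)

lemma C1_cmult: assumes "C1 f f0 f1 f2"
  shows "C1 (\<lambda>y. a * f y) (\<lambda>y. a * f0 y) (\<lambda>y. a * f1 y) (\<lambda>y. a * f2 y)"
  by (rule C1_I, rule has_derivative_mult_right[OF C1_D(1)[OF assms(1)], THEN has_derivative_eq_rhs])
    (use C1_D(2-4)[OF assms, of UNIV] in \<open>auto intro!: continuous_intros simp: algebra_simps\<close>)

lemma C1_diff: assumes "C1 f f0 f1 f2" "C1 g g0 g1 g2"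
  shows "C1 (\<lambda>y. f y - g y) (\<lambda>y. f0 y - g0 y) (\<lambda>y. f1 y - g1 y) (\<lambda>y. f2 y - g2 y)"
  using C1_add[OF assms(1) C1_cmult[OF assms(2), of "-1"]] by simp

lemma C1_mult: assumes "C1 f f0 f1 f2" "C1 g g0 g1 g2"
  shows "C1 (\<lambda>y. f y * g y) (\<lambda>y. f0 y * g y + f y * g0 y) (\<lambda>y. f1 y * g y + f y * g1 y) (\<lambda>y. f2 y * g y + f y * g2 y)"
  by (rule C1_I, rule has_derivative_mult[OF C1_D(1)[OF assms(1)] C1_D(1)[OF assms(2)], THEN has_derivative_eq_rhs])
    (use C1_D(2-4)[OF assms(1), of UNIV] C1_D(2-4)[OF assms(2), of UNIV] C1_cont[OF assms(1), of UNIV] C1_cont[OF assms(2), of UNIV]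
      in \<open>auto intro!: continuous_intros simp: algebra_simps\<close>)

lemma C1_real:
  assumes "\<And>x. (g has_real_derivative g' x) (at x)" "continuous_on UNIV g'"
  shows "C1 (\<lambda>y. g (a0 * fst y + a1 * fst (snd y) + a2 * snd (snd y)))
     (\<lambda>y. a0 * g' (a0 * fst y + a1 * fst (snd y) + a2 * snd (snd y)))
     (\<lambda>y. a1 * g' (a0 * fst y + a1 * fst (snd y) + a2 * snd (snd y)))
     (\<lambda>y. a2 * g' (a0 * fst y + a1 * fst (snd y) + a2 * snd (snd y)))"
proof (rule C1_I)
  fix y :: pt
  let ?l = "\<lambda>y::pt. a0 * fst y + a1 * fst (snd y) + a2 * snd (snd y)"
  have l: "(?l has_derivative ?l) (at y)"
    by (auto intro!: derivative_eq_intros)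
  show "((\<lambda>y. g (?l y)) has_derivative
      (\<lambda>h. a0 * g' (?l y) * fst h + a1 * g' (?l y) * fst (snd h) + a2 * g' (?l y) * snd (snd h))) (at y)"
    by (rule has_derivative_compose[OF l assms(1)[unfolded has_field_derivative_def], THEN has_derivative_eq_rhs])
      (simp add: algebra_simps)
qed (auto intro!: continuous_intros continuous_on_compose2[OF assms(2)])

lemma C1_fst_snd: "C1 (\<lambda>y. fst (snd y)) (\<lambda>_. 0) (\<lambda>_. 1) (\<lambda>_. 0)" "C1 (\<lambda>y. snd (snd y)) (\<lambda>_. 0) (\<lambda>_. 0) (\<lambda>_. 1)"
  by (auto intro!: C1_I derivative_eq_intros)

lemma C1_affine:
  assumes "C1 f f0 f1 f2"
  shows "C1 (\<lambda>y. f (x + r *\<^sub>R y)) (\<lambda>y. r * f0 (x + r *\<^sub>R y)) (\<lambda>y. r * f1 (x + r *\<^sub>R y)) (\<lambda>y. r * f2 (x + r *\<^sub>R y))"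
proof (rule C1_I)
  fix y
  have l: "((\<lambda>y. x + r *\<^sub>R y) has_derivative (\<lambda>h. r *\<^sub>R h)) (at y)"
    by (auto intro!: derivative_eq_intros)
  show "((\<lambda>y. f (x + r *\<^sub>R y)) has_derivative (\<lambda>h. r * f0 (x + r *\<^sub>R y) * fst h
      + r * f1 (x + r *\<^sub>R y) * fst (snd h) + r * f2 (x + r *\<^sub>R y) * snd (snd h))) (at y)"
    by (rule has_derivative_compose[OF l C1_D(1)[OF assms], THEN has_derivative_eq_rhs])
      (simp add: algebra_simps)
qed (auto intro!: continuous_intros continuous_on_compose2[OF C1_D(2)[OF assms, of UNIV]]
  continuous_on_compose2[OF C1_D(3)[OF assms, of UNIV]] continuous_on_compose2[OF C1_D(4)[OF assms, of UNIV]])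

section \<open>Integrals over space-time: substitution and vanishing integrals of
  derivatives\<close>

lemma integrable_compact_support:
  fixes f :: "'a::euclidean_space \<Rightarrow> real"
  assumes "continuous_on UNIV f" "compact K" "\<And>y. y \<notin> K \<Longrightarrow> f y = 0"
  shows "integrable lborel f"
proof -
  have "integrable lborel (\<lambda>x. indicator K x *\<^sub>R f x)"
    by (intro borel_integrable_compact assms continuous_on_subset[OF assms(1)]) auto
  moreover have "(\<lambda>x. indicator K x *\<^sub>R f x) = f" using assms(3) by (auto simp: fun_eq_iff indicator_def)
  ultimately show ?thesis by simp
qed

lemma integral_lborel_translate:
  fixes f :: "'a::euclidean_space \<Rightarrow> real"
  assumes [measurable]: "f \<in> borel_measurable borel"
  shows "(LINT y|lborel. f (c + y)) = (LINT y|lborel. f y)"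
proof -
  have "(LINT y|lborel. f (c + y)) = (LINT y|distr lborel borel ((+) c). f y)"
    by (subst integral_distr) auto
  then show ?thesis by (simp add: lborel_distr_plus)
qed

lemma integral_lborel_affine:
  fixes f :: "pt \<Rightarrow> real"
  assumes [measurable]: "f \<in> borel_measurable borel" and r: "r > 0"
  shows "(LINT y|lborel. f y) = r^3 * (LINT y|lborel. f (x + r *\<^sub>R y))"
proof -
  have "(LINT y|lborel. f y) = (LINT y|density (distr lborel borel (\<lambda>y. x + r *\<^sub>R y)) (\<lambda>_. ennreal (\<bar>r\<bar>^DIM(pt))). f y)"
    using lborel_affine[of r x] r by simp
  also have "\<dots> = (LINT y|distr lborel borel (\<lambda>y. x + r *\<^sub>R y). \<bar>r\<bar>^DIM(pt) * f y)"
    by (subst integral_real_density) (use r in auto)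
  also have "\<dots> = (LINT y|lborel. \<bar>r\<bar>^DIM(pt) * f (x + r *\<^sub>R y))"
    by (subst integral_distr) auto
  finally show ?thesis using r by (simp add: power3_eq_cube)
qed

text \<open>By translation invariance all difference quotients of f in direction e have integral
  zero. They converge to the derivative and are dominated, by the mean value theorem, by a constant
  on a fixed ball.\<close>

lemma integral_derivative_zero:
  fixes f f' :: "pt \<Rightarrow> real" and e :: pt
  assumes d: "\<And>y s. ((\<lambda>s. f (y + s *\<^sub>R e)) has_real_derivative f' (y + s *\<^sub>R e)) (at s)"
    and cf: "continuous_on UNIV f" and cont: "continuous_on UNIV f'"
    and K: "compact K" and out: "\<And>y. y \<notin> K \<Longrightarrow> f y = 0"
  shows "(LINT y|lborel. f' y) = 0"
proof -
  obtain R where R: "K \<subseteq> cball 0 R" "R > 0"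
    using compact_imp_bounded[OF K] by (metis bounded_subset_ballD ball_subset_cball order_trans)
  \<comment> \<open>The shifts have length at most \<open>norm e\<close>, so every quotient vanishes
    outside this ball; intermediate points reach another \<open>norm e\<close> further, whence the
    radius for \<open>M\<close>.\<close>
  define B where "B = cball (0::pt) (R + norm e)"
  have cB: "compact B" by (simp add: B_def)
  obtain M where M: "\<And>y. y \<in> cball 0 (R + 2 * norm e) \<Longrightarrow> \<bar>f' y\<bar> \<le> M"
    using compact_imp_bounded[OF compact_continuous_image[OF continuous_on_subset[OF cont subset_UNIV] compact_cball[of 0 "R + 2 * norm e"]]]
    unfolding bounded_iff by (metis image_eqI real_norm_def)
  define q where "q n y = (f (y + (1 / Suc n) *\<^sub>R e) - f y) / (1 / Suc n)" for n y
  have mf [measurable]: "f \<in> borel_measurable borel" "f' \<in> borel_measurable borel"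
    using cf cont by (auto intro: borel_measurable_continuous_onI)
  have lim: "(\<lambda>n. q n y) \<longlonglongrightarrow> f' y" for y
  proof -
    have "((\<lambda>h. (f (y + h *\<^sub>R e) - f y) / h) \<longlongrightarrow> f' y) (at 0)"
      using d[of y 0] by (simp add: DERIV_def)
    moreover have "filterlim (\<lambda>n. 1 / real (Suc n)) (at 0) sequentially"
      using LIMSEQ_inverse_real_of_nat by (auto simp: filterlim_at inverse_eq_divide)
    ultimately show ?thesis unfolding q_def by (rule filterlim_compose)
  qed
  have small: "norm (y + (s / Suc n) *\<^sub>R e) \<le> norm y + norm e" if "0 \<le> s" "s \<le> 1" for s n y
  proof -
    have "norm ((s / Suc n) *\<^sub>R e) \<le> 1 * norm e"
      unfolding norm_scaleR using that by (intro mult_right_mono) (auto simp: divide_le_eq_1)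
    then show ?thesis using norm_triangle_ineq[of y "(s / Suc n) *\<^sub>R e"] by simp
  qed
  have dom: "\<bar>q n y\<bar> \<le> M * indicator B y" for n y
  proof (cases "y \<in> B")
    case True
    obtain \<xi> where x: "0 < \<xi>" "\<xi> < 1 / Suc n"
      "f (y + (1 / Suc n) *\<^sub>R e) - f (y + 0 *\<^sub>R e) = (1 / Suc n - 0) * f' (y + \<xi> *\<^sub>R e)"
      using MVT2[of 0 "1 / Suc n" "\<lambda>s. f (y + s *\<^sub>R e)" "\<lambda>s. f' (y + s *\<^sub>R e)"] d by auto
    then have "q n y = f' (y + \<xi> *\<^sub>R e)" unfolding q_def by (simp add: field_simps)
    moreover have "\<bar>f' (y + \<xi> *\<^sub>R e)\<bar> \<le> M"
    proof (rule M)
      have "\<xi> * Suc n \<le> 1" using x by (simp add: field_simps)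
      then have "norm (y + \<xi> *\<^sub>R e) \<le> norm y + norm e"
        using small[of "\<xi> * Suc n" y n] x by simp
      then show "y + \<xi> *\<^sub>R e \<in> cball 0 (R + 2 * norm e)" using True by (simp add: B_def)
    qed
    ultimately show ?thesis using True by simp
  next
    case False
    then have n: "norm y > R + norm e" by (simp add: B_def)
    have "norm y \<le> norm (y + (1 / Suc n) *\<^sub>R e) + norm e"
      using small[of 1 "y + (1 / Suc n) *\<^sub>R e" n]
        norm_triangle_ineq4[of "y + (1 / Suc n) *\<^sub>R e" "(1 / Suc n) *\<^sub>R e"]
        small[of 1 0 n] by simp
    then have "norm (y + (1 / Suc n) *\<^sub>R e) > R" "norm y > R" using n norm_ge_zero[of e] by linarith+
    then have "y + (1 / Suc n) *\<^sub>R e \<notin> K" "y \<notin> K" using R by (meson mem_cball_0 not_le subsetD)+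
    then show ?thesis using False out by (simp add: q_def)
  qed
  have "(\<lambda>n. LINT y|lborel. q n y) \<longlonglongrightarrow> (LINT y|lborel. f' y)"
  proof (rule integral_dominated_convergence[where w = "\<lambda>y. M * indicator B y"])
    show "integrable lborel (\<lambda>y. M * indicator B y)"
      using emeasure_bounded_finite[OF compact_imp_bounded[OF cB]] cB
      by (intro integrable_mult_right integrable_real_indicator) (auto simp: B_def)
    show "q n \<in> borel_measurable lborel" for n unfolding q_def [abs_def] by measurable
  qed (use lim dom in auto)
  moreover have "(LINT y|lborel. q n y) = 0" for n
  proof -
    have i: "integrable lborel f" by (rule integrable_compact_support[OF cf K out])
    have "integrable lborel (\<lambda>y. f ((1 / Suc n) *\<^sub>R e + y))"
    proof (rule integrable_compact_support[where K = "(\<lambda>y. y - (1 / Suc n) *\<^sub>R e) ` K"])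
      show "continuous_on UNIV (\<lambda>y. f ((1 / Suc n) *\<^sub>R e + y))"
        by (intro continuous_on_compose2[OF cf] continuous_intros) auto
      show "compact ((\<lambda>y. y - (1 / Suc n) *\<^sub>R e) ` K)"
        by (intro compact_continuous_image K continuous_intros)
      show "f ((1 / Suc n) *\<^sub>R e + y) = 0" if "y \<notin> (\<lambda>y. y - (1 / Suc n) *\<^sub>R e) ` K" for y
        by (rule out) (use that in \<open>auto simp: image_iff algebra_simps\<close>)
    qed
    then have "(LINT y|lborel. f ((1 / Suc n) *\<^sub>R e + y) - f y) = 0"
      using i integral_lborel_translate[of f "(1 / Suc n) *\<^sub>R e"] by simp
    then show ?thesis unfolding q_def by (simp add: add.commute)
  qed
  ultimately show ?thesis by (simp add: LIMSEQ_const_iff)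
qed

lemma C1_integral_zero:
  assumes c: "C1 f f0 f1 f2" and K: "compact K" "\<And>y. y \<notin> K \<Longrightarrow> f y = 0"
  shows "(LINT y|lborel. f0 y) = 0" "(LINT y|lborel. f1 y) = 0" "(LINT y|lborel. f2 y) = 0"
proof -
  have *: "(LINT y|lborel. f0 y * fst e + f1 y * fst (snd e) + f2 y * snd (snd e)) = 0" for e :: pt
  proof (rule integral_derivative_zero[OF _ C1_cont[OF c] _ K, where e = e])
    show "continuous_on UNIV (\<lambda>y. f0 y * fst e + f1 y * fst (snd e) + f2 y * snd (snd e))"
      by (intro continuous_intros C1_D[OF c])
    fix y and s :: real
    have l: "((\<lambda>s. y + s *\<^sub>R e) has_derivative (\<lambda>h. h *\<^sub>R e)) (at s)"
      by (auto intro!: derivative_eq_intros)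
    show "((\<lambda>s. f (y + s *\<^sub>R e)) has_real_derivative f0 (y + s *\<^sub>R e) * fst e
      + f1 (y + s *\<^sub>R e) * fst (snd e) + f2 (y + s *\<^sub>R e) * snd (snd e)) (at s)"
      unfolding has_field_derivative_def
      by (rule has_derivative_compose[OF l C1_D(1)[OF c], THEN has_derivative_eq_rhs])
        (simp add: fun_eq_iff algebra_simps)
  qed auto
  show "(LINT y|lborel. f0 y) = 0" "(LINT y|lborel. f1 y) = 0" "(LINT y|lborel. f2 y) = 0"
    using *[of "(1,0,0)"] *[of "(0,1,0)"] *[of "(0,0,1)"] by simp_all
qed

section \<open>The linear system and its compactly supported solutions\<close>

type_synonym st = "real \<times> real \<times> real \<times> real"

abbreviation V1 :: "st \<Rightarrow> real" where "V1 z \<equiv> fst z"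
abbreviation V2 :: "st \<Rightarrow> real" where "V2 z \<equiv> fst (snd z)"
abbreviation M1 :: "st \<Rightarrow> real" where "M1 z \<equiv> fst (snd (snd z))"
abbreviation M2 :: "st \<Rightarrow> real" where "M2 z \<equiv> snd (snd (snd z))"

text \<open>A state \<open>(V1, V2, M1, M2)\<close> encodes the velocity \<open>(V1, V2)\<close> and the symmetric traceless
  matrix with rows \<open>(M1, M2)\<close> and \<open>(M2, -M1)\<close>; the integrals express
  \<open>div v = 0\<close> and \<open>\<partial>\<^sub>t v + div m = 0\<close>.\<close>

definition weak_eqs :: "(pt \<Rightarrow> st) \<Rightarrow> (pt \<Rightarrow> real) \<Rightarrow> (pt \<Rightarrow> real) \<Rightarrow> (pt \<Rightarrow> real) \<Rightarrow> bool" where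
  "weak_eqs w \<psi>0 \<psi>1 \<psi>2 \<longleftrightarrow>
     (LINT y|lborel. V1 (w y) * \<psi>1 y + V2 (w y) * \<psi>2 y) = 0 \<and>
     (LINT y|lborel. V1 (w y) * \<psi>0 y + M1 (w y) * \<psi>1 y + M2 (w y) * \<psi>2 y) = 0 \<and>
     (LINT y|lborel. V2 (w y) * \<psi>0 y + M2 (w y) * \<psi>1 y - M1 (w y) * \<psi>2 y) = 0"

text \<open>Because the wave itself has compact support, the test functions need none. In particular
  the coordinate functions are allowed, which gives zero mean velocity. Stating the equations weakly
  makes sums and rescalings easy and is the form that survives limits.\<close>

definition pwave :: "pt set \<Rightarrow> (pt \<Rightarrow> st) \<Rightarrow> bool" where
  "pwave \<Omega> w \<longleftrightarrow> continuous_on UNIV w \<and> (\<exists>K. compact K \<and> K \<subseteq> \<Omega> \<and> (\<forall>y. y \<notin> K \<longrightarrow> w y = 0)) \<and>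
     (\<forall>\<psi> \<psi>0 \<psi>1 \<psi>2. C1 \<psi> \<psi>0 \<psi>1 \<psi>2 \<longrightarrow> weak_eqs w \<psi>0 \<psi>1 \<psi>2)"

lemma pwave_zero: "pwave \<Omega> (\<lambda>_. 0)"
  unfolding pwave_def weak_eqs_def by (auto intro: exI[of _ "{}"])

lemma pwave_mono: "pwave \<Omega> w \<Longrightarrow> \<Omega> \<subseteq> \<Omega>' \<Longrightarrow> pwave \<Omega>' w"
  unfolding pwave_def by blast

lemma pwave_integrable:
  assumes w: "pwave \<Omega> w" and g: "continuous_on UNIV g"
  shows "integrable lborel (\<lambda>y. V1 (w y) * g y)" "integrable lborel (\<lambda>y. V2 (w y) * g y)"
    "integrable lborel (\<lambda>y. M1 (w y) * g y)" "integrable lborel (\<lambda>y. M2 (w y) * g y)"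
proof -
  obtain K where K: "compact K" "\<And>y. y \<notin> K \<Longrightarrow> w y = 0" and c: "continuous_on UNIV w"
    using w by (auto simp: pwave_def)
  show "integrable lborel (\<lambda>y. V1 (w y) * g y)" "integrable lborel (\<lambda>y. V2 (w y) * g y)"
    "integrable lborel (\<lambda>y. M1 (w y) * g y)" "integrable lborel (\<lambda>y. M2 (w y) * g y)"
    by (rule integrable_compact_support[OF _ K(1)]; use c g K(2) in \<open>auto intro!: continuous_intros\<close>)+
qed

lemma pwave_add:
  assumes v: "pwave \<Omega> v" and w: "pwave \<Omega> w"
  shows "pwave \<Omega> (\<lambda>y. v y + w y)"
  unfolding pwave_def
proof (intro conjI allI impI)
  show "continuous_on UNIV (\<lambda>y. v y + w y)"
    using v w by (auto simp: pwave_def intro!: continuous_intros)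
  obtain K L where "compact K" "K \<subseteq> \<Omega>" "\<And>y. y \<notin> K \<Longrightarrow> v y = 0" "compact L" "L \<subseteq> \<Omega>" "\<And>y. y \<notin> L \<Longrightarrow> w y = 0"
    using v w by (auto simp: pwave_def)
  then show "\<exists>K. compact K \<and> K \<subseteq> \<Omega> \<and> (\<forall>y. y \<notin> K \<longrightarrow> v y + w y = 0)"
    by (intro exI[of _ "K \<union> L"]) auto
  fix \<psi> \<psi>0 \<psi>1 \<psi>2 assume C: "C1 \<psi> \<psi>0 \<psi>1 \<psi>2"
  then have c: "continuous_on UNIV \<psi>0" "continuous_on UNIV \<psi>1" "continuous_on UNIV \<psi>2"
    by (auto intro: C1_D(2-4))
  have e: "weak_eqs v \<psi>0 \<psi>1 \<psi>2" "weak_eqs w \<psi>0 \<psi>1 \<psi>2" using v w C by (auto simp: pwave_def)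
  note I = pwave_integrable[OF v c(1)] pwave_integrable[OF v c(2)] pwave_integrable[OF v c(3)]
    pwave_integrable[OF w c(1)] pwave_integrable[OF w c(2)] pwave_integrable[OF w c(3)]
  show "weak_eqs (\<lambda>y. v y + w y) \<psi>0 \<psi>1 \<psi>2"
    using e I unfolding weak_eqs_def by (simp add: distrib_right)
qed

lemma pwave_sum:
  assumes "finite I" "\<And>i. i \<in> I \<Longrightarrow> pwave \<Omega> (w i)"
  shows "pwave \<Omega> (\<lambda>y. \<Sum>i\<in>I. w i y)"
  using assms by (induction rule: finite_induct) (auto intro: pwave_zero pwave_add)

text \<open>All equations are homogeneous of first order in space-time derivatives, so scaling time
  and space by the same factor r only multiplies the weak identities by a power of r.\<close>

lemma pwave_affine:
  assumes w: "pwave \<Omega> w" and r: "r > 0" and sub: "\<And>y. y \<in> \<Omega> \<Longrightarrow> x + r *\<^sub>R y \<in> \<Omega>'"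
  shows "pwave \<Omega>' (\<lambda>y. w ((1/r) *\<^sub>R (y - x)))"
  unfolding pwave_def
proof (intro conjI allI impI)
  have c: "continuous_on UNIV w" using w by (auto simp: pwave_def)
  show c': "continuous_on UNIV (\<lambda>y. w ((1/r) *\<^sub>R (y - x)))"
    by (intro continuous_on_compose2[OF c] continuous_intros) auto
  obtain K where K: "compact K" "K \<subseteq> \<Omega>" "\<And>y. y \<notin> K \<Longrightarrow> w y = 0" using w by (auto simp: pwave_def)
  show "\<exists>K. compact K \<and> K \<subseteq> \<Omega>' \<and> (\<forall>y. y \<notin> K \<longrightarrow> w ((1/r) *\<^sub>R (y - x)) = 0)"
  proof (intro exI[of _ "(\<lambda>y. x + r *\<^sub>R y) ` K"] conjI allI impI)
    show "compact ((\<lambda>y. x + r *\<^sub>R y) ` K)" by (intro compact_continuous_image K continuous_intros)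
    show "(\<lambda>y. x + r *\<^sub>R y) ` K \<subseteq> \<Omega>'" using K sub by auto
    fix y assume y: "y \<notin> (\<lambda>y. x + r *\<^sub>R y) ` K"
    have "y = x + r *\<^sub>R ((1/r) *\<^sub>R (y - x))" using r by simp
    then show "w ((1/r) *\<^sub>R (y - x)) = 0" using y by (intro K(3)) (metis image_eqI)
  qed
  fix \<psi> \<psi>0 \<psi>1 \<psi>2 assume C: "C1 \<psi> \<psi>0 \<psi>1 \<psi>2"
  then have cc: "continuous_on UNIV \<psi>0" "continuous_on UNIV \<psi>1" "continuous_on UNIV \<psi>2"
    by (auto intro: C1_D(2-4))
  have m [measurable]: "\<psi>0 \<in> borel_measurable borel" "\<psi>1 \<in> borel_measurable borel" "\<psi>2 \<in> borel_measurable borel"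
    using cc by (auto intro: borel_measurable_continuous_onI)
  have "(\<lambda>y. w ((1/r) *\<^sub>R (y - x))) \<in> borel_measurable borel"
    using c' by (rule borel_measurable_continuous_onI)
  then have mw [measurable]: "(\<lambda>y. V1 (w ((1/r) *\<^sub>R (y - x)))) \<in> borel_measurable borel"
    "(\<lambda>y. V2 (w ((1/r) *\<^sub>R (y - x)))) \<in> borel_measurable borel"
    "(\<lambda>y. M1 (w ((1/r) *\<^sub>R (y - x)))) \<in> borel_measurable borel"
    "(\<lambda>y. M2 (w ((1/r) *\<^sub>R (y - x)))) \<in> borel_measurable borel"
    using c' by (auto intro!: borel_measurable_continuous_onI continuous_intros)
  have e: "weak_eqs w (\<lambda>y. r * \<psi>0 (x + r *\<^sub>R y)) (\<lambda>y. r * \<psi>1 (x + r *\<^sub>R y)) (\<lambda>y. r * \<psi>2 (x + r *\<^sub>R y))"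
    using w C1_affine[OF C, of x r] by (auto simp: pwave_def)
  have s: "(LINT y|lborel. h y) = 0" if "h \<in> borel_measurable borel" "(LINT y|lborel. r * h (x + r *\<^sub>R y)) = 0" for h
    by (subst integral_lborel_affine[OF that(1) r, where x = x]) (use that(2) r in simp)
  have inv: "(1/r) *\<^sub>R (x + r *\<^sub>R y - x) = y" for y using r by simp
  show "weak_eqs (\<lambda>y. w ((1/r) *\<^sub>R (y - x))) \<psi>0 \<psi>1 \<psi>2"
    unfolding weak_eqs_def
  proof (intro conjI; rule s)
    show "(LINT y|lborel. r * (V1 (w ((1/r) *\<^sub>R (x + r *\<^sub>R y - x))) * \<psi>1 (x + r *\<^sub>R y)
        + V2 (w ((1/r) *\<^sub>R (x + r *\<^sub>R y - x))) * \<psi>2 (x + r *\<^sub>R y))) = 0"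
      using e unfolding inv weak_eqs_def by (simp only: algebra_simps)
    show "(LINT y|lborel. r * (V1 (w ((1/r) *\<^sub>R (x + r *\<^sub>R y - x))) * \<psi>0 (x + r *\<^sub>R y)
        + M1 (w ((1/r) *\<^sub>R (x + r *\<^sub>R y - x))) * \<psi>1 (x + r *\<^sub>R y)
        + M2 (w ((1/r) *\<^sub>R (x + r *\<^sub>R y - x))) * \<psi>2 (x + r *\<^sub>R y))) = 0"
      using e unfolding inv weak_eqs_def by (simp only: algebra_simps)
    show "(LINT y|lborel. r * (V2 (w ((1/r) *\<^sub>R (x + r *\<^sub>R y - x))) * \<psi>0 (x + r *\<^sub>R y)
        + M2 (w ((1/r) *\<^sub>R (x + r *\<^sub>R y - x))) * \<psi>1 (x + r *\<^sub>R y)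
        - M1 (w ((1/r) *\<^sub>R (x + r *\<^sub>R y - x))) * \<psi>2 (x + r *\<^sub>R y))) = 0"
      using e unfolding inv weak_eqs_def by (simp only: algebra_simps)
  qed (measurable)
qed

text \<open>The coordinates x1 and x2 are used as test functions in the divergence equation. A
  rescaled wave on a small ball is therefore almost orthogonal to any continuous field.\<close>

lemma pwave_mean:
  assumes "pwave \<Omega> w"
  shows "(LINT y|lborel. V1 (w y)) = 0" "(LINT y|lborel. V2 (w y)) = 0"
proof -
  have "weak_eqs w (\<lambda>_. 0) (\<lambda>_. 1) (\<lambda>_. 0)" "weak_eqs w (\<lambda>_. 0) (\<lambda>_. 0) (\<lambda>_. 1)"
    using assms C1_fst_snd unfolding pwave_def by blast+
  then show "(LINT y|lborel. V1 (w y)) = 0" "(LINT y|lborel. V2 (w y)) = 0"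
    by (simp_all add: weak_eqs_def)
qed

lemma pwave_classical:
  assumes w1: "C1 (\<lambda>y. V1 (w y)) w10 w11 w12" and w2: "C1 (\<lambda>y. V2 (w y)) w20 w21 w22"
    and m1: "C1 (\<lambda>y. M1 (w y)) m10 m11 m12" and m2: "C1 (\<lambda>y. M2 (w y)) m20 m21 m22"
    and K: "compact K" "K \<subseteq> \<Omega>" "\<And>y. y \<notin> K \<Longrightarrow> w y = 0"
    and pde: "\<And>y. w11 y + w22 y = 0" "\<And>y. w10 y + m11 y + m22 y = 0" "\<And>y. w20 y + m21 y - m12 y = 0"
  shows "pwave \<Omega> w"
  unfolding pwave_def
proof (intro conjI allI impI)
  have "continuous_on UNIV (\<lambda>y. (V1 (w y), V2 (w y), M1 (w y), M2 (w y)))"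
    using w1 w2 m1 m2 by (intro continuous_intros C1_cont)
  then show cw: "continuous_on UNIV w" by simp
  show "\<exists>K. compact K \<and> K \<subseteq> \<Omega> \<and> (\<forall>y. y \<notin> K \<longrightarrow> w y = 0)" using K by blast
  fix \<psi> \<psi>0 \<psi>1 \<psi>2 assume C: "C1 \<psi> \<psi>0 \<psi>1 \<psi>2"
  have cc: "continuous_on UNIV \<psi>" "continuous_on UNIV \<psi>0" "continuous_on UNIV \<psi>1" "continuous_on UNIV \<psi>2"
    using C1_D(2-4)[OF C] C1_cont[OF C] by auto
  have ibp: "(LINT y|lborel. f0 y * \<psi> y + f y * \<psi>0 y) = 0"
    "(LINT y|lborel. f1 y * \<psi> y + f y * \<psi>1 y) = 0"
    "(LINT y|lborel. f2 y * \<psi> y + f y * \<psi>2 y) = 0"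
    "integrable lborel (\<lambda>y. f0 y * \<psi> y + f y * \<psi>0 y)"
    "integrable lborel (\<lambda>y. f1 y * \<psi> y + f y * \<psi>1 y)"
    "integrable lborel (\<lambda>y. f2 y * \<psi> y + f y * \<psi>2 y)"
    if c: "C1 f f0 f1 f2" and o: "\<And>y. y \<notin> K \<Longrightarrow> f y = 0" for f f0 f1 f2
  proof -
    have o': "f y * \<psi> y = 0" if "y \<notin> K" for y using o[OF that] by simp
    show "(LINT y|lborel. f0 y * \<psi> y + f y * \<psi>0 y) = 0"
      "(LINT y|lborel. f1 y * \<psi> y + f y * \<psi>1 y) = 0"
      "(LINT y|lborel. f2 y * \<psi> y + f y * \<psi>2 y) = 0"
      using C1_integral_zero[OF C1_mult[OF c C] K(1) o'] by auto
    have z: "f0 y = 0 \<and> f1 y = 0 \<and> f2 y = 0" if "y \<notin> K" for y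
    proof -
      have "((\<lambda>_. 0) has_derivative (\<lambda>h. f0 y * fst h + f1 y * fst (snd h) + f2 y * snd (snd h))) (at y)"
        by (rule has_derivative_transform_within_open[of f _ y UNIV "- K"])
           (use that o compact_imp_closed[OF K(1)] C1_D(1)[OF c] in auto)
      then have "(\<lambda>h. f0 y * fst h + f1 y * fst (snd h) + f2 y * snd (snd h)) = (\<lambda>h. 0 :: real)"
        by (intro has_derivative_unique[of "\<lambda>_. 0"]) auto
      from fun_cong[OF this, of "(1,0,0)"] fun_cong[OF this, of "(0,1,0)"] fun_cong[OF this, of "(0,0,1)"]
      show ?thesis by simp
    qed
    show "integrable lborel (\<lambda>y. f0 y * \<psi> y + f y * \<psi>0 y)"
      "integrable lborel (\<lambda>y. f1 y * \<psi> y + f y * \<psi>1 y)"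
      "integrable lborel (\<lambda>y. f2 y * \<psi> y + f y * \<psi>2 y)"
      using c C1_cont[OF c] C1_D(2-4)[OF c] cc z o
      by (auto intro!: integrable_compact_support[OF _ K(1)] continuous_intros)
  qed
  have o: "V1 (w y) = 0" "V2 (w y) = 0" "M1 (w y) = 0" "M2 (w y) = 0" if "y \<notin> K" for y
    using K(3)[OF that] by simp_all
  note i1 = ibp[OF w1 o(1)] and i2 = ibp[OF w2 o(2)] and i3 = ibp[OF m1 o(3)] and i4 = ibp[OF m2 o(4)]
  have 1: "(LINT y|lborel. V1 (w y) * \<psi>1 y + V2 (w y) * \<psi>2 y) =
    (LINT y|lborel. (w11 y * \<psi> y + V1 (w y) * \<psi>1 y) + (w22 y * \<psi> y + V2 (w y) * \<psi>2 y))"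
  proof (rule Bochner_Integration.integral_cong)
    fix y
    have "(w11 y + w22 y) * \<psi> y = 0" using pde(1)[of y] by simp
    then show "V1 (w y) * \<psi>1 y + V2 (w y) * \<psi>2 y = (w11 y * \<psi> y + V1 (w y) * \<psi>1 y) + (w22 y * \<psi> y + V2 (w y) * \<psi>2 y)"
      by (simp add: algebra_simps)
  qed simp
  have 2: "(LINT y|lborel. V1 (w y) * \<psi>0 y + M1 (w y) * \<psi>1 y + M2 (w y) * \<psi>2 y) =
    (LINT y|lborel. (w10 y * \<psi> y + V1 (w y) * \<psi>0 y) + (m11 y * \<psi> y + M1 (w y) * \<psi>1 y) + (m22 y * \<psi> y + M2 (w y) * \<psi>2 y))"
  proof (rule Bochner_Integration.integral_cong)
    fix y
    have "(w10 y + m11 y + m22 y) * \<psi> y = 0" using pde(2)[of y] by simp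
    then show "V1 (w y) * \<psi>0 y + M1 (w y) * \<psi>1 y + M2 (w y) * \<psi>2 y
      = (w10 y * \<psi> y + V1 (w y) * \<psi>0 y) + (m11 y * \<psi> y + M1 (w y) * \<psi>1 y) + (m22 y * \<psi> y + M2 (w y) * \<psi>2 y)"
      by (simp add: algebra_simps)
  qed simp
  have 3: "(LINT y|lborel. V2 (w y) * \<psi>0 y + M2 (w y) * \<psi>1 y - M1 (w y) * \<psi>2 y) =
    (LINT y|lborel. (w20 y * \<psi> y + V2 (w y) * \<psi>0 y) + (m21 y * \<psi> y + M2 (w y) * \<psi>1 y) - (m12 y * \<psi> y + M1 (w y) * \<psi>2 y))"
  proof (rule Bochner_Integration.integral_cong)
    fix y
    have "(w20 y + m21 y - m12 y) * \<psi> y = 0" using pde(3)[of y] by simp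
    then show "V2 (w y) * \<psi>0 y + M2 (w y) * \<psi>1 y - M1 (w y) * \<psi>2 y
      = (w20 y * \<psi> y + V2 (w y) * \<psi>0 y) + (m21 y * \<psi> y + M2 (w y) * \<psi>1 y) - (m12 y * \<psi> y + M1 (w y) * \<psi>2 y)"
      by (simp add: algebra_simps)
  qed simp
  show "weak_eqs w \<psi>0 \<psi>1 \<psi>2"
    unfolding weak_eqs_def 1 2 3 using i1 i2 i3 i4 by simp
qed

text \<open>A derivative of the potential, with i, j, k counting derivatives in t, r = b . x and s =
  b^\<bottom> . x - c t; only s carries the high frequency N. The normalisation by
  \<open>(pi * N)^3\<close> makes the three-fold s-derivative of size one, while all jets with k
  \<le> 2 are O(1/N).\<close>

definition jet :: "nat \<Rightarrow> real \<Rightarrow> real \<Rightarrow> real \<Rightarrow> nat \<Rightarrow> nat \<Rightarrow> nat \<Rightarrow> pt \<Rightarrow> real" where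
  "jet N b1 b2 c i j k y = bump 1 i (fst y) * bump 1 j (b1 * fst (snd y) + b2 * snd (snd y))
     * (bump N k (- b2 * fst (snd y) + b1 * snd (snd y) - c * fst y) / (pi * N)^3)"

lemma jet_C1:
  assumes "i \<le> 3" "j \<le> 3" "k \<le> 3"
  shows "C1 (jet N b1 b2 c i j k)
    (\<lambda>y. jet N b1 b2 c (Suc i) j k y - c * jet N b1 b2 c i j (Suc k) y)
    (\<lambda>y. b1 * jet N b1 b2 c i (Suc j) k y - b2 * jet N b1 b2 c i j (Suc k) y)
    (\<lambda>y. b2 * jet N b1 b2 c i (Suc j) k y + b1 * jet N b1 b2 c i j (Suc k) y)"
proof -
  have d: "((\<lambda>s. bump N k s / (pi*N)^3) has_real_derivative bump N (Suc k) x / (pi*N)^3) (at x)" for x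
    by (intro DERIV_cdivide bump_deriv assms)
  have c: "continuous_on UNIV (\<lambda>s. bump N (Suc k) s / (pi*N)^3)"
    unfolding divide_inverse by (intro continuous_intros bump_cont) (use assms in auto)
  have c1: "continuous_on UNIV (bump 1 (Suc i))" "continuous_on UNIV (bump 1 (Suc j))"
    using assms by (auto intro!: bump_cont)
  note 1 = C1_real[OF bump_deriv[OF assms(1), of 1] c1(1), of 1 0 0]
  note 2 = C1_real[OF bump_deriv[OF assms(2), of 1] c1(2), of 0 b1 b2]
  note 3 = C1_real[OF d c, of "-c" "-b2" b1]
  show ?thesis
    unfolding jet_def [abs_def]
    using C1_mult[OF C1_mult[OF 1 2] 3] by (simp add: algebra_simps)
qed

text \<open>Velocity and matrix are linear expressions in an array \<open>F i j k\<close> of jets,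
  so the same formulas give their partial derivatives when F is replaced by an array of
  differentiated jets.\<close>

definition jv1 :: "real \<Rightarrow> real \<Rightarrow> (nat \<Rightarrow> nat \<Rightarrow> nat \<Rightarrow> real) \<Rightarrow> real" where
  "jv1 b1 b2 F = (- b2) * (F 0 3 0 + F 0 1 2) + (- b1) * (F 0 2 1 + F 0 0 3)"
definition jv2 :: "real \<Rightarrow> real \<Rightarrow> (nat \<Rightarrow> nat \<Rightarrow> nat \<Rightarrow> real) \<Rightarrow> real" where
  "jv2 b1 b2 F = b1 * (F 0 3 0 + F 0 1 2) + (- b2) * (F 0 2 1 + F 0 0 3)"
definition jm1 :: "real \<Rightarrow> real \<Rightarrow> real \<Rightarrow> (nat \<Rightarrow> nat \<Rightarrow> nat \<Rightarrow> real) \<Rightarrow> real" where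
  "jm1 b1 b2 c F = 2 * b1 * b2 * (F 1 2 0 - c * F 0 2 1) + 2 * (b1\<^sup>2 - b2\<^sup>2) * (F 1 1 1 - c * F 0 1 2)
     + (- 2 * b1 * b2) * (F 1 0 2 - c * F 0 0 3)"
definition jm2 :: "real \<Rightarrow> real \<Rightarrow> real \<Rightarrow> (nat \<Rightarrow> nat \<Rightarrow> nat \<Rightarrow> real) \<Rightarrow> real" where
  "jm2 b1 b2 c F = (b2\<^sup>2 - b1\<^sup>2) * (F 1 2 0 - c * F 0 2 1) + 4 * b1 * b2 * (F 1 1 1 - c * F 0 1 2)
     + (b1\<^sup>2 - b2\<^sup>2) * (F 1 0 2 - c * F 0 0 3)"

text \<open>With \<open>\<phi> = jet 0 0 0\<close> this is the field \<open>v = (-\<partial>\<^sub>2 \<Delta> \<phi>, \<partial>\<^sub>1 \<Delta> \<phi>)\<close>,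
  \<open>m = \<partial>\<^sub>t (2 \<partial>\<^sub>1 \<partial>\<^sub>2 \<phi>, (\<partial>\<^sub>2\<partial>\<^sub>2 - \<partial>\<^sub>1\<partial>\<^sub>1) \<phi>)\<close>, written in the coordinates
  \<open>t\<close>, \<open>r = b \<bullet> x\<close>, \<open>s = b\<^sup>\<bottom> \<bullet> x - c t\<close>.\<close>

definition osc :: "nat \<Rightarrow> real \<Rightarrow> real \<Rightarrow> real \<Rightarrow> real \<Rightarrow> pt \<Rightarrow> st" where
  "osc N b1 b2 c A y = (let F = (\<lambda>i j k. A * jet N b1 b2 c i j k y) in
     (jv1 b1 b2 F, jv2 b1 b2 F, jm1 b1 b2 c F, jm2 b1 b2 c F))"

text \<open>The potential lives where t, r and s are in the unit interval. Rotation preserves the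
  norm of x, and undoing the shift c t costs at most L.\<close>

lemma jet_support:
  assumes b: "b1\<^sup>2 + b2\<^sup>2 = 1" and c: "\<bar>c\<bar> \<le> L" and y: "jet N b1 b2 c i j k y \<noteq> 0"
  shows "norm y \<le> 4 + L"
proof -
  define t x1 x2 where "t = fst y" and "x1 = fst (snd y)" and "x2 = snd (snd y)"
  define r s where "r = b1 * x1 + b2 * x2" and "s = - b2 * x1 + b1 * x2 - c * t"
  have "bump 1 i t \<noteq> 0" "bump 1 j r \<noteq> 0" "bump N k s \<noteq> 0"
    using y by (auto simp: jet_def t_def x1_def x2_def r_def s_def)
  then have *: "t \<in> {0..1}" "r \<in> {0..1}" "s \<in> {0..1}" using bump_outside by metis+
  have "norm (x1, x2) \<le> 2 + L"
  proof (rule power2_le_imp_le)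
    have "(norm (x1, x2))\<^sup>2 = (b1\<^sup>2 + b2\<^sup>2) * (x1\<^sup>2 + x2\<^sup>2)" unfolding b by (simp add: norm_Pair)
    also have "\<dots> = r\<^sup>2 + (s + c * t)\<^sup>2" by (simp add: r_def s_def power2_eq_square algebra_simps)
    also have "\<dots> \<le> (\<bar>r\<bar> + \<bar>s + c * t\<bar>)\<^sup>2" by (simp add: power2_sum)
    also have "\<dots> \<le> (2 + L)\<^sup>2"
    proof (rule power_mono)
      have "\<bar>c * t\<bar> \<le> L * 1" unfolding abs_mult using c * by (intro mult_mono) auto
      then show "\<bar>r\<bar> + \<bar>s + c * t\<bar> \<le> 2 + L" using * by auto
    qed auto
    finally show "(norm (x1, x2))\<^sup>2 \<le> (2 + L)\<^sup>2" .
  qed (use c in auto)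
  moreover have "norm y \<le> norm t + norm (x1, x2)"
    using norm_Pair_le[of t "(x1, x2)"] by (simp add: t_def x1_def x2_def)
  ultimately show ?thesis using * by simp
qed

lemma osc_pwave:
  assumes b: "b1\<^sup>2 + b2\<^sup>2 = 1" and c: "\<bar>c\<bar> \<le> L"
  shows "pwave (cball 0 (4 + L)) (osc N b1 b2 c A)"
proof -
  let ?J = "\<lambda>i j k y. A * jet N b1 b2 c i j k y"
  let ?D0 = "\<lambda>i j k y. A * (jet N b1 b2 c (Suc i) j k y - c * jet N b1 b2 c i j (Suc k) y)"
  let ?D1 = "\<lambda>i j k y. A * (b1 * jet N b1 b2 c i (Suc j) k y - b2 * jet N b1 b2 c i j (Suc k) y)"
  let ?D2 = "\<lambda>i j k y. A * (b2 * jet N b1 b2 c i (Suc j) k y + b1 * jet N b1 b2 c i j (Suc k) y)"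
  have J: "C1 (?J i j k) (?D0 i j k) (?D1 i j k) (?D2 i j k)" if "i \<le> 3" "j \<le> 3" "k \<le> 3" for i j k
    by (rule C1_cmult[OF jet_C1[OF that]])
  have v1: "C1 (\<lambda>y. jv1 b1 b2 (\<lambda>i j k. ?J i j k y)) (\<lambda>y. jv1 b1 b2 (\<lambda>i j k. ?D0 i j k y))
     (\<lambda>y. jv1 b1 b2 (\<lambda>i j k. ?D1 i j k y)) (\<lambda>y. jv1 b1 b2 (\<lambda>i j k. ?D2 i j k y))"
    unfolding jv1_def by (intro C1_add C1_cmult J) auto
  have v2: "C1 (\<lambda>y. jv2 b1 b2 (\<lambda>i j k. ?J i j k y)) (\<lambda>y. jv2 b1 b2 (\<lambda>i j k. ?D0 i j k y))
     (\<lambda>y. jv2 b1 b2 (\<lambda>i j k. ?D1 i j k y)) (\<lambda>y. jv2 b1 b2 (\<lambda>i j k. ?D2 i j k y))"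
    unfolding jv2_def by (intro C1_add C1_cmult J) auto
  have m1: "C1 (\<lambda>y. jm1 b1 b2 c (\<lambda>i j k. ?J i j k y)) (\<lambda>y. jm1 b1 b2 c (\<lambda>i j k. ?D0 i j k y))
     (\<lambda>y. jm1 b1 b2 c (\<lambda>i j k. ?D1 i j k y)) (\<lambda>y. jm1 b1 b2 c (\<lambda>i j k. ?D2 i j k y))"
    unfolding jm1_def by (intro C1_add C1_diff C1_cmult J) auto
  have m2: "C1 (\<lambda>y. jm2 b1 b2 c (\<lambda>i j k. ?J i j k y)) (\<lambda>y. jm2 b1 b2 c (\<lambda>i j k. ?D0 i j k y))
     (\<lambda>y. jm2 b1 b2 c (\<lambda>i j k. ?D1 i j k y)) (\<lambda>y. jm2 b1 b2 c (\<lambda>i j k. ?D2 i j k y))"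
    unfolding jm2_def by (intro C1_add C1_diff C1_cmult J) auto
  show ?thesis
  proof (rule pwave_classical[where w = "osc N b1 b2 c A", unfolded osc_def Let_def fst_conv snd_conv, OF v1 v2 m1 m2, folded osc_def[unfolded Let_def]])
    show "compact (cball (0::pt) (4 + L))" by simp
    fix y :: pt assume "y \<notin> cball 0 (4 + L)"
    then have "jet N b1 b2 c i j k y = 0" for i j k using jet_support[OF b c] by (metis mem_cball_0)
    then show "osc N b1 b2 c A y = 0"
      by (simp add: osc_def jv1_def jv2_def jm1_def jm2_def zero_prod_def)
  next
    fix y
    note unf = jv1_def jv2_def jm1_def jm2_def power2_eq_square numeral_2_eq_2 numeral_3_eq_3 One_nat_def
    show "jv1 b1 b2 (\<lambda>i j k. ?D1 i j k y) + jv2 b1 b2 (\<lambda>i j k. ?D2 i j k y) = 0"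
      unfolding unf by algebra
    let ?j = "\<lambda>i j k. jet N b1 b2 c i j k y"
    \<comment> \<open>The two momentum equations hold only because b is a unit vector: their left
      sides are multiples of |b|^2 - 1, and \<open>?Q\<close> and \<open>?R\<close> are the
      cofactors.\<close>
    let ?Q = "b1 * ?j 1 0 3 + b1 * ?j 1 2 1 + b2 * ?j 1 1 2 + b2 * ?j 1 3 0
      - c * (b1 * ?j 0 0 4 + b1 * ?j 0 2 2 + b2 * ?j 0 1 3 + b2 * ?j 0 3 1)"
    let ?R = "b2 * ?j 1 0 3 + b2 * ?j 1 2 1 - b1 * ?j 1 1 2 - b1 * ?j 1 3 0
      - c * (b2 * ?j 0 0 4 + b2 * ?j 0 2 2 - b1 * ?j 0 1 3 - b1 * ?j 0 3 1)"
    have n: "4 = Suc (Suc (Suc (Suc 0)))" by simp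
    have "jv1 b1 b2 (\<lambda>i j k. ?D0 i j k y) + jm1 b1 b2 c (\<lambda>i j k. ?D1 i j k y) + jm2 b1 b2 c (\<lambda>i j k. ?D2 i j k y)
      = A * ?Q * (b1\<^sup>2 + b2\<^sup>2 - 1)"
      by (simp add: unf n algebra_simps)
    then show "jv1 b1 b2 (\<lambda>i j k. ?D0 i j k y) + jm1 b1 b2 c (\<lambda>i j k. ?D1 i j k y) + jm2 b1 b2 c (\<lambda>i j k. ?D2 i j k y) = 0"
      using b by simp
    have "jv2 b1 b2 (\<lambda>i j k. ?D0 i j k y) + jm2 b1 b2 c (\<lambda>i j k. ?D1 i j k y) - jm1 b1 b2 c (\<lambda>i j k. ?D2 i j k y)
      = A * ?R * (b1\<^sup>2 + b2\<^sup>2 - 1)"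
      by (simp add: unf n algebra_simps)
    then show "jv2 b1 b2 (\<lambda>i j k. ?D0 i j k y) + jm2 b1 b2 c (\<lambda>i j k. ?D1 i j k y) - jm1 b1 b2 c (\<lambda>i j k. ?D2 i j k y) = 0"
      using b by simp
  qed simp
qed

lemma jet_bound:
  assumes i: "i \<le> 3" and j: "j \<le> 3" and k: "k \<le> 3" and N: "N > 0"
  shows "\<bar>jet N b1 b2 c i j k y\<bar> \<le> (17 * pi^3)\<^sup>2 * 17"
    "k \<le> 2 \<Longrightarrow> \<bar>jet N b1 b2 c i j k y\<bar> \<le> (17 * pi^3)\<^sup>2 * 17 / N"
proof -
  have p1: "pi \<ge> 1" using pi_gt3 by simp
  have 1: "\<bar>bump 1 i s\<bar> \<le> 17 * pi^3" if "i \<le> 3" for i s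
    using bump_bound[OF that, of 1 s] power_increasing[OF that p1] by simp
  have q: "\<bar>bump N k s / (pi*N)^3\<bar> \<le> 17 * ((pi * N)^k / (pi*N)^3)" for s
    using bump_bound[OF k, of N s] N by (simp add: abs_divide divide_right_mono abs_mult)
  have a1: "1 \<le> pi * N" using p1 N by (metis One_nat_def Suc_leI mult_mono mult.right_neutral of_nat_1 of_nat_le_iff pi_ge_zero zero_le_one)
  have *: "\<bar>jet N b1 b2 c i j k y\<bar> \<le> (17 * pi^3 * (17 * pi^3)) * (17 * X)"
    if "(pi * N)^k / (pi*N)^3 \<le> X" for X
    unfolding jet_def abs_mult
    by (intro mult_mono 1 i j order_trans[OF q] mult_left_mono that) auto
  have "(pi * N)^k / (pi*N)^3 \<le> 1" using power_increasing[OF k a1] a1 by (simp add: divide_le_eq)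
  from *[OF this] show "\<bar>jet N b1 b2 c i j k y\<bar> \<le> (17 * pi^3)\<^sup>2 * 17" by (simp add: power2_eq_square)
  assume "k \<le> 2"
  then have "(pi * N)^k / (pi*N)^3 \<le> (pi * N)^2 / (pi*N)^3"
    using power_increasing[of k 2, OF _ a1] a1 by (intro divide_right_mono) auto
  also have "\<dots> = 1 / (pi * N)" using a1 by (simp add: power3_eq_cube power2_eq_square)
  also have "\<dots> \<le> 1 / N" using p1 N by (simp add: field_simps)
  finally show "\<bar>jet N b1 b2 c i j k y\<bar> \<le> (17 * pi^3)\<^sup>2 * 17 / N"
    using *[of "1/N"] by (simp add: power2_eq_square)
qed

text \<open>At fixed time the coordinates (r, s) arise from x by a rotation and a translation by c
  t, so the integral factors into three integrals on the line: 63/256 for t and for r (k = 0), and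
  33950/512 for s (k = 3).\<close>

lemma jet_003_integral:
  assumes b: "b1\<^sup>2 + b2\<^sup>2 = 1" and N: "N > 0"
  shows "(LINT y|lborel. (jet N b1 b2 c 0 0 3 y)\<^sup>2) = (63/256)\<^sup>2 * (33950/512)"
proof -
  have [measurable]: "bump (Suc 0) 0 \<in> borel_measurable borel" "bump 1 0 \<in> borel_measurable borel" "bump N 3 \<in> borel_measurable borel"
    by (auto intro!: borel_measurable_continuous_onI bump_cont)
  let ?f = "\<lambda>s. ennreal ((bump 1 0 s)\<^sup>2)" and ?g = "\<lambda>s. ennreal ((bump N 3 s / (pi*N)^3)\<^sup>2)"
  have fm: "?f \<in> borel_measurable borel" and gm: "?g \<in> borel_measurable borel"
    by measurable
  have M: "(\<lambda>y. ?f (fst y) * (?f (b1 * fst (snd y) + b2 * snd (snd y)) * ?g (- b2 * fst (snd y) + b1 * snd (snd y) - c * fst y)))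
    \<in> borel_measurable (lborel \<Otimes>\<^sub>M lborel)"
    unfolding lborel_prod[symmetric] by measurable
  have "(\<integral>\<^sup>+y. ennreal ((jet N b1 b2 c 0 0 3 y)\<^sup>2) \<partial>lborel)
    = (\<integral>\<^sup>+y. ?f (fst y) * (?f (b1 * fst (snd y) + b2 * snd (snd y)) * ?g (- b2 * fst (snd y) + b1 * snd (snd y) - c * fst y)) \<partial>(lborel \<Otimes>\<^sub>M lborel))"
    unfolding lborel_prod
    by (intro nn_integral_cong) (simp add: jet_def power_mult_distrib ennreal_mult[symmetric] mult.assoc power_divide)
  also have "\<dots> = (\<integral>\<^sup>+t. \<integral>\<^sup>+x. ?f t * (?f (b1 * fst x + b2 * snd x) * ?g (- b2 * fst x + b1 * snd x - c * t)) \<partial>lborel \<partial>lborel)"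
    by (subst lborel.nn_integral_fst[symmetric, OF M]) simp
  also have "\<dots> = (\<integral>\<^sup>+t. ?f t * ((\<integral>\<^sup>+r. ?f r \<partial>lborel) * (\<integral>\<^sup>+s. ?g s \<partial>lborel)) \<partial>lborel)"
  proof (rule nn_integral_cong)
    fix t
    have "(\<lambda>x::real\<times>real. ?f (b1 * fst x + b2 * snd x) * ?g (- b2 * fst x + b1 * snd x - c * t)) \<in> borel_measurable borel"
      unfolding borel_prod[symmetric] by measurable
    then show "(\<integral>\<^sup>+x. ?f t * (?f (b1 * fst x + b2 * snd x) * ?g (- b2 * fst x + b1 * snd x - c * t)) \<partial>lborel)
       = ?f t * ((\<integral>\<^sup>+r. ?f r \<partial>lborel) * (\<integral>\<^sup>+s. ?g s \<partial>lborel))"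
      by (subst nn_integral_cmult, simp, subst nn_integral_rotate[OF fm gm b]) simp_all
  qed
  also have "\<dots> = (\<integral>\<^sup>+r. ?f r \<partial>lborel) * ((\<integral>\<^sup>+r. ?f r \<partial>lborel) * (\<integral>\<^sup>+s. ?g s \<partial>lborel))"
    by (rule nn_integral_multc) simp
  also have "(\<integral>\<^sup>+r. ?f r \<partial>lborel) = ennreal (63/256)"
    using bump_sq_integral[of 1 0] by simp
  also have "(\<integral>\<^sup>+s. ?g s \<partial>lborel) = ennreal (33950/512)"
    using bump_sq_integral[OF N, of 3] by simp
  finally have "(\<integral>\<^sup>+y. ennreal ((jet N b1 b2 c 0 0 3 y)\<^sup>2) \<partial>lborel) = ennreal ((63/256)\<^sup>2 * (33950/512))"
    by (simp add: ennreal_mult[symmetric] power2_eq_square del: ennreal_numeral)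
  moreover have "(\<lambda>y. (jet N b1 b2 c 0 0 3 y)\<^sup>2) \<in> borel_measurable borel"
    using C1_cont[OF jet_C1[of 0 0 3 N b1 b2 c]] by (intro borel_measurable_continuous_onI continuous_intros) auto
  ultimately show ?thesis by (subst integral_eq_nn_integral) simp_all
qed

text \<open>The matrix part is c times the symmetric traceless matrix b \<otimes> b^\<bottom> +
  b^\<bottom> \<otimes> b. It maps b^\<bottom> to c b, and the velocity b is orthogonal to
  b^\<bottom>, so any profile of b^\<bottom> . x - c t times this vector solves the linear system: a
  transversal plane wave of speed c.\<close>

definition osc_dir :: "real \<Rightarrow> real \<Rightarrow> real \<Rightarrow> st" where
  "osc_dir b1 b2 c = (b1, b2, - 2 * c * b1 * b2, c * (b1\<^sup>2 - b2\<^sup>2))"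

definition jetB :: real where "jetB = (17 * pi^3)\<^sup>2 * 17"

lemma jetB_pos: "jetB > 0" by (simp add: jetB_def)

lemma unit_bounds:
  assumes "b1\<^sup>2 + b2\<^sup>2 = (1::real)"
  shows "\<bar>b1\<bar> \<le> 1" "\<bar>b2\<bar> \<le> 1" "\<bar>b1\<^sup>2 - b2\<^sup>2\<bar> \<le> 1" "\<bar>b1 * b2\<bar> \<le> 1"
proof -
  show 1: "\<bar>b1\<bar> \<le> 1" "\<bar>b2\<bar> \<le> 1"
    using assms zero_le_power2[of b1] zero_le_power2[of b2] unfolding abs_square_le_1[symmetric] by linarith+
  show "\<bar>b1\<^sup>2 - b2\<^sup>2\<bar> \<le> 1" using assms zero_le_power2[of b1] zero_le_power2[of b2] by linarith
  show "\<bar>b1 * b2\<bar> \<le> 1" using mult_mono[OF 1] by (simp add: abs_mult)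
qed

text \<open>Every term other than the one with three s-derivatives carries at most two of them and
  is O(1/N). The constant 40 covers 3 + 3 + 12 + 12, the terms of the four components.\<close>

lemma osc_close:
  assumes b: "b1\<^sup>2 + b2\<^sup>2 = 1" and c: "\<bar>c\<bar> \<le> L" and A: "A \<ge> 0" and N: "N > 0"
  shows "norm (osc N b1 b2 c A y - (- A * jet N b1 b2 c 0 0 3 y) *\<^sub>R osc_dir b1 b2 c) \<le> 40 * (1 + L) * A * jetB / N"
proof -
  define X where "X = A * (jetB / N)"
  have X0: "X \<ge> 0" using A jetB_pos by (simp add: X_def)
  have L0: "L \<ge> 0" using c by simp
  let ?F = "\<lambda>i j k. A * jet N b1 b2 c i j k y"
  have F: "\<bar>?F i j k\<bar> \<le> X" if "i \<le> 3" "j \<le> 3" "k \<le> 2" for i j k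
    using mult_left_mono[OF jet_bound(2)[OF that(1,2) _ N that(3), of b1 b2 c y] A] A that
    by (simp add: X_def jetB_def abs_mult)
  have m: "\<bar>a * f\<bar> \<le> K * X" if "\<bar>a\<bar> \<le> K" "\<bar>f\<bar> \<le> X" for a f K
    unfolding abs_mult using that by (intro mult_mono) auto
  note ub = unit_bounds[OF b]
  have ub': "\<bar>- b1\<bar> \<le> 1" "\<bar>- b2\<bar> \<le> 1" using ub by simp_all
  have cF: "\<bar>c * ?F i j k\<bar> \<le> L * X" if "i \<le> 3" "j \<le> 3" "k \<le> 2" for i j k
    by (rule m[OF c F[OF that]])
  have e1: "\<bar>V1 (osc N b1 b2 c A y) - (- ?F 0 0 3) * b1\<bar> \<le> 3 * X"
  proof -
    have "V1 (osc N b1 b2 c A y) - (- ?F 0 0 3) * b1 = (-b2) * ?F 0 3 0 + (-b2) * ?F 0 1 2 + (-b1) * ?F 0 2 1"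
      by (simp add: osc_def jv1_def Let_def algebra_simps)
    moreover have "\<bar>(-b2) * ?F 0 3 0\<bar> \<le> 1 * X" "\<bar>(-b2) * ?F 0 1 2\<bar> \<le> 1 * X" "\<bar>(-b1) * ?F 0 2 1\<bar> \<le> 1 * X"
      by (rule m[OF ub'(2) F]; simp)+ (rule m[OF ub'(1) F]; simp)
    ultimately show ?thesis by linarith
  qed
  have e2: "\<bar>V2 (osc N b1 b2 c A y) - (- ?F 0 0 3) * b2\<bar> \<le> 3 * X"
  proof -
    have "V2 (osc N b1 b2 c A y) - (- ?F 0 0 3) * b2 = b1 * ?F 0 3 0 + b1 * ?F 0 1 2 + (-b2) * ?F 0 2 1"
      by (simp add: osc_def jv2_def Let_def algebra_simps)
    moreover have "\<bar>b1 * ?F 0 3 0\<bar> \<le> 1 * X" "\<bar>b1 * ?F 0 1 2\<bar> \<le> 1 * X" "\<bar>(-b2) * ?F 0 2 1\<bar> \<le> 1 * X"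
      by (rule m[OF ub(1) F]; simp)+ (rule m[OF ub'(2) F]; simp)
    ultimately show ?thesis by linarith
  qed
  have g1: "\<bar>?F 1 2 0 - c * ?F 0 2 1\<bar> \<le> (1 + L) * X" "\<bar>?F 1 1 1 - c * ?F 0 1 2\<bar> \<le> (1 + L) * X"
    "\<bar>?F 1 0 2\<bar> \<le> (1 + L) * X"
    using F[of 1 2 0] F[of 1 1 1] F[of 1 0 2] cF[of 0 2 1] cF[of 0 1 2] X0 L0
    by (auto simp: distrib_right) 
  have m': "\<bar>a * f\<bar> \<le> 4 * ((1 + L) * X)" if "\<bar>a\<bar> \<le> 4" "\<bar>f\<bar> \<le> (1 + L) * X" for a f
    unfolding abs_mult using that by (intro mult_mono) auto
  have u: "\<bar>2 * (b1 * b2)\<bar> \<le> 4" "\<bar>2 * (b1\<^sup>2 - b2\<^sup>2)\<bar> \<le> 4" "\<bar>- 2 * (b1 * b2)\<bar> \<le> 4"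
    "\<bar>- (b1\<^sup>2 - b2\<^sup>2)\<bar> \<le> 4" "\<bar>4 * (b1 * b2)\<bar> \<le> 4" "\<bar>b1\<^sup>2 - b2\<^sup>2\<bar> \<le> 4"
    using ub(3,4) by (auto simp: abs_le_iff)
  have e3: "\<bar>M1 (osc N b1 b2 c A y) - (- ?F 0 0 3) * (- 2 * c * b1 * b2)\<bar> \<le> 12 * ((1 + L) * X)"
  proof -
    have "M1 (osc N b1 b2 c A y) - (- ?F 0 0 3) * (- 2 * c * b1 * b2) =
      (2 * (b1 * b2)) * (?F 1 2 0 - c * ?F 0 2 1) + (2 * (b1\<^sup>2 - b2\<^sup>2)) * (?F 1 1 1 - c * ?F 0 1 2) + (- 2 * (b1 * b2)) * ?F 1 0 2"
      by (simp add: osc_def jm1_def Let_def algebra_simps)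
    moreover have "\<bar>(2 * (b1 * b2)) * (?F 1 2 0 - c * ?F 0 2 1)\<bar> \<le> 4 * ((1 + L) * X)"
      "\<bar>(2 * (b1\<^sup>2 - b2\<^sup>2)) * (?F 1 1 1 - c * ?F 0 1 2)\<bar> \<le> 4 * ((1 + L) * X)"
      "\<bar>(- 2 * (b1 * b2)) * ?F 1 0 2\<bar> \<le> 4 * ((1 + L) * X)"
      by (intro m' u g1)+
    ultimately show ?thesis by linarith
  qed
  have e4: "\<bar>M2 (osc N b1 b2 c A y) - (- ?F 0 0 3) * (c * (b1\<^sup>2 - b2\<^sup>2))\<bar> \<le> 12 * ((1 + L) * X)"
  proof -
    have "M2 (osc N b1 b2 c A y) - (- ?F 0 0 3) * (c * (b1\<^sup>2 - b2\<^sup>2)) =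
      (- (b1\<^sup>2 - b2\<^sup>2)) * (?F 1 2 0 - c * ?F 0 2 1) + (4 * (b1 * b2)) * (?F 1 1 1 - c * ?F 0 1 2) + (b1\<^sup>2 - b2\<^sup>2) * ?F 1 0 2"
      by (simp add: osc_def jm2_def Let_def algebra_simps)
    moreover have "\<bar>(- (b1\<^sup>2 - b2\<^sup>2)) * (?F 1 2 0 - c * ?F 0 2 1)\<bar> \<le> 4 * ((1 + L) * X)"
      "\<bar>(4 * (b1 * b2)) * (?F 1 1 1 - c * ?F 0 1 2)\<bar> \<le> 4 * ((1 + L) * X)"
      "\<bar>(b1\<^sup>2 - b2\<^sup>2) * ?F 1 0 2\<bar> \<le> 4 * ((1 + L) * X)"
      by (intro m' u g1)+
    ultimately show ?thesis by linarith
  qed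
  have nb: "norm q \<le> \<bar>V1 q\<bar> + \<bar>V2 q\<bar> + \<bar>M1 q\<bar> + \<bar>M2 q\<bar>" for q :: st
    using norm_Pair_le[of "V1 q" "snd q"] norm_Pair_le[of "V2 q" "snd (snd q)"] norm_Pair_le[of "M1 q" "M2 q"] by simp
  let ?Q = "osc N b1 b2 c A y - (- A * jet N b1 b2 c 0 0 3 y) *\<^sub>R osc_dir b1 b2 c"
  have "\<bar>V1 ?Q\<bar> \<le> 3 * X" "\<bar>V2 ?Q\<bar> \<le> 3 * X" "\<bar>M1 ?Q\<bar> \<le> 12 * ((1 + L) * X)" "\<bar>M2 ?Q\<bar> \<le> 12 * ((1 + L) * X)"
    using e1 e2 e3 e4 by (simp_all add: osc_dir_def)
  then have "norm ?Q \<le> 3 * X + 3 * X + 12 * ((1 + L) * X) + 12 * ((1 + L) * X)"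
    using nb[of ?Q] by linarith
  also have "\<dots> \<le> 40 * ((1 + L) * X)" using X0 L0 by (simp add: algebra_simps)
  finally show ?thesis unfolding X_def by (simp only: mult.assoc times_divide_eq_right)
qed

lemma osc_energy:
  assumes b: "b1\<^sup>2 + b2\<^sup>2 = 1" and c: "\<bar>c\<bar> \<le> L" and N: "N > 0"
  shows "(LINT y|lborel. (V1 (osc N b1 b2 c A y))\<^sup>2 + (V2 (osc N b1 b2 c A y))\<^sup>2)
    \<ge> A\<^sup>2 * ((63/256)\<^sup>2 * (33950/512) / 2 - (jetB / N)\<^sup>2 * measure lborel (cball (0::pt) (4 + L)))"
proof -
  let ?J = "\<lambda>i j k y. jet N b1 b2 c i j k y" and ?K = "cball (0::pt) (4 + L)"
  have cJ: "continuous_on UNIV (?J i j k)" if "i \<le> 3" "j \<le> 3" "k \<le> 3" for i j k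
    by (rule C1_cont[OF jet_C1[OF that]])
  have out: "?J i j k y = 0" if "y \<notin> ?K" for i j k y
    using jet_support[OF b c] that by (metis mem_cball_0)
  have I: "integrable lborel (\<lambda>y. (?J i j k y)\<^sup>2)" if "i \<le> 3" "j \<le> 3" "k \<le> 3" for i j k
    by (rule integrable_compact_support[where K = ?K]) (use out cJ[OF that] in \<open>auto intro!: continuous_intros\<close>)
  have iK: "integrable lborel (indicator ?K :: pt \<Rightarrow> real)"
    using emeasure_bounded_finite[OF bounded_cball, of "0::pt" "4 + L"]
    by (intro integrable_real_indicator) auto
  have P: "(V1 (osc N b1 b2 c A y))\<^sup>2 + (V2 (osc N b1 b2 c A y))\<^sup>2 =
    A\<^sup>2 * ((?J 0 3 0 y + ?J 0 1 2 y)\<^sup>2 + (?J 0 2 1 y + ?J 0 0 3 y)\<^sup>2)" for y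
  proof -
    let ?p = "A * (?J 0 3 0 y + ?J 0 1 2 y)" and ?q = "A * (?J 0 2 1 y + ?J 0 0 3 y)"
    have "(V1 (osc N b1 b2 c A y))\<^sup>2 + (V2 (osc N b1 b2 c A y))\<^sup>2 = (b2 * ?p + b1 * ?q)\<^sup>2 + (b1 * ?p - b2 * ?q)\<^sup>2"
      by (simp add: osc_def jv1_def jv2_def Let_def power2_eq_square algebra_simps)
    also have "\<dots> = (b1\<^sup>2 + b2\<^sup>2) * (?p\<^sup>2 + ?q\<^sup>2)" by (simp add: power2_eq_square algebra_simps)
    finally show ?thesis unfolding b power_mult_distrib by (simp only: distrib_left mult_1)
  qed
  have le: "A\<^sup>2 * ((?J 0 0 3 y)\<^sup>2 / 2 - (jetB / N)\<^sup>2 * indicator ?K y)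
     \<le> (V1 (osc N b1 b2 c A y))\<^sup>2 + (V2 (osc N b1 b2 c A y))\<^sup>2" for y
    unfolding P
  proof (rule mult_left_mono)
    have j: "(?J 0 2 1 y)\<^sup>2 \<le> (jetB / N)\<^sup>2 * indicator ?K y"
    proof (cases "y \<in> ?K")
      case True
      have "\<bar>?J 0 2 1 y\<bar> \<le> \<bar>jetB / N\<bar>"
        using jet_bound(2)[of 0 2 1 N b1 b2 c y] N jetB_pos by (simp add: jetB_def)
      from abs_le_square_iff[THEN iffD1, OF this] show ?thesis using True by simp
    qed (use out in simp)
    \<comment> \<open>Twice the difference of the two sides is (2p + q)^2. Thus half the energy of
      the leading jet survives, up to the square of an O(1/N) term.\<close>
    have "(p + q)\<^sup>2 \<ge> q\<^sup>2 / 2 - p\<^sup>2" for p q :: real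
      using zero_le_power2[of "2 * p + q"] by (simp add: power2_eq_square algebra_simps)
    from this[of "?J 0 0 3 y" "?J 0 2 1 y"] j
    show "(?J 0 0 3 y)\<^sup>2 / 2 - (jetB / N)\<^sup>2 * indicator ?K y
      \<le> (?J 0 3 0 y + ?J 0 1 2 y)\<^sup>2 + (?J 0 2 1 y + ?J 0 0 3 y)\<^sup>2"
      using zero_le_power2[of "?J 0 3 0 y + ?J 0 1 2 y"] by linarith
  qed simp
  have "integrable lborel (\<lambda>y. (V1 (osc N b1 b2 c A y))\<^sup>2 + (V2 (osc N b1 b2 c A y))\<^sup>2)"
    unfolding P by (rule integrable_compact_support[where K = ?K])
      (use out cJ in \<open>auto intro!: continuous_intros\<close>)
  then have "(LINT y|lborel. A\<^sup>2 * ((?J 0 0 3 y)\<^sup>2 / 2 - (jetB / N)\<^sup>2 * indicator ?K y))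
    \<le> (LINT y|lborel. (V1 (osc N b1 b2 c A y))\<^sup>2 + (V2 (osc N b1 b2 c A y))\<^sup>2)"
    using I[of 0 0 3] iK le by (intro integral_mono) auto
  also have "(LINT y|lborel. A\<^sup>2 * ((?J 0 0 3 y)\<^sup>2 / 2 - (jetB / N)\<^sup>2 * indicator ?K y))
    = A\<^sup>2 * ((63/256)\<^sup>2 * (33950/512) / 2 - (jetB / N)\<^sup>2 * measure lborel ?K)"
    using I[of 0 0 3] iK jet_003_integral[OF b N, of c] by simp
  finally show ?thesis .
qed

text \<open>The point is that \<beta> depends only on the bound L for the speed, not on the state,
  the direction, the length \<sigma>0 or the open set. U enters only through the frequency: a
  segment compactly inside U has a positive distance to the complement, and a large N brings the
  wave closer to the segment than that.\<close>

lemma localized_wave: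
  assumes L: "L \<ge> 0"
  shows "\<exists>\<beta>>0. \<forall>b1 b2 c \<sigma>0 z U. b1\<^sup>2 + b2\<^sup>2 = 1 \<longrightarrow> \<bar>c\<bar> \<le> L \<longrightarrow> \<sigma>0 \<ge> 0 \<longrightarrow> open U \<longrightarrow>
      (\<forall>\<sigma>. \<bar>\<sigma>\<bar> \<le> \<sigma>0 \<longrightarrow> z + \<sigma> *\<^sub>R osc_dir b1 b2 c \<in> U) \<longrightarrow>
      (\<exists>w. pwave (ball 0 1) w \<and> (\<forall>y. z + w y \<in> U) \<and>
         (LINT y|lborel. (V1 (w y))\<^sup>2 + (V2 (w y))\<^sup>2) \<ge> \<beta> * \<sigma>0\<^sup>2)"
\<comment> \<open>The factors: \<open>(1 / (5 + L))^3\<close> from shrinking the support into the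
  unit ball, a quarter of the energy of the leading jet (half, minus the error terms), and
  \<open>jetB\<close> squared from normalising the amplitude.\<close>
proof (intro exI[of _ "(1 / (5 + L))^3 * (((63/256)\<^sup>2 * (33950/512) / 4) / jetB\<^sup>2)"] conjI allI impI)
  let ?G = "(63/256)\<^sup>2 * (33950/512) :: real" and ?m = "measure lborel (cball (0::pt) (4 + L))"
  show "(1 / (5 + L))^3 * ((?G / 4) / jetB\<^sup>2) > 0" using L jetB_pos by simp
  fix b1 b2 c \<sigma>0 :: real and z :: st and U
  assume b: "b1\<^sup>2 + b2\<^sup>2 = 1" and c: "\<bar>c\<bar> \<le> L" and s: "\<sigma>0 \<ge> 0" and U: "open U"
    and seg: "\<forall>\<sigma>. \<bar>\<sigma>\<bar> \<le> \<sigma>0 \<longrightarrow> z + \<sigma> *\<^sub>R osc_dir b1 b2 c \<in> U"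
  let ?S = "(\<lambda>\<sigma>. z + \<sigma> *\<^sub>R osc_dir b1 b2 c) ` {-\<sigma>0..\<sigma>0}"
  have "compact ?S" by (intro compact_continuous_image continuous_intros) auto
  moreover have "?S \<subseteq> U" using seg by (auto simp: abs_le_iff)
  ultimately obtain e where e: "e > 0" "{x. infdist x ?S \<le> e} \<subseteq> U" 
    using compact_in_open_separated[of ?S U] U s by auto
  \<comment> \<open>With this amplitude the leading coefficient never exceeds \<sigma>0 in absolute
    value, so the main part stays on the given segment.\<close>
  define A where "A = \<sigma>0 / jetB"
  have A0: "A \<ge> 0" using s jetB_pos by (simp add: A_def)
  have l1: "(\<lambda>n. 40 * (1 + L) * A * jetB / real n) \<longlonglongrightarrow> 0"
    by (rule lim_const_over_n)
  have l2: "(\<lambda>n. (jetB / real n)\<^sup>2 * ?m) \<longlonglongrightarrow> 0\<^sup>2 * ?m"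
    by (intro tendsto_intros lim_const_over_n)
  have "eventually (\<lambda>n. 40 * (1 + L) * A * jetB / real n < e) sequentially"
    by (rule order_tendstoD(2)[OF l1 e(1)])
  moreover have "eventually (\<lambda>n. (jetB / real n)\<^sup>2 * ?m < ?G / 4) sequentially"
    by (rule order_tendstoD(2)[OF l2]) simp
  ultimately have "eventually (\<lambda>n. 40 * (1 + L) * A * jetB / real n < e \<and> (jetB / real n)\<^sup>2 * ?m < ?G / 4 \<and> n > 0) sequentially"
    using eventually_gt_at_top[of 0] by eventually_elim auto
  then obtain N where N: "40 * (1 + L) * A * jetB / real N < e" "(jetB / real N)\<^sup>2 * ?m < ?G / 4" "N > 0"
    by (auto simp: eventually_sequentially)
  let ?o = "osc N b1 b2 c A"
  define R where "R = 5 + L"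
  have R: "R > 0" using L by (simp add: R_def)
  define w where "w = (\<lambda>y. ?o ((1 / (1/R)) *\<^sub>R (y - 0)))"
  have "pwave (ball 0 1) w"
    unfolding w_def
  proof (rule pwave_affine[OF osc_pwave[OF b c]])
    fix y :: pt assume "y \<in> cball 0 (4 + L)"
    then show "0 + (1/R) *\<^sub>R y \<in> ball 0 1" using R by (simp add: R_def divide_less_eq)
  qed (use R in simp)
  moreover have "z + w y \<in> U" for y
  proof -
    let ?x = "R *\<^sub>R y"
    have "\<bar>A * jet N b1 b2 c 0 0 3 ?x\<bar> \<le> A * jetB"
      using jet_bound(1)[of 0 0 3 N b1 b2 c ?x] N(3) A0 by (simp add: abs_mult jetB_def mult_left_mono)
    also have "A * jetB = \<sigma>0" using jetB_pos by (simp add: A_def)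
    finally have p: "z + (- A * jet N b1 b2 c 0 0 3 ?x) *\<^sub>R osc_dir b1 b2 c \<in> ?S"
      by (intro image_eqI[where x = "- A * jet N b1 b2 c 0 0 3 ?x"]) (auto simp: abs_le_iff)
    have "infdist (z + w y) ?S \<le> dist (z + w y) (z + (- A * jet N b1 b2 c 0 0 3 ?x) *\<^sub>R osc_dir b1 b2 c)"
      by (rule infdist_le[OF p])
    also have "\<dots> = norm (?o ?x - (- A * jet N b1 b2 c 0 0 3 ?x) *\<^sub>R osc_dir b1 b2 c)"
      by (simp add: dist_norm w_def)
    also have "\<dots> \<le> e" using osc_close[OF b c A0 N(3), of ?x] N(1) by linarith
    finally show ?thesis using e(2) by auto
  qed
  moreover have "(LINT y|lborel. (V1 (w y))\<^sup>2 + (V2 (w y))\<^sup>2) \<ge> (1 / (5 + L))^3 * ((?G / 4) / jetB\<^sup>2) * \<sigma>0\<^sup>2"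
  proof -
    have m: "(\<lambda>y. (V1 (w y))\<^sup>2 + (V2 (w y))\<^sup>2) \<in> borel_measurable borel"
      using \<open>pwave (ball 0 1) w\<close> by (auto simp: pwave_def intro!: borel_measurable_continuous_onI continuous_intros)
    have "(1 / (5 + L))^3 * ((?G / 4) / jetB\<^sup>2) * \<sigma>0\<^sup>2 = (1/R)^3 * (A\<^sup>2 * (?G / 4))"
      by (simp add: A_def R_def power_divide)
    also have "\<dots> \<le> (1/R)^3 * (A\<^sup>2 * (?G / 2 - (jetB / N)\<^sup>2 * ?m))"
      using N(2) R by (intro mult_left_mono) auto
    also have "\<dots> \<le> (1/R)^3 * (LINT y|lborel. (V1 (?o y))\<^sup>2 + (V2 (?o y))\<^sup>2)"
      using osc_energy[OF b c N(3), of A] R by (intro mult_left_mono) auto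
    also have "\<dots> = (LINT y|lborel. (V1 (w y))\<^sup>2 + (V2 (w y))\<^sup>2)"
      using R integral_lborel_affine[OF m, of "1/R" 0] by (simp add: w_def)
    finally show ?thesis .
  qed
  ultimately show "\<exists>w. pwave (ball 0 1) w \<and> (\<forall>y. z + w y \<in> U) \<and>
     (1 / (5 + L))^3 * ((?G / 4) / jetB\<^sup>2) * \<sigma>0\<^sup>2 \<le> (LINT y|lborel. (V1 (w y))\<^sup>2 + (V2 (w y))\<^sup>2)" by blast
qed

section \<open>The relaxation set and segments inside it\<close>

definition E11 :: "real \<Rightarrow> st \<Rightarrow> real" where "E11 C z = C / 2 - (V1 z)\<^sup>2 + M1 z"
definition E22 :: "real \<Rightarrow> st \<Rightarrow> real" where "E22 C z = C / 2 - (V2 z)\<^sup>2 - M1 z"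
definition E12 :: "real \<Rightarrow> st \<Rightarrow> real" where "E12 C z = M2 z - V1 z * V2 z"

text \<open>The relaxation set: the matrix \<open>C/2 I - v \<otimes> v + m\<close> is positive definite.\<close>

definition subsol :: "real \<Rightarrow> st set" where
  "subsol C = {z. 0 < E11 C z + E22 C z \<and> (E12 C z)\<^sup>2 < E11 C z * E22 C z}"

lemma open_subsol: "open (subsol C)"
  unfolding subsol_def E11_def E22_def E12_def
  by (intro open_Collect_conj open_Collect_less continuous_intros)

lemma subsol_trace: "E11 C z + E22 C z = C - ((V1 z)\<^sup>2 + (V2 z)\<^sup>2)"
  by (simp add: E11_def E22_def)

text \<open>In a positive definite matrix the trace bounds every entry, and here the trace is the
  energy gap. So when |v|^2 reaches C, the linear unknown m is forced to be the traceless part of v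
  \<otimes> v.\<close>

lemma subsol_bounds:
  assumes z: "z \<in> subsol C"
  shows "(V1 z)\<^sup>2 + (V2 z)\<^sup>2 < C" "\<bar>M1 z - ((V1 z)\<^sup>2 - C / 2)\<bar> \<le> C - ((V1 z)\<^sup>2 + (V2 z)\<^sup>2)"
    "\<bar>M2 z - V1 z * V2 z\<bar> \<le> C - ((V1 z)\<^sup>2 + (V2 z)\<^sup>2)"
proof -
  let ?a = "E11 C z" and ?b = "E22 C z" and ?c = "E12 C z"
  have t: "0 < ?a + ?b" and d: "?c\<^sup>2 < ?a * ?b" using z by (auto simp: subsol_def)
  have "0 < ?a * ?b" using d zero_le_power2[of ?c] by linarith
  then have p: "?a > 0" "?b > 0" using t by (auto simp: zero_less_mult_iff)
  show "(V1 z)\<^sup>2 + (V2 z)\<^sup>2 < C" using t subsol_trace[of C z] by simp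
  have "\<bar>?a\<bar> \<le> ?a + ?b" using p by simp
  then show "\<bar>M1 z - ((V1 z)\<^sup>2 - C / 2)\<bar> \<le> C - ((V1 z)\<^sup>2 + (V2 z)\<^sup>2)"
    using subsol_trace[of C z] by (simp add: E11_def)
  have "\<bar>?c\<bar> \<le> ?a + ?b"
  proof (rule abs_le_square_iff[THEN iffD2, of ?c "?a + ?b", simplified abs_of_pos[OF t]])
    have "?c\<^sup>2 \<le> ?a * ?b" using d by simp
    also have "\<dots> \<le> (?a + ?b)\<^sup>2" using p by (simp add: power2_eq_square algebra_simps)
    finally show "?c\<^sup>2 \<le> (?a + ?b)\<^sup>2" .
  qed
  then show "\<bar>M2 z - V1 z * V2 z\<bar> \<le> C - ((V1 z)\<^sup>2 + (V2 z)\<^sup>2)"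
    using subsol_trace[of C z] by (simp add: E12_def)
qed

text \<open>Moving along \<open>osc_dir\<close> with \<open>c = v \<bullet> b\<^sup>\<bottom>\<close> changes the matrix only by a multiple of \<open>b \<otimes> b\<close>;
  taking \<open>b\<close> as a top eigenvector leaves room proportional to the trace.\<close>

lemma subsol_segment:
  assumes z: "z \<in> subsol C"
  shows "\<exists>b1 b2 c. b1\<^sup>2 + b2\<^sup>2 = 1 \<and> \<bar>c\<bar> \<le> 1 + C \<and>
    (\<forall>\<sigma>. \<bar>\<sigma>\<bar> \<le> (C - ((V1 z)\<^sup>2 + (V2 z)\<^sup>2)) / (8 * (1 + C)) \<longrightarrow> z + \<sigma> *\<^sub>R osc_dir b1 b2 c \<in> subsol C)"
proof -
  define a d q \<tau> where "a = E11 C z" and "d = E22 C z" and "q = E12 C z" and "\<tau> = C - ((V1 z)\<^sup>2 + (V2 z)\<^sup>2)"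
  have ad: "a + d = \<tau>" by (simp add: a_def d_def \<tau>_def subsol_trace)
  have t: "\<tau> > 0" and det: "q\<^sup>2 < a * d" using z by (auto simp: subsol_def a_def d_def q_def \<tau>_def subsol_trace)
  have C: "C > 0" "\<tau> \<le> C" using t zero_le_power2[of "V1 z"] zero_le_power2[of "V2 z"] unfolding \<tau>_def by linarith+
  \<comment> \<open>The eigenvalues of the matrix with entries a, d, q are \<tau>/2 + s and \<tau>/2
    - s.\<close>
  define p where "p = (a - d) / 2"
  define s where "s = sqrt (p\<^sup>2 + q\<^sup>2)"
  have s: "s \<ge> 0" "s\<^sup>2 = p\<^sup>2 + q\<^sup>2" by (auto simp: s_def)
  obtain \<phi> where \<phi>: "p = s * cos \<phi>" "q = s * sin \<phi>"
  proof (cases "s = 0")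
    case True then show ?thesis using s by (intro that[of 0]) (auto simp: sum_power2_eq_zero_iff)
  next
    case False
    then have "(p / s)\<^sup>2 + (q / s)\<^sup>2 = 1" unfolding power_divide add_divide_distrib[symmetric] s(2)[symmetric] by simp
    then obtain t where "p / s = cos t" "q / s = sin t" using sincos_total_2pi by metis
    then show ?thesis using False by (intro that[of t]) (auto simp: field_simps)
  qed
  \<comment> \<open>Half of the angle of (p, q) diagonalises the matrix: b belongs to the larger
    eigenvalue and b^\<bottom> = (-b2, b1) to the smaller one.\<close>
  define b1 b2 where "b1 = cos (\<phi>/2)" and "b2 = sin (\<phi>/2)"
  have b: "b1\<^sup>2 + b2\<^sup>2 = 1" by (simp add: b1_def b2_def)
  have dbl: "cos \<phi> = b1\<^sup>2 - b2\<^sup>2" "sin \<phi> = 2 * b2 * b1"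
    using cos_double[of "\<phi>/2"] sin_double[of "\<phi>/2"] by (auto simp: b1_def b2_def)
  define c where "c = - b2 * V1 z + b1 * V2 z"
  define e where "e = b1 * V1 z + b2 * V2 z"
  have ce: "c\<^sup>2 + e\<^sup>2 = (V1 z)\<^sup>2 + (V2 z)\<^sup>2"
  proof -
    have "c\<^sup>2 + e\<^sup>2 = (b1\<^sup>2 + b2\<^sup>2) * ((V1 z)\<^sup>2 + (V2 z)\<^sup>2)"
      by (simp add: c_def e_def power2_eq_square algebra_simps)
    then show ?thesis using b by simp
  qed
  have le1: "\<bar>x\<bar> \<le> (1 + C) / 2 + 0" if "x\<^sup>2 \<le> C" for x
  proof -
    have "0 \<le> (\<bar>x\<bar> - 1)\<^sup>2" by simp
    then have "2 * \<bar>x\<bar> \<le> 1 + x\<^sup>2" by (simp add: power2_diff)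
    then show ?thesis using that by simp
  qed
  have cb: "\<bar>c\<bar> \<le> (1 + C) / 2" "\<bar>e\<bar> \<le> (1 + C) / 2"
    using le1[of c] le1[of e] ce t zero_le_power2[of c] zero_le_power2[of e] unfolding \<tau>_def by linarith+
  define \<mu> where "\<mu> = \<tau> / 2 - s"
  \<comment> \<open>The quadratic form at b^\<bottom> is the smaller eigenvalue \<mu>; it is the
    rate at which a multiple of b \<otimes> b changes the determinant.\<close>
  have n: "a * b2\<^sup>2 - 2 * q * b1 * b2 + d * b1\<^sup>2 = \<mu>"
  proof -
    have "a * b2\<^sup>2 - 2 * q * b1 * b2 + d * b1\<^sup>2 = \<tau> / 2 * (b1\<^sup>2 + b2\<^sup>2) - p * (b1\<^sup>2 - b2\<^sup>2) - q * (2 * b2 * b1)"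
      by (simp add: p_def ad[symmetric] field_simps)
    also have "\<dots> = \<tau> / 2 - (s * cos \<phi>) * cos \<phi> - (s * sin \<phi>) * sin \<phi>"
      unfolding dbl[symmetric] \<phi> b by simp
    also have "\<dots> = \<tau> / 2 - s * ((cos \<phi>)\<^sup>2 + (sin \<phi>)\<^sup>2)"
      by (simp only: power2_eq_square algebra_simps)
    finally show ?thesis by (simp add: \<mu>_def)
  qed
  have det': "a * d - q\<^sup>2 = \<mu> * (\<tau> / 2 + s)"
  proof -
    have "\<mu> * (\<tau> / 2 + s) = (\<tau>/2)\<^sup>2 - s\<^sup>2" by (simp add: \<mu>_def power2_eq_square algebra_simps)
    also have "\<dots> = a * d - q\<^sup>2" unfolding s(2) p_def ad[symmetric] by (simp add: power2_eq_square field_simps)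
    finally show ?thesis by simp
  qed
  have \<mu>: "\<mu> > 0"
  proof -
    have "\<mu> * (\<tau> / 2 + s) > 0" using det det' by simp
    then show ?thesis using t s(1) by (simp add: zero_less_mult_iff)
  qed
  show ?thesis
  proof (intro exI conjI allI impI)
    show "b1\<^sup>2 + b2\<^sup>2 = 1" by (rule b)
    show "\<bar>c\<bar> \<le> 1 + C" using cb C by simp
    fix \<sigma> assume "\<bar>\<sigma>\<bar> \<le> (C - ((V1 z)\<^sup>2 + (V2 z)\<^sup>2)) / (8 * (1 + C))"
    then have sg: "\<bar>\<sigma>\<bar> * (8 * (1 + C)) \<le> \<tau>" using C by (simp add: \<tau>_def pos_le_divide_eq)
    \<comment> \<open>Along the segment the matrix loses \<rho> b \<otimes> b. Since |e| \<le> (1 +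
      C)/2 and |\<sigma>| \<le> 1 + C, \<rho> is at most 2 |\<sigma>| (1 + C), which the factor 8
      keeps below \<tau>/2; the eigenvalue at b is at least that large.\<close>
    define \<rho> where "\<rho> = 2 * \<sigma> * e + \<sigma>\<^sup>2"
    have \<rho>: "\<rho> < \<tau> / 2"
    proof -
      have "\<sigma> * e \<le> \<bar>\<sigma>\<bar> * ((1 + C) / 2)"
        using mult_left_mono[OF cb(2), of "\<bar>\<sigma>\<bar>"] abs_ge_self[of "\<sigma> * e"] by (simp add: abs_mult)
      moreover have "\<sigma>\<^sup>2 \<le> \<bar>\<sigma>\<bar> * (1 + C)"
      proof -
        have "\<bar>\<sigma>\<bar> * 8 \<le> \<bar>\<sigma>\<bar> * (8 * (1 + C))" using C by (intro mult_left_mono) auto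
        then have "\<bar>\<sigma>\<bar> \<le> 1 + C" using sg C by linarith
        then show ?thesis using mult_left_mono[of "\<bar>\<sigma>\<bar>" "1 + C" "\<bar>\<sigma>\<bar>"] by (simp add: power2_eq_square)
      qed
      ultimately have "\<rho> \<le> 2 * (\<bar>\<sigma>\<bar> * (1 + C))" by (simp add: \<rho>_def)
      then show ?thesis using sg t by linarith
    qed
    let ?z = "z + \<sigma> *\<^sub>R osc_dir b1 b2 c"
    have c1: "c * b2 = - V1 z + e * b1" 
    proof -
      have "c * b2 = - V1 z * (b1\<^sup>2 + b2\<^sup>2) + e * b1"
        by (simp add: c_def e_def power2_eq_square algebra_simps)
      then show ?thesis using b by simp
    qed
    have c2: "c * b1 = V2 z - e * b2"
    proof -
      have "c * b1 = V2 z * (b1\<^sup>2 + b2\<^sup>2) - e * b2"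
        by (simp add: c_def e_def power2_eq_square algebra_simps)
      then show ?thesis using b by simp
    qed
    have "E11 C ?z = a - 2 * \<sigma> * b1 * (V1 z + c * b2) - \<sigma>\<^sup>2 * b1\<^sup>2"
      by (simp add: E11_def a_def osc_dir_def power2_eq_square algebra_simps)
    then have e11: "E11 C ?z = a - \<rho> * b1\<^sup>2" unfolding c1 by (simp add: \<rho>_def power2_eq_square algebra_simps)
    have "E22 C ?z = d - 2 * \<sigma> * b2 * (V2 z - c * b1) - \<sigma>\<^sup>2 * b2\<^sup>2"
      by (simp add: E22_def d_def osc_dir_def power2_eq_square algebra_simps)
    then have e22: "E22 C ?z = d - \<rho> * b2\<^sup>2" unfolding c2 by (simp add: \<rho>_def power2_eq_square algebra_simps)
    have "E12 C ?z = q + \<sigma> * ((c * b1) * b1 - (c * b2) * b2) - \<sigma> * (b1 * V2 z + b2 * V1 z) - \<sigma>\<^sup>2 * b1 * b2"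
      by (simp add: E12_def q_def osc_dir_def power2_eq_square algebra_simps)
    then have e12: "E12 C ?z = q - \<rho> * (b1 * b2)" unfolding c1 c2 by (simp add: \<rho>_def power2_eq_square algebra_simps)
    have "E11 C ?z + E22 C ?z = \<tau> - \<rho> * (b1\<^sup>2 + b2\<^sup>2)" unfolding e11 e22 ad[symmetric] by (simp add: algebra_simps)
    then have tr: "E11 C ?z + E22 C ?z > 0" using \<rho> t b by simp
    have "E11 C ?z * E22 C ?z - (E12 C ?z)\<^sup>2 = (a * d - q\<^sup>2) - \<rho> * (a * b2\<^sup>2 - 2 * q * b1 * b2 + d * b1\<^sup>2)"
      unfolding e11 e22 e12 by (simp add: power2_eq_square algebra_simps)
    also have "\<dots> = \<mu> * (\<tau> / 2 + s - \<rho>)" unfolding n det' by (simp add: algebra_simps)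
    also have "\<dots> > 0" using \<mu> \<rho> s(1) by simp
    finally show "?z \<in> subsol C" using tr by (simp add: subsol_def)
  qed
qed

section \<open>Convex integration\<close>

definition gap :: "real \<Rightarrow> st \<Rightarrow> real" where "gap C z = C - ((V1 z)\<^sup>2 + (V2 z)\<^sup>2)"

lemma gap_pos: "z \<in> subsol C \<Longrightarrow> gap C z > 0"
  using subsol_bounds(1)[of z C] by (simp add: gap_def)

lemma pwave_outside: "pwave \<Omega> w \<Longrightarrow> y \<notin> \<Omega> \<Longrightarrow> w y = 0"
  unfolding pwave_def by blast

lemma abs_le_of_sq: assumes "x\<^sup>2 \<le> (C::real)" shows "\<bar>x\<bar> \<le> (1 + C) / 2"
proof -
  have "0 \<le> (\<bar>x\<bar> - 1)\<^sup>2" by simp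
  then have "2 * \<bar>x\<bar> \<le> 1 + x\<^sup>2" by (simp add: power2_diff)
  then show ?thesis using assms by simp
qed

lemma subsol_vel_bound:
  assumes "z \<in> subsol C" shows "\<bar>V1 z\<bar> \<le> (1 + C) / 2" "\<bar>V2 z\<bar> \<le> (1 + C) / 2"
  using subsol_bounds(1)[OF assms] zero_le_power2[of "V1 z"] zero_le_power2[of "V2 z"]
  by (intro abs_le_of_sq; linarith)+

text \<open>Two uniformities are added to the segment lemma: the gain is a multiple of the squared
  gap with a constant depending on C alone, and by compactness of the range of z0 + \<zeta> the same
  wave may be added to every state near z0. The latter lets one wave serve a whole small ball on
  which the state varies.\<close>

lemma unit_wave:
  assumes C: "C > 0"
  shows "\<exists>\<beta>>0. \<forall>z0\<in>subsol C. \<exists>\<zeta> \<delta>. pwave (ball 0 1) \<zeta> \<and> \<delta> > 0 \<and>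
    (\<forall>y z'. dist z' z0 < \<delta> \<longrightarrow> z' + \<zeta> y \<in> subsol C) \<and>
    (LINT y|lborel. (V1 (\<zeta> y))\<^sup>2 + (V2 (\<zeta> y))\<^sup>2) \<ge> \<beta> * (gap C z0)\<^sup>2 \<and>
    (\<forall>y. \<bar>V1 (\<zeta> y)\<bar> \<le> 1 + C \<and> \<bar>V2 (\<zeta> y)\<bar> \<le> 1 + C)"
proof -
  obtain \<beta> where \<beta>: "\<beta> > 0" and B: "\<And>b1 b2 c \<sigma>0 z U. b1\<^sup>2 + b2\<^sup>2 = 1 \<Longrightarrow> \<bar>c\<bar> \<le> 1 + C \<Longrightarrow> \<sigma>0 \<ge> 0 \<Longrightarrow> open U \<Longrightarrow>
      (\<forall>\<sigma>. \<bar>\<sigma>\<bar> \<le> \<sigma>0 \<longrightarrow> z + \<sigma> *\<^sub>R osc_dir b1 b2 c \<in> U) \<Longrightarrow>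
      (\<exists>w. pwave (ball 0 1) w \<and> (\<forall>y. z + w y \<in> U) \<and>
         (LINT y|lborel. (V1 (w y))\<^sup>2 + (V2 (w y))\<^sup>2) \<ge> \<beta> * \<sigma>0\<^sup>2)"
    using localized_wave[of "1 + C"] C by auto
  show ?thesis
  proof (intro exI[of _ "\<beta> / (8 * (1 + C))\<^sup>2"] conjI ballI)
    show "\<beta> / (8 * (1 + C))\<^sup>2 > 0" using \<beta> C by simp
    fix z0 assume z0: "z0 \<in> subsol C"
    obtain b1 b2 c where s: "b1\<^sup>2 + b2\<^sup>2 = 1" "\<bar>c\<bar> \<le> 1 + C"
      "\<forall>\<sigma>. \<bar>\<sigma>\<bar> \<le> gap C z0 / (8 * (1 + C)) \<longrightarrow> z0 + \<sigma> *\<^sub>R osc_dir b1 b2 c \<in> subsol C"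
      using subsol_segment[OF z0] by (auto simp: gap_def)
    have "gap C z0 / (8 * (1 + C)) \<ge> 0" using gap_pos[OF z0] C by simp
    from B[OF s(1,2) this open_subsol s(3)]
    obtain w where w: "pwave (ball 0 1) w" "\<And>y. z0 + w y \<in> subsol C"
      "(LINT y|lborel. (V1 (w y))\<^sup>2 + (V2 (w y))\<^sup>2) \<ge> \<beta> * (gap C z0 / (8 * (1 + C)))\<^sup>2"
      by blast
    obtain K where K: "compact K" "\<And>y. y \<notin> K \<Longrightarrow> w y = 0" and cw: "continuous_on UNIV w"
      using w(1) by (auto simp: pwave_def)
    let ?S = "(\<lambda>y. z0 + w y) ` K \<union> {z0}"
    have "compact ?S"
      by (intro compact_Un compact_continuous_image K continuous_intros continuous_on_subset[OF cw]) auto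
    moreover have "?S \<subseteq> subsol C" using w(2) z0 by auto
    ultimately obtain \<delta> where \<delta>: "\<delta> > 0" "{x. infdist x ?S \<le> \<delta>} \<subseteq> subsol C"
      using compact_in_open_separated[of ?S "subsol C"] open_subsol by auto
    have "z' + w y \<in> subsol C" if "dist z' z0 < \<delta>" for y z'
    proof -
      have "z0 + w y \<in> ?S" using K(2)[of y] by (cases "y \<in> K") auto
      then have "infdist (z' + w y) ?S \<le> dist (z' + w y) (z0 + w y)" by (rule infdist_le)
      then show ?thesis using that \<delta>(2) by (auto simp: dist_norm)
    qed
    moreover have "\<bar>V1 (w y)\<bar> \<le> 1 + C \<and> \<bar>V2 (w y)\<bar> \<le> 1 + C" for y
    proof -
      have "\<bar>b\<bar> \<le> M" if "\<bar>a\<bar> \<le> M / 2" "\<bar>a + b\<bar> \<le> M / 2" for a b M :: real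
        using that by linarith
      then show ?thesis
        using subsol_vel_bound[OF z0] subsol_vel_bound[OF w(2)[of y]] unfolding fst_add snd_add by blast
    qed
    moreover have "\<beta> / (8 * (1 + C))\<^sup>2 * (gap C z0)\<^sup>2 \<le> (LINT y|lborel. (V1 (w y))\<^sup>2 + (V2 (w y))\<^sup>2)"
      using w(3) by (simp add: power_divide)
    ultimately show "\<exists>\<zeta> \<delta>. pwave (ball 0 1) \<zeta> \<and> \<delta> > 0 \<and>
      (\<forall>y z'. dist z' z0 < \<delta> \<longrightarrow> z' + \<zeta> y \<in> subsol C) \<and>
      (LINT y|lborel. (V1 (\<zeta> y))\<^sup>2 + (V2 (\<zeta> y))\<^sup>2) \<ge> \<beta> / (8 * (1 + C))\<^sup>2 * (gap C z0)\<^sup>2 \<and>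
      (\<forall>y. \<bar>V1 (\<zeta> y)\<bar> \<le> 1 + C \<and> \<bar>V2 (\<zeta> y)\<bar> \<le> 1 + C)"
      using w(1) \<delta>(1) by blast
  qed
qed

text \<open>The Vitali theorem gives countably many disjoint good balls that cover \<Omega> up to a
  null set, hence carry all the mass of h. Finitely many of them already carry more than half, by
  continuity from below of the finite measure with density h. Finiteness matters because only finite
  sums of waves keep a compact support.\<close>

lemma Vitali_half_mass:
  fixes h :: "pt \<Rightarrow> real"
  assumes h: "integrable lborel h" "\<And>y. h y \<ge> 0" and out: "\<And>y. y \<notin> \<Omega> \<Longrightarrow> h y = 0"
    and good: "\<And>x d. x \<in> \<Omega> \<Longrightarrow> d > 0 \<Longrightarrow> \<exists>r. 0 < r \<and> r < d \<and> P x r"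
  shows "\<exists>D. finite D \<and> (\<forall>i\<in>D. fst i \<in> \<Omega> \<and> 0 < snd i \<and> P (fst i) (snd i)) \<and>
     pairwise (\<lambda>i j. disjnt (ball (fst i) (snd i)) (ball (fst j) (snd j))) D \<and>
     (LINT y|lborel. h y) \<le> 2 * (\<Sum>i\<in>D. LINT y|lborel. indicator (ball (fst i) (snd i)) y * h y)"
proof (cases "(LINT y|lborel. h y) = 0")
  case True then show ?thesis by (intro exI[of _ "{}"]) auto
next
  case False
  define I where "I = (LINT y|lborel. h y)"
  have I: "I > 0" using False Bochner_Integration.integral_nonneg[of lborel h] h(2) by (auto simp: I_def less_le)
  define K where "K = {i. fst i \<in> \<Omega> \<and> 0 < snd i \<and> P (fst i) (snd i)}"
  have V: "\<exists>i. i \<in> K \<and> x \<in> ball (fst i) (snd i) \<and> snd i < d" if "x \<in> \<Omega>" "d > 0" for x d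
    proof -
    obtain r where "0 < r" "r < d" "P x r" using good[OF \<open>x \<in> \<Omega>\<close> \<open>d > 0\<close>] by blast
    then show ?thesis using that by (intro exI[of _ "(x, r)"]) (simp add: K_def)
  qed
  obtain Q where Q: "countable Q" "Q \<subseteq> K" "pairwise (\<lambda>i j. disjnt (ball (fst i) (snd i)) (ball (fst j) (snd j))) Q"
    "negligible (\<Omega> - (\<Union>i\<in>Q. ball (fst i) (snd i)))"
    using Vitali_covering_theorem_balls[of \<Omega> K fst snd, OF V] by blast
  define M where "M = density lborel (\<lambda>y. ennreal (h y))"
  have m [measurable]: "h \<in> borel_measurable borel" using h(1) by auto
  have sM: "sets M = sets borel" by (simp add: M_def)
  have eM: "emeasure M A = ennreal (LINT y|lborel. indicator A y * h y)" if "A \<in> sets borel" for A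
  proof -
    have "emeasure M A = (\<integral>\<^sup>+y. ennreal (indicator A y * h y) \<partial>lborel)"
      unfolding M_def using that h(2)
      by (subst emeasure_density) (auto intro!: nn_integral_cong simp: indicator_def)
    also have "\<dots> = ennreal (LINT y|lborel. indicator A y * h y)"
      using that h integrable_real_mult_indicator[OF _ h(1), of A]
      by (intro nn_integral_eq_integral) (auto simp: mult.commute)
    finally show ?thesis .
  qed
  have mM: "measure M A = (LINT y|lborel. indicator A y * h y)" if "A \<in> sets borel" for A
    unfolding measure_def eM[OF that] using h(2) by (intro enn2real_ennreal Bochner_Integration.integral_nonneg) auto
  interpret finite_measure M by (rule finite_measureI) (simp add: M_def[symmetric] eM sM[THEN sets_eq_imp_space_eq])
  let ?B = "\<lambda>i. ball (fst i) (snd i)"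
  have neg: "(\<Union>i\<in>Q. ?B i) \<in> sets borel" by (intro borel_open open_UN) auto
  have total: "measure M (\<Union>i\<in>Q. ?B i) = I"
  proof -
    have "AE y in lebesgue. y \<notin> \<Omega> - (\<Union>i\<in>Q. ?B i)"
      using Q(4) by (intro AE_not_in) (simp add: negligible_iff_null_sets)
    then have "AE y in lebesgue. indicator (\<Union>i\<in>Q. ?B i) y * h y = h y"
      by eventually_elim (auto simp: indicator_def out)
    then have "AE y in lborel. indicator (\<Union>i\<in>Q. ?B i) y * h y = h y"
      using neg by (subst (asm) AE_completion_iff) auto
    then show ?thesis unfolding mM[OF neg] I_def using neg by (intro integral_cong_AE) auto
  qed
  have "Q \<noteq> {}" using total I by auto
  define e where "e = from_nat_into Q"
  have e: "range e = Q" unfolding e_def using \<open>Q \<noteq> {}\<close> Q(1) by (rule range_from_nat_into)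
  have "(\<lambda>n. measure M (\<Union>i<n. ?B (e i))) \<longlonglongrightarrow> measure M (\<Union>n. \<Union>i<n. ?B (e i))"
    by (rule finite_Lim_measure_incseq) (auto simp: sM incseq_def intro!: borel_open intro: less_le_trans)
  moreover have "(\<Union>n. \<Union>i<n. ?B (e i)) = (\<Union>i\<in>Q. ?B i)" unfolding e[symmetric] by auto
  ultimately have "(\<lambda>n. measure M (\<Union>i<n. ?B (e i))) \<longlonglongrightarrow> I" using total by simp
  then have "eventually (\<lambda>n. measure M (\<Union>i<n. ?B (e i)) > I / 2) sequentially"
    by (rule order_tendstoD(1)) (use I in simp)
  then obtain n where n: "measure M (\<Union>i<n. ?B (e i)) > I / 2" by (auto simp: eventually_sequentially)
  define D where "D = e ` {..<n}"
  have D: "finite D" "D \<subseteq> Q" using e by (auto simp: D_def)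
  have "I / 2 < measure M (\<Union>i\<in>D. ?B i)" using n by (simp add: D_def)
  also have "\<dots> \<le> (\<Sum>i\<in>D. measure M (?B i))"
    by (rule measure_UNION_le[OF D(1)]) (auto simp: sM)
  also have "\<dots> = (\<Sum>i\<in>D. LINT y|lborel. indicator (?B i) y * h y)" by (intro sum.cong mM) auto
  finally have "I \<le> 2 * (\<Sum>i\<in>D. LINT y|lborel. indicator (?B i) y * h y)" by simp
  moreover have "pairwise (\<lambda>i j. disjnt (?B i) (?B j)) D" using Q(3) D(2) by (rule pairwise_subset)
  ultimately show ?thesis using D Q(2) by (intro exI[of _ D]) (auto simp: I_def K_def)
qed

definition vdot :: "st \<Rightarrow> real \<times> real \<Rightarrow> real" where
  "vdot z f = V1 z * fst f + V2 z * snd f"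

definition vsq :: "st \<Rightarrow> real" where "vsq z = (V1 z)\<^sup>2 + (V2 z)\<^sup>2"

text \<open>The state is frozen at the centres of small disjoint balls, and a rescaled unit wave is
  put into each. Zero mean makes the sum nearly orthogonal to finitely many prescribed fields, while
  its energy does not shrink with the balls. The constant depends on C only, so the step can be
  iterated without loss.\<close>

lemma improvement_step:
  assumes C: "C > 0"
  shows "\<exists>\<kappa>>0. \<forall>\<Omega> \<omega> z F \<epsilon>. open \<Omega> \<longrightarrow> continuous_on UNIV \<omega> \<longrightarrow> integrable lborel \<omega> \<longrightarrow> (\<forall>y. \<omega> y > 0) \<longrightarrow>
     continuous_on UNIV z \<longrightarrow> (\<forall>y\<in>\<Omega>. z y \<in> subsol C) \<longrightarrow> finite F \<longrightarrow> (\<forall>f\<in>F. continuous_on UNIV f) \<longrightarrow> \<epsilon> > 0 \<longrightarrow>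
     (\<exists>\<zeta>. pwave \<Omega> \<zeta> \<and> (\<forall>y\<in>\<Omega>. z y + \<zeta> y \<in> subsol C) \<and>
       (\<forall>f\<in>F. \<bar>LINT y|lborel. vdot (\<zeta> y) (f y)\<bar> \<le> \<epsilon>) \<and>
       (LINT y|lborel. \<omega> y * vsq (\<zeta> y)) \<ge> \<kappa> * (LINT y|lborel. indicator \<Omega> y * (\<omega> y * (gap C (z y))\<^sup>2)))"
proof -
  obtain \<beta> where \<beta>: "\<beta> > 0" and UW: "\<And>z0. z0 \<in> subsol C \<Longrightarrow> \<exists>\<zeta> \<delta>. pwave (ball 0 1) \<zeta> \<and> \<delta> > 0 \<and>
    (\<forall>y z'. dist z' z0 < \<delta> \<longrightarrow> z' + \<zeta> y \<in> subsol C) \<and>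
    (LINT y|lborel. (V1 (\<zeta> y))\<^sup>2 + (V2 (\<zeta> y))\<^sup>2) \<ge> \<beta> * (gap C z0)\<^sup>2 \<and>
    (\<forall>y. \<bar>V1 (\<zeta> y)\<bar> \<le> 1 + C \<and> \<bar>V2 (\<zeta> y)\<bar> \<le> 1 + C)"
    using unit_wave[OF C] by blast
  define v3 where "v3 = unit_ball_vol 3"
  have v3: "v3 > 0" by (simp add: v3_def)
  show ?thesis
  \<comment> \<open>The 8 is a product of three factors 2: half the mass lost in the covering, the
    variation of \<open>g\<close> on a ball, and that of the weight. \<open>v3\<close> converts r^3
    into the volume of a ball.\<close>
  proof (intro exI[of _ "\<beta> / (8 * v3)"] conjI allI impI)
    show "\<beta> / (8 * v3) > 0" using \<beta> v3 by simp
    fix \<Omega> :: "pt set" and \<omega> :: "pt \<Rightarrow> real" and z :: "pt \<Rightarrow> st" and F :: "(pt \<Rightarrow> real \<times> real) set" and \<epsilon> :: real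
    assume op: "open \<Omega>" and cw: "continuous_on UNIV \<omega>" and iw: "integrable lborel \<omega>" and pw: "\<forall>y. \<omega> y > 0"
      and cz: "continuous_on UNIV z" and sz: "\<forall>y\<in>\<Omega>. z y \<in> subsol C" and F: "finite F" "\<forall>f\<in>F. continuous_on UNIV f"
      and \<epsilon>: "\<epsilon> > 0"
    have mw [measurable]: "\<omega> \<in> borel_measurable borel" using iw by auto
    have pw0: "0 \<le> \<omega> y" for y using pw by (blast intro: less_imp_le)
    define W where "W = (LINT y|lborel. \<omega> y)"
    have W: "W \<ge> 0" unfolding W_def using pw by (intro Bochner_Integration.integral_nonneg less_imp_le) blast
    \<comment> \<open>On a ball the two velocity components contribute at most 2 (1 + C) 2\<eta>
      times the weight to the pairing, and the weights of the disjoint balls add up to at most W.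
      The 1 added to W keeps the denominator positive.\<close>
    define \<eta> where "\<eta> = \<epsilon> / (4 * (1 + C) * (W + 1))"
    have \<eta>: "\<eta> > 0" using \<epsilon> C W by (simp add: \<eta>_def)
    obtain Z \<delta> where Z: "\<And>x. x \<in> \<Omega> \<Longrightarrow> pwave (ball 0 1) (Z x)" and \<delta>: "\<And>x. x \<in> \<Omega> \<Longrightarrow> \<delta> x > 0"
      and stay: "\<And>x y z'. x \<in> \<Omega> \<Longrightarrow> dist z' (z x) < \<delta> x \<Longrightarrow> z' + Z x y \<in> subsol C"
      and gain: "\<And>x. x \<in> \<Omega> \<Longrightarrow> (LINT y|lborel. vsq (Z x y)) \<ge> \<beta> * (gap C (z x))\<^sup>2"
      and bd: "\<And>x y. x \<in> \<Omega> \<Longrightarrow> \<bar>V1 (Z x y)\<bar> \<le> 1 + C" "\<And>x y. x \<in> \<Omega> \<Longrightarrow> \<bar>V2 (Z x y)\<bar> \<le> 1 + C"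
    proof -
      define Q where "Q x w d \<longleftrightarrow> pwave (ball 0 1) w \<and> d > 0 \<and>
        (\<forall>y z'. dist z' (z x) < d \<longrightarrow> z' + w y \<in> subsol C) \<and>
        (LINT y|lborel. vsq (w y)) \<ge> \<beta> * (gap C (z x))\<^sup>2 \<and>
        (\<forall>y. \<bar>V1 (w y)\<bar> \<le> 1 + C \<and> \<bar>V2 (w y)\<bar> \<le> 1 + C)" for x w and d :: real
      have "\<forall>x\<in>\<Omega>. \<exists>w. \<exists>d. Q x w d" using UW sz unfolding Q_def vsq_def by blast
      from bchoice[OF this] obtain Z where "\<forall>x\<in>\<Omega>. \<exists>d. Q x (Z x) d" ..
      from bchoice[OF this] obtain \<delta> where "\<forall>x\<in>\<Omega>. Q x (Z x) (\<delta> x)" ..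
      then have "Q x (Z x) (\<delta> x)" if "x \<in> \<Omega>" for x using that by blast
      note * = this[unfolded Q_def]
      show ?thesis
      proof (rule that[of Z \<delta>])
        fix x y z' assume x: "x \<in> \<Omega>"
        note q = *[OF x]
        show "pwave (ball 0 1) (Z x)" "\<delta> x > 0" "(LINT y|lborel. vsq (Z x y)) \<ge> \<beta> * (gap C (z x))\<^sup>2"
          "\<bar>V1 (Z x y)\<bar> \<le> 1 + C" "\<bar>V2 (Z x y)\<bar> \<le> 1 + C" using q by blast+
        assume "dist z' (z x) < \<delta> x"
        then show "z' + Z x y \<in> subsol C" using q by blast
      qed
    qed
    define g where "g y = \<omega> y * (gap C (z y))\<^sup>2" for y
    have cg: "continuous_on UNIV g" unfolding g_def gap_def by (intro continuous_intros cw cz)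
    have mg [measurable]: "g \<in> borel_measurable borel" using cg by (rule borel_measurable_continuous_onI)
    have mO [measurable]: "\<Omega> \<in> sets borel" using op by simp
    define h where "h y = indicator \<Omega> y * g y" for y
    have h0: "h y \<ge> 0" for y by (simp add: h_def g_def pw0)
    have ih: "integrable lborel h"
    proof (rule Bochner_Integration.integrable_bound)
      show "integrable lborel (\<lambda>y. C\<^sup>2 * \<omega> y)" using iw by simp
      show "h \<in> borel_measurable lborel" unfolding h_def [abs_def] by measurable
      show "AE y in lborel. norm (h y) \<le> norm (C\<^sup>2 * \<omega> y)"
      proof (rule AE_I2)
        fix y
        show "norm (h y) \<le> norm (C\<^sup>2 * \<omega> y)"
        proof (cases "y \<in> \<Omega>")
          case True
          then have "0 < gap C (z y)" using gap_pos bspec[OF sz] by blast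
          moreover have "gap C (z y) \<le> C" by (simp add: gap_def)
          ultimately have "(gap C (z y))\<^sup>2 \<le> C\<^sup>2" by (intro power_mono) auto
          then show ?thesis using True pw[rule_format, of y]
            by (simp add: h_def g_def abs_mult mult.commute mult_left_mono)
        qed (simp add: h_def)
      qed
    qed
    \<comment> \<open>A good ball is so small that the wave chosen at its centre stays admissible,
      weight and density change by a factor below 2, and the test fields oscillate little compared
      with the weight.\<close>
    define P where "P x r \<longleftrightarrow> ball x r \<subseteq> \<Omega> \<and> (\<forall>y\<in>ball x r. dist (z y) (z x) < \<delta> x \<and> \<omega> x < 2 * \<omega> y \<and>
      g y < 2 * g x \<and> (\<forall>f\<in>F. dist (f y) (f x) < \<eta> * \<omega> x))" for x and r :: real
    have good: "\<exists>r. 0 < r \<and> r < d \<and> P x r" if x: "x \<in> \<Omega>" and d: "d > 0" for x d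
    proof -
      have at: "(f \<longlongrightarrow> f x) (nhds x)" if "continuous_on UNIV f" for f :: "pt \<Rightarrow> 'b::topological_space"
        using that unfolding continuous_on_eq_continuous_at[OF open_UNIV] isCont_def tendsto_at_iff_tendsto_nhds by blast
      have gx: "g x > 0" using pw[rule_format, of x] gap_pos[of "z x" C] bspec[OF sz x] by (simp add: g_def)
      have "eventually (\<lambda>y. dist (z y) (z x) < \<delta> x) (nhds x)" by (rule tendstoD[OF at[OF cz] \<delta>[OF x]])
      moreover have "eventually (\<lambda>y. \<omega> y > \<omega> x / 2) (nhds x)"
        by (rule order_tendstoD(1)[OF at[OF cw]]) (use pw[rule_format, of x] in simp)
      moreover have "eventually (\<lambda>y. g y < 2 * g x) (nhds x)"
        by (rule order_tendstoD(2)[OF at[OF cg]]) (use gx in simp)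
      moreover have "eventually (\<lambda>y. \<forall>f\<in>F. dist (f y) (f x) < \<eta> * \<omega> x) (nhds x)"
        using F \<eta> pw[rule_format, of x] by (intro eventually_ball_finite ballI tendstoD at) auto
      moreover have "eventually (\<lambda>y. y \<in> \<Omega>) (nhds x)" using op x by (rule eventually_nhds_in_open)
      ultimately have "eventually (\<lambda>y. y \<in> \<Omega> \<and> dist (z y) (z x) < \<delta> x \<and> \<omega> x < 2 * \<omega> y \<and>
      g y < 2 * g x \<and> (\<forall>f\<in>F. dist (f y) (f x) < \<eta> * \<omega> x)) (nhds x)" by eventually_elim auto
      then obtain r where r: "r > 0" "\<And>y. dist y x < r \<Longrightarrow> y \<in> \<Omega> \<and> dist (z y) (z x) < \<delta> x \<and> \<omega> x < 2 * \<omega> y \<and>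
      g y < 2 * g x \<and> (\<forall>f\<in>F. dist (f y) (f x) < \<eta> * \<omega> x)" unfolding eventually_nhds_metric by blast
      have "P x (min r (d/2))" unfolding P_def using r(2) by (auto simp: dist_commute)
      then show ?thesis using r(1) d by (intro exI[of _ "min r (d/2)"]) auto
    qed
    obtain D where D: "finite D" "\<And>i. i \<in> D \<Longrightarrow> fst i \<in> \<Omega>" "\<And>i. i \<in> D \<Longrightarrow> 0 < snd i" "\<And>i. i \<in> D \<Longrightarrow> P (fst i) (snd i)"
      "pairwise (\<lambda>i j. disjnt (ball (fst i) (snd i)) (ball (fst j) (snd j))) D"
      "(LINT y|lborel. h y) \<le> 2 * (\<Sum>i\<in>D. LINT y|lborel. indicator (ball (fst i) (snd i)) y * h y)"
      using Vitali_half_mass[of h \<Omega> P, OF ih h0 _ good] by (auto simp: h_def)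
    let ?B = "\<lambda>i. ball (fst i) (snd i)"
    define Y where "Y i y = Z (fst i) ((1 / snd i) *\<^sub>R (y - fst i))" for i y
    define \<zeta> where "\<zeta> y = (\<Sum>i\<in>D. Y i y)" for y
    have pY: "pwave (?B i) (Y i)" if "i \<in> D" for i
      unfolding Y_def [abs_def]
      by (rule pwave_affine[OF Z[OF D(2)[OF that]] D(3)[OF that]])
         (use D(3)[OF that] in \<open>auto simp: dist_norm mult_less_cancel_left2\<close>)
    have BO: "?B i \<subseteq> \<Omega>" if "i \<in> D" for i using D(4)[OF that] by (simp add: P_def)
    have Y0: "Y i y = 0" if "i \<in> D" "y \<notin> ?B i" for i y
      by (rule pwave_outside[OF pY[OF that(1)] that(2)])
    have dis: "y \<notin> ?B j" if "i \<in> D" "y \<in> ?B i" "j \<in> D - {i}" for i j y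
      using D(5) that unfolding pairwise_def disjnt_def by blast
    have one: "\<zeta> y = Y i y" if "i \<in> D" "y \<in> ?B i" for i y
    proof -
      have "Y j y = 0" if j: "j \<in> D - {i}" for j
        using j dis[OF \<open>i \<in> D\<close> \<open>y \<in> ?B i\<close> j] by (intro Y0) auto
      then show ?thesis unfolding \<zeta>_def using D(1) that(1) by (simp add: sum.remove)
    qed
    have none: "\<zeta> y = 0" if "\<And>i. i \<in> D \<Longrightarrow> y \<notin> ?B i" for y
      unfolding \<zeta>_def using Y0 that by (intro sum.neutral) auto
    have p\<zeta>: "pwave \<Omega> \<zeta>" unfolding \<zeta>_def [abs_def]
      by (intro pwave_sum D(1) pwave_mono[OF pY BO])
    have s\<zeta>: "z y + \<zeta> y \<in> subsol C" if y: "y \<in> \<Omega>" for y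
    proof (cases "\<exists>i\<in>D. y \<in> ?B i")
      case True
      then obtain i where i: "i \<in> D" "y \<in> ?B i" by blast
      have "dist (z y) (z (fst i)) < \<delta> (fst i)" using D(4)[OF i(1)] i(2) unfolding P_def by blast
      from stay[OF D(2)[OF i(1)] this] show ?thesis unfolding one[OF i] Y_def .
    qed (use none bspec[OF sz y] in auto)
    have cY: "continuous_on UNIV (Y i)" if "i \<in> D" for i using pY[OF that] by (simp add: pwave_def)
    have iB: "integrable lborel (\<lambda>y. indicator (?B i) y * \<omega> y)" for i
      using integrable_real_mult_indicator[OF _ iw, of "?B i"] by (simp add: mult.commute)
    have sumB: "(\<Sum>i\<in>D. LINT y|lborel. indicator (?B i) y * \<omega> y) \<le> W"
    proof -
      have "(\<Sum>i\<in>D. LINT y|lborel. indicator (?B i) y * \<omega> y) = (LINT y|lborel. (\<Sum>i\<in>D. indicator (?B i) y * \<omega> y))"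
        by (rule Bochner_Integration.integral_sum[symmetric]) (rule iB)
      also have "\<dots> \<le> W" unfolding W_def
      proof (rule integral_mono)
        fix y
        show "(\<Sum>i\<in>D. indicator (?B i) y * \<omega> y) \<le> \<omega> y"
        proof (cases "\<exists>i\<in>D. y \<in> ?B i")
          case True
          then obtain i where i: "i \<in> D" "y \<in> ?B i" by blast
          have "indicator (?B j) y * \<omega> y = 0" if j: "j \<in> D - {i}" for j
            using dis[OF i j] by simp
          then have "(\<Sum>j\<in>D - {i}. indicator (?B j) y * \<omega> y) = 0" by (intro sum.neutral ballI)
          then show ?thesis unfolding sum.remove[OF D(1) i(1)] using i(2) by simp
        next
          case False
          then have "(\<Sum>i\<in>D. indicator (?B i) y * \<omega> y) = 0" by (intro sum.neutral ballI) simp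
          then show ?thesis using pw[rule_format, of y] by simp
        qed
      qed (use iw iB in auto)
      finally show ?thesis .
    qed
    have orth: "\<bar>LINT y|lborel. vdot (\<zeta> y) (f y)\<bar> \<le> \<epsilon>" if f: "f \<in> F" for f
    proof -
      have cf: "continuous_on UNIV f" using F f by blast
      have c12: "continuous_on UNIV (\<lambda>y. fst (f y))" "continuous_on UNIV (\<lambda>y. snd (f y))"
        by (intro continuous_intros cf)+
      have iY: "integrable lborel (\<lambda>y. vdot (Y i y) (f y))" if "i \<in> D" for i
        unfolding vdot_def using pwave_integrable[OF pY[OF that] c12(1)] pwave_integrable[OF pY[OF that] c12(2)] by auto
      \<comment> \<open>The wave has zero mean, so f may be replaced by its deviation from the value
        at the centre.\<close>
      have each: "\<bar>LINT y|lborel. vdot (Y i y) (f y)\<bar> \<le> 4 * (1 + C) * \<eta> * (LINT y|lborel. indicator (?B i) y * \<omega> y)"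
        if i: "i \<in> D" for i
      proof -
        let ?x = "fst i"
        have c0: "continuous_on UNIV (\<lambda>_::pt. 1::real)" by simp
        note iV = pwave_integrable[OF pY[OF i] c0, simplified]
        have "(LINT y|lborel. vdot (Y i y) (f ?x)) = 0"
          unfolding vdot_def using iV pwave_mean[OF pY[OF i]] by simp
        moreover have i0: "integrable lborel (\<lambda>y. vdot (Y i y) (f ?x))"
          unfolding vdot_def using iV by simp
        ultimately have e: "(LINT y|lborel. vdot (Y i y) (f y)) = (LINT y|lborel. vdot (Y i y) (f y) - vdot (Y i y) (f ?x))"
          using iY[OF i] by simp
        have "\<bar>LINT y|lborel. vdot (Y i y) (f y) - vdot (Y i y) (f ?x)\<bar>
          \<le> (LINT y|lborel. \<bar>vdot (Y i y) (f y) - vdot (Y i y) (f ?x)\<bar>)"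
          by (rule integral_abs_bound)
        also have "\<dots> \<le> (LINT y|lborel. 4 * (1 + C) * \<eta> * (indicator (?B i) y * \<omega> y))"
        proof (rule integral_mono)
          fix y
          show "\<bar>vdot (Y i y) (f y) - vdot (Y i y) (f ?x)\<bar> \<le> 4 * (1 + C) * \<eta> * (indicator (?B i) y * \<omega> y)"
          proof (cases "y \<in> ?B i")
            case True
            have q: "dist (f y) (f ?x) < \<eta> * \<omega> ?x" "\<omega> ?x < 2 * \<omega> y"
              using D(4)[OF i] True f unfolding P_def by blast+
            have "\<eta> * \<omega> ?x \<le> \<eta> * (2 * \<omega> y)" using q(2) \<eta> by (intro mult_left_mono) auto
            then have "\<bar>fst (f y) - fst (f ?x)\<bar> \<le> 2 * \<eta> * \<omega> y" "\<bar>snd (f y) - snd (f ?x)\<bar> \<le> 2 * \<eta> * \<omega> y"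
              using q(1) dist_fst_le[of "f y" "f ?x"] dist_snd_le[of "f y" "f ?x"] by (auto simp: dist_real_def)
            then have "\<bar>V1 (Y i y) * (fst (f y) - fst (f ?x))\<bar> \<le> (1 + C) * (2 * \<eta> * \<omega> y)"
              "\<bar>V2 (Y i y) * (snd (f y) - snd (f ?x))\<bar> \<le> (1 + C) * (2 * \<eta> * \<omega> y)"
              unfolding abs_mult Y_def by (intro mult_mono bd[OF D(2)[OF i]] order_refl; use C in simp)+
            moreover have "vdot (Y i y) (f y) - vdot (Y i y) (f ?x)
              = V1 (Y i y) * (fst (f y) - fst (f ?x)) + V2 (Y i y) * (snd (f y) - snd (f ?x))"
              by (simp add: vdot_def algebra_simps)
            ultimately have "\<bar>vdot (Y i y) (f y) - vdot (Y i y) (f ?x)\<bar> \<le> 2 * ((1 + C) * (2 * \<eta> * \<omega> y))"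
              by linarith
            then show ?thesis using True by (simp add: algebra_simps)
          qed (use Y0[OF i] in \<open>simp add: vdot_def\<close>)
        qed (use iY[OF i] i0 iB in auto)
        finally show ?thesis unfolding e by simp
      qed
      have "(LINT y|lborel. vdot (\<zeta> y) (f y)) = (LINT y|lborel. (\<Sum>i\<in>D. vdot (Y i y) (f y)))"
        unfolding \<zeta>_def vdot_def by (simp add: fst_sum snd_sum sum_distrib_right sum.distrib)
      also have "\<dots> = (\<Sum>i\<in>D. LINT y|lborel. vdot (Y i y) (f y))"
        by (rule Bochner_Integration.integral_sum) (rule iY)
      finally have "\<bar>LINT y|lborel. vdot (\<zeta> y) (f y)\<bar> \<le> (\<Sum>i\<in>D. \<bar>LINT y|lborel. vdot (Y i y) (f y)\<bar>)"
        by (simp add: sum_abs)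
      also have "\<dots> \<le> (\<Sum>i\<in>D. 4 * (1 + C) * \<eta> * (LINT y|lborel. indicator (?B i) y * \<omega> y))"
        by (intro sum_mono each)
      also have "\<dots> \<le> 4 * (1 + C) * \<eta> * W"
        unfolding sum_distrib_left[symmetric] using sumB C \<eta> by (intro mult_left_mono) auto
      also have "\<dots> = \<epsilon> * (W / (W + 1))"
      proof -
        have "K * (\<epsilon> / (K * (W + 1))) * W = \<epsilon> * (W / (W + 1))" if "K \<noteq> 0" for K using that by simp
        then show ?thesis unfolding \<eta>_def using C by simp
      qed
      also have "\<dots> \<le> \<epsilon> * 1" using \<epsilon> W by (intro mult_left_mono) auto
      finally show ?thesis by simp
    qed
    have energy: "\<beta> / (8 * v3) * (LINT y|lborel. h y) \<le> (LINT y|lborel. \<omega> y * vsq (\<zeta> y))"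
    proof -
      have iY: "integrable lborel (\<lambda>y. \<omega> y * vsq (Y i y))" "integrable lborel (\<lambda>y. vsq (Y i y))" if i: "i \<in> D" for i
      proof -
        obtain K where "compact K" "\<And>y. y \<notin> K \<Longrightarrow> Y i y = 0" using pY[OF i] by (auto simp: pwave_def)
        then show "integrable lborel (\<lambda>y. \<omega> y * vsq (Y i y))" "integrable lborel (\<lambda>y. vsq (Y i y))"
          using cw cY[OF i] by (auto simp: vsq_def intro!: integrable_compact_support[of _ K] continuous_intros)
      qed
      have each: "\<beta> / (4 * v3) * (LINT y|lborel. indicator (?B i) y * h y) \<le> (LINT y|lborel. \<omega> y * vsq (Y i y))"
        if i: "i \<in> D" for i
      proof -
        let ?x = "fst i" and ?r = "snd i"
        have r: "?r > 0" by (rule D(3)[OF i])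
        have q: "\<omega> ?x < 2 * \<omega> y" "g y < 2 * g ?x" if "y \<in> ?B i" for y
          using D(4)[OF i] that unfolding P_def by blast+
        have "(LINT y|lborel. indicator (?B i) y * h y) \<le> (LINT y|lborel. 2 * g ?x * indicator (?B i) y)"
        proof (rule integral_mono)
          show "integrable lborel (\<lambda>y. indicator (?B i) y * h y)"
            using integrable_real_mult_indicator[OF _ ih, of "?B i"] by (simp add: mult.commute)
          show "integrable lborel (\<lambda>y. 2 * g ?x * indicator (?B i) y)"
            using emeasure_bounded_finite[OF bounded_ball, of ?x ?r] by (intro integrable_mult_right integrable_real_indicator) auto
          show "indicator (?B i) y * h y \<le> 2 * g ?x * indicator (?B i) y" for y
            using q(2)[of y] BO[OF i] by (cases "y \<in> ?B i") (auto simp: h_def)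
        qed
        also have "\<dots> = 2 * g ?x * (v3 * ?r ^ 3)"
          using r by (simp add: content_ball v3_def power3_eq_cube)
        finally have 1: "(LINT y|lborel. indicator (?B i) y * h y) \<le> 2 * g ?x * (v3 * ?r ^ 3)" .
        have mY: "(\<lambda>y. vsq (Y i y)) \<in> borel_measurable borel"
          using cY[OF i] by (auto simp: vsq_def intro!: borel_measurable_continuous_onI continuous_intros)
        have "(LINT y|lborel. vsq (Y i y)) = ?r ^ 3 * (LINT y|lborel. vsq (Z ?x y))"
          using r by (subst integral_lborel_affine[OF mY r, of ?x]) (simp add: Y_def)
        also have "\<dots> \<ge> ?r ^ 3 * (\<beta> * (gap C (z ?x))\<^sup>2)"
          using r gain[OF D(2)[OF i]] by (intro mult_left_mono) auto
        finally have "\<omega> ?x / 2 * (?r ^ 3 * (\<beta> * (gap C (z ?x))\<^sup>2)) \<le> \<omega> ?x / 2 * (LINT y|lborel. vsq (Y i y))"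
          using pw[rule_format, of ?x] by (intro mult_left_mono) auto
        also have "\<dots> = (LINT y|lborel. \<omega> ?x / 2 * vsq (Y i y))" by simp
        also have "\<dots> \<le> (LINT y|lborel. \<omega> y * vsq (Y i y))"
        proof (rule integral_mono)
          fix y
          show "\<omega> ?x / 2 * vsq (Y i y) \<le> \<omega> y * vsq (Y i y)"
          proof (cases "y \<in> ?B i")
            case True
            then show ?thesis using q(1)[OF True] by (intro mult_right_mono) (simp_all add: vsq_def)
          qed (use Y0[OF i] in \<open>simp add: vsq_def\<close>)
        qed (use iY[OF i] in auto)
        finally have 2: "\<omega> ?x / 2 * (?r ^ 3 * (\<beta> * (gap C (z ?x))\<^sup>2)) \<le> (LINT y|lborel. \<omega> y * vsq (Y i y))" .
        have "\<beta> / (4 * v3) * (LINT y|lborel. indicator (?B i) y * h y) \<le> \<beta> / (4 * v3) * (2 * g ?x * (v3 * ?r ^ 3))"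
          using 1 \<beta> v3 by (intro mult_left_mono) auto
        also have "\<dots> = \<omega> ?x / 2 * (?r ^ 3 * (\<beta> * (gap C (z ?x))\<^sup>2))" using v3 by (simp add: g_def)
        finally show ?thesis using 2 by simp
      qed
      have "\<beta> / (8 * v3) * (LINT y|lborel. h y) \<le> \<beta> / (8 * v3) * (2 * (\<Sum>i\<in>D. LINT y|lborel. indicator (?B i) y * h y))"
        using D(6) \<beta> v3 by (intro mult_left_mono) auto
      also have "\<dots> = (\<Sum>i\<in>D. \<beta> / (4 * v3) * (LINT y|lborel. indicator (?B i) y * h y))"
        by (simp add: sum_distrib_left)
      also have "\<dots> \<le> (\<Sum>i\<in>D. LINT y|lborel. \<omega> y * vsq (Y i y))" by (intro sum_mono each)
      also have "\<dots> = (LINT y|lborel. (\<Sum>i\<in>D. \<omega> y * vsq (Y i y)))"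
        by (rule Bochner_Integration.integral_sum[symmetric]) (rule iY)
      also have "\<dots> = (LINT y|lborel. \<omega> y * vsq (\<zeta> y))"
      proof (rule Bochner_Integration.integral_cong)
        fix y
        show "(\<Sum>i\<in>D. \<omega> y * vsq (Y i y)) = \<omega> y * vsq (\<zeta> y)"
        proof (cases "\<exists>i\<in>D. y \<in> ?B i")
          case True
          then obtain i where i: "i \<in> D" "y \<in> ?B i" by blast
          have "\<omega> y * vsq (Y j y) = 0" if j: "j \<in> D - {i}" for j
          proof -
            have "Y j y = 0" using j dis[OF i j] by (intro Y0) auto
            then show ?thesis by (simp add: vsq_def)
          qed
          then have "(\<Sum>j\<in>D - {i}. \<omega> y * vsq (Y j y)) = 0" by (intro sum.neutral ballI)
          then show ?thesis unfolding one[OF i] sum.remove[OF D(1) i(1)] by simp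
        next
          case False
          then have "\<zeta> y = 0" "\<And>i. i \<in> D \<Longrightarrow> Y i y = 0" using none Y0 by blast+
          then show ?thesis by (simp add: vsq_def)
        qed
      qed simp
      finally show ?thesis .
    qed
    show "\<exists>\<zeta>. pwave \<Omega> \<zeta> \<and> (\<forall>y\<in>\<Omega>. z y + \<zeta> y \<in> subsol C) \<and>
       (\<forall>f\<in>F. \<bar>LINT y|lborel. vdot (\<zeta> y) (f y)\<bar> \<le> \<epsilon>) \<and>
       \<beta> / (8 * v3) * (LINT y|lborel. indicator \<Omega> y * (\<omega> y * (gap C (z y))\<^sup>2)) \<le> (LINT y|lborel. \<omega> y * vsq (\<zeta> y))"
      using p\<zeta> s\<zeta> orth energy unfolding h_def g_def by blast
  qed
qed

section \<open>Iteration of the improvement step and passage to the limit\<close>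

lemma AE_convergent_L1_summable:
  fixes u :: "nat \<Rightarrow> 'a \<Rightarrow> real"
  assumes i: "\<And>k. integrable M (u k)" and s: "summable (\<lambda>k. \<integral>x. \<bar>u (Suc k) x - u k x\<bar> \<partial>M)"
  shows "AE x in M. convergent (\<lambda>k. u k x)"
proof -
  have [measurable]: "u k \<in> borel_measurable M" for k using i by auto
  have "(\<integral>\<^sup>+x. (\<Sum>k. ennreal \<bar>u (Suc k) x - u k x\<bar>) \<partial>M) = (\<Sum>k. \<integral>\<^sup>+x. ennreal \<bar>u (Suc k) x - u k x\<bar> \<partial>M)"
    by (rule nn_integral_suminf) measurable
  also have "\<dots> = (\<Sum>k. ennreal (\<integral>x. \<bar>u (Suc k) x - u k x\<bar> \<partial>M))"
    by (intro suminf_cong nn_integral_eq_integral) (auto intro!: integrable_abs Bochner_Integration.integrable_diff i)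
  also have "\<dots> = ennreal (\<Sum>k. \<integral>x. \<bar>u (Suc k) x - u k x\<bar> \<partial>M)"
    by (rule suminf_ennreal2[OF _ s]) (rule Bochner_Integration.integral_nonneg, simp)
  also have "\<dots> \<noteq> \<infinity>" by simp
  finally have "AE x in M. (\<Sum>k. ennreal \<bar>u (Suc k) x - u k x\<bar>) \<noteq> \<infinity>"
    by (intro nn_integral_PInf_AE) auto
  then show ?thesis
  proof eventually_elim
    case (elim x)
    have "summable (\<lambda>k. \<bar>u (Suc k) x - u k x\<bar>)"
      by (rule summable_suminf_not_top) (use elim in \<open>simp_all add: infinity_ennreal_def\<close>)
    then have "summable (\<lambda>k. u (Suc k) x - u k x)" by (rule summable_rabs_cancel)
    then have "convergent (\<lambda>n. \<Sum>k<n. u (Suc k) x - u k x)" by (rule summable_iff_convergent[THEN iffD1])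
    then have "convergent (\<lambda>n. u n x - u 0 x)" unfolding sum_lessThan_telescope[of "\<lambda>k. u k x"] .
    then have "convergent (\<lambda>n. (u n x - u 0 x) + u 0 x)" by (rule convergent_add[OF _ convergent_const])
    then show ?case by simp
  qed
qed

lemma subsol_comp_bound:
  assumes "z \<in> subsol C"
  shows "\<bar>V1 z\<bar> \<le> 3 * C + 1" "\<bar>V2 z\<bar> \<le> 3 * C + 1" "\<bar>M1 z\<bar> \<le> 3 * C + 1" "\<bar>M2 z\<bar> \<le> 3 * C + 1"
proof -
  note b = subsol_bounds[OF assms] and v = subsol_vel_bound[OF assms]
  have sq: "0 \<le> (V1 z)\<^sup>2" "0 \<le> (V2 z)\<^sup>2" by simp_all
  then have C: "C > 0" using b(1) by linarith
  show "\<bar>V1 z\<bar> \<le> 3 * C + 1" "\<bar>V2 z\<bar> \<le> 3 * C + 1" using v C by simp_all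
  show "\<bar>M1 z\<bar> \<le> 3 * C + 1" using b(1,2) sq C by linarith
  have "0 \<le> (V1 z - V2 z)\<^sup>2" "0 \<le> (V1 z + V2 z)\<^sup>2" by simp_all
  then have "2 * \<bar>V1 z * V2 z\<bar> \<le> (V1 z)\<^sup>2 + (V2 z)\<^sup>2" by (simp add: power2_sum power2_diff abs_le_iff)
  then show "\<bar>M2 z\<bar> \<le> 3 * C + 1" using b(1,3) sq C by linarith
qed

text \<open>Pairing an increment with this field gives its weighted product with the current
  velocity, that is, the cross term in the expansion of the weighted energy.\<close>

definition wvel :: "(pt \<Rightarrow> real) \<Rightarrow> st \<Rightarrow> (pt \<Rightarrow> st) \<Rightarrow> pt \<Rightarrow> real \<times> real" where
  "wvel \<omega> zc w y = (\<omega> y * V1 (zc + w y), \<omega> y * V2 (zc + w y))"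

lemma wvel_cont: "continuous_on UNIV \<omega> \<Longrightarrow> continuous_on UNIV w \<Longrightarrow> continuous_on UNIV (wvel \<omega> zc w)"
  unfolding wvel_def [abs_def] by (intro continuous_intros)

lemma pwave_cont: "pwave \<Omega> w \<Longrightarrow> continuous_on UNIV w"
  by (simp add: pwave_def)

lemma pwave_diff_integrable:
  assumes "pwave \<Omega> v" "pwave \<Omega> w" "continuous_on UNIV f"
  shows "integrable lborel (\<lambda>y. vdot (v y - w y) (f y))"
proof -
  have "continuous_on UNIV (\<lambda>y. fst (f y))" "continuous_on UNIV (\<lambda>y. snd (f y))"
    using assms(3) by (auto intro!: continuous_intros)
  note c = this
  show ?thesis
    using pwave_integrable[OF assms(1) c(1)] pwave_integrable[OF assms(1) c(2)]
      pwave_integrable[OF assms(2) c(1)] pwave_integrable[OF assms(2) c(2)]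
    unfolding vdot_def fst_diff snd_diff left_diff_distrib by auto
qed

text \<open>The list of fields to which an increment must be nearly orthogonal grows: each new
  iterate adds its own weighted velocity. The tolerances halve, so the sum of all later increments
  is still nearly orthogonal to every earlier iterate.\<close>

lemma iteration_sequence:
  assumes C: "C > 0" and op: "open \<Omega>"
    and cw: "continuous_on UNIV \<omega>" and iw: "integrable lborel \<omega>" and pw: "\<And>y. \<omega> y > 0"
    and w0: "pwave \<Omega> w0" "\<And>y. y \<in> \<Omega> \<Longrightarrow> zc + w0 y \<in> subsol C"
    and F: "finite F" "\<And>f. f \<in> F \<Longrightarrow> continuous_on UNIV f" and \<epsilon>: "\<epsilon> > 0"
  shows "\<exists>w. w 0 = w0 \<and> (\<forall>n. pwave \<Omega> (w n) \<and> (\<forall>y\<in>\<Omega>. zc + w n y \<in> subsol C)) \<and>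
     (\<forall>n m. n \<le> m \<longrightarrow> \<bar>LINT y|lborel. vdot (w m y - w n y) (wvel \<omega> zc (w n) y)\<bar> \<le> \<epsilon> / 2^n) \<and>
     (\<forall>f\<in>F. \<forall>m. \<bar>LINT y|lborel. vdot (w m y - w0 y) (f y)\<bar> \<le> \<epsilon>) \<and>
     (\<exists>\<kappa>>0. \<forall>n. \<kappa> * (LINT y|lborel. indicator \<Omega> y * (\<omega> y * (gap C (zc + w n y))\<^sup>2))
         \<le> (LINT y|lborel. \<omega> y * vsq (w (Suc n) y - w n y)))"
proof -
  obtain \<kappa> where \<kappa>: "\<kappa> > 0" and step: "\<And>\<Omega> \<omega> z F \<epsilon>. open \<Omega> \<Longrightarrow> continuous_on UNIV \<omega> \<Longrightarrow> integrable lborel \<omega> \<Longrightarrow> (\<forall>y. \<omega> y > 0) \<Longrightarrow>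
     continuous_on UNIV z \<Longrightarrow> (\<forall>y\<in>\<Omega>. z y \<in> subsol C) \<Longrightarrow> finite F \<Longrightarrow> (\<forall>f\<in>F. continuous_on UNIV f) \<Longrightarrow> \<epsilon> > 0 \<Longrightarrow>
     (\<exists>\<zeta>. pwave \<Omega> \<zeta> \<and> (\<forall>y\<in>\<Omega>. z y + \<zeta> y \<in> subsol C) \<and>
       (\<forall>f\<in>F. \<bar>LINT y|lborel. vdot (\<zeta> y) (f y)\<bar> \<le> \<epsilon>) \<and>
       (LINT y|lborel. \<omega> y * vsq (\<zeta> y)) \<ge> \<kappa> * (LINT y|lborel. indicator \<Omega> y * (\<omega> y * (gap C (z y))\<^sup>2)))"
    using improvement_step[OF C] by blast
  \<comment> \<open>A stage is a pair: the finite set of fields to be respected, and the wave built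
    so far. \<open>P\<close> is the invariant of a stage, \<open>Q\<close> the relation between
    consecutive stages.\<close>
  define P where "P s \<longleftrightarrow> finite (fst s) \<and> (\<forall>f\<in>fst s. continuous_on UNIV f) \<and> pwave \<Omega> (snd s) \<and>
      (\<forall>y\<in>\<Omega>. zc + snd s y \<in> subsol C)" for s :: "(pt \<Rightarrow> real \<times> real) set \<times> (pt \<Rightarrow> st)"
  define Q where "Q n s s' \<longleftrightarrow> fst s' = insert (wvel \<omega> zc (snd s')) (fst s) \<and>
      (\<forall>f\<in>fst s. \<bar>LINT y|lborel. vdot (snd s' y - snd s y) (f y)\<bar> \<le> \<epsilon> / 2^(Suc n)) \<and>
      \<kappa> * (LINT y|lborel. indicator \<Omega> y * (\<omega> y * (gap C (zc + snd s y))\<^sup>2))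
         \<le> (LINT y|lborel. \<omega> y * vsq (snd s' y - snd s y))" for n :: nat and s s' :: "(pt \<Rightarrow> real \<times> real) set \<times> (pt \<Rightarrow> st)"
  have ex: "\<exists>s'. P s' \<and> Q n s s'" if s: "P s" for s n
  proof -
    have cs: "continuous_on UNIV (snd s)" using s by (simp add: P_def pwave_def)
    have "\<exists>\<zeta>. pwave \<Omega> \<zeta> \<and> (\<forall>y\<in>\<Omega>. zc + snd s y + \<zeta> y \<in> subsol C) \<and>
       (\<forall>f\<in>fst s. \<bar>LINT y|lborel. vdot (\<zeta> y) (f y)\<bar> \<le> \<epsilon> / 2^(Suc n)) \<and>
       (LINT y|lborel. \<omega> y * vsq (\<zeta> y)) \<ge> \<kappa> * (LINT y|lborel. indicator \<Omega> y * (\<omega> y * (gap C (zc + snd s y))\<^sup>2))"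
      using s \<epsilon> pw unfolding P_def by (intro step op cw iw continuous_intros cs) auto
    then obtain \<zeta> where \<zeta>: "pwave \<Omega> \<zeta>" "\<forall>y\<in>\<Omega>. zc + snd s y + \<zeta> y \<in> subsol C"
       "\<forall>f\<in>fst s. \<bar>LINT y|lborel. vdot (\<zeta> y) (f y)\<bar> \<le> \<epsilon> / 2^(Suc n)"
       "(LINT y|lborel. \<omega> y * vsq (\<zeta> y)) \<ge> \<kappa> * (LINT y|lborel. indicator \<Omega> y * (\<omega> y * (gap C (zc + snd s y))\<^sup>2))"
      by blast
    let ?w = "\<lambda>y. snd s y + \<zeta> y"
    have w: "pwave \<Omega> ?w" using s \<zeta>(1) by (auto simp: P_def intro: pwave_add)
    have "P (insert (wvel \<omega> zc ?w) (fst s), ?w)"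
      using s w \<zeta>(2) wvel_cont[OF cw pwave_cont[OF w], of zc] by (simp add: P_def add.assoc)
    moreover have "Q n s (insert (wvel \<omega> zc ?w) (fst s), ?w)"
      using \<zeta>(3,4) by (simp add: Q_def)
    ultimately show ?thesis by blast
  qed
  define s0 where "s0 = (insert (wvel \<omega> zc w0) F, w0)"
  have P0: "P s0" using F w0 wvel_cont[OF cw pwave_cont[OF w0(1)], of zc] by (simp add: P_def s0_def)
  have "\<exists>s. \<forall>n. (P (s n) \<and> (n = 0 \<longrightarrow> s n = s0)) \<and> Q n (s n) (s (Suc n))"
  proof (rule dependent_nat_choice)
    show "\<exists>x. P x \<and> (0 = 0 \<longrightarrow> x = s0)" using P0 by blast
    fix x and n :: nat assume "P x \<and> (n = 0 \<longrightarrow> x = s0)"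
    then show "\<exists>y. (P y \<and> (Suc n = 0 \<longrightarrow> y = s0)) \<and> Q n x y" using ex by blast
  qed
  then obtain s where s: "\<And>n. P (s n)" "s 0 = s0" "\<And>n. Q n (s n) (s (Suc n))" by blast
  define w where "w n = snd (s n)" for n
  define G where "G n = fst (s n)" for n
  have pw': "pwave \<Omega> (w n)" "\<And>y. y \<in> \<Omega> \<Longrightarrow> zc + w n y \<in> subsol C" "\<And>f. f \<in> G n \<Longrightarrow> continuous_on UNIV f" for n
    using s(1)[of n] by (auto simp: P_def w_def G_def)
  have Gs: "G n \<subseteq> G (Suc n)" "wvel \<omega> zc (w (Suc n)) \<in> G (Suc n)" for n
    using s(3)[of n] by (auto simp: Q_def w_def G_def)
  have Gm: "G n \<subseteq> G m" if "n \<le> m" for n m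
    using lift_Suc_mono_le[of G, OF Gs(1) that] .
  have G0: "F \<subseteq> G 0" "wvel \<omega> zc (w 0) \<in> G 0" "w 0 = w0" by (auto simp: G_def w_def s(2) s0_def)
  have Gv: "wvel \<omega> zc (w n) \<in> G n" for n using G0(2) Gs(2) by (cases n) auto
  have est: "\<bar>LINT y|lborel. vdot (w (Suc k) y - w k y) (f y)\<bar> \<le> \<epsilon> / 2^(Suc k)" if "f \<in> G k" for f k
    using s(3)[of k] that by (auto simp: Q_def w_def G_def)
  have tele: "\<bar>LINT y|lborel. vdot (w (n + m) y - w n y) (f y)\<bar> \<le> \<epsilon> / 2^n - \<epsilon> / 2^(n + m)" if f: "f \<in> G n" for f n m
  proof (induction m)
    case 0 then show ?case by (simp add: vdot_def)
  next
    case (Suc m)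
    have fc: "continuous_on UNIV f" using f pw'(3) by blast
    have "(LINT y|lborel. vdot (w (n + Suc m) y - w n y) (f y)) =
      (LINT y|lborel. vdot (w (Suc (n + m)) y - w (n + m) y) (f y) + vdot (w (n + m) y - w n y) (f y))"
      by (intro Bochner_Integration.integral_cong) (auto simp: vdot_def algebra_simps)
    also have "\<dots> = (LINT y|lborel. vdot (w (Suc (n + m)) y - w (n + m) y) (f y)) + (LINT y|lborel. vdot (w (n + m) y - w n y) (f y))"
      by (intro Bochner_Integration.integral_add pwave_diff_integrable[OF pw'(1) pw'(1) fc])
    finally have "\<bar>LINT y|lborel. vdot (w (n + Suc m) y - w n y) (f y)\<bar> \<le> \<epsilon> / 2^(Suc (n + m)) + (\<epsilon> / 2^n - \<epsilon> / 2^(n + m))"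
      using Suc.IH est[of f "n + m"] f Gm[of n "n + m"] by auto
    moreover have "\<epsilon> / 2^(n + m) = 2 * (\<epsilon> / 2^(n + Suc m))" by simp
    ultimately show ?case unfolding add_Suc_right by linarith
  qed
  have t2: "\<bar>LINT y|lborel. vdot (w m y - w n y) (f y)\<bar> \<le> \<epsilon> / 2^n" if "f \<in> G n" "n \<le> m" for f n m
  proof -
    have "\<epsilon> / 2^(n + (m - n)) \<ge> 0" using \<epsilon> by simp
    then show ?thesis using tele[OF that(1), of "m - n"] that(2) by simp
  qed
  show ?thesis
  proof (intro exI[of _ w] conjI allI impI ballI)
    show "w 0 = w0" by (rule G0(3))
    fix n m f
    show "pwave \<Omega> (w n)" by (rule pw')
    show "zc + w n y \<in> subsol C" if "y \<in> \<Omega>" for y by (rule pw'(2)[OF that])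
    show "\<bar>LINT y|lborel. vdot (w m y - w n y) (wvel \<omega> zc (w n) y)\<bar> \<le> \<epsilon> / 2^n" if "n \<le> m"
      by (rule t2[OF Gv that])
    show "\<bar>LINT y|lborel. vdot (w m y - w0 y) (f y)\<bar> \<le> \<epsilon>" if "f \<in> F"
      using t2[of f 0 m] G0 that by auto
    show "\<exists>\<kappa>>0. \<forall>n. \<kappa> * (LINT y|lborel. indicator \<Omega> y * (\<omega> y * (gap C (zc + w n y))\<^sup>2))
         \<le> (LINT y|lborel. \<omega> y * vsq (w (Suc n) y - w n y))"
    proof (intro exI[of _ \<kappa>] conjI allI \<kappa>)
      fix n
      show "\<kappa> * (LINT y|lborel. indicator \<Omega> y * (\<omega> y * (gap C (zc + w n y))\<^sup>2))
         \<le> (LINT y|lborel. \<omega> y * vsq (w (Suc n) y - w n y))"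
        using s(3)[of n] unfolding Q_def w_def by (elim conjE)
    qed
  qed
qed

lemma tendsto_integral_mult_cc:
  fixes a :: "nat \<Rightarrow> pt \<Rightarrow> real" and b g :: "pt \<Rightarrow> real"
  assumes ma: "\<And>k. a k \<in> borel_measurable borel" and mb: "b \<in> borel_measurable borel"
    and lim: "AE y in lborel. (\<lambda>k. a k y) \<longlonglongrightarrow> b y" and bd: "\<And>k y. \<bar>a k y\<bar> \<le> B"
    and g: "continuous_on UNIV g" "compact K" "\<And>y. y \<notin> K \<Longrightarrow> g y = 0"
  shows "(\<lambda>k. LINT y|lborel. a k y * g y) \<longlonglongrightarrow> (LINT y|lborel. b y * g y)"
    "integrable lborel (\<lambda>y. b y * g y)"
proof -
  have ig: "integrable lborel g" by (rule integrable_compact_support[OF g])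
  have [measurable]: "g \<in> borel_measurable borel" "\<And>k. a k \<in> borel_measurable borel" "b \<in> borel_measurable borel"
    using ig ma mb by auto
  have w: "integrable lborel (\<lambda>y. B * \<bar>g y\<bar>)" using ig by simp
  have l: "AE y in lborel. (\<lambda>k. a k y * g y) \<longlonglongrightarrow> b y * g y"
    using lim by eventually_elim (intro tendsto_intros)
  have n: "AE y in lborel. norm (a k y * g y) \<le> B * \<bar>g y\<bar>" for k
    by (intro AE_I2) (simp add: abs_mult mult_right_mono bd)
  show "(\<lambda>k. LINT y|lborel. a k y * g y) \<longlonglongrightarrow> (LINT y|lborel. b y * g y)"
    by (rule integral_dominated_convergence[OF _ _ w l n]) measurable
  show "integrable lborel (\<lambda>y. b y * g y)"
    by (rule integrable_dominated_convergence[OF _ _ w l n]) measurable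
qed

text \<open>Almost orthogonality of the increments turns the bounded, almost increasing energies into an \<open>L\<^sup>2\<close> Cauchy property.\<close>

lemma almost_mono_cauchy:
  fixes e :: "nat \<Rightarrow> real" and D :: "nat \<Rightarrow> nat \<Rightarrow> real"
  assumes D: "\<And>n m. n \<le> m \<Longrightarrow> D n m \<le> e m - e n + 2 * \<epsilon> / 2^n" "\<And>n m. D n m \<ge> 0"
    and bd: "\<And>n. e n \<le> M" and \<epsilon>: "\<epsilon> > 0" and \<eta>: "\<eta> > 0"
  shows "\<exists>N. \<forall>n\<ge>N. \<forall>m\<ge>n. D n m \<le> \<eta>"
proof -
  \<comment> \<open>The correction drops by exactly 2\<epsilon> / 2^n in step n, the largest
    possible decrease of e, so b is increasing.\<close>
  define b where "b n = e n - 4 * \<epsilon> / 2^n" for n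
  have "b n \<le> b (Suc n)" for n
  proof -
    have "e n - 2 * \<epsilon> / 2^n \<le> e (Suc n)" using D(1)[of n "Suc n"] D(2)[of n "Suc n"] by simp
    moreover have "4 * \<epsilon> / 2^(Suc n) = 2 * \<epsilon> / 2^n" "4 * \<epsilon> / 2^n = 2 * \<epsilon> / 2^n + 2 * \<epsilon> / 2^n" by simp_all
    ultimately show ?thesis unfolding b_def by linarith
  qed
  then have inc: "incseq b" by (rule incseq_SucI)
  have "b n \<le> M" for n
  proof -
    have "4 * \<epsilon> / 2^n \<ge> 0" using \<epsilon> by simp
    then show ?thesis using bd[of n] unfolding b_def by linarith
  qed
  with inc obtain L where L: "b \<longlonglongrightarrow> L" using incseq_convergent[of b M] by blast
  have z: "(\<lambda>n. 4 * \<epsilon> / 2^n) \<longlonglongrightarrow> 0"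
    using tendsto_mult_right_zero[OF LIMSEQ_realpow_zero[of "1/2"], of "4 * \<epsilon>"] by (simp add: power_divide)
  have e: "e \<longlonglongrightarrow> L" using tendsto_add[OF L z] by (simp add: b_def)
  have "eventually (\<lambda>n. dist (e n) L < \<eta> / 4) sequentially" using e \<eta> by (intro tendstoD) auto
  moreover have "eventually (\<lambda>n. 4 * \<epsilon> / 2^n < \<eta> / 2) sequentially" using z \<eta> by (intro order_tendstoD) auto
  ultimately have "eventually (\<lambda>n. dist (e n) L < \<eta> / 4 \<and> 4 * \<epsilon> / 2^n < \<eta> / 2) sequentially"
    by eventually_elim auto
  then obtain N where N: "\<And>n. n \<ge> N \<Longrightarrow> dist (e n) L < \<eta> / 4 \<and> 4 * \<epsilon> / 2^n < \<eta> / 2"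
    unfolding eventually_sequentially by blast
  have "D n m \<le> \<eta>" if n: "n \<ge> N" and m: "m \<ge> n" for n m
  proof -
    have "dist (e n) L < \<eta> / 4" "dist (e m) L < \<eta> / 4" "4 * \<epsilon> / 2^n < \<eta> / 2" using N[of n] N[of m] n m by auto
    moreover have "4 * \<epsilon> / 2^n = 2 * \<epsilon> / 2^n + 2 * \<epsilon> / 2^n" "2 * \<epsilon> / 2^n \<ge> 0" using \<epsilon> by simp_all
    ultimately show ?thesis using D(1)[OF m] unfolding dist_real_def by linarith
  qed
  then show ?thesis by blast
qed

text \<open>Strong convergence is essential: the energies are bounded, hence the increments tend to
  zero; each increment dominates the squared gap, hence the gap tends to zero as well, and the limit
  lies on the constraint set although every iterate is strictly inside the relaxation set. The last
  clause keeps the limit close to the initial wave in finitely many directions.\<close>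

lemma convex_integration:
  fixes \<Omega> :: "pt set" and \<omega> :: "pt \<Rightarrow> real"
  assumes C: "C > 0" and op: "open \<Omega>"
    and cw: "continuous_on UNIV \<omega>" and iw: "integrable lborel \<omega>" and pw: "\<And>y. \<omega> y > 0"
    and w0: "pwave \<Omega> w0" "\<And>y. y \<in> \<Omega> \<Longrightarrow> zc + w0 y \<in> subsol C"
    and F: "finite F" "\<And>f. f \<in> F \<Longrightarrow> continuous_on UNIV f" "\<And>f. f \<in> F \<Longrightarrow> \<exists>K. compact K \<and> (\<forall>y. y \<notin> K \<longrightarrow> f y = 0)"
    and \<epsilon>: "\<epsilon> > 0"
  shows "\<exists>w. w \<in> borel_measurable borel \<and> (\<forall>y. y \<notin> \<Omega> \<longrightarrow> w y = 0) \<and>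
     (\<forall>y\<in>\<Omega>. vsq (zc + w y) = C \<and> M1 (zc + w y) = (V1 (zc + w y))\<^sup>2 - C / 2 \<and> M2 (zc + w y) = V1 (zc + w y) * V2 (zc + w y)) \<and>
     (\<forall>\<psi> \<psi>0 \<psi>1 \<psi>2 K. C1 \<psi> \<psi>0 \<psi>1 \<psi>2 \<longrightarrow> compact K \<longrightarrow> (\<forall>y. y \<notin> K \<longrightarrow> \<psi>0 y = 0 \<and> \<psi>1 y = 0 \<and> \<psi>2 y = 0) \<longrightarrow> weak_eqs w \<psi>0 \<psi>1 \<psi>2) \<and>
     (\<forall>f\<in>F. \<bar>LINT y|lborel. vdot (w y - w0 y) (f y)\<bar> \<le> \<epsilon>)"
proof -
  obtain w where wall: "w 0 = w0 \<and> (\<forall>n. pwave \<Omega> (w n) \<and> (\<forall>y\<in>\<Omega>. zc + w n y \<in> subsol C)) \<and>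
     (\<forall>n m. n \<le> m \<longrightarrow> \<bar>LINT y|lborel. vdot (w m y - w n y) (wvel \<omega> zc (w n) y)\<bar> \<le> \<epsilon> / 2^n) \<and>
     (\<forall>f\<in>F. \<forall>m. \<bar>LINT y|lborel. vdot (w m y - w0 y) (f y)\<bar> \<le> \<epsilon>) \<and>
     (\<exists>\<kappa>>0. \<forall>n. \<kappa> * (LINT y|lborel. indicator \<Omega> y * (\<omega> y * (gap C (zc + w n y))\<^sup>2))
         \<le> (LINT y|lborel. \<omega> y * vsq (w (Suc n) y - w n y)))"
    using iteration_sequence[OF C op cw iw pw w0 F(1,2) \<epsilon>] ..
  note w2 = wall[THEN conjunct2, THEN conjunct1]
    and w3 = wall[THEN conjunct2, THEN conjunct2, THEN conjunct1]
    and w4 = wall[THEN conjunct2, THEN conjunct2, THEN conjunct2, THEN conjunct1]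
    and w5 = wall[THEN conjunct2, THEN conjunct2, THEN conjunct2, THEN conjunct2]
  have wp: "pwave \<Omega> (w n)" for n using w2 by blast
  have ws: "zc + w n y \<in> subsol C" if "y \<in> \<Omega>" for n y using w2 that by blast
  have orth: "\<bar>LINT y|lborel. vdot (w m y - w n y) (wvel \<omega> zc (w n) y)\<bar> \<le> \<epsilon> / 2^n" if "n \<le> m" for n m
    using w3[rule_format, OF that] .
  have wF: "\<bar>LINT y|lborel. vdot (w m y - w0 y) (f y)\<bar> \<le> \<epsilon>" if "f \<in> F" for f m
    using bspec[OF w4 that] by (rule spec)
  obtain \<kappa> where \<kappa>0: "\<kappa> > 0" and \<kappa>1: "\<forall>n. \<kappa> * (LINT y|lborel. indicator \<Omega> y * (\<omega> y * (gap C (zc + w n y))\<^sup>2))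
         \<le> (LINT y|lborel. \<omega> y * vsq (w (Suc n) y - w n y))"
    using w5 by (elim exE conjE)
  note \<kappa> = \<kappa>0 spec[OF \<kappa>1]
  have mO [measurable]: "\<Omega> \<in> sets borel" using op by simp
  have mw [measurable]: "\<omega> \<in> borel_measurable borel" using iw by auto
  have cwn: "continuous_on UNIV (w n)" for n by (rule pwave_cont[OF wp])
  have mc: "(\<lambda>y. V1 (w n y)) \<in> borel_measurable borel" "(\<lambda>y. V2 (w n y)) \<in> borel_measurable borel"
    "(\<lambda>y. M1 (w n y)) \<in> borel_measurable borel" "(\<lambda>y. M2 (w n y)) \<in> borel_measurable borel" for n
    using cwn by (auto intro!: borel_measurable_continuous_onI continuous_intros)
  note [measurable] = mc
  have out: "w n y = 0" if "y \<notin> \<Omega>" for n y by (rule pwave_outside[OF wp that])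
  have pw0: "\<omega> y \<ge> 0" for y using pw[of y] by simp
  define W where "W = (LINT y|lborel. \<omega> y)"
  define e where "e n = (LINT y|lborel. indicator \<Omega> y * (\<omega> y * vsq (zc + w n y)))" for n
  define D where "D n m = (LINT y|lborel. \<omega> y * vsq (w m y - w n y))" for n m
  have vb: "0 \<le> vsq (zc + w n y)" "y \<in> \<Omega> \<Longrightarrow> vsq (zc + w n y) \<le> C" for n y
    using subsol_bounds(1)[OF ws[of y n]] by (auto simp: vsq_def)
  have ie: "integrable lborel (\<lambda>y. indicator \<Omega> y * (\<omega> y * vsq (zc + w n y)))" for n
  proof (rule Bochner_Integration.integrable_bound)
    show "integrable lborel (\<lambda>y. C * \<omega> y)" using iw by simp
    show "(\<lambda>y. indicator \<Omega> y * (\<omega> y * vsq (zc + w n y))) \<in> borel_measurable lborel"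
      unfolding vsq_def fst_add snd_add by measurable
    show "AE y in lborel. norm (indicator \<Omega> y * (\<omega> y * vsq (zc + w n y))) \<le> norm (C * \<omega> y)"
    proof (rule AE_I2)
      fix y
      show "norm (indicator \<Omega> y * (\<omega> y * vsq (zc + w n y))) \<le> norm (C * \<omega> y)"
      proof (cases "y \<in> \<Omega>")
        case True
        then show ?thesis using vb(1)[of n y] vb(2)[OF True, of n] C pw0[of y]
          by (simp add: abs_mult mult.commute[of C] mult_left_mono)
      qed simp
    qed
  qed
  have iD: "integrable lborel (\<lambda>y. \<omega> y * vsq (w m y - w n y))" for n m
  proof -
    obtain K L where "compact K" "\<And>y. y \<notin> K \<Longrightarrow> w m y = 0" "compact L" "\<And>y. y \<notin> L \<Longrightarrow> w n y = 0"
      using wp[of n] wp[of m] unfolding pwave_def by blast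
    then show ?thesis
      by (intro integrable_compact_support[of _ "K \<union> L"])
        (auto simp: vsq_def intro!: continuous_intros cw cwn)
  qed
  have D0: "D n m \<ge> 0" for n m
    unfolding D_def by (intro Bochner_Integration.integral_nonneg mult_nonneg_nonneg pw0) (simp add: vsq_def)
  \<comment> \<open>The weighted energy of iterate m is expanded around iterate n; the cross term is
    small by near orthogonality.\<close>
  have eD: "D n m \<le> e m - e n + 2 * \<epsilon> / 2^n" if nm: "n \<le> m" for n m
  proof -
    have cv: "continuous_on UNIV (wvel \<omega> zc (w n))" by (rule wvel_cont[OF cw cwn])
    have iX: "integrable lborel (\<lambda>y. vdot (w m y - w n y) (wvel \<omega> zc (w n) y))"
      by (rule pwave_diff_integrable[OF wp wp cv])
    have "e m = (LINT y|lborel. indicator \<Omega> y * (\<omega> y * vsq (zc + w n y))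
      + 2 * vdot (w m y - w n y) (wvel \<omega> zc (w n) y) + \<omega> y * vsq (w m y - w n y))"
      unfolding e_def
    proof (rule Bochner_Integration.integral_cong)
      fix y
      show "indicator \<Omega> y * (\<omega> y * vsq (zc + w m y)) = indicator \<Omega> y * (\<omega> y * vsq (zc + w n y))
        + 2 * vdot (w m y - w n y) (wvel \<omega> zc (w n) y) + \<omega> y * vsq (w m y - w n y)"
      proof (cases "y \<in> \<Omega>")
        case True
        then show ?thesis by (simp add: vsq_def vdot_def wvel_def power2_eq_square algebra_simps)
      next
        case False
        then show ?thesis using out[OF False] by (simp add: vsq_def vdot_def)
      qed
    qed simp
    also have "\<dots> = e n + 2 * (LINT y|lborel. vdot (w m y - w n y) (wvel \<omega> zc (w n) y)) + D n m"
      unfolding e_def D_def using ie[of n] iX iD[of m n] by simp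
    finally show ?thesis using orth[OF nm] by (simp add: abs_le_iff)
  qed
  have eW: "e n \<le> C * W" for n
  proof -
    have "e n \<le> (LINT y|lborel. C * \<omega> y)"
      unfolding e_def
    proof (rule integral_mono[OF ie])
      show "integrable lborel (\<lambda>y. C * \<omega> y)" using iw by simp
      fix y
      show "indicator \<Omega> y * (\<omega> y * vsq (zc + w n y)) \<le> C * \<omega> y"
      proof (cases "y \<in> \<Omega>")
        case True
        then show ?thesis using vb(2)[OF True, of n] pw0[of y] by (simp add: mult.commute[of C] mult_left_mono)
      qed (use C pw0 in simp)
    qed
    then show ?thesis by (simp add: W_def)
  qed
  have cau: "\<exists>N. \<forall>n\<ge>N. \<forall>m\<ge>n. D n m \<le> \<eta>" if "\<eta> > 0" for \<eta>
    by (rule almost_mono_cauchy[OF eD D0 eW \<epsilon> that])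
  then have "\<forall>k. \<exists>N. \<forall>n\<ge>N. \<forall>m\<ge>n. D n m \<le> (1/4)^k" by simp
  then obtain N where N: "\<And>k n m. n \<ge> N k \<Longrightarrow> m \<ge> n \<Longrightarrow> D n m \<le> (1/4)^k" by metis
  \<comment> \<open>Summing the successors makes r strictly increasing while it stays above
    N.\<close>
  define r where "r k = (\<Sum>i\<le>k. Suc (N i))" for k
  have r: "r k < r (Suc k)" "N k \<le> r k" for k
  proof -
    show "r k < r (Suc k)" by (simp add: r_def)
    have "Suc (N k) \<le> r k" unfolding r_def by (intro member_le_sum) auto
    then show "N k \<le> r k" by simp
  qed
  have Dr: "D (r k) (r (Suc k)) \<le> (1/4)^k" for k using N[OF r(2)] r(1)[of k] by simp
  have conv1: "AE y in lborel. convergent (\<lambda>k. c (w (r k) y) * \<omega> y)"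
    if c: "c = V1 \<or> c = V2" for c :: "st \<Rightarrow> real"
  proof (rule AE_convergent_L1_summable)
    have i: "integrable lborel (\<lambda>y. c (w n y) * \<omega> y)" for n
      using pwave_integrable[OF wp cw] c by auto
    then show "integrable lborel (\<lambda>y. c (w (r k) y) * \<omega> y)" for k .
    have le: "(LINT y|lborel. \<bar>c (w (r (Suc k)) y) * \<omega> y - c (w (r k) y) * \<omega> y\<bar>) \<le> (1 + W) * (1/2)^k" for k
    proof -
      have "(LINT y|lborel. \<bar>c (w (r (Suc k)) y) * \<omega> y - c (w (r k) y) * \<omega> y\<bar>)
        \<le> (LINT y|lborel. 2^k * (\<omega> y * vsq (w (r (Suc k)) y - w (r k) y)) + (1/2)^k * \<omega> y)"
      proof (rule integral_mono)
        show "integrable lborel (\<lambda>y. 2^k * (\<omega> y * vsq (w (r (Suc k)) y - w (r k) y)) + (1/2)^k * \<omega> y)"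
          using iD iw by simp
        show "integrable lborel (\<lambda>y. \<bar>c (w (r (Suc k)) y) * \<omega> y - c (w (r k) y) * \<omega> y\<bar>)"
          by (intro integrable_abs Bochner_Integration.integrable_diff i)
        fix y
        define x where "x = c (w (r (Suc k)) y) - c (w (r k) y)"
        have xs: "x\<^sup>2 \<le> vsq (w (r (Suc k)) y - w (r k) y)" using c by (auto simp: x_def vsq_def)
        \<comment> \<open>Young's inequality with parameter 2^k: it turns the bound 4^-k for the
          squared increments, together with the finite total weight, into a summable bound for the
          weighted absolute increments.\<close>
        have "0 \<le> (2^k * \<bar>x\<bar> - 1)\<^sup>2" by simp
        then have "2 * (2^k * \<bar>x\<bar>) \<le> 2^k * 2^k * x\<^sup>2 + 1" by (simp add: power2_diff power_mult_distrib power2_eq_square[of "2^k"])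
        then have "(1/2)^k * (2 * (2^k * \<bar>x\<bar>)) \<le> (1/2)^k * (2^k * 2^k * x\<^sup>2 + 1)" by (intro mult_left_mono) auto
        moreover have "(1/2)^k * (2::real)^k = 1" by (simp flip: power_mult_distrib)
        then have "(1/2)^k * (2 * (2^k * \<bar>x\<bar>)) = 2 * \<bar>x\<bar>" "(1/2)^k * (2^k * 2^k * x\<^sup>2 + 1) = 2^k * x\<^sup>2 + (1/2)^k"
          by (simp_all add: algebra_simps)
        ultimately have "2 * \<bar>x\<bar> \<le> 2^k * x\<^sup>2 + (1/2)^k" by simp
        also have "\<dots> \<le> 2^k * vsq (w (r (Suc k)) y - w (r k) y) + (1/2)^k" using xs by simp
        finally have "\<bar>x\<bar> \<le> 2^k * vsq (w (r (Suc k)) y - w (r k) y) + (1/2)^k" by linarith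
        then have "\<omega> y * \<bar>x\<bar> \<le> \<omega> y * (2^k * vsq (w (r (Suc k)) y - w (r k) y) + (1/2)^k)"
          by (rule mult_left_mono[OF _ pw0])
        moreover have "\<bar>c (w (r (Suc k)) y) * \<omega> y - c (w (r k) y) * \<omega> y\<bar> = \<omega> y * \<bar>x\<bar>"
          using pw0[of y] by (simp add: x_def abs_mult flip: left_diff_distrib)
        ultimately show "\<bar>c (w (r (Suc k)) y) * \<omega> y - c (w (r k) y) * \<omega> y\<bar>
          \<le> 2^k * (\<omega> y * vsq (w (r (Suc k)) y - w (r k) y)) + (1/2)^k * \<omega> y" by (simp add: algebra_simps)
      qed
      also have "\<dots> = 2^k * D (r k) (r (Suc k)) + (1/2)^k * W"
        using iD iw by (simp add: D_def W_def)
      also have "\<dots> \<le> 2^k * (1/4)^k + (1/2)^k * W" using Dr[of k] by simp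
      also have "(2::real)^k * (1/4)^k = (1/2)^k" by (simp flip: power_mult_distrib)
      finally show ?thesis by (simp add: algebra_simps)
    qed
    show "summable (\<lambda>k. LINT y|lborel. \<bar>c (w (r (Suc k)) y) * \<omega> y - c (w (r k) y) * \<omega> y\<bar>)"
    proof (rule summable_comparison_test)
      show "summable (\<lambda>k. (1 + W) * (1/2::real)^k)" by (intro summable_mult summable_geometric) simp
      show "\<exists>N. \<forall>n\<ge>N. norm (LINT y|lborel. \<bar>c (w (r (Suc n)) y) * \<omega> y - c (w (r n) y) * \<omega> y\<bar>) \<le> (1 + W) * (1/2)^n"
        using le by (simp add: Bochner_Integration.integral_nonneg)
    qed
  qed
  have conv: "AE y in lborel. convergent (\<lambda>k. c (w (r k) y))" if c: "c = V1 \<or> c = V2" for c :: "st \<Rightarrow> real"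
    using conv1[OF c]
  proof eventually_elim
    case (elim y)
    have "convergent (\<lambda>k. (c (w (r k) y) * \<omega> y) * (1 / \<omega> y))" using elim by (rule convergent_mult[OF _ convergent_const])
    then show ?case using pw[of y] by simp
  qed
  define X1 where "X1 y = V1 zc + lim (\<lambda>k. V1 (w (r k) y))" for y
  define X2 where "X2 y = V2 zc + lim (\<lambda>k. V2 (w (r k) y))" for y
  have mX [measurable]: "X1 \<in> borel_measurable borel" "X2 \<in> borel_measurable borel"
    unfolding X1_def [abs_def] X2_def [abs_def] by measurable
  have lim12: "AE y in lborel. (\<lambda>k. V1 (zc + w (r k) y)) \<longlonglongrightarrow> X1 y \<and> (\<lambda>k. V2 (zc + w (r k) y)) \<longlonglongrightarrow> X2 y"
    using conv[of V1, simplified] conv[of V2, simplified]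
    by eventually_elim (auto simp: X1_def X2_def convergent_LIMSEQ_iff intro!: tendsto_intros)
  let ?g = "\<lambda>k y. indicator \<Omega> y * (\<omega> y * (gap C (zc + w (r k) y))\<^sup>2)"
  let ?G = "\<lambda>y. indicator \<Omega> y * (\<omega> y * (C - ((X1 y)\<^sup>2 + (X2 y)\<^sup>2))\<^sup>2)"
  have lg: "AE y in lborel. (\<lambda>k. ?g k y) \<longlonglongrightarrow> ?G y"
    using lim12 by eventually_elim (auto simp: gap_def intro!: tendsto_intros)
  have mg: "?g k \<in> borel_measurable lborel" for k unfolding gap_def fst_add snd_add by measurable
  have bg: "norm (?g k y) \<le> C\<^sup>2 * \<omega> y" for k y
  proof (cases "y \<in> \<Omega>")
    case True
    have "0 \<le> gap C (zc + w (r k) y)" "gap C (zc + w (r k) y) \<le> C"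
      using gap_pos[OF ws[OF True]] by (auto simp: gap_def less_imp_le)
    then have "(gap C (zc + w (r k) y))\<^sup>2 \<le> C\<^sup>2" by (intro power_mono)
    then show ?thesis using True pw0[of y] by (simp add: abs_mult mult.commute[of "C\<^sup>2"] mult_left_mono)
  qed (use pw0 in simp)
  have iC: "integrable lborel (\<lambda>y. C\<^sup>2 * \<omega> y)" using iw by simp
  have mG: "?G \<in> borel_measurable lborel" by measurable
  have limG: "(\<lambda>k. LINT y|lborel. ?g k y) \<longlonglongrightarrow> (LINT y|lborel. ?G y)"
    by (rule integral_dominated_convergence[OF mG mg iC lg]) (use bg in auto)
  have iG: "integrable lborel ?G"
    by (rule integrable_dominated_convergence[OF mG mg iC lg]) (use bg in auto)
  \<comment> \<open>The gain of the next step, of which the gap integral is a fixed fraction, is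
    itself an increment of the sequence and hence at most (1/4)^k.\<close>
  have limG0: "(\<lambda>k. LINT y|lborel. ?g k y) \<longlonglongrightarrow> 0"
  proof (rule tendsto_sandwich[where f = "\<lambda>_. 0" and h = "\<lambda>k. (1/\<kappa>) * (1/4)^k"])
    show "\<forall>\<^sub>F k in sequentially. 0 \<le> (LINT y|lborel. ?g k y)"
      by (intro always_eventually allI Bochner_Integration.integral_nonneg) (simp add: pw0)
    have "(LINT y|lborel. ?g k y) \<le> (1/\<kappa>) * (1/4)^k" for k
    proof -
      have "\<kappa> * (LINT y|lborel. ?g k y) \<le> D (r k) (Suc (r k))" using \<kappa>(2)[of "r k"] by (simp add: D_def)
      also have "\<dots> \<le> (1/4)^k" using N[OF r(2)] by simp
      finally show ?thesis using \<kappa>(1) by (simp add: field_simps)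
    qed
    then show "\<forall>\<^sub>F k in sequentially. (LINT y|lborel. ?g k y) \<le> (1/\<kappa>) * (1/4)^k" by simp
    show "(\<lambda>k. (1/\<kappa>) * (1/4)^k) \<longlonglongrightarrow> 0"
      by (intro tendsto_mult_right_zero LIMSEQ_realpow_zero) auto
  qed simp
  have "(LINT y|lborel. ?G y) = 0" by (rule LIMSEQ_unique[OF limG limG0])
  then have "AE y in lborel. ?G y = 0"
    using integral_nonneg_eq_0_iff_AE[OF iG] pw0 by simp
  then have circ: "AE y in lborel. y \<in> \<Omega> \<longrightarrow> (X1 y)\<^sup>2 + (X2 y)\<^sup>2 = C"
    by eventually_elim (use pw in \<open>auto simp: indicator_def less_imp_neq[THEN not_sym]\<close>)
  \<comment> \<open>The limit of the velocities lies on the circle only almost everywhere. The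
    default \<open>(sqrt C, 0, C / 2, 0)\<close> is a point of the constraint set, so that the
    constraints hold at every point of \<Omega>.\<close>
  define pt' where "pt' y = (if (X1 y)\<^sup>2 + (X2 y)\<^sup>2 = C then (X1 y, X2 y, (X1 y)\<^sup>2 - C / 2, X1 y * X2 y)
     else (sqrt C, 0, C / 2, 0))" for y
  define wl where "wl y = (if y \<in> \<Omega> then pt' y - zc else 0)" for y
  have mwl: "(\<lambda>y. V1 (wl y)) \<in> borel_measurable borel" "(\<lambda>y. V2 (wl y)) \<in> borel_measurable borel"
    "(\<lambda>y. M1 (wl y)) \<in> borel_measurable borel" "(\<lambda>y. M2 (wl y)) \<in> borel_measurable borel"
    unfolding wl_def pt'_def by (simp_all add: if_distrib[of fst] if_distrib[of snd] cong: if_cong)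
  have "(\<lambda>y. (V1 (wl y), V2 (wl y), M1 (wl y), M2 (wl y))) \<in> borel_measurable borel"
    by (intro borel_measurable_Pair mwl)
  then have mwl': "wl \<in> borel_measurable borel" by simp
  have K: "vsq (zc + wl y) = C \<and> M1 (zc + wl y) = (V1 (zc + wl y))\<^sup>2 - C / 2 \<and> M2 (zc + wl y) = V1 (zc + wl y) * V2 (zc + wl y)"
    if "y \<in> \<Omega>" for y
    using that C by (auto simp: wl_def pt'_def vsq_def)
  have lim: "AE y in lborel. (\<lambda>k. w (r k) y) \<longlonglongrightarrow> wl y"
    using lim12 circ
  proof eventually_elim
    case (elim y)
    show ?case
    proof (cases "y \<in> \<Omega>")
      case False then show ?thesis using out by (simp add: wl_def)
    next
      case True
      have cq: "(X1 y)\<^sup>2 + (X2 y)\<^sup>2 = C" using elim True by simp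
      have l1: "(\<lambda>k. V1 (zc + w (r k) y)) \<longlonglongrightarrow> X1 y" and l2: "(\<lambda>k. V2 (zc + w (r k) y)) \<longlonglongrightarrow> X2 y"
        using elim by auto
      have g0: "(\<lambda>k. gap C (zc + w (r k) y)) \<longlonglongrightarrow> 0"
      proof -
        have "(\<lambda>k. gap C (zc + w (r k) y)) \<longlonglongrightarrow> C - ((X1 y)\<^sup>2 + (X2 y)\<^sup>2)"
          unfolding gap_def by (intro tendsto_intros l1 l2)
        then show ?thesis using cq by simp
      qed
      \<comment> \<open>No estimate on the increments of the matrix part is available or required:
        its distance to the product of the velocities is bounded by the gap.\<close>
      have "(\<lambda>k. M1 (zc + w (r k) y) - ((V1 (zc + w (r k) y))\<^sup>2 - C / 2)) \<longlonglongrightarrow> 0"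
        by (rule Lim_null_comparison[OF always_eventually g0])
           (use subsol_bounds(2)[OF ws[OF True]] in \<open>auto simp: gap_def\<close>)
      from tendsto_add[OF this tendsto_diff[OF tendsto_power[OF l1, of 2] tendsto_const[of "C/2"]]]
      have l3: "(\<lambda>k. M1 (zc + w (r k) y)) \<longlonglongrightarrow> (X1 y)\<^sup>2 - C / 2" by simp
      have "(\<lambda>k. M2 (zc + w (r k) y) - V1 (zc + w (r k) y) * V2 (zc + w (r k) y)) \<longlonglongrightarrow> 0"
        by (rule Lim_null_comparison[OF always_eventually g0])
           (use subsol_bounds(3)[OF ws[OF True]] in \<open>auto simp: gap_def\<close>)
      from tendsto_add[OF this tendsto_mult[OF l1 l2]]
      have l4: "(\<lambda>k. M2 (zc + w (r k) y)) \<longlonglongrightarrow> X1 y * X2 y" by simp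
      have "(\<lambda>k. (V1 (zc + w (r k) y), V2 (zc + w (r k) y), M1 (zc + w (r k) y), M2 (zc + w (r k) y))) \<longlonglongrightarrow> pt' y"
        unfolding pt'_def if_P[OF cq] by (intro tendsto_Pair l1 l2 l3 l4)
      then have "(\<lambda>k. zc + w (r k) y) \<longlonglongrightarrow> pt' y" by (simp only: prod.collapse)
      from tendsto_diff[OF this tendsto_const[of zc]]
      show ?thesis using True by (simp add: wl_def)
    qed
  qed
  define B where "B = 3 * C + 1 + norm zc"
  have B: "\<bar>V1 (w n y)\<bar> \<le> B" "\<bar>V2 (w n y)\<bar> \<le> B" "\<bar>M1 (w n y)\<bar> \<le> B" "\<bar>M2 (w n y)\<bar> \<le> B" for n y
  proof -
    have nz: "\<bar>V1 zc\<bar> \<le> norm zc" "\<bar>V2 zc\<bar> \<le> norm zc" "\<bar>M1 zc\<bar> \<le> norm zc" "\<bar>M2 zc\<bar> \<le> norm zc"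
      using norm_fst_le[of "fst zc" "snd zc"] norm_snd_le[of "snd zc" "fst zc"]
        norm_fst_le[of "fst (snd zc)" "snd (snd zc)"] norm_snd_le[of "snd (snd zc)" "fst (snd zc)"]
        norm_fst_le[of "fst (snd (snd zc))" "snd (snd (snd zc))"] norm_snd_le[of "snd (snd (snd zc))" "fst (snd (snd zc))"]
      by auto
    have "\<bar>V1 (w n y)\<bar> \<le> B \<and> \<bar>V2 (w n y)\<bar> \<le> B \<and> \<bar>M1 (w n y)\<bar> \<le> B \<and> \<bar>M2 (w n y)\<bar> \<le> B"
    proof (cases "y \<in> \<Omega>")
      case True
      note b = subsol_comp_bound[OF ws[OF True, of n], unfolded fst_add snd_add]
      show ?thesis using nz b unfolding B_def by (auto simp: abs_le_iff)
    next
      case False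
      then show ?thesis using out[OF False] C by (simp add: B_def)
    qed
    then show "\<bar>V1 (w n y)\<bar> \<le> B" "\<bar>V2 (w n y)\<bar> \<le> B" "\<bar>M1 (w n y)\<bar> \<le> B" "\<bar>M2 (w n y)\<bar> \<le> B" by auto
  qed
  have limc: "AE y in lborel. (\<lambda>k. V1 (w (r k) y)) \<longlonglongrightarrow> V1 (wl y)" "AE y in lborel. (\<lambda>k. V2 (w (r k) y)) \<longlonglongrightarrow> V2 (wl y)"
    "AE y in lborel. (\<lambda>k. M1 (w (r k) y)) \<longlonglongrightarrow> M1 (wl y)" "AE y in lborel. (\<lambda>k. M2 (w (r k) y)) \<longlonglongrightarrow> M2 (wl y)"
    by (rule eventually_mono[OF lim], intro tendsto_intros, assumption)+
  note T1 = tendsto_integral_mult_cc[OF mc(1) mwl(1) limc(1) B(1)]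
    and T2 = tendsto_integral_mult_cc[OF mc(2) mwl(2) limc(2) B(2)]
    and T3 = tendsto_integral_mult_cc[OF mc(3) mwl(3) limc(3) B(3)]
    and T4 = tendsto_integral_mult_cc[OF mc(4) mwl(4) limc(4) B(4)]
  have weak: "weak_eqs wl \<psi>0 \<psi>1 \<psi>2"
    if \<psi>: "C1 \<psi> \<psi>0 \<psi>1 \<psi>2" and cK: "compact K" and z: "\<And>y. y \<notin> K \<Longrightarrow> \<psi>0 y = 0" "\<And>y. y \<notin> K \<Longrightarrow> \<psi>1 y = 0" "\<And>y. y \<notin> K \<Longrightarrow> \<psi>2 y = 0"
    for \<psi> \<psi>0 \<psi>1 \<psi>2 K
  proof -
    have c0: "continuous_on UNIV \<psi>0" and c1: "continuous_on UNIV \<psi>1" and c2: "continuous_on UNIV \<psi>2"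
      using C1_D(2-4)[OF \<psi>] by auto
    have we: "weak_eqs (w n) \<psi>0 \<psi>1 \<psi>2" for n using wp[of n] \<psi> unfolding pwave_def by blast
    note I0 = pwave_integrable[OF wp c0] and I1 = pwave_integrable[OF wp c1] and I2 = pwave_integrable[OF wp c2]
    note L0 = T1[OF c0 cK z(1)] T2[OF c0 cK z(1)] T3[OF c0 cK z(1)] T4[OF c0 cK z(1)]
      and L1 = T1[OF c1 cK z(2)] T2[OF c1 cK z(2)] T3[OF c1 cK z(2)] T4[OF c1 cK z(2)]
      and L2 = T1[OF c2 cK z(3)] T2[OF c2 cK z(3)] T3[OF c2 cK z(3)] T4[OF c2 cK z(3)]
    have "(\<lambda>k. (LINT y|lborel. V1 (w (r k) y) * \<psi>1 y) + (LINT y|lborel. V2 (w (r k) y) * \<psi>2 y)) \<longlonglongrightarrow>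
      (LINT y|lborel. V1 (wl y) * \<psi>1 y) + (LINT y|lborel. V2 (wl y) * \<psi>2 y)"
      by (intro tendsto_add L1 L2)
    moreover have "(LINT y|lborel. V1 (w (r k) y) * \<psi>1 y) + (LINT y|lborel. V2 (w (r k) y) * \<psi>2 y) = 0" for k
      using we[of "r k"] I1 I2 by (simp add: weak_eqs_def)
    ultimately have 1: "(LINT y|lborel. V1 (wl y) * \<psi>1 y) + (LINT y|lborel. V2 (wl y) * \<psi>2 y) = 0"
      by (simp add: LIMSEQ_const_iff)
    have "(\<lambda>k. (LINT y|lborel. V1 (w (r k) y) * \<psi>0 y) + (LINT y|lborel. M1 (w (r k) y) * \<psi>1 y) + (LINT y|lborel. M2 (w (r k) y) * \<psi>2 y)) \<longlonglongrightarrow>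
      (LINT y|lborel. V1 (wl y) * \<psi>0 y) + (LINT y|lborel. M1 (wl y) * \<psi>1 y) + (LINT y|lborel. M2 (wl y) * \<psi>2 y)"
      by (intro tendsto_add L0 L1 L2)
    moreover have "(LINT y|lborel. V1 (w (r k) y) * \<psi>0 y) + (LINT y|lborel. M1 (w (r k) y) * \<psi>1 y) + (LINT y|lborel. M2 (w (r k) y) * \<psi>2 y) = 0" for k
      using we[of "r k"] I0 I1 I2 by (simp add: weak_eqs_def)
    ultimately have 2: "(LINT y|lborel. V1 (wl y) * \<psi>0 y) + (LINT y|lborel. M1 (wl y) * \<psi>1 y) + (LINT y|lborel. M2 (wl y) * \<psi>2 y) = 0"
      by (simp add: LIMSEQ_const_iff)
    have "(\<lambda>k. (LINT y|lborel. V2 (w (r k) y) * \<psi>0 y) + (LINT y|lborel. M2 (w (r k) y) * \<psi>1 y) - (LINT y|lborel. M1 (w (r k) y) * \<psi>2 y)) \<longlonglongrightarrow>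
      (LINT y|lborel. V2 (wl y) * \<psi>0 y) + (LINT y|lborel. M2 (wl y) * \<psi>1 y) - (LINT y|lborel. M1 (wl y) * \<psi>2 y)"
      by (intro tendsto_add tendsto_diff L0 L1 L2)
    moreover have "(LINT y|lborel. V2 (w (r k) y) * \<psi>0 y) + (LINT y|lborel. M2 (w (r k) y) * \<psi>1 y) - (LINT y|lborel. M1 (w (r k) y) * \<psi>2 y) = 0" for k
      using we[of "r k"] I0 I1 I2 by (simp add: weak_eqs_def)
    ultimately have 3: "(LINT y|lborel. V2 (wl y) * \<psi>0 y) + (LINT y|lborel. M2 (wl y) * \<psi>1 y) - (LINT y|lborel. M1 (wl y) * \<psi>2 y) = 0"
      by (simp add: LIMSEQ_const_iff)
    show ?thesis unfolding weak_eqs_def using 1 2 3 L0 L1 L2 by simp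
  qed
  have close: "\<bar>LINT y|lborel. vdot (wl y - w0 y) (f y)\<bar> \<le> \<epsilon>" if f: "f \<in> F" for f
  proof -
    obtain K where cK: "compact K" and K0: "\<And>y. y \<notin> K \<Longrightarrow> f y = 0" using F(3)[OF f] by blast
    have c1: "continuous_on UNIV (\<lambda>y. fst (f y))" and c2: "continuous_on UNIV (\<lambda>y. snd (f y))"
      using F(2)[OF f] by (auto intro!: continuous_intros)
    have z: "fst (f y) = 0" "snd (f y) = 0" if "y \<notin> K" for y using K0[OF that] by simp_all
    note L = T1[OF c1 cK z(1)] T2[OF c2 cK z(2)]
    note I = pwave_integrable[OF wp c1] pwave_integrable[OF wp c2] pwave_integrable[OF w0(1) c1] pwave_integrable[OF w0(1) c2]
    have s: "(LINT y|lborel. vdot (w (r k) y - w0 y) (f y)) = (LINT y|lborel. V1 (w (r k) y) * fst (f y)) + (LINT y|lborel. V2 (w (r k) y) * snd (f y))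
       - ((LINT y|lborel. V1 (w0 y) * fst (f y)) + (LINT y|lborel. V2 (w0 y) * snd (f y)))" for k
      unfolding vdot_def fst_diff snd_diff left_diff_distrib using I by simp
    have sl: "(LINT y|lborel. vdot (wl y - w0 y) (f y)) = (LINT y|lborel. V1 (wl y) * fst (f y)) + (LINT y|lborel. V2 (wl y) * snd (f y))
       - ((LINT y|lborel. V1 (w0 y) * fst (f y)) + (LINT y|lborel. V2 (w0 y) * snd (f y)))"
      unfolding vdot_def fst_diff snd_diff left_diff_distrib using I L by simp
    have "(\<lambda>k. LINT y|lborel. vdot (w (r k) y - w0 y) (f y)) \<longlonglongrightarrow> (LINT y|lborel. vdot (wl y - w0 y) (f y))"
      unfolding s sl by (intro tendsto_intros L)
    then have "(\<lambda>k. \<bar>LINT y|lborel. vdot (w (r k) y - w0 y) (f y)\<bar>) \<longlonglongrightarrow> \<bar>LINT y|lborel. vdot (wl y - w0 y) (f y)\<bar>"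
      by (rule tendsto_rabs)
    then show ?thesis by (rule LIMSEQ_le_const2) (use wF[OF f] in blast)
  qed
  show ?thesis
  proof (intro exI[of _ wl] conjI allI impI ballI)
    show "wl \<in> borel_measurable borel" by (rule mwl')
    show "wl y = 0" if "y \<notin> \<Omega>" for y using that by (simp add: wl_def)
    show "vsq (zc + wl y) = C" "M1 (zc + wl y) = (V1 (zc + wl y))\<^sup>2 - C / 2" "M2 (zc + wl y) = V1 (zc + wl y) * V2 (zc + wl y)"
      if "y \<in> \<Omega>" for y using K[OF that] by auto
    show "weak_eqs wl \<psi>0 \<psi>1 \<psi>2" if "C1 \<psi> \<psi>0 \<psi>1 \<psi>2" "compact K" "\<forall>y. y \<notin> K \<longrightarrow> \<psi>0 y = 0 \<and> \<psi>1 y = 0 \<and> \<psi>2 y = 0" for \<psi> \<psi>0 \<psi>1 \<psi>2 K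
      by (rule weak[OF that(1,2)]) (use that(3) in blast)+
    show "\<bar>LINT y|lborel. vdot (wl y - w0 y) (f y)\<bar> \<le> \<epsilon>" if "f \<in> F" for f by (rule close[OF that])
  qed
qed

section \<open>Weak forms across fan interfaces\<close>

lemma FTC_line:
  fixes f f' :: "real \<Rightarrow> real"
  assumes d: "\<And>x. (f has_real_derivative f' x) (at x)" and c: "continuous_on UNIV f'"
    and R: "R > 0" and out: "\<And>x. \<bar>x\<bar> \<ge> R \<Longrightarrow> f x = 0"
  shows "(LINT x|lborel. f' x) = 0" "(LINT x|lborel. indicator {0<..} x * f' x) = - f 0"
proof -
  have v: "(f has_vector_derivative f' x) (at x within S)" for x S
    using d has_field_derivative_at_within has_real_derivative_iff_has_vector_derivative by blast
  have z: "f' x = 0" if "\<bar>x\<bar> > R" for x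
  proof -
    have "((\<lambda>_. 0) has_real_derivative f' x) (at x)"
    proof (rule has_field_derivative_transform_within_open[OF d[of x]])
      show "open {x. \<bar>x\<bar> > R}" by (intro open_Collect_less continuous_intros)
    qed (use that out in auto)
    then show ?thesis by (intro DERIV_unique[OF _ DERIV_const[of 0]]) simp
  qed
  have z': "- R \<le> x \<and> x \<le> R" if "f' x \<noteq> 0" for x using z[of x] that by linarith
  have c': "continuous_on S f'" for S using c by (rule continuous_on_subset) simp
  have [measurable]: "f' \<in> borel_measurable borel" using c by (rule borel_measurable_continuous_onI)
  have "(LINT x|lborel. f' x) = (LINT x|lborel. indicator {-R..R} x *\<^sub>R f' x)"
    using z' by (intro Bochner_Integration.integral_cong) (auto simp: indicator_def)
  also have "\<dots> = f R - f (-R)"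
    by (rule integral_FTC_atLeastAtMost) (use R v c' in auto)
  finally show "(LINT x|lborel. f' x) = 0" using out[of R] out[of "-R"] R by simp
  have "AE x in lborel. indicator {0<..} x * f' x = indicator {0..R} x *\<^sub>R f' x"
    using AE_lborel_singleton[of 0] by eventually_elim (use z in \<open>auto simp: indicator_def\<close>)
  then have "(LINT x|lborel. indicator {0<..} x * f' x) = (LINT x|lborel. indicator {0..R} x *\<^sub>R f' x)"
    by (intro integral_cong_AE) auto
  also have "\<dots> = f R - f 0"
    by (rule integral_FTC_atLeastAtMost) (use R v c' in auto)
  finally show "(LINT x|lborel. indicator {0<..} x * f' x) = - f 0" using out[of R] R by simp
qed

lemma lborel_Fubini:
  fixes h :: "'a::euclidean_space \<times> 'b::euclidean_space \<Rightarrow> real"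
  assumes "integrable lborel h"
  shows "(LINT y|lborel. h y) = (LINT s|lborel. (LINT x|lborel. h (s, x)))"
    "(LINT y|lborel. h y) = (LINT x|lborel. (LINT s|lborel. h (s, x)))"
proof -
  have i: "integrable (lborel \<Otimes>\<^sub>M lborel) h" using assms by (simp add: lborel_prod)
  show "(LINT y|lborel. h y) = (LINT s|lborel. (LINT x|lborel. h (s, x)))"
    using lborel_pair.integral_fst'[OF i] by (simp add: lborel_prod)
  have "integrable (lborel \<Otimes>\<^sub>M lborel) (case_prod (\<lambda>s x. h (s, x)))" using i by simp
  from lborel_pair.integral_snd[OF this]
  show "(LINT y|lborel. h y) = (LINT x|lborel. (LINT s|lborel. h (s, x)))" by (simp add: lborel_prod)
qed

lemma integrable_indicator_cc:
  fixes f :: "'a::euclidean_space \<Rightarrow> real"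
  assumes "continuous_on UNIV f" "compact K" "\<And>y. y \<notin> K \<Longrightarrow> f y = 0" and A: "A \<in> sets borel"
  shows "integrable lborel (\<lambda>y. indicator A y * f y)"
  using integrable_mult_indicator[OF _ integrable_compact_support[OF assms(1-3)], of A] A by simp

text \<open>The class must be stable under the shear that straightens a moving interface, and its
  members need an explicit radius of support to be integrated along lines.\<close>

locale test_C1 =
  fixes \<phi> \<phi>0 \<phi>1 \<phi>2 :: "pt \<Rightarrow> real" and R :: real
  assumes C: "C1 \<phi> \<phi>0 \<phi>1 \<phi>2" and R: "R > 0"
    and out: "\<And>y. norm y \<ge> R \<Longrightarrow> \<phi> y = 0"
begin

lemma cont: "continuous_on S \<phi>" "continuous_on S \<phi>0" "continuous_on S \<phi>1" "continuous_on S \<phi>2"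
  using C1_cont[OF C] C1_D(2-4)[OF C] by auto

lemma out_deriv: assumes "norm y > R" shows "\<phi>0 y = 0" "\<phi>1 y = 0" "\<phi>2 y = 0"
proof -
  have "((\<lambda>_. 0) has_derivative (\<lambda>h. \<phi>0 y * fst h + \<phi>1 y * fst (snd h) + \<phi>2 y * snd (snd h))) (at y)"
  proof (rule has_derivative_transform_within_open[OF C1_D(1)[OF C]])
    show "open {y::pt. norm y > R}" by (intro open_Collect_less continuous_intros)
  qed (use assms out in \<open>auto simp: less_imp_le\<close>)
  then have "(\<lambda>h. \<phi>0 y * fst h + \<phi>1 y * fst (snd h) + \<phi>2 y * snd (snd h)) = (\<lambda>h. 0 :: real)"
    by (intro has_derivative_unique[of "\<lambda>_. 0"]) auto
  from fun_cong[OF this, of "(1,0,0)"] fun_cong[OF this, of "(0,1,0)"] fun_cong[OF this, of "(0,0,1)"]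
  show "\<phi>0 y = 0" "\<phi>1 y = 0" "\<phi>2 y = 0" by simp_all
qed

lemma out_cball: "y \<notin> cball 0 R \<Longrightarrow> \<phi> y = 0" "y \<notin> cball 0 R \<Longrightarrow> \<phi>0 y = 0"
  "y \<notin> cball 0 R \<Longrightarrow> \<phi>1 y = 0" "y \<notin> cball 0 R \<Longrightarrow> \<phi>2 y = 0"
  using out out_deriv by (auto simp: mem_cball_0)

lemma coord: "\<bar>t\<bar> \<le> norm (t, x1, x2)" "\<bar>x1\<bar> \<le> norm (t, x1, x2)" "\<bar>x2\<bar> \<le> norm (t, x1, x2)" "norm (x1, x2) \<le> norm (t, x1, x2)"
  for t x1 x2 :: real
proof -
  show a: "\<bar>t\<bar> \<le> norm (t, x1, x2)" and b: "norm (x1, x2) \<le> norm (t, x1, x2)"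
    using norm_fst_le[of t "(x1, x2)"] norm_snd_le[of "(x1, x2)" t] by auto
  show "\<bar>x1\<bar> \<le> norm (t, x1, x2)" "\<bar>x2\<bar> \<le> norm (t, x1, x2)"
    using norm_fst_le[of x1 x2] norm_snd_le[of x2 x1] b by auto
qed

lemma deriv_coord:
  "((\<lambda>t. \<phi> (t, x1, x2)) has_real_derivative \<phi>0 (t, x1, x2)) (at t)"
  "((\<lambda>x1. \<phi> (t, x1, x2)) has_real_derivative \<phi>1 (t, x1, x2)) (at x1)"
  "((\<lambda>x2. \<phi> (t, x1, x2)) has_real_derivative \<phi>2 (t, x1, x2)) (at x2)"
proof -
  have l: "((\<lambda>t. (t, x1, x2)) has_derivative (\<lambda>h. (h, 0, 0))) (at t)"
    "((\<lambda>x1. (t, x1, x2)) has_derivative (\<lambda>h. (0, h, 0))) (at x1)"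
    "((\<lambda>x2. (t, x1, x2)) has_derivative (\<lambda>h. (0, 0, h))) (at x2)"
    by (auto intro!: derivative_eq_intros simp: zero_prod_def)
  show "((\<lambda>t. \<phi> (t, x1, x2)) has_real_derivative \<phi>0 (t, x1, x2)) (at t)"
    unfolding has_field_derivative_def
    by (rule has_derivative_compose[OF l(1) C1_D(1)[OF C], THEN has_derivative_eq_rhs]) (simp add: fun_eq_iff)
  show "((\<lambda>x1. \<phi> (t, x1, x2)) has_real_derivative \<phi>1 (t, x1, x2)) (at x1)"
    unfolding has_field_derivative_def
    by (rule has_derivative_compose[OF l(2) C1_D(1)[OF C], THEN has_derivative_eq_rhs]) (simp add: fun_eq_iff)
  show "((\<lambda>x2. \<phi> (t, x1, x2)) has_real_derivative \<phi>2 (t, x1, x2)) (at x2)"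
    unfolding has_field_derivative_def
    by (rule has_derivative_compose[OF l(3) C1_D(1)[OF C], THEN has_derivative_eq_rhs]) (simp add: fun_eq_iff)
qed

lemma line_t: "(LINT t|lborel. indicator {0<..} t * \<phi>0 (t, x1, x2)) = - \<phi> (0, x1, x2)"
  by (rule FTC_line(2)[OF deriv_coord(1) _ R])
    (auto intro!: continuous_on_compose2[OF cont(2)[of UNIV]] continuous_intros out order_trans[OF _ coord(1)])

lemma line_x1: "(LINT x1|lborel. \<phi>1 (t, x1, x2)) = 0"
  by (rule FTC_line(1)[OF deriv_coord(2) _ R])
    (auto intro!: continuous_on_compose2[OF cont(3)[of UNIV]] continuous_intros out order_trans[OF _ coord(2)])

lemma line_x2: "(LINT x2|lborel. \<phi>2 (t, x1, x2)) = 0"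
  "(LINT x2|lborel. indicator {0<..} x2 * \<phi>2 (t, x1, x2)) = - \<phi> (t, x1, 0)"
  by (rule FTC_line[OF deriv_coord(3) _ R];
    auto intro!: continuous_on_compose2[OF cont(4)[of UNIV]] continuous_intros out order_trans[OF _ coord(3)])+

lemma integrable_ind:
  assumes "A \<in> sets borel"
  shows "integrable lborel (\<lambda>y. indicator A y * \<phi>0 y)" "integrable lborel (\<lambda>y. indicator A y * \<phi>1 y)"
    "integrable lborel (\<lambda>y. indicator A y * \<phi>2 y)"
  by (rule integrable_indicator_cc[OF _ compact_cball[of 0 R] _ assms]; (rule cont out_cball)?; assumption?)+

lemma integrable_section:
  fixes g :: "pt \<Rightarrow> real"
  assumes "continuous_on UNIV g" "\<And>y. y \<notin> cball 0 R \<Longrightarrow> g y = 0" and A: "A \<in> sets borel"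
  shows "integrable lborel (\<lambda>x. indicator A x * g (t, x))"
proof (rule integrable_indicator_cc[OF _ compact_cball[of 0 R] _ A])
  show "continuous_on UNIV (\<lambda>x. g (t, x))"
    by (intro continuous_on_compose2[OF assms(1)] continuous_intros) auto
  fix x :: "real \<times> real" assume x: "x \<notin> cball 0 R"
  have "norm x \<le> norm (t, x)" by (rule norm_snd_le)
  then show "g (t, x) = 0" using x by (intro assms(2)) auto
qed

lemma integral_t:
  assumes [measurable]: "A \<in> sets borel"
  shows "(LINT y|lborel. indicator ({0<..} \<times> A) y * \<phi>0 y) = - (LINT x|lborel. indicator A x * \<phi> (0, x))"
proof -
  have "({0<..} :: real set) \<times> A \<in> sets (borel \<Otimes>\<^sub>M borel)" by (intro pair_measureI) (use assms in auto)
  then have "({0<..} :: real set) \<times> A \<in> sets borel" unfolding borel_prod .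
  then have "(LINT y|lborel. indicator ({0<..} \<times> A) y * \<phi>0 y) = (LINT x|lborel. (LINT t|lborel. indicator ({0<..} \<times> A) (t, x) * \<phi>0 (t, x)))"
    by (intro lborel_Fubini(2) integrable_ind)
  also have "\<dots> = (LINT x|lborel. indicator A x * - \<phi> (0, x))"
  proof (rule Bochner_Integration.integral_cong)
    fix x :: "real \<times> real"
    have "(LINT t|lborel. indicator ({0<..} \<times> A) (t, x) * \<phi>0 (t, x)) = (LINT t|lborel. indicator A x * (indicator {0<..} t * \<phi>0 (t, x)))"
      by (intro Bochner_Integration.integral_cong) (auto simp: indicator_def)
    also have "\<dots> = indicator A x * - \<phi> (0, x)" using line_t[of "fst x" "snd x"] by simp
    finally show "(LINT t|lborel. indicator ({0<..} \<times> A) (t, x) * \<phi>0 (t, x)) = indicator A x * - \<phi> (0, x)" .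
  qed simp
  finally show ?thesis by simp
qed

text \<open>Integrating in x2 first leaves minus the trace on the plane x2 = 0 in the half-space
  case, and nothing on the full line.\<close>

lemma integral_x2_halfspace:
  "(LINT y|lborel. indicator ({0<..} \<times> UNIV \<times> {0<..}) y * \<phi>2 y)
     = (LINT t|lborel. (LINT x1|lborel. indicator {0<..} t * - \<phi> (t, x1, 0)))"
  "(LINT y|lborel. indicator ({0<..} \<times> UNIV) y * \<phi>2 y) = 0"
proof -
  have m: "({0<..} \<times> UNIV \<times> {0<..} :: pt set) \<in> sets borel" "({0<..} \<times> UNIV :: pt set) \<in> sets borel"
    "(UNIV \<times> {0<..} :: (real \<times> real) set) \<in> sets borel"
    by (auto intro!: borel_open open_Times)
  have "(LINT y|lborel. indicator ({0<..} \<times> UNIV \<times> {0<..}) y * \<phi>2 y)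
     = (LINT t|lborel. (LINT x|lborel. indicator ({0<..} \<times> UNIV \<times> {0<..}) (t, x) * \<phi>2 (t, x)))"
    by (intro lborel_Fubini(1) integrable_ind m)
  also have "\<dots> = (LINT t|lborel. (LINT x|lborel. indicator {0<..} t * (indicator (UNIV \<times> {0<..}) x * \<phi>2 (t, x))))"
    by (intro Bochner_Integration.integral_cong) (auto simp: indicator_def)
  also have "\<dots> = (LINT t|lborel. indicator {0<..} t * (LINT x1|lborel. (LINT x2|lborel. indicator (UNIV \<times> {0<..}) (x1, x2) * \<phi>2 (t, x1, x2))))"
    unfolding integral_mult_right_zero
    by (intro Bochner_Integration.integral_cong arg_cong2[where f = "(*)"] refl
        lborel_Fubini(1)[OF integrable_section[OF cont(4) out_cball(4) m(3)]])
  also have "\<dots> = (LINT t|lborel. indicator {0<..} t * (LINT x1|lborel. - \<phi> (t, x1, 0)))"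
    using line_x2(2) by (simp add: indicator_times)
  finally show "(LINT y|lborel. indicator ({0<..} \<times> UNIV \<times> {0<..}) y * \<phi>2 y)
     = (LINT t|lborel. (LINT x1|lborel. indicator {0<..} t * - \<phi> (t, x1, 0)))" by simp
  have "(LINT y|lborel. indicator ({0<..} \<times> UNIV) y * \<phi>2 y)
     = (LINT t|lborel. (LINT x|lborel. indicator ({0<..} \<times> UNIV) (t, x) * \<phi>2 (t, x)))"
    by (intro lborel_Fubini(1) integrable_ind m)
  also have "\<dots> = (LINT t|lborel. (LINT x|lborel. indicator {0<..} t * (indicator UNIV x * \<phi>2 (t, x))))"
    by (intro Bochner_Integration.integral_cong) (auto simp: indicator_def)
  also have "\<dots> = (LINT t|lborel. indicator {0<..} t * (LINT x1|lborel. (LINT x2|lborel. indicator UNIV (x1, x2) * \<phi>2 (t, x1, x2))))"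
    unfolding integral_mult_right_zero
    by (intro Bochner_Integration.integral_cong arg_cong2[where f = "(*)"] refl
        lborel_Fubini(1)[OF integrable_section[OF cont(4) out_cball(4)]]) auto
  finally show "(LINT y|lborel. indicator ({0<..} \<times> UNIV) y * \<phi>2 y) = 0"
    using line_x2(1) by simp
qed

text \<open>The region is invariant in x1, so the innermost integral is that of a full derivative
  along the x1-axis.\<close>

lemma integral_x1:
  assumes [measurable]: "S \<in> sets borel"
  shows "(LINT y|lborel. indicator {y. (fst y, snd (snd y)) \<in> S} y * \<phi>1 y) = 0"
proof -
  have m: "{y::pt. (fst y, snd (snd y)) \<in> S} \<in> sets borel"
  proof -
    have "(\<lambda>y::pt. (fst y, snd (snd y))) -` S \<inter> space borel \<in> sets borel"
      by (rule measurable_sets[of _ _ borel]) (auto intro!: borel_measurable_continuous_onI continuous_intros assms)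
    then show ?thesis by (simp add: vimage_def)
  qed
  have mt: "{x::real\<times>real. (t, snd x) \<in> S} \<in> sets borel" for t
  proof -
    have "(\<lambda>x::real\<times>real. (t, snd x)) -` S \<inter> space borel \<in> sets borel"
      by (rule measurable_sets[of _ _ borel]) (auto intro!: borel_measurable_continuous_onI continuous_intros assms)
    then show ?thesis by (simp add: vimage_def)
  qed
  have "(LINT y|lborel. indicator {y. (fst y, snd (snd y)) \<in> S} y * \<phi>1 y)
    = (LINT t|lborel. (LINT x|lborel. indicator {y. (fst y, snd (snd y)) \<in> S} (t, x) * \<phi>1 (t, x)))"
    by (intro lborel_Fubini(1) integrable_ind m)
  also have "\<dots> = (LINT t|lborel. (LINT x|lborel. indicator {x. (t, snd x) \<in> S} x * \<phi>1 (t, x)))"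
    by (intro Bochner_Integration.integral_cong) (auto simp: indicator_def)
  also have "\<dots> = (LINT t|lborel. (LINT x2|lborel. (LINT x1|lborel. indicator {x. (t, snd x) \<in> S} (x1, x2) * \<phi>1 (t, x1, x2))))"
    using lborel_Fubini(2)[OF integrable_section[OF cont(3) out_cball(3) mt]] by simp
  also have "\<dots> = (LINT t|lborel. (LINT x2|lborel. indicator S (t, x2) * (LINT x1|lborel. \<phi>1 (t, x1, x2))))"
    by (simp add: indicator_def)
  finally show ?thesis by (simp add: line_x1)
qed

end

text \<open>At each fixed time the shear is a translation in x2.\<close>

lemma integral_shear:
  fixes g :: "pt \<Rightarrow> real"
  assumes "integrable lborel g" "integrable lborel (\<lambda>y. g (fst y, fst (snd y), snd (snd y) + \<mu> * fst y))"
  shows "(LINT y|lborel. g y) = (LINT y|lborel. g (fst y, fst (snd y), snd (snd y) + \<mu> * fst y))"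
proof -
  have [measurable]: "g \<in> borel_measurable (borel \<Otimes>\<^sub>M borel)" using assms(1) by (auto simp: borel_prod)
  have "(LINT y|lborel. g (fst y, fst (snd y), snd (snd y) + \<mu> * fst y)) = (LINT t|lborel. (LINT x|lborel. g (t, (0, \<mu> * t) + x)))"
    by (subst lborel_Fubini(1)[OF assms(2)]) (simp add: add.commute plus_prod_def)
  also have "\<dots> = (LINT t|lborel. (LINT x|lborel. g (t, x)))"
  proof (rule Bochner_Integration.integral_cong)
    fix t :: real
    have "(\<lambda>x. g (t, x)) \<in> borel_measurable borel" by measurable
    then show "(LINT x|lborel. g (t, (0, \<mu> * t) + x)) = (LINT x|lborel. g (t, x))"
      using integral_lborel_translate[of "\<lambda>x. g (t, x)" "(0, \<mu> * t)"] by simp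
  qed simp
  also have "\<dots> = (LINT y|lborel. g y)" by (rule lborel_Fubini(1)[OF assms(1), symmetric])
  finally show ?thesis by simp
qed

section \<open>Test functions on the region above a moving interface\<close>

definition upper :: "real \<Rightarrow> pt set" where "upper \<mu> = {y. fst y > 0 \<and> snd (snd y) > \<mu> * fst y}"

lemma upper_sets: "upper \<mu> \<in> sets borel"
  unfolding upper_def by (intro borel_open open_Collect_conj open_Collect_less continuous_intros)

context test_C1 begin

text \<open>After the shear x2 + \<mu> t the interface becomes x2 = 0, and by the chain rule the
  time derivative of the sheared function is \<phi>0 + \<mu> \<phi>2. All integrals reduce to that
  of \<phi>2, which is minus the integral of \<phi> over the interface; hence its sign for
  nonnegative \<phi>.\<close>

lemma upper_integrals:
  "(LINT y|lborel. indicator (upper \<mu>) y * \<phi>1 y) = 0"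
  "(LINT y|lborel. indicator (upper \<mu>) y * \<phi>0 y) =
     - \<mu> * (LINT y|lborel. indicator (upper \<mu>) y * \<phi>2 y) - (LINT x|lborel. indicator (UNIV \<times> {0<..}) x * \<phi> (0, x))"
  "(\<And>y. \<phi> y \<ge> 0) \<Longrightarrow> (LINT y|lborel. indicator (upper \<mu>) y * \<phi>2 y) \<le> 0"
proof -
  have "{p::real\<times>real. fst p > 0 \<and> snd p > \<mu> * fst p} \<in> sets borel"
    by (intro borel_open open_Collect_conj open_Collect_less continuous_intros)
  from integral_x1[OF this] show "(LINT y|lborel. indicator (upper \<mu>) y * \<phi>1 y) = 0"
    by (simp add: upper_def)
  let ?s = "\<lambda>y::pt. (fst y, fst (snd y), snd (snd y) + \<mu> * fst y)"
  let ?Q = "{0<..} \<times> UNIV \<times> {0<..} :: pt set"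
  have lin: "(?s has_derivative ?s) (at y)" for y
    by (auto intro!: derivative_eq_intros)
  have cs: "continuous_on S ?s" for S by (intro continuous_intros)
  have C': "C1 (\<lambda>y. \<phi> (?s y)) (\<lambda>y. \<phi>0 (?s y) + \<mu> * \<phi>2 (?s y)) (\<lambda>y. \<phi>1 (?s y)) (\<lambda>y. \<phi>2 (?s y))"
  proof (rule C1_I)
    fix y
    show "((\<lambda>y. \<phi> (?s y)) has_derivative (\<lambda>h. (\<phi>0 (?s y) + \<mu> * \<phi>2 (?s y)) * fst h + \<phi>1 (?s y) * fst (snd h) + \<phi>2 (?s y) * snd (snd h))) (at y)"
      by (rule has_derivative_compose[OF lin C1_D(1)[OF C], THEN has_derivative_eq_rhs]) (simp add: fun_eq_iff algebra_simps)
  qed (auto intro!: continuous_intros continuous_on_compose2[OF cont(2)[of UNIV] cs]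
      continuous_on_compose2[OF cont(3)[of UNIV] cs] continuous_on_compose2[OF cont(4)[of UNIV] cs])
  \<comment> \<open>Undoing the shear enlarges norms by at most this factor, which gives the support
    radius of the sheared function.\<close>
  have nb: "norm y \<le> (2 + \<bar>\<mu>\<bar>) * norm (?s y)" for y
  proof -
    have "y = ?s y - (0, 0, \<mu> * fst y)" by (simp add: prod_eq_iff)
    then have "norm y \<le> norm (?s y) + norm (0::real, 0::real, \<mu> * fst y)" by (metis norm_triangle_ineq4)
    also have "norm (0::real, 0::real, \<mu> * fst y) = \<bar>\<mu>\<bar> * \<bar>fst y\<bar>" by (simp add: norm_Pair abs_mult)
    also have "\<dots> \<le> \<bar>\<mu>\<bar> * norm (?s y)" by (intro mult_left_mono coord(1)) auto
    finally show ?thesis using norm_ge_zero[of "?s y"] unfolding distrib_right by linarith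
  qed
  interpret S: test_C1 "\<lambda>y. \<phi> (?s y)" "\<lambda>y. \<phi>0 (?s y) + \<mu> * \<phi>2 (?s y)" "\<lambda>y. \<phi>1 (?s y)" "\<lambda>y. \<phi>2 (?s y)" "(2 + \<bar>\<mu>\<bar>) * R"
  proof
    show "(2 + \<bar>\<mu>\<bar>) * R > 0" using R by (intro mult_pos_pos) auto
    fix y :: pt assume "(2 + \<bar>\<mu>\<bar>) * R \<le> norm y"
    then have "(2 + \<bar>\<mu>\<bar>) * R \<le> (2 + \<bar>\<mu>\<bar>) * norm (?s y)" using nb[of y] by linarith
    then have "R \<le> norm (?s y)" by (subst (asm) mult_le_cancel_left_pos) auto
    then show "\<phi> (?s y) = 0" by (rule out)
  qed (rule C')
  have iu: "indicator (upper \<mu>) (?s y) = (indicator ?Q y :: real)" for y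
    by (simp add: upper_def indicator_def mem_Times_iff)
  have mQ: "?Q \<in> sets borel" by (intro borel_open open_Times) auto
  have sh: "(LINT y|lborel. indicator (upper \<mu>) y * g y) = (LINT y|lborel. indicator ?Q y * g (?s y))"
    if "integrable lborel (\<lambda>y. indicator (upper \<mu>) y * g y)" "integrable lborel (\<lambda>y. indicator ?Q y * g (?s y))" for g :: "pt \<Rightarrow> real"
    using integral_shear[of "\<lambda>y. indicator (upper \<mu>) y * g y" \<mu>] that by (simp add: iu)
  have i2: "integrable lborel (\<lambda>y. indicator ?Q y * \<phi>2 (?s y))" by (rule S.integrable_ind(3)[OF mQ])
  have i02: "integrable lborel (\<lambda>y. indicator ?Q y * (\<phi>0 (?s y) + \<mu> * \<phi>2 (?s y)))" by (rule S.integrable_ind(1)[OF mQ])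
  have i0: "integrable lborel (\<lambda>y. indicator ?Q y * \<phi>0 (?s y))"
    using Bochner_Integration.integrable_diff[OF i02 integrable_mult_right[OF i2, of \<mu>]] by (simp add: algebra_simps)
  have e2: "(LINT y|lborel. indicator (upper \<mu>) y * \<phi>2 y) = (LINT y|lborel. indicator ?Q y * \<phi>2 (?s y))"
    by (rule sh[OF integrable_ind(3)[OF upper_sets] i2])
  have e0: "(LINT y|lborel. indicator (upper \<mu>) y * \<phi>0 y) = (LINT y|lborel. indicator ?Q y * \<phi>0 (?s y))"
    by (rule sh[OF integrable_ind(1)[OF upper_sets] i0])
  have "(LINT y|lborel. indicator ?Q y * (\<phi>0 (?s y) + \<mu> * \<phi>2 (?s y)))
     = (LINT y|lborel. indicator ?Q y * \<phi>0 (?s y) + \<mu> * (indicator ?Q y * \<phi>2 (?s y)))"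
    by (simp add: algebra_simps)
  also have "\<dots> = (LINT y|lborel. indicator (upper \<mu>) y * \<phi>0 y) + \<mu> * (LINT y|lborel. indicator (upper \<mu>) y * \<phi>2 y)"
    unfolding e0 e2 using i0 i2 by simp
  finally show "(LINT y|lborel. indicator (upper \<mu>) y * \<phi>0 y) =
     - \<mu> * (LINT y|lborel. indicator (upper \<mu>) y * \<phi>2 y) - (LINT x|lborel. indicator (UNIV \<times> {0<..}) x * \<phi> (0, x))"
    using S.integral_t[of "UNIV \<times> {0<..}"] by (simp add: borel_open open_Times)
  assume pos: "\<And>y. \<phi> y \<ge> 0"
  have "(LINT t|lborel. (LINT x1|lborel. indicator {0<..} t * - \<phi> (?s (t, x1, 0)))) =
     - (LINT t|lborel. (LINT x1|lborel. indicator {0<..} t * \<phi> (?s (t, x1, 0))))" by simp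
  also have "\<dots> \<le> 0"
    using pos by (simp add: Bochner_Integration.integral_nonneg)
  finally show "(LINT y|lborel. indicator (upper \<mu>) y * \<phi>2 y) \<le> 0"
    unfolding e2 S.integral_x2_halfspace(1) .
qed

end

lemma test_fun_C1:
  assumes "test_fun \<phi>"
  shows "\<exists>R. test_C1 \<phi> (pd 0 \<phi>) (pd 1 \<phi>) (pd 2 \<phi>) R"
proof -
  have sm: "smooth3 \<phi>" and cK: "compact (closure {y. \<phi> y \<noteq> 0})" using assms by (auto simp: test_fun_def)
  have d: "\<phi> differentiable (at y)" for y using sm[unfolded smooth3_def, rule_format, of "[]"] by simp
  have dp: "pd i \<phi> differentiable (at y)" for i y using sm[unfolded smooth3_def, rule_format, of "[i]"] by simp
  have c: "continuous_on UNIV (pd i \<phi>)" for i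
    using dp differentiable_imp_continuous_within by (metis continuous_at_imp_continuous_on)
  have C: "C1 \<phi> (pd 0 \<phi>) (pd 1 \<phi>) (pd 2 \<phi>)"
  proof (rule C1_I)
    fix y
    let ?D = "frechet_derivative \<phi> (at y)"
    have D: "(\<phi> has_derivative ?D) (at y)" using d by (simp add: frechet_derivative_works)
    then have l: "linear ?D" by (rule has_derivative_linear)
    have "?D h = pd 0 \<phi> y * fst h + pd 1 \<phi> y * fst (snd h) + pd 2 \<phi> y * snd (snd h)" for h
    proof -
      have "h = fst h *\<^sub>R (1,0,0) + fst (snd h) *\<^sub>R (0,1,0) + snd (snd h) *\<^sub>R (0,0,1)" by (simp add: prod_eq_iff)
      then have "?D h = ?D (fst h *\<^sub>R (1,0,0) + fst (snd h) *\<^sub>R (0,1,0) + snd (snd h) *\<^sub>R (0,0,1))" by metis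
      also have "\<dots> = fst h * ?D (1,0,0) + fst (snd h) * ?D (0,1,0) + snd (snd h) * ?D (0,0,1)"
        by (simp only: linear_add[OF l] linear_scale[OF l] real_scaleR_def)
      finally show ?thesis by (simp add: pd_def e_dir_def mult.commute)
    qed
    then show "(\<phi> has_derivative (\<lambda>h. pd 0 \<phi> y * fst h + pd 1 \<phi> y * fst (snd h) + pd 2 \<phi> y * snd (snd h))) (at y)"
      using D by presburger
  qed (rule c)+
  obtain R where R: "closure {y. \<phi> y \<noteq> 0} \<subseteq> ball 0 R" "R > 0"
    using bounded_subset_ballD[OF compact_imp_bounded[OF cK]] by blast
  have "\<phi> y = 0" if "norm y \<ge> R" for y
  proof (rule ccontr)
    assume "\<phi> y \<noteq> 0"
    then have "y \<in> ball 0 R" using R(1) closure_subset[of "{y. \<phi> y \<noteq> 0}"] by blast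
    then show False using that by simp
  qed
  then show ?thesis using C R(2) by (intro exI[of _ R]) (unfold_locales, auto)
qed

section \<open>Piecewise constant fields and their jump conditions\<close>

definition stepf :: "real \<Rightarrow> real \<Rightarrow> real \<Rightarrow> real \<Rightarrow> real \<Rightarrow> real \<Rightarrow> real \<Rightarrow> pt \<Rightarrow> real" where
  "stepf \<mu>0 \<mu>1 \<mu>2 a0 a1 a2 a3 y = (if snd (snd y) > \<mu>2 * fst y then a3
     else if snd (snd y) > \<mu>1 * fst y then a2 else if snd (snd y) > \<mu>0 * fst y then a1 else a0)"

lemma stepf_measurable [measurable]: "stepf \<mu>0 \<mu>1 \<mu>2 a0 a1 a2 a3 \<in> borel_measurable borel"
proof -
  have "{y::pt. \<mu> * fst y < snd (snd y)} \<in> sets borel" for \<mu>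
    by (intro borel_open open_Collect_less continuous_intros)
  then have [measurable]: "Measurable.pred borel (\<lambda>y::pt. \<mu> * fst y < snd (snd y))" for \<mu>
    by (simp add: pred_def)
  show ?thesis unfolding stepf_def [abs_def] by measurable
qed

text \<open>Each jump is attached to the whole region above its interface, so the weak form splits
  into one term per interface.\<close>

lemma stepf_sum:
  assumes "y \<in> Hplus" "\<mu>0 < \<mu>1" "\<mu>1 < \<mu>2"
  shows "stepf \<mu>0 \<mu>1 \<mu>2 a0 a1 a2 a3 y = a0 + (a1 - a0) * indicator (upper \<mu>0) y
     + (a2 - a1) * indicator (upper \<mu>1) y + (a3 - a2) * indicator (upper \<mu>2) y"
proof -
  have t: "fst y > 0" using assms(1) by (simp add: Hplus_def)
  have o: "\<mu>0 * fst y < \<mu>1 * fst y" "\<mu>1 * fst y < \<mu>2 * fst y"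
    using assms(2,3) t by (auto intro: mult_strict_right_mono)
  have "(if s > p2 then a3 else if s > p1 then a2 else if s > p0 then a1 else a0) = a0 + (a1 - a0) * of_bool (s > p0)
     + (a2 - a1) * of_bool (s > p1) + (a3 - a2) * of_bool (s > p2)" if "p0 < p1" "p1 < p2" for s p0 p1 p2 :: real
    using that by auto
  from this[OF o, of "snd (snd y)"] show ?thesis using t by (simp add: stepf_def upper_def indicator_def)
qed

lemma Hplus_eq: "Hplus = {0<..} \<times> UNIV" by (auto simp: Hplus_def)

lemma Hplus_sets [measurable]: "Hplus \<in> sets borel"
  unfolding Hplus_def by (intro borel_open open_Collect_less continuous_intros)

context test_C1 begin

abbreviation "T \<mu> \<equiv> (LINT y|lborel. indicator (upper \<mu>) y * \<phi>2 y)"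

lemma initial_integrable:
  assumes "A \<in> sets borel"
  shows "integrable lborel (\<lambda>x. indicator A x * \<phi> (0, x))"
  by (rule integrable_section[OF cont(1) out_cball(1) assms])

lemma riem_initial:
  "integrable lborel (\<lambda>x. riem a b x * \<phi> (0, x))"
  "(LINT x|lborel. riem a b x * \<phi> (0, x)) = a * (LINT x|lborel. indicator UNIV x * \<phi> (0, x))
     + (b - a) * (LINT x|lborel. indicator (UNIV \<times> {0<..}) x * \<phi> (0, x))"
proof -
  have mU: "(UNIV \<times> {0<..} :: (real \<times> real) set) \<in> sets borel" by (auto intro!: borel_open open_Times)
  note I = initial_integrable[OF mU] initial_integrable[of UNIV]
  \<comment> \<open>The Riemann data and their expression by indicators may differ on the line x2 =
    0, a null set.\<close>
  have "negligible {x::real\<times>real. (0,1) \<bullet> x = 0}" by (rule negligible_hyperplane) (auto simp: zero_prod_def)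
  then have "AE x in lebesgue. x \<notin> {x::real\<times>real. (0,1) \<bullet> x = 0}"
    by (intro AE_not_in) (simp add: negligible_iff_null_sets)
  moreover have mS: "{x::real\<times>real. (0,1) \<bullet> x = 0} \<in> sets borel"
    by (intro borel_closed closed_Collect_eq continuous_intros)
  ultimately have "AE x in lborel. x \<notin> {x::real\<times>real. (0,1) \<bullet> x = 0}"
    by (subst (asm) AE_completion_iff) auto
  then have e: "AE x in lborel. riem a b x * \<phi> (0, x) = a * (indicator UNIV x * \<phi> (0, x)) + (b - a) * (indicator (UNIV \<times> {0<..}) x * \<phi> (0, x))"
    by eventually_elim (auto simp: riem_def indicator_def algebra_simps)
  have mp: "{x::real\<times>real. snd x < 0} \<in> sets borel"
    by (intro borel_open open_Collect_less continuous_intros)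
  have mr: "riem a b \<in> borel_measurable borel"
    unfolding riem_def [abs_def] using mp by (intro measurable_If) (auto simp: pred_def)
  have m\<phi>: "(\<lambda>x. \<phi> (0, x)) \<in> borel_measurable borel"
    by (intro borel_measurable_continuous_onI continuous_on_compose2[OF cont(1)[of UNIV]] continuous_intros) auto
  have m: "(\<lambda>x. riem a b x * \<phi> (0, x)) \<in> borel_measurable lborel" using mr m\<phi> by simp
  have i: "integrable lborel (\<lambda>x. a * (indicator UNIV x * \<phi> (0, x)) + (b - a) * (indicator (UNIV \<times> {0<..}) x * \<phi> (0, x)))"
    using I by auto
  show "integrable lborel (\<lambda>x. riem a b x * \<phi> (0, x))"
    using integrable_cong_AE[OF m _ e] i by blast
  have "(LINT x|lborel. riem a b x * \<phi> (0, x)) = (LINT x|lborel. a * (indicator UNIV x * \<phi> (0, x)) + (b - a) * (indicator (UNIV \<times> {0<..}) x * \<phi> (0, x)))"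
    using i by (intro integral_cong_AE m e) auto
  also have "\<dots> = a * (LINT x|lborel. indicator UNIV x * \<phi> (0, x))
     + (b - a) * (LINT x|lborel. indicator (UNIV \<times> {0<..}) x * \<phi> (0, x))"
    using I by (subst Bochner_Integration.integral_add) auto
  finally show "(LINT x|lborel. riem a b x * \<phi> (0, x)) = a * (LINT x|lborel. indicator UNIV x * \<phi> (0, x))
     + (b - a) * (LINT x|lborel. indicator (UNIV \<times> {0<..}) x * \<phi> (0, x))" .
qed

lemma step_integral:
  assumes g: "g = \<phi>0 \<or> g = \<phi>1 \<or> g = \<phi>2" and \<mu>: "\<mu>0 < \<mu>1" "\<mu>1 < \<mu>2"
  shows "integrable lborel (\<lambda>y. indicator Hplus y * (stepf \<mu>0 \<mu>1 \<mu>2 a0 a1 a2 a3 y * g y))"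
    "(LINT y|lborel. indicator Hplus y * (stepf \<mu>0 \<mu>1 \<mu>2 a0 a1 a2 a3 y * g y)) =
      a0 * (LINT y|lborel. indicator Hplus y * g y) + (a1 - a0) * (LINT y|lborel. indicator (upper \<mu>0) y * g y)
       + (a2 - a1) * (LINT y|lborel. indicator (upper \<mu>1) y * g y) + (a3 - a2) * (LINT y|lborel. indicator (upper \<mu>2) y * g y)"
proof -
  have I: "integrable lborel (\<lambda>y. indicator A y * g y)" if "A \<in> sets borel" for A
    using integrable_ind[OF that] g by auto
  note Is = I[OF Hplus_sets] I[OF upper_sets]
  have e: "indicator Hplus y * (stepf \<mu>0 \<mu>1 \<mu>2 a0 a1 a2 a3 y * g y) =
      a0 * (indicator Hplus y * g y) + (a1 - a0) * (indicator (upper \<mu>0) y * g y)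
       + (a2 - a1) * (indicator (upper \<mu>1) y * g y) + (a3 - a2) * (indicator (upper \<mu>2) y * g y)" for y
  proof (cases "y \<in> Hplus")
    case True
    then show ?thesis unfolding stepf_sum[OF True \<mu>] by (simp add: algebra_simps)
  next
    case False
    then show ?thesis by (simp add: upper_def Hplus_def)
  qed
  show "integrable lborel (\<lambda>y. indicator Hplus y * (stepf \<mu>0 \<mu>1 \<mu>2 a0 a1 a2 a3 y * g y))"
    unfolding e using Is by auto
  show "(LINT y|lborel. indicator Hplus y * (stepf \<mu>0 \<mu>1 \<mu>2 a0 a1 a2 a3 y * g y)) =
      a0 * (LINT y|lborel. indicator Hplus y * g y) + (a1 - a0) * (LINT y|lborel. indicator (upper \<mu>0) y * g y)
       + (a2 - a1) * (LINT y|lborel. indicator (upper \<mu>1) y * g y) + (a3 - a2) * (LINT y|lborel. indicator (upper \<mu>2) y * g y)"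
    unfolding e using Is by simp
qed

text \<open>The time derivative integrated over the region above a line produces the speed times the
  \<phi>2-integral and an initial term; the latter cancels against the data. What remains on each
  interface is its Rankine-Hugoniot defect times an integral of known sign.\<close>

lemma fan_value:
  fixes a0 a1 a2 a3 b0 b1 b2 b3 f0 f1 f2 f3 :: real
  assumes \<mu>: "\<mu>0 < \<mu>1" "\<mu>1 < \<mu>2"
  defines "I \<equiv> \<lambda>y. indicator Hplus y * (stepf \<mu>0 \<mu>1 \<mu>2 a0 a1 a2 a3 y * \<phi>0 y)
      + indicator Hplus y * (stepf \<mu>0 \<mu>1 \<mu>2 b0 b1 b2 b3 y * \<phi>1 y) + indicator Hplus y * (stepf \<mu>0 \<mu>1 \<mu>2 f0 f1 f2 f3 y * \<phi>2 y)"
  shows "integrable lborel I"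
    "(LINT y|lborel. I y) + (LINT x|lborel. riem a0 a3 x * \<phi> (0, x)) =
      ((f1 - f0) - \<mu>0 * (a1 - a0)) * T \<mu>0 + ((f2 - f1) - \<mu>1 * (a2 - a1)) * T \<mu>1 + ((f3 - f2) - \<mu>2 * (a3 - a2)) * T \<mu>2"
proof -
  note S0 = step_integral[of \<phi>0, simplified, OF \<mu>] and S1 = step_integral[of \<phi>1, simplified, OF \<mu>]
    and S2 = step_integral[of \<phi>2, simplified, OF \<mu>]
  show "integrable lborel I" unfolding I_def using S0(1) S1(1) S2(1) by auto
  have h: "(LINT y|lborel. indicator Hplus y * \<phi>0 y) = - (LINT x|lborel. indicator UNIV x * \<phi> (0, x))"
    "(LINT y|lborel. indicator Hplus y * \<phi>2 y) = 0" "(LINT y|lborel. indicator Hplus y * \<phi>1 y) = 0"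
  proof -
    show "(LINT y|lborel. indicator Hplus y * \<phi>0 y) = - (LINT x|lborel. indicator UNIV x * \<phi> (0, x))"
      unfolding Hplus_eq by (rule integral_t) simp
    show "(LINT y|lborel. indicator Hplus y * \<phi>2 y) = 0"
      unfolding Hplus_eq by (rule integral_x2_halfspace(2))
    have "({0<..} \<times> UNIV :: (real \<times> real) set) \<in> sets borel" by (auto intro!: borel_open open_Times)
    from integral_x1[OF this] show "(LINT y|lborel. indicator Hplus y * \<phi>1 y) = 0"
      by (simp add: Hplus_def)
  qed
  have "(LINT y|lborel. I y) = (LINT y|lborel. indicator Hplus y * (stepf \<mu>0 \<mu>1 \<mu>2 a0 a1 a2 a3 y * \<phi>0 y))
     + (LINT y|lborel. indicator Hplus y * (stepf \<mu>0 \<mu>1 \<mu>2 b0 b1 b2 b3 y * \<phi>1 y))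
     + (LINT y|lborel. indicator Hplus y * (stepf \<mu>0 \<mu>1 \<mu>2 f0 f1 f2 f3 y * \<phi>2 y))"
    unfolding I_def using S0(1) S1(1) S2(1) by simp
  also have "\<dots> = (a0 * - (LINT x|lborel. indicator UNIV x * \<phi> (0, x))
      + (a1 - a0) * (- \<mu>0 * T \<mu>0 - (LINT x|lborel. indicator (UNIV \<times> {0<..}) x * \<phi> (0, x)))
      + (a2 - a1) * (- \<mu>1 * T \<mu>1 - (LINT x|lborel. indicator (UNIV \<times> {0<..}) x * \<phi> (0, x)))
      + (a3 - a2) * (- \<mu>2 * T \<mu>2 - (LINT x|lborel. indicator (UNIV \<times> {0<..}) x * \<phi> (0, x))))
      + 0 + ((f1 - f0) * T \<mu>0 + (f2 - f1) * T \<mu>1 + (f3 - f2) * T \<mu>2)"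
    unfolding S0(2) S1(2) S2(2) h upper_integrals(1,2) by simp
  finally show "(LINT y|lborel. I y) + (LINT x|lborel. riem a0 a3 x * \<phi> (0, x)) =
      ((f1 - f0) - \<mu>0 * (a1 - a0)) * T \<mu>0 + ((f2 - f1) - \<mu>1 * (a2 - a1)) * T \<mu>1 + ((f3 - f2) - \<mu>2 * (a3 - a2)) * T \<mu>2"
    unfolding riem_initial(2) by (simp add: algebra_simps)
qed

end

text \<open>Density and fluxes are split into a piecewise constant part and fluctuations
  \<open>g0\<close>, \<open>g1\<close>, \<open>g2\<close> which, as a solution of the linear system,
  drop out of the weak form. All five balance laws are instances.\<close>

lemma wf_combine:
  assumes tf: "test_C1 \<phi> (pd 0 \<phi>) (pd 1 \<phi>) (pd 2 \<phi>) R" and \<mu>: "\<mu>0 < \<mu>1" "\<mu>1 < \<mu>2"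
    and m: "\<eta> \<in> borel_measurable borel" "F1 \<in> borel_measurable borel" "F2 \<in> borel_measurable borel"
    and ae: "AE y in lborel. y \<in> Hplus \<longrightarrow> \<eta> y = stepf \<mu>0 \<mu>1 \<mu>2 a0 a1 a2 a3 y + g0 y \<and>
       F1 y = stepf \<mu>0 \<mu>1 \<mu>2 b0 b1 b2 b3 y + g1 y \<and> F2 y = stepf \<mu>0 \<mu>1 \<mu>2 f0 f1 f2 f3 y + g2 y"
    and g: "\<And>y. y \<notin> Hplus \<Longrightarrow> g0 y = 0 \<and> g1 y = 0 \<and> g2 y = 0"
    and ig: "integrable lborel (\<lambda>y. g0 y * pd 0 \<phi> y + g1 y * pd 1 \<phi> y + g2 y * pd 2 \<phi> y)"
    and g0: "(LINT y|lborel. g0 y * pd 0 \<phi> y + g1 y * pd 1 \<phi> y + g2 y * pd 2 \<phi> y) = 0"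
    and ini: "\<And>x. \<eta>0 x = riem a0 a3 x"
  shows "wf_integrable \<eta> F1 F2 \<eta>0 \<phi>"
    "wf_value \<eta> F1 F2 \<eta>0 \<phi> = ((f1 - f0) - \<mu>0 * (a1 - a0)) * (LINT y|lborel. indicator (upper \<mu>0) y * pd 2 \<phi> y)
      + ((f2 - f1) - \<mu>1 * (a2 - a1)) * (LINT y|lborel. indicator (upper \<mu>1) y * pd 2 \<phi> y)
      + ((f3 - f2) - \<mu>2 * (a3 - a2)) * (LINT y|lborel. indicator (upper \<mu>2) y * pd 2 \<phi> y)"
proof -
  interpret test_C1 \<phi> "pd 0 \<phi>" "pd 1 \<phi>" "pd 2 \<phi>" R by (rule tf)
  define J where "J y = indicator Hplus y * (stepf \<mu>0 \<mu>1 \<mu>2 a0 a1 a2 a3 y * pd 0 \<phi> y)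
      + indicator Hplus y * (stepf \<mu>0 \<mu>1 \<mu>2 b0 b1 b2 b3 y * pd 1 \<phi> y) + indicator Hplus y * (stepf \<mu>0 \<mu>1 \<mu>2 f0 f1 f2 f3 y * pd 2 \<phi> y)" for y
  define G where "G y = g0 y * pd 0 \<phi> y + g1 y * pd 1 \<phi> y + g2 y * pd 2 \<phi> y" for y
  note FV = fan_value[OF \<mu>, where ?a0.0 = a0 and ?a1.0 = a1 and ?a2.0 = a2 and ?a3.0 = a3 and ?b0.0 = b0 and ?b1.0 = b1 and ?b2.0 = b2 and ?b3.0 = b3
    and ?f0.0 = f0 and ?f1.0 = f1 and ?f2.0 = f2 and ?f3.0 = f3, folded J_def [abs_def]]
  have ae': "AE y in lborel. indicator Hplus y *\<^sub>R wf_int \<eta> F1 F2 \<phi> y = J y + G y"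
    using ae
  proof eventually_elim
    case (elim y)
    show ?case
    proof (cases "y \<in> Hplus")
      case True
      then show ?thesis using elim by (simp add: wf_int_def J_def G_def algebra_simps)
    qed (use g in \<open>simp add: J_def G_def\<close>)
  qed
  have mp: "pd i \<phi> \<in> borel_measurable borel" if "i = 0 \<or> i = 1 \<or> i = 2" for i
    using that cont(2-4)[of UNIV] by (auto intro!: borel_measurable_continuous_onI)
  have mI: "(\<lambda>y. indicator Hplus y *\<^sub>R wf_int \<eta> F1 F2 \<phi> y) \<in> borel_measurable lborel"
    unfolding wf_int_def using m mp[of 0] mp[of 1] mp[of 2] by simp
  have iJ: "integrable lborel (\<lambda>y. J y + G y)" using FV(1) ig by (simp add: G_def)
  have s1: "set_integrable lborel Hplus (wf_int \<eta> F1 F2 \<phi>)"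
    unfolding set_integrable_def using integrable_cong_AE[OF mI _ ae'] iJ by blast
  have ini': "wf_init \<eta>0 \<phi> = (\<lambda>x. riem a0 a3 x * \<phi> (0, x))"
    by (auto simp: wf_init_def ini fun_eq_iff)
  show "wf_integrable \<eta> F1 F2 \<eta>0 \<phi>"
    unfolding wf_integrable_def ini' using s1 riem_initial(1) by blast
  have "(LINT y:Hplus|lborel. wf_int \<eta> F1 F2 \<phi> y) = (LINT y|lborel. J y + G y)"
    unfolding set_lebesgue_integral_def using iJ by (intro integral_cong_AE mI ae') auto
  also have "\<dots> = (LINT y|lborel. J y)" using FV(1) ig g0 by (simp add: G_def)
  finally show "wf_value \<eta> F1 F2 \<eta>0 \<phi> = ((f1 - f0) - \<mu>0 * (a1 - a0)) * T \<mu>0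
      + ((f2 - f1) - \<mu>1 * (a2 - a1)) * T \<mu>1 + ((f3 - f2) - \<mu>2 * (a3 - a2)) * T \<mu>2"
    unfolding wf_value_def ini' using FV(2) by simp
qed

text \<open>The outcome of convex integration without the closeness clause. The constraints are
  demanded at every point of the region because the definition of a 2-fan fixes |v|^2
  pointwise.\<close>

definition wild :: "pt set \<Rightarrow> st \<Rightarrow> real \<Rightarrow> (pt \<Rightarrow> st) \<Rightarrow> bool" where
  "wild \<Omega> zc C w \<longleftrightarrow> w \<in> borel_measurable borel \<and> (\<forall>y. y \<notin> \<Omega> \<longrightarrow> w y = 0) \<and>
     (\<forall>y\<in>\<Omega>. vsq (zc + w y) = C \<and> M1 (zc + w y) = (V1 (zc + w y))\<^sup>2 - C / 2 \<and> M2 (zc + w y) = V1 (zc + w y) * V2 (zc + w y)) \<and>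
     (\<forall>\<psi> \<psi>0 \<psi>1 \<psi>2 K. C1 \<psi> \<psi>0 \<psi>1 \<psi>2 \<longrightarrow> compact K \<longrightarrow> (\<forall>y. y \<notin> K \<longrightarrow> \<psi>0 y = 0 \<and> \<psi>1 y = 0 \<and> \<psi>2 y = 0) \<longrightarrow> weak_eqs w \<psi>0 \<psi>1 \<psi>2)"

lemma wild_D:
  assumes "wild \<Omega> zc C w"
  shows "w \<in> borel_measurable borel" "y \<notin> \<Omega> \<Longrightarrow> w y = 0"
    "y \<in> \<Omega> \<Longrightarrow> (V1 (zc + w y))\<^sup>2 + (V2 (zc + w y))\<^sup>2 = C"
    "y \<in> \<Omega> \<Longrightarrow> M1 (zc + w y) = (V1 (zc + w y))\<^sup>2 - C / 2"
    "y \<in> \<Omega> \<Longrightarrow> M2 (zc + w y) = V1 (zc + w y) * V2 (zc + w y)"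
    "C1 \<psi> \<psi>0 \<psi>1 \<psi>2 \<Longrightarrow> compact K \<Longrightarrow> (\<And>y. y \<notin> K \<Longrightarrow> \<psi>0 y = 0 \<and> \<psi>1 y = 0 \<and> \<psi>2 y = 0) \<Longrightarrow> weak_eqs w \<psi>0 \<psi>1 \<psi>2"
proof -
  note d1 = assms[unfolded wild_def, THEN conjunct1] and d2 = assms[unfolded wild_def, THEN conjunct2, THEN conjunct1]
    and d3 = assms[unfolded wild_def, THEN conjunct2, THEN conjunct2, THEN conjunct1]
    and d4 = assms[unfolded wild_def, THEN conjunct2, THEN conjunct2, THEN conjunct2]
  show "w \<in> borel_measurable borel" by (rule d1)
  show "y \<notin> \<Omega> \<Longrightarrow> w y = 0" using d2 by blast
  show "y \<in> \<Omega> \<Longrightarrow> (V1 (zc + w y))\<^sup>2 + (V2 (zc + w y))\<^sup>2 = C" using d3 unfolding vsq_def by blast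
  show "y \<in> \<Omega> \<Longrightarrow> M1 (zc + w y) = (V1 (zc + w y))\<^sup>2 - C / 2" "y \<in> \<Omega> \<Longrightarrow> M2 (zc + w y) = V1 (zc + w y) * V2 (zc + w y)"
    using d3 by blast+
  show "weak_eqs w \<psi>0 \<psi>1 \<psi>2" if "C1 \<psi> \<psi>0 \<psi>1 \<psi>2" "compact K" "\<And>y. y \<notin> K \<Longrightarrow> \<psi>0 y = 0 \<and> \<psi>1 y = 0 \<and> \<psi>2 y = 0"
    using d4[rule_format, OF that(1,2)] that(3) by blast
qed

lemma wild_bound:
  assumes w: "wild \<Omega> zc C w"
  shows "\<exists>B. \<forall>y. \<bar>V1 (w y)\<bar> \<le> B \<and> \<bar>V2 (w y)\<bar> \<le> B \<and> \<bar>M1 (w y)\<bar> \<le> B \<and> \<bar>M2 (w y)\<bar> \<le> B"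
proof (intro exI allI)
  fix y
  let ?B = "3 * \<bar>C\<bar> + 1 + \<bar>V1 zc\<bar> + \<bar>V2 zc\<bar> + \<bar>M1 zc\<bar> + \<bar>M2 zc\<bar>"
  show "\<bar>V1 (w y)\<bar> \<le> ?B \<and> \<bar>V2 (w y)\<bar> \<le> ?B \<and> \<bar>M1 (w y)\<bar> \<le> ?B \<and> \<bar>M2 (w y)\<bar> \<le> ?B"
  proof (cases "y \<in> \<Omega>")
    case False then show ?thesis using wild_D(2)[OF w] by simp
  next
    case True
    define a b where "a = V1 (zc + w y)" and "b = V2 (zc + w y)"
    have ab: "a\<^sup>2 + b\<^sup>2 = C" "M1 (zc + w y) = a\<^sup>2 - C / 2" "M2 (zc + w y) = a * b"
      using wild_D(3-5)[OF w True] by (simp_all add: a_def b_def)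
    have sq: "a\<^sup>2 \<ge> 0" "b\<^sup>2 \<ge> 0" "(\<bar>a\<bar> - 1)\<^sup>2 \<ge> 0" "(\<bar>b\<bar> - 1)\<^sup>2 \<ge> 0" "(a - b)\<^sup>2 \<ge> 0" "(a + b)\<^sup>2 \<ge> 0" by simp_all
    then have "2 * \<bar>a\<bar> \<le> 1 + a\<^sup>2" "2 * \<bar>b\<bar> \<le> 1 + b\<^sup>2" "2 * \<bar>a * b\<bar> \<le> a\<^sup>2 + b\<^sup>2"
      by (simp_all add: power2_diff power2_sum abs_le_iff)
    then have c: "\<bar>a\<bar> \<le> 1 + C" "\<bar>b\<bar> \<le> 1 + C" "\<bar>a * b\<bar> \<le> C" "\<bar>a\<^sup>2 - C / 2\<bar> \<le> C" "C \<ge> 0" using ab sq by linarith+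
    have e: "V1 (w y) = a - V1 zc" "V2 (w y) = b - V2 zc" "M1 (w y) = a\<^sup>2 - C / 2 - M1 zc" "M2 (w y) = a * b - M2 zc"
      using ab by (auto simp: a_def b_def)
    show ?thesis unfolding e using c by (auto simp: abs_le_iff)
  qed
qed

lemma wild_test:
  assumes w: "wild \<Omega> zc C w" and tf: "test_C1 \<phi> (pd 0 \<phi>) (pd 1 \<phi>) (pd 2 \<phi>) R"
  shows "weak_eqs w (pd 0 \<phi>) (pd 1 \<phi>) (pd 2 \<phi>)"
    "i \<in> {0,1,2} \<Longrightarrow> integrable lborel (\<lambda>y. V1 (w y) * pd i \<phi> y)" "i \<in> {0,1,2} \<Longrightarrow> integrable lborel (\<lambda>y. V2 (w y) * pd i \<phi> y)"
    "i \<in> {0,1,2} \<Longrightarrow> integrable lborel (\<lambda>y. M1 (w y) * pd i \<phi> y)" "i \<in> {0,1,2} \<Longrightarrow> integrable lborel (\<lambda>y. M2 (w y) * pd i \<phi> y)"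
proof -
  interpret test_C1 \<phi> "pd 0 \<phi>" "pd 1 \<phi>" "pd 2 \<phi>" R by (rule tf)
  show "weak_eqs w (pd 0 \<phi>) (pd 1 \<phi>) (pd 2 \<phi>)"
    by (rule wild_D(6)[OF w C compact_cball[of 0 R]]) (use out_cball in blast)
  obtain B where B: "\<And>y. \<bar>V1 (w y)\<bar> \<le> B" "\<And>y. \<bar>V2 (w y)\<bar> \<le> B" "\<And>y. \<bar>M1 (w y)\<bar> \<le> B" "\<And>y. \<bar>M2 (w y)\<bar> \<le> B"
    using wild_bound[OF w] by blast
  have mw: "w \<in> borel \<rightarrow>\<^sub>M borel \<Otimes>\<^sub>M (borel \<Otimes>\<^sub>M (borel \<Otimes>\<^sub>M borel))" using wild_D(1)[OF w] by (simp add: borel_prod)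
  have m: "(\<lambda>y. V1 (w y)) \<in> borel_measurable borel" "(\<lambda>y. V2 (w y)) \<in> borel_measurable borel"
    "(\<lambda>y. M1 (w y)) \<in> borel_measurable borel" "(\<lambda>y. M2 (w y)) \<in> borel_measurable borel"
    using mw by measurable
  have g: "continuous_on UNIV (pd i \<phi>)" "\<And>y. y \<notin> cball 0 R \<Longrightarrow> pd i \<phi> y = 0" if "i \<in> {0,1,2}" for i
    using that cont(2-4)[of UNIV] out_cball(2-4) by auto
  \<comment> \<open>A constant sequence: the convergence lemma is used here for its integrability
    part.\<close>
  have L: "AE y in lborel. (\<lambda>k. f y) \<longlonglongrightarrow> f y" for f :: "pt \<Rightarrow> real" by simp
  show "integrable lborel (\<lambda>y. V1 (w y) * pd i \<phi> y)" "integrable lborel (\<lambda>y. V2 (w y) * pd i \<phi> y)"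
    "integrable lborel (\<lambda>y. M1 (w y) * pd i \<phi> y)" "integrable lborel (\<lambda>y. M2 (w y) * pd i \<phi> y)" if i: "i \<in> {0,1,2}"
    using tendsto_integral_mult_cc(2)[OF m(1) m(1) L B(1) g(1)[OF i] compact_cball[of 0 R] g(2)[OF i]]
      tendsto_integral_mult_cc(2)[OF m(2) m(2) L B(2) g(1)[OF i] compact_cball[of 0 R] g(2)[OF i]]
      tendsto_integral_mult_cc(2)[OF m(3) m(3) L B(3) g(1)[OF i] compact_cball[of 0 R] g(2)[OF i]]
      tendsto_integral_mult_cc(2)[OF m(4) m(4) L B(4) g(1)[OF i] compact_cball[of 0 R] g(2)[OF i]] by auto
qed

lemma wild_measurable:
  assumes w: "wild \<Omega> zc C w"
  shows "(\<lambda>y. V1 (w y)) \<in> borel_measurable borel" "(\<lambda>y. V2 (w y)) \<in> borel_measurable borel"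
proof -
  have mw: "w \<in> borel \<rightarrow>\<^sub>M borel \<Otimes>\<^sub>M (borel \<Otimes>\<^sub>M (borel \<Otimes>\<^sub>M borel))" using wild_D(1)[OF w] by (simp add: borel_prod)
  show "(\<lambda>y. V1 (w y)) \<in> borel_measurable borel" "(\<lambda>y. V2 (w y)) \<in> borel_measurable borel"
    using mw by measurable
qed

text \<open>In each balance law the fluctuation is multiplied by one constant per region (density,
  enthalpy, or entropy density), so linear combinations of the two wild fields suffice. The first
  pair of claims serves mass, energy and entropy, the other two the components of momentum.\<close>

lemma wild_flux:
  assumes w: "wild \<Omega> zc C w" and w': "wild \<Omega>' zc' C' w'" and tf: "test_C1 \<phi> (pd 0 \<phi>) (pd 1 \<phi>) (pd 2 \<phi>) R"
  shows
   "integrable lborel (\<lambda>y. 0 * pd 0 \<phi> y + (k * V1 (w y) + k' * V1 (w' y)) * pd 1 \<phi> y + (k * V2 (w y) + k' * V2 (w' y)) * pd 2 \<phi> y)" (is ?A)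
   "(LINT y|lborel. 0 * pd 0 \<phi> y + (k * V1 (w y) + k' * V1 (w' y)) * pd 1 \<phi> y + (k * V2 (w y) + k' * V2 (w' y)) * pd 2 \<phi> y) = 0" (is ?Az)
   "integrable lborel (\<lambda>y. (k * V1 (w y) + k' * V1 (w' y)) * pd 0 \<phi> y + (k * M1 (w y) + k' * M1 (w' y)) * pd 1 \<phi> y + (k * M2 (w y) + k' * M2 (w' y)) * pd 2 \<phi> y)" (is ?B)
   "(LINT y|lborel. (k * V1 (w y) + k' * V1 (w' y)) * pd 0 \<phi> y + (k * M1 (w y) + k' * M1 (w' y)) * pd 1 \<phi> y + (k * M2 (w y) + k' * M2 (w' y)) * pd 2 \<phi> y) = 0" (is ?Bz)
   "integrable lborel (\<lambda>y. (k * V2 (w y) + k' * V2 (w' y)) * pd 0 \<phi> y + (k * M2 (w y) + k' * M2 (w' y)) * pd 1 \<phi> y + - (k * M1 (w y) + k' * M1 (w' y)) * pd 2 \<phi> y)" (is ?C)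
   "(LINT y|lborel. (k * V2 (w y) + k' * V2 (w' y)) * pd 0 \<phi> y + (k * M2 (w y) + k' * M2 (w' y)) * pd 1 \<phi> y + - (k * M1 (w y) + k' * M1 (w' y)) * pd 2 \<phi> y) = 0" (is ?Cz)
proof -
  note W = wild_test(1)[OF w tf, unfolded weak_eqs_def] wild_test(1)[OF w' tf, unfolded weak_eqs_def]
  have I: "integrable lborel (\<lambda>y. V1 (w y) * pd i \<phi> y)" "integrable lborel (\<lambda>y. V2 (w y) * pd i \<phi> y)"
    "integrable lborel (\<lambda>y. M1 (w y) * pd i \<phi> y)" "integrable lborel (\<lambda>y. M2 (w y) * pd i \<phi> y)"
    "integrable lborel (\<lambda>y. V1 (w' y) * pd i \<phi> y)" "integrable lborel (\<lambda>y. V2 (w' y) * pd i \<phi> y)"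
    "integrable lborel (\<lambda>y. M1 (w' y) * pd i \<phi> y)" "integrable lborel (\<lambda>y. M2 (w' y) * pd i \<phi> y)"
    if "i \<in> {0,1,2}" for i
    using wild_test(2-5)[OF w tf that] wild_test(2-5)[OF w' tf that] by auto
  note J = I[of 0, simplified] I[of 1, simplified] I[of 2, simplified]
  have a: "0 * pd 0 \<phi> y + (k * V1 (w y) + k' * V1 (w' y)) * pd 1 \<phi> y + (k * V2 (w y) + k' * V2 (w' y)) * pd 2 \<phi> y
    = k * (V1 (w y) * pd 1 \<phi> y + V2 (w y) * pd 2 \<phi> y) + k' * (V1 (w' y) * pd 1 \<phi> y + V2 (w' y) * pd 2 \<phi> y)" for y
    by (simp add: algebra_simps)
  have b: "(k * V1 (w y) + k' * V1 (w' y)) * pd 0 \<phi> y + (k * M1 (w y) + k' * M1 (w' y)) * pd 1 \<phi> y + (k * M2 (w y) + k' * M2 (w' y)) * pd 2 \<phi> y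
    = k * (V1 (w y) * pd 0 \<phi> y + M1 (w y) * pd 1 \<phi> y + M2 (w y) * pd 2 \<phi> y) + k' * (V1 (w' y) * pd 0 \<phi> y + M1 (w' y) * pd 1 \<phi> y + M2 (w' y) * pd 2 \<phi> y)" for y
    by (simp add: algebra_simps)
  have c: "(k * V2 (w y) + k' * V2 (w' y)) * pd 0 \<phi> y + (k * M2 (w y) + k' * M2 (w' y)) * pd 1 \<phi> y + - (k * M1 (w y) + k' * M1 (w' y)) * pd 2 \<phi> y
    = k * (V2 (w y) * pd 0 \<phi> y + M2 (w y) * pd 1 \<phi> y - M1 (w y) * pd 2 \<phi> y) + k' * (V2 (w' y) * pd 0 \<phi> y + M2 (w' y) * pd 1 \<phi> y - M1 (w' y) * pd 2 \<phi> y)" for y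
    by (simp add: algebra_simps)
  have ia: "integrable lborel (\<lambda>y. V1 (w y) * pd 1 \<phi> y + V2 (w y) * pd 2 \<phi> y)" "integrable lborel (\<lambda>y. V1 (w' y) * pd 1 \<phi> y + V2 (w' y) * pd 2 \<phi> y)"
    using J by auto
  have aa: "integrable lborel (\<lambda>y. k * (V1 (w y) * pd 1 \<phi> y + V2 (w y) * pd 2 \<phi> y) + k' * (V1 (w' y) * pd 1 \<phi> y + V2 (w' y) * pd 2 \<phi> y))"
    "(LINT y|lborel. k * (V1 (w y) * pd 1 \<phi> y + V2 (w y) * pd 2 \<phi> y) + k' * (V1 (w' y) * pd 1 \<phi> y + V2 (w' y) * pd 2 \<phi> y)) = 0"
    using ia W by (auto simp: Bochner_Integration.integral_add[OF integrable_mult_right[OF ia(1)] integrable_mult_right[OF ia(2)]])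
  have ib: "integrable lborel (\<lambda>y. V1 (w y) * pd 0 \<phi> y + M1 (w y) * pd 1 \<phi> y + M2 (w y) * pd 2 \<phi> y)"
    "integrable lborel (\<lambda>y. V1 (w' y) * pd 0 \<phi> y + M1 (w' y) * pd 1 \<phi> y + M2 (w' y) * pd 2 \<phi> y)"
    using J by auto
  have bb: "integrable lborel (\<lambda>y. k * (V1 (w y) * pd 0 \<phi> y + M1 (w y) * pd 1 \<phi> y + M2 (w y) * pd 2 \<phi> y) + k' * (V1 (w' y) * pd 0 \<phi> y + M1 (w' y) * pd 1 \<phi> y + M2 (w' y) * pd 2 \<phi> y))"
    "(LINT y|lborel. k * (V1 (w y) * pd 0 \<phi> y + M1 (w y) * pd 1 \<phi> y + M2 (w y) * pd 2 \<phi> y) + k' * (V1 (w' y) * pd 0 \<phi> y + M1 (w' y) * pd 1 \<phi> y + M2 (w' y) * pd 2 \<phi> y)) = 0"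
    using ib W by (auto simp: Bochner_Integration.integral_add[OF integrable_mult_right[OF ib(1)] integrable_mult_right[OF ib(2)]])
  have ic: "integrable lborel (\<lambda>y. V2 (w y) * pd 0 \<phi> y + M2 (w y) * pd 1 \<phi> y - M1 (w y) * pd 2 \<phi> y)"
    "integrable lborel (\<lambda>y. V2 (w' y) * pd 0 \<phi> y + M2 (w' y) * pd 1 \<phi> y - M1 (w' y) * pd 2 \<phi> y)"
    using J by auto
  have cc: "integrable lborel (\<lambda>y. k * (V2 (w y) * pd 0 \<phi> y + M2 (w y) * pd 1 \<phi> y - M1 (w y) * pd 2 \<phi> y) + k' * (V2 (w' y) * pd 0 \<phi> y + M2 (w' y) * pd 1 \<phi> y - M1 (w' y) * pd 2 \<phi> y))"
    "(LINT y|lborel. k * (V2 (w y) * pd 0 \<phi> y + M2 (w y) * pd 1 \<phi> y - M1 (w y) * pd 2 \<phi> y) + k' * (V2 (w' y) * pd 0 \<phi> y + M2 (w' y) * pd 1 \<phi> y - M1 (w' y) * pd 2 \<phi> y)) = 0"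
    using ic W by (auto simp: Bochner_Integration.integral_add[OF integrable_mult_right[OF ic(1)] integrable_mult_right[OF ic(2)]])
  show ?A by (simp only: a aa)
  show ?Az by (simp only: a aa)
  show ?B by (simp only: b bb)
  show ?Bz by (simp only: b bb)
  show ?C by (simp only: c cc)
  show ?Cz by (simp only: c cc)
qed

section \<open>Assembly of a fan solution from its wild parts\<close>

lemma AE_off_lines: "AE y in lborel. snd (snd y) \<noteq> \<mu> * fst (y :: pt)"
proof -
  have "negligible {y::pt. (-\<mu>, 0, 1) \<bullet> y = 0}" by (rule negligible_hyperplane) (auto simp: zero_prod_def)
  then have "AE y in lebesgue. y \<notin> {y::pt. (-\<mu>, 0, 1) \<bullet> y = 0}"
    by (intro AE_not_in) (simp add: negligible_iff_null_sets)
  moreover have mS: "{y::pt. (-\<mu>, 0, 1) \<bullet> y = 0} \<in> sets borel"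
    by (intro borel_closed closed_Collect_eq continuous_intros)
  ultimately have "AE y in lborel. y \<notin> {y::pt. (-\<mu>, 0, 1) \<bullet> y = 0}"
    by (subst (asm) AE_completion_iff) auto
  then show ?thesis by eventually_elim (auto simp: inner_prod_def)
qed

lemma stepf_map2: "F (stepf \<mu>0 \<mu>1 \<mu>2 a0 a1 a2 a3 y) (stepf \<mu>0 \<mu>1 \<mu>2 b0 b1 b2 b3 y)
    = stepf \<mu>0 \<mu>1 \<mu>2 (F a0 b0) (F a1 b1) (F a2 b2) (F a3 b3) y"
  by (simp add: stepf_def)

text \<open>The third entry is chosen so that, with C = \<beta>^2 + A + B, the matrix of the
  relaxation set is diag(A, B). Equivalently the wild velocity has v \<otimes> v equal on average to
  diag(A, \<beta>^2 + B).\<close>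

definition fan_state :: "real \<Rightarrow> real \<Rightarrow> real \<Rightarrow> st" where
  "fan_state \<beta> A B = (0, \<beta>, (A - B - \<beta>\<^sup>2) / 2, 0)"

lemma fan_state_subsol:
  assumes "A > 0" "B > 0"
  shows "fan_state \<beta> A B \<in> subsol (\<beta>\<^sup>2 + A + B)"
  using assms by (simp add: subsol_def fan_state_def E11_def E22_def E12_def field_simps)

text \<open>\<open>A\<close>, \<open>B\<close> are the variances of the two velocity components in a fan region with mean
  velocity \<open>(0, \<beta>)\<close>; the central wave is stationary relative to the fluid, so \<open>\<mu>\<^sub>1 = \<beta>\<close>.\<close>

lemma fan_solution:
  fixes cv rl ul pl rr ur pr \<beta> \<mu>0 \<mu>2 r1 r2 p A1 A2 B1 B2 :: real
  defines "C1' \<equiv> \<beta>\<^sup>2 + A1 + B1" and "C2' \<equiv> \<beta>\<^sup>2 + A2 + B2"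
  assumes ord: "\<mu>0 < \<beta>" "\<beta> < \<mu>2" and pos: "rl > 0" "rr > 0" "pl > 0" "pr > 0" "r1 > 0" "r2 > 0" "p > 0"
    and mid: "r1 * B1 = r2 * B2"
    and massl: "\<mu>0 * (r1 - rl) = r1 * \<beta> - rl * ul"
    and moml: "\<mu>0 * (r1 * \<beta> - rl * ul) = (r1 * (\<beta>\<^sup>2 + B1) + p) - (rl * ul\<^sup>2 + pl)"
    and enl: "\<mu>0 * ((r1 * C1' / 2 + cv * p) - (rl * ul\<^sup>2 / 2 + cv * pl)) = (r1 * C1' / 2 + cv * p + p) * \<beta> - (rl * ul\<^sup>2 / 2 + cv * pl + pl) * ul"
    and entl: "\<mu>0 * (r1 * entr cv r1 p - rl * entr cv rl pl) \<le> r1 * entr cv r1 p * \<beta> - rl * entr cv rl pl * ul"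
    and massr: "\<mu>2 * (rr - r2) = rr * ur - r2 * \<beta>"
    and momr: "\<mu>2 * (rr * ur - r2 * \<beta>) = (rr * ur\<^sup>2 + pr) - (r2 * (\<beta>\<^sup>2 + B2) + p)"
    and enr: "\<mu>2 * ((rr * ur\<^sup>2 / 2 + cv * pr) - (r2 * C2' / 2 + cv * p)) = (rr * ur\<^sup>2 / 2 + cv * pr + pr) * ur - (r2 * C2' / 2 + cv * p + p) * \<beta>"
    and entr': "\<mu>2 * (rr * entr cv rr pr - r2 * entr cv r2 p) \<le> rr * entr cv rr pr * ur - r2 * entr cv r2 p * \<beta>"
    and w: "wild (fan_region \<mu>0 \<beta>) (fan_state \<beta> A1 B1) C1' w" and w': "wild (fan_region \<beta> \<mu>2) (fan_state \<beta> A2 B2) C2' w'"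
  defines "\<rho> \<equiv> stepf \<mu>0 \<beta> \<mu>2 rl r1 r2 rr" and "v1 \<equiv> \<lambda>y. V1 (w y) + V1 (w' y)"
    and "v2 \<equiv> \<lambda>y. stepf \<mu>0 \<beta> \<mu>2 ul \<beta> \<beta> ur y + (V2 (w y) + V2 (w' y))" and "P \<equiv> stepf \<mu>0 \<beta> \<mu>2 pl p p pr"
  shows "admissible_sol cv rl (0, ul) pl rr (0, ur) pr \<rho> v1 v2 P" "is_2fan rl (0, ul) pl rr (0, ur) pr \<rho> v1 v2 P"
proof -
  note W0 = wild_D(2)[OF w] and W0' = wild_D(2)[OF w']
  have regions: "(snd (snd y) < \<mu>0 * fst y \<Longrightarrow> y \<notin> fan_region \<mu>0 \<beta> \<and> y \<notin> fan_region \<beta> \<mu>2 \<and> (\<forall>a b c d. stepf \<mu>0 \<beta> \<mu>2 a b c d y = a))"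
    "(\<mu>0 * fst y < snd (snd y) \<Longrightarrow> snd (snd y) < \<beta> * fst y \<Longrightarrow> y \<in> fan_region \<mu>0 \<beta> \<and> y \<notin> fan_region \<beta> \<mu>2 \<and> (\<forall>a b c d. stepf \<mu>0 \<beta> \<mu>2 a b c d y = b))"
    "(\<beta> * fst y < snd (snd y) \<Longrightarrow> snd (snd y) < \<mu>2 * fst y \<Longrightarrow> y \<notin> fan_region \<mu>0 \<beta> \<and> y \<in> fan_region \<beta> \<mu>2 \<and> (\<forall>a b c d. stepf \<mu>0 \<beta> \<mu>2 a b c d y = c))"
    "(snd (snd y) > \<mu>2 * fst y \<Longrightarrow> y \<notin> fan_region \<mu>0 \<beta> \<and> y \<notin> fan_region \<beta> \<mu>2 \<and> (\<forall>a b c d. stepf \<mu>0 \<beta> \<mu>2 a b c d y = d))"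
    if "fst y > 0" for y :: pt
  proof -
    define m0 m1 m2 where m: "m0 = \<mu>0 * fst y" "m1 = \<beta> * fst y" "m2 = \<mu>2 * fst y"
    have o: "m0 < m1" "m1 < m2" unfolding m using ord that by (auto intro: mult_strict_right_mono)
    show "(snd (snd y) < \<mu>0 * fst y \<Longrightarrow> y \<notin> fan_region \<mu>0 \<beta> \<and> y \<notin> fan_region \<beta> \<mu>2 \<and> (\<forall>a b c d. stepf \<mu>0 \<beta> \<mu>2 a b c d y = a))"
      "(\<mu>0 * fst y < snd (snd y) \<Longrightarrow> snd (snd y) < \<beta> * fst y \<Longrightarrow> y \<in> fan_region \<mu>0 \<beta> \<and> y \<notin> fan_region \<beta> \<mu>2 \<and> (\<forall>a b c d. stepf \<mu>0 \<beta> \<mu>2 a b c d y = b))"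
      "(\<beta> * fst y < snd (snd y) \<Longrightarrow> snd (snd y) < \<mu>2 * fst y \<Longrightarrow> y \<notin> fan_region \<mu>0 \<beta> \<and> y \<in> fan_region \<beta> \<mu>2 \<and> (\<forall>a b c d. stepf \<mu>0 \<beta> \<mu>2 a b c d y = c))"
      "(snd (snd y) > \<mu>2 * fst y \<Longrightarrow> y \<notin> fan_region \<mu>0 \<beta> \<and> y \<notin> fan_region \<beta> \<mu>2 \<and> (\<forall>a b c d. stepf \<mu>0 \<beta> \<mu>2 a b c d y = d))"
      unfolding fan_region_def stepf_def mem_Collect_eq m[symmetric] using o that by auto
  qed
  have sq1: "(V1 (w y))\<^sup>2 = C1' / 2 + (A1 - B1 - \<beta>\<^sup>2) / 2 + M1 (w y)" "(V1 (w y))\<^sup>2 + (\<beta> + V2 (w y))\<^sup>2 = C1'"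
    "M2 (w y) = V1 (w y) * (\<beta> + V2 (w y))" if "y \<in> fan_region \<mu>0 \<beta>" for y
    using wild_D(3-5)[OF w that] by (simp_all add: fan_state_def)
  have sq2: "(V1 (w' y))\<^sup>2 = C2' / 2 + (A2 - B2 - \<beta>\<^sup>2) / 2 + M1 (w' y)" "(V1 (w' y))\<^sup>2 + (\<beta> + V2 (w' y))\<^sup>2 = C2'"
    "M2 (w' y) = V1 (w' y) * (\<beta> + V2 (w' y))" if "y \<in> fan_region \<beta> \<mu>2" for y
    using wild_D(3-5)[OF w' that] by (simp_all add: fan_state_def)
  have split: "Q y" if "y \<in> Hplus" "snd (snd y) \<noteq> \<mu>0 * fst y" "snd (snd y) \<noteq> \<beta> * fst y" "snd (snd y) \<noteq> \<mu>2 * fst y"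
    and "\<And>y. w y = 0 \<Longrightarrow> w' y = 0 \<Longrightarrow> (\<forall>a b c d. stepf \<mu>0 \<beta> \<mu>2 a b c d y = a) \<Longrightarrow> Q y"
    and "\<And>y. y \<in> fan_region \<mu>0 \<beta> \<Longrightarrow> w' y = 0 \<Longrightarrow> (\<forall>a b c d. stepf \<mu>0 \<beta> \<mu>2 a b c d y = b) \<Longrightarrow> Q y"
    and "\<And>y. y \<in> fan_region \<beta> \<mu>2 \<Longrightarrow> w y = 0 \<Longrightarrow> (\<forall>a b c d. stepf \<mu>0 \<beta> \<mu>2 a b c d y = c) \<Longrightarrow> Q y"
    and "\<And>y. w y = 0 \<Longrightarrow> w' y = 0 \<Longrightarrow> (\<forall>a b c d. stepf \<mu>0 \<beta> \<mu>2 a b c d y = d) \<Longrightarrow> Q y" for Q y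
  proof -
    have t: "fst y > 0" using that(1) by (simp add: Hplus_def)
    have "snd (snd y) < \<mu>0 * fst y \<or> (\<mu>0 * fst y < snd (snd y) \<and> snd (snd y) < \<beta> * fst y)
      \<or> (\<beta> * fst y < snd (snd y) \<and> snd (snd y) < \<mu>2 * fst y) \<or> snd (snd y) > \<mu>2 * fst y" using that(2-4) by linarith
    then show ?thesis
    proof (elim disjE conjE)
      assume a: "snd (snd y) < \<mu>0 * fst y"
      note r = regions(1)[OF t a]
      show ?thesis by (rule that(5)[OF W0[OF conjunct1[OF r]] W0'[OF conjunct1[OF conjunct2[OF r]]] conjunct2[OF conjunct2[OF r]]])
    next
      assume a: "\<mu>0 * fst y < snd (snd y)" "snd (snd y) < \<beta> * fst y"
      note r = regions(2)[OF t a]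
      show ?thesis by (rule that(6)[OF conjunct1[OF r] W0'[OF conjunct1[OF conjunct2[OF r]]] conjunct2[OF conjunct2[OF r]]])
    next
      assume a: "\<beta> * fst y < snd (snd y)" "snd (snd y) < \<mu>2 * fst y"
      note r = regions(3)[OF t a]
      show ?thesis by (rule that(7)[OF conjunct1[OF conjunct2[OF r]] W0[OF conjunct1[OF r]] conjunct2[OF conjunct2[OF r]]])
    next
      assume a: "snd (snd y) > \<mu>2 * fst y"
      note r = regions(4)[OF t a]
      show ?thesis by (rule that(8)[OF W0[OF conjunct1[OF r]] W0'[OF conjunct1[OF conjunct2[OF r]]] conjunct2[OF conjunct2[OF r]]])
    qed
  qed
  \<comment> \<open>The interfaces are null sets, so identities between the fields need checking
    only in the two outer and two inner regions.\<close>
  have ae: "AE y in lborel. y \<in> Hplus \<longrightarrow> Q y"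
    if "\<And>y. w y = 0 \<Longrightarrow> w' y = 0 \<Longrightarrow> (\<forall>a b c d. stepf \<mu>0 \<beta> \<mu>2 a b c d y = a) \<Longrightarrow> Q y"
    and "\<And>y. y \<in> fan_region \<mu>0 \<beta> \<Longrightarrow> w' y = 0 \<Longrightarrow> (\<forall>a b c d. stepf \<mu>0 \<beta> \<mu>2 a b c d y = b) \<Longrightarrow> Q y"
    and "\<And>y. y \<in> fan_region \<beta> \<mu>2 \<Longrightarrow> w y = 0 \<Longrightarrow> (\<forall>a b c d. stepf \<mu>0 \<beta> \<mu>2 a b c d y = c) \<Longrightarrow> Q y"
    and "\<And>y. w y = 0 \<Longrightarrow> w' y = 0 \<Longrightarrow> (\<forall>a b c d. stepf \<mu>0 \<beta> \<mu>2 a b c d y = d) \<Longrightarrow> Q y" for Q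
    using AE_off_lines[of \<mu>0] AE_off_lines[of \<beta>] AE_off_lines[of \<mu>2]
  proof eventually_elim
    case (elim y)
    show ?case
    proof
      assume h: "y \<in> Hplus"
      show "Q y" by (rule split[of y Q, OF h elim]) (fact that)+
    qed
  qed
  have ww: "w y = 0 \<and> w' y = 0" if "y \<notin> Hplus" for y
    using that by (intro conjI W0 W0') (auto simp: fan_region_def Hplus_def)
  note [measurable] = wild_measurable[OF w] wild_measurable[OF w']
  have m\<rho> [measurable]: "\<rho> \<in> borel_measurable borel" and mP [measurable]: "P \<in> borel_measurable borel"
    unfolding \<rho>_def P_def by measurable
  have mv [measurable]: "v1 \<in> borel_measurable borel" "v2 \<in> borel_measurable borel"
    unfolding v1_def v2_def by measurable
  define e0 e1 e2 e3 where "e0 = rl * ul\<^sup>2 / 2 + cv * pl" and "e1 = r1 * C1' / 2 + cv * p" and "e2 = r2 * C2' / 2 + cv * p" and "e3 = rr * ur\<^sup>2 / 2 + cv * pr"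
  define s0 s1 s2 s3 where "s0 = rl * entr cv rl pl" and "s1 = r1 * entr cv r1 p" and "s2 = r2 * entr cv r2 p" and "s3 = rr * entr cv rr pr"
  have mass: "distr_eq \<rho> (\<lambda>y. \<rho> y * v1 y) (\<lambda>y. \<rho> y * v2 y) (riem rl rr)"
    unfolding distr_eq_def
  proof (intro allI impI)
    fix \<phi> assume "test_fun \<phi>"
    then obtain R where tf: "test_C1 \<phi> (pd 0 \<phi>) (pd 1 \<phi>) (pd 2 \<phi>) R" using test_fun_C1 by blast
    note fl = wild_flux[OF w w' tf, where k = r1 and k' = r2]
    have AE: "AE y in lborel. y \<in> Hplus \<longrightarrow> \<rho> y = stepf \<mu>0 \<beta> \<mu>2 rl r1 r2 rr y + 0 \<and>
      \<rho> y * v1 y = stepf \<mu>0 \<beta> \<mu>2 0 0 0 0 y + (r1 * V1 (w y) + r2 * V1 (w' y)) \<and>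
      \<rho> y * v2 y = stepf \<mu>0 \<beta> \<mu>2 (rl * ul) (r1 * \<beta>) (r2 * \<beta>) (rr * ur) y + (r1 * V2 (w y) + r2 * V2 (w' y))"
      by (rule ae) (simp_all add: \<rho>_def v1_def v2_def algebra_simps)
    have "wf_integrable \<rho> (\<lambda>y. \<rho> y * v1 y) (\<lambda>y. \<rho> y * v2 y) (riem rl rr) \<phi>"
      "wf_value \<rho> (\<lambda>y. \<rho> y * v1 y) (\<lambda>y. \<rho> y * v2 y) (riem rl rr) \<phi> =
      ((r1 * \<beta> - rl * ul) - \<mu>0 * (r1 - rl)) * (LINT y|lborel. indicator (upper \<mu>0) y * pd 2 \<phi> y)
      + ((r2 * \<beta> - r1 * \<beta>) - \<beta> * (r2 - r1)) * (LINT y|lborel. indicator (upper \<beta>) y * pd 2 \<phi> y)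
      + ((rr * ur - r2 * \<beta>) - \<mu>2 * (rr - r2)) * (LINT y|lborel. indicator (upper \<mu>2) y * pd 2 \<phi> y)"
      by (rule wf_combine[OF tf ord _ _ _ AE _ fl(1,2)]; use ww in simp)+
    moreover have "(r1 * \<beta> - rl * ul) - \<mu>0 * (r1 - rl) = 0" using massl by simp
    \<comment> \<open>The central interface moves with the mean velocity, so no mass crosses it
      whatever the densities are; energy and entropy below follow the same pattern.\<close>
    moreover have "(r2 * \<beta> - r1 * \<beta>) - \<beta> * (r2 - r1) = 0" by (simp add: algebra_simps)
    moreover have "(rr * ur - r2 * \<beta>) - \<mu>2 * (rr - r2) = 0" using massr by simp
    ultimately show "wf_integrable \<rho> (\<lambda>y. \<rho> y * v1 y) (\<lambda>y. \<rho> y * v2 y) (riem rl rr) \<phi> \<and> wf_value \<rho> (\<lambda>y. \<rho> y * v1 y) (\<lambda>y. \<rho> y * v2 y) (riem rl rr) \<phi> = 0"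
      by simp
  qed
  have mom1: "distr_eq (\<lambda>y. \<rho> y * v1 y) (\<lambda>y. \<rho> y * v1 y * v1 y + P y) (\<lambda>y. \<rho> y * v1 y * v2 y) (\<lambda>x. riem rl rr x * riem 0 0 x)"
    unfolding distr_eq_def
  proof (intro allI impI)
    fix \<phi> assume "test_fun \<phi>"
    then obtain R where tf: "test_C1 \<phi> (pd 0 \<phi>) (pd 1 \<phi>) (pd 2 \<phi>) R" using test_fun_C1 by blast
    note fl = wild_flux[OF w w' tf, where k = r1 and k' = r2]
    \<comment> \<open>The tangential mean fluxes, r1 A1 + p and r2 A2 + p. Depending only on t and
      x2, they integrate to zero against the x1-derivative.\<close>
    let ?k1 = "r1 * (C1' / 2 + (A1 - B1 - \<beta>\<^sup>2) / 2) + p" and ?k2 = "r2 * (C2' / 2 + (A2 - B2 - \<beta>\<^sup>2) / 2) + p"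
    have AE: "AE y in lborel. y \<in> Hplus \<longrightarrow> \<rho> y * v1 y = stepf \<mu>0 \<beta> \<mu>2 0 0 0 0 y + (r1 * V1 (w y) + r2 * V1 (w' y)) \<and>
      \<rho> y * v1 y * v1 y + P y = stepf \<mu>0 \<beta> \<mu>2 pl ?k1 ?k2 pr y + (r1 * M1 (w y) + r2 * M1 (w' y)) \<and>
      \<rho> y * v1 y * v2 y = stepf \<mu>0 \<beta> \<mu>2 0 0 0 0 y + (r1 * M2 (w y) + r2 * M2 (w' y))"
    proof (rule ae)
      fix y assume y: "y \<in> fan_region \<mu>0 \<beta>" "w' y = 0" "\<forall>a b c d. stepf \<mu>0 \<beta> \<mu>2 a b c d y = b"
      have 1: "r1 * V1 (w y) * V1 (w y) + p = ?k1 + r1 * M1 (w y)"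
      proof -
        have "r1 * V1 (w y) * V1 (w y) = r1 * (V1 (w y))\<^sup>2" by (simp add: power2_eq_square)
        also have "\<dots> = r1 * (C1' / 2 + (A1 - B1 - \<beta>\<^sup>2) / 2) + r1 * M1 (w y)"
          unfolding sq1(1)[OF y(1)] by (simp only: distrib_left)
        finally show ?thesis by linarith
      qed
      have 2: "r1 * V1 (w y) * (\<beta> + V2 (w y)) = r1 * M2 (w y)"
        unfolding sq1(3)[OF y(1)] by (simp only: mult.assoc)
      have a: "\<rho> y = r1" "P y = p" "v1 y = V1 (w y)" "v2 y = \<beta> + V2 (w y)" "V1 (w' y) = 0" "M1 (w' y) = 0" "M2 (w' y) = 0"
        "stepf \<mu>0 \<beta> \<mu>2 0 0 0 0 y = 0" "stepf \<mu>0 \<beta> \<mu>2 pl ?k1 ?k2 pr y = ?k1"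
        using y by (simp_all add: \<rho>_def v1_def v2_def P_def)
      show "\<rho> y * v1 y = stepf \<mu>0 \<beta> \<mu>2 0 0 0 0 y + (r1 * V1 (w y) + r2 * V1 (w' y)) \<and>
      \<rho> y * v1 y * v1 y + P y = stepf \<mu>0 \<beta> \<mu>2 pl ?k1 ?k2 pr y + (r1 * M1 (w y) + r2 * M1 (w' y)) \<and>
      \<rho> y * v1 y * v2 y = stepf \<mu>0 \<beta> \<mu>2 0 0 0 0 y + (r1 * M2 (w y) + r2 * M2 (w' y))"
        unfolding a 1 2 by simp
    next
      fix y assume y: "y \<in> fan_region \<beta> \<mu>2" "w y = 0" "\<forall>a b c d. stepf \<mu>0 \<beta> \<mu>2 a b c d y = c"
      have 1: "r2 * V1 (w' y) * V1 (w' y) + p = ?k2 + r2 * M1 (w' y)"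
      proof -
        have "r2 * V1 (w' y) * V1 (w' y) = r2 * (V1 (w' y))\<^sup>2" by (simp add: power2_eq_square)
        also have "\<dots> = r2 * (C2' / 2 + (A2 - B2 - \<beta>\<^sup>2) / 2) + r2 * M1 (w' y)"
          unfolding sq2(1)[OF y(1)] by (simp only: distrib_left)
        finally show ?thesis by linarith
      qed
      have 2: "r2 * V1 (w' y) * (\<beta> + V2 (w' y)) = r2 * M2 (w' y)"
        unfolding sq2(3)[OF y(1)] by (simp only: mult.assoc)
      have a: "\<rho> y = r2" "P y = p" "v1 y = V1 (w' y)" "v2 y = \<beta> + V2 (w' y)" "V1 (w y) = 0" "M1 (w y) = 0" "M2 (w y) = 0"
        "stepf \<mu>0 \<beta> \<mu>2 0 0 0 0 y = 0" "stepf \<mu>0 \<beta> \<mu>2 pl ?k1 ?k2 pr y = ?k2"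
        using y by (simp_all add: \<rho>_def v1_def v2_def P_def)
      show "\<rho> y * v1 y = stepf \<mu>0 \<beta> \<mu>2 0 0 0 0 y + (r1 * V1 (w y) + r2 * V1 (w' y)) \<and>
      \<rho> y * v1 y * v1 y + P y = stepf \<mu>0 \<beta> \<mu>2 pl ?k1 ?k2 pr y + (r1 * M1 (w y) + r2 * M1 (w' y)) \<and>
      \<rho> y * v1 y * v2 y = stepf \<mu>0 \<beta> \<mu>2 0 0 0 0 y + (r1 * M2 (w y) + r2 * M2 (w' y))"
        unfolding a 1 2 by simp
    qed (simp_all add: \<rho>_def v1_def v2_def P_def)
    have "wf_integrable (\<lambda>y. \<rho> y * v1 y) (\<lambda>y. \<rho> y * v1 y * v1 y + P y) (\<lambda>y. \<rho> y * v1 y * v2 y) (\<lambda>x. riem rl rr x * riem 0 0 x) \<phi>"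
      "wf_value (\<lambda>y. \<rho> y * v1 y) (\<lambda>y. \<rho> y * v1 y * v1 y + P y) (\<lambda>y. \<rho> y * v1 y * v2 y) (\<lambda>x. riem rl rr x * riem 0 0 x) \<phi> =
      ((0 - 0) - \<mu>0 * (0 - 0)) * (LINT y|lborel. indicator (upper \<mu>0) y * pd 2 \<phi> y)
      + ((0 - 0) - \<beta> * (0 - 0)) * (LINT y|lborel. indicator (upper \<beta>) y * pd 2 \<phi> y)
      + ((0 - 0) - \<mu>2 * (0 - 0)) * (LINT y|lborel. indicator (upper \<mu>2) y * pd 2 \<phi> y)"
      by (rule wf_combine[OF tf ord _ _ _ AE _ fl(3,4)]; use ww in \<open>simp add: riem_def\<close>)+
    then show "wf_integrable (\<lambda>y. \<rho> y * v1 y) (\<lambda>y. \<rho> y * v1 y * v1 y + P y) (\<lambda>y. \<rho> y * v1 y * v2 y) (\<lambda>x. riem rl rr x * riem 0 0 x) \<phi> \<and>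
      wf_value (\<lambda>y. \<rho> y * v1 y) (\<lambda>y. \<rho> y * v1 y * v1 y + P y) (\<lambda>y. \<rho> y * v1 y * v2 y) (\<lambda>x. riem rl rr x * riem 0 0 x) \<phi> = 0"
      by simp
  qed
  have mom2: "distr_eq (\<lambda>y. \<rho> y * v2 y) (\<lambda>y. \<rho> y * v2 y * v1 y) (\<lambda>y. \<rho> y * v2 y * v2 y + P y) (\<lambda>x. riem rl rr x * riem ul ur x)"
    unfolding distr_eq_def
  proof (intro allI impI)
    fix \<phi> assume "test_fun \<phi>"
    then obtain R where tf: "test_C1 \<phi> (pd 0 \<phi>) (pd 1 \<phi>) (pd 2 \<phi>) R" using test_fun_C1 by blast
    note fl = wild_flux[OF w w' tf, where k = r1 and k' = r2]
    \<comment> \<open>The normal momentum flux contains the variance as an additional pressure r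
      B.\<close>
    let ?k1 = "r1 * (\<beta>\<^sup>2 + B1) + p" and ?k2 = "r2 * (\<beta>\<^sup>2 + B2) + p"
    have AE: "AE y in lborel. y \<in> Hplus \<longrightarrow> \<rho> y * v2 y = stepf \<mu>0 \<beta> \<mu>2 (rl * ul) (r1 * \<beta>) (r2 * \<beta>) (rr * ur) y + (r1 * V2 (w y) + r2 * V2 (w' y)) \<and>
      \<rho> y * v2 y * v1 y = stepf \<mu>0 \<beta> \<mu>2 0 0 0 0 y + (r1 * M2 (w y) + r2 * M2 (w' y)) \<and>
      \<rho> y * v2 y * v2 y + P y = stepf \<mu>0 \<beta> \<mu>2 (rl * ul\<^sup>2 + pl) ?k1 ?k2 (rr * ur\<^sup>2 + pr) y + - (r1 * M1 (w y) + r2 * M1 (w' y))"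
    proof (rule ae)
      fix y assume y: "y \<in> fan_region \<mu>0 \<beta>" "w' y = 0" "\<forall>a b c d. stepf \<mu>0 \<beta> \<mu>2 a b c d y = b"
      have "(\<beta> + V2 (w y))\<^sup>2 = \<beta>\<^sup>2 + B1 - M1 (w y)" using sq1(1,2)[OF y(1)] by (simp add: C1'_def field_simps)
      then have 1: "r1 * (\<beta> + V2 (w y)) * (\<beta> + V2 (w y)) = r1 * (\<beta>\<^sup>2 + B1 - M1 (w y))" by (simp add: power2_eq_square mult.assoc)
      have 2: "r1 * (\<beta> + V2 (w y)) * V1 (w y) = r1 * M2 (w y)" using sq1(3)[OF y(1)] by simp
      have a: "\<rho> y = r1" "P y = p" "v1 y = V1 (w y)" "v2 y = \<beta> + V2 (w y)" "V2 (w' y) = 0" "M1 (w' y) = 0" "M2 (w' y) = 0"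
        "stepf \<mu>0 \<beta> \<mu>2 0 0 0 0 y = 0" "stepf \<mu>0 \<beta> \<mu>2 (rl * ul) (r1 * \<beta>) (r2 * \<beta>) (rr * ur) y = r1 * \<beta>"
        "stepf \<mu>0 \<beta> \<mu>2 (rl * ul\<^sup>2 + pl) ?k1 ?k2 (rr * ur\<^sup>2 + pr) y = ?k1"
        using y by (simp_all add: \<rho>_def v1_def v2_def P_def)
      show "\<rho> y * v2 y = stepf \<mu>0 \<beta> \<mu>2 (rl * ul) (r1 * \<beta>) (r2 * \<beta>) (rr * ur) y + (r1 * V2 (w y) + r2 * V2 (w' y)) \<and>
      \<rho> y * v2 y * v1 y = stepf \<mu>0 \<beta> \<mu>2 0 0 0 0 y + (r1 * M2 (w y) + r2 * M2 (w' y)) \<and>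
      \<rho> y * v2 y * v2 y + P y = stepf \<mu>0 \<beta> \<mu>2 (rl * ul\<^sup>2 + pl) ?k1 ?k2 (rr * ur\<^sup>2 + pr) y + - (r1 * M1 (w y) + r2 * M1 (w' y))"
        unfolding a 1 2 by (simp add: algebra_simps)
    next
      fix y assume y: "y \<in> fan_region \<beta> \<mu>2" "w y = 0" "\<forall>a b c d. stepf \<mu>0 \<beta> \<mu>2 a b c d y = c"
      have "(\<beta> + V2 (w' y))\<^sup>2 = \<beta>\<^sup>2 + B2 - M1 (w' y)" using sq2(1,2)[OF y(1)] by (simp add: C2'_def field_simps)
      then have 1: "r2 * (\<beta> + V2 (w' y)) * (\<beta> + V2 (w' y)) = r2 * (\<beta>\<^sup>2 + B2 - M1 (w' y))" by (simp add: power2_eq_square mult.assoc)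
      have 2: "r2 * (\<beta> + V2 (w' y)) * V1 (w' y) = r2 * M2 (w' y)" using sq2(3)[OF y(1)] by simp
      have a: "\<rho> y = r2" "P y = p" "v1 y = V1 (w' y)" "v2 y = \<beta> + V2 (w' y)" "V2 (w y) = 0" "M1 (w y) = 0" "M2 (w y) = 0"
        "stepf \<mu>0 \<beta> \<mu>2 0 0 0 0 y = 0" "stepf \<mu>0 \<beta> \<mu>2 (rl * ul) (r1 * \<beta>) (r2 * \<beta>) (rr * ur) y = r2 * \<beta>"
        "stepf \<mu>0 \<beta> \<mu>2 (rl * ul\<^sup>2 + pl) ?k1 ?k2 (rr * ur\<^sup>2 + pr) y = ?k2"
        using y by (simp_all add: \<rho>_def v1_def v2_def P_def)
      show "\<rho> y * v2 y = stepf \<mu>0 \<beta> \<mu>2 (rl * ul) (r1 * \<beta>) (r2 * \<beta>) (rr * ur) y + (r1 * V2 (w y) + r2 * V2 (w' y)) \<and>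
      \<rho> y * v2 y * v1 y = stepf \<mu>0 \<beta> \<mu>2 0 0 0 0 y + (r1 * M2 (w y) + r2 * M2 (w' y)) \<and>
      \<rho> y * v2 y * v2 y + P y = stepf \<mu>0 \<beta> \<mu>2 (rl * ul\<^sup>2 + pl) ?k1 ?k2 (rr * ur\<^sup>2 + pr) y + - (r1 * M1 (w y) + r2 * M1 (w' y))"
        unfolding a 1 2 by (simp add: algebra_simps)
    qed (simp_all add: \<rho>_def v1_def v2_def P_def power2_eq_square)
    have "wf_integrable (\<lambda>y. \<rho> y * v2 y) (\<lambda>y. \<rho> y * v2 y * v1 y) (\<lambda>y. \<rho> y * v2 y * v2 y + P y) (\<lambda>x. riem rl rr x * riem ul ur x) \<phi>"
      "wf_value (\<lambda>y. \<rho> y * v2 y) (\<lambda>y. \<rho> y * v2 y * v1 y) (\<lambda>y. \<rho> y * v2 y * v2 y + P y) (\<lambda>x. riem rl rr x * riem ul ur x) \<phi> =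
      ((?k1 - (rl * ul\<^sup>2 + pl)) - \<mu>0 * (r1 * \<beta> - rl * ul)) * (LINT y|lborel. indicator (upper \<mu>0) y * pd 2 \<phi> y)
      + ((?k2 - ?k1) - \<beta> * (r2 * \<beta> - r1 * \<beta>)) * (LINT y|lborel. indicator (upper \<beta>) y * pd 2 \<phi> y)
      + (((rr * ur\<^sup>2 + pr) - ?k2) - \<mu>2 * (rr * ur - r2 * \<beta>)) * (LINT y|lborel. indicator (upper \<mu>2) y * pd 2 \<phi> y)"
      by (rule wf_combine[OF tf ord _ _ _ AE _ fl(5,6)]; use ww in \<open>simp add: riem_def\<close>)+
    moreover have "(?k1 - (rl * ul\<^sup>2 + pl)) - \<mu>0 * (r1 * \<beta> - rl * ul) = 0" using moml by simp
    \<comment> \<open>Here the two sides must agree in p + r B; this is what the shared \<delta>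
      provides.\<close>
    moreover have "(?k2 - ?k1) - \<beta> * (r2 * \<beta> - r1 * \<beta>) = 0" using mid by (simp add: power2_eq_square algebra_simps)
    moreover have "((rr * ur\<^sup>2 + pr) - ?k2) - \<mu>2 * (rr * ur - r2 * \<beta>) = 0" using momr by simp
    ultimately show "wf_integrable (\<lambda>y. \<rho> y * v2 y) (\<lambda>y. \<rho> y * v2 y * v1 y) (\<lambda>y. \<rho> y * v2 y * v2 y + P y) (\<lambda>x. riem rl rr x * riem ul ur x) \<phi> \<and>
      wf_value (\<lambda>y. \<rho> y * v2 y) (\<lambda>y. \<rho> y * v2 y * v1 y) (\<lambda>y. \<rho> y * v2 y * v2 y + P y) (\<lambda>x. riem rl rr x * riem ul ur x) \<phi> = 0"
      by simp
  qed
  let ?E = "\<lambda>y. energy cv (\<rho> y) (v1 y) (v2 y) (P y)" and ?Ei = "\<lambda>x. energy cv (riem rl rr x) (riem 0 0 x) (riem ul ur x) (riem pl pr x)"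
  have mE: "?E \<in> borel_measurable borel" unfolding energy_def by measurable
  have en: "distr_eq ?E (\<lambda>y. (?E y + P y) * v1 y) (\<lambda>y. (?E y + P y) * v2 y) ?Ei"
    unfolding distr_eq_def
  proof (intro allI impI)
    fix \<phi> assume "test_fun \<phi>"
    then obtain R where tf: "test_C1 \<phi> (pd 0 \<phi>) (pd 1 \<phi>) (pd 2 \<phi>) R" using test_fun_C1 by blast
    \<comment> \<open>Since |v|^2 is constant in each region, so is the energy density, and the
      fluctuating energy flux is the constant e + p times a divergence-free field.\<close>
    note fl = wild_flux[OF w w' tf, where k = "e1 + p" and k' = "e2 + p"]
    have AE: "AE y in lborel. y \<in> Hplus \<longrightarrow> ?E y = stepf \<mu>0 \<beta> \<mu>2 e0 e1 e2 e3 y + 0 \<and>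
      (?E y + P y) * v1 y = stepf \<mu>0 \<beta> \<mu>2 0 0 0 0 y + ((e1 + p) * V1 (w y) + (e2 + p) * V1 (w' y)) \<and>
      (?E y + P y) * v2 y = stepf \<mu>0 \<beta> \<mu>2 ((e0 + pl) * ul) ((e1 + p) * \<beta>) ((e2 + p) * \<beta>) ((e3 + pr) * ur) y + ((e1 + p) * V2 (w y) + (e2 + p) * V2 (w' y))"
    proof (rule ae)
      fix y assume y: "y \<in> fan_region \<mu>0 \<beta>" "w' y = 0" "\<forall>a b c d. stepf \<mu>0 \<beta> \<mu>2 a b c d y = b"
      have "?E y = e1" using y sq1(2)[OF y(1)] by (simp add: \<rho>_def v1_def v2_def P_def energy_def e1_def)
      then show "?E y = stepf \<mu>0 \<beta> \<mu>2 e0 e1 e2 e3 y + 0 \<and>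
      (?E y + P y) * v1 y = stepf \<mu>0 \<beta> \<mu>2 0 0 0 0 y + ((e1 + p) * V1 (w y) + (e2 + p) * V1 (w' y)) \<and>
      (?E y + P y) * v2 y = stepf \<mu>0 \<beta> \<mu>2 ((e0 + pl) * ul) ((e1 + p) * \<beta>) ((e2 + p) * \<beta>) ((e3 + pr) * ur) y + ((e1 + p) * V2 (w y) + (e2 + p) * V2 (w' y))"
        using y by (simp add: v1_def v2_def P_def algebra_simps)
    next
      fix y assume y: "y \<in> fan_region \<beta> \<mu>2" "w y = 0" "\<forall>a b c d. stepf \<mu>0 \<beta> \<mu>2 a b c d y = c"
      have "?E y = e2" using y sq2(2)[OF y(1)] by (simp add: \<rho>_def v1_def v2_def P_def energy_def e2_def)
      then show "?E y = stepf \<mu>0 \<beta> \<mu>2 e0 e1 e2 e3 y + 0 \<and>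
      (?E y + P y) * v1 y = stepf \<mu>0 \<beta> \<mu>2 0 0 0 0 y + ((e1 + p) * V1 (w y) + (e2 + p) * V1 (w' y)) \<and>
      (?E y + P y) * v2 y = stepf \<mu>0 \<beta> \<mu>2 ((e0 + pl) * ul) ((e1 + p) * \<beta>) ((e2 + p) * \<beta>) ((e3 + pr) * ur) y + ((e1 + p) * V2 (w y) + (e2 + p) * V2 (w' y))"
        using y by (simp add: v1_def v2_def P_def algebra_simps)
    qed (simp_all add: \<rho>_def v1_def v2_def P_def energy_def e0_def e3_def)
    have "wf_integrable ?E (\<lambda>y. (?E y + P y) * v1 y) (\<lambda>y. (?E y + P y) * v2 y) ?Ei \<phi>"
      "wf_value ?E (\<lambda>y. (?E y + P y) * v1 y) (\<lambda>y. (?E y + P y) * v2 y) ?Ei \<phi> =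
      (((e1 + p) * \<beta> - (e0 + pl) * ul) - \<mu>0 * (e1 - e0)) * (LINT y|lborel. indicator (upper \<mu>0) y * pd 2 \<phi> y)
      + (((e2 + p) * \<beta> - (e1 + p) * \<beta>) - \<beta> * (e2 - e1)) * (LINT y|lborel. indicator (upper \<beta>) y * pd 2 \<phi> y)
      + (((e3 + pr) * ur - (e2 + p) * \<beta>) - \<mu>2 * (e3 - e2)) * (LINT y|lborel. indicator (upper \<mu>2) y * pd 2 \<phi> y)"
      by (rule wf_combine[OF tf ord _ _ _ AE _ fl(1,2)]; use ww mE in \<open>simp add: riem_def energy_def e0_def e3_def\<close>)+
    moreover have "((e1 + p) * \<beta> - (e0 + pl) * ul) - \<mu>0 * (e1 - e0) = 0" using enl by (simp add: e1_def e0_def)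
    moreover have "((e2 + p) * \<beta> - (e1 + p) * \<beta>) - \<beta> * (e2 - e1) = 0" by (simp add: algebra_simps)
    moreover have "((e3 + pr) * ur - (e2 + p) * \<beta>) - \<mu>2 * (e3 - e2) = 0" using enr by (simp add: e3_def e2_def)
    ultimately show "wf_integrable ?E (\<lambda>y. (?E y + P y) * v1 y) (\<lambda>y. (?E y + P y) * v2 y) ?Ei \<phi> \<and> wf_value ?E (\<lambda>y. (?E y + P y) * v1 y) (\<lambda>y. (?E y + P y) * v2 y) ?Ei \<phi> = 0"
      by simp
  qed
  let ?S = "\<lambda>y. \<rho> y * entr cv (\<rho> y) (P y)" and ?Si = "\<lambda>x. riem rl rr x * entr cv (riem rl rr x) (riem pl pr x)"
  have S: "?S y = stepf \<mu>0 \<beta> \<mu>2 s0 s1 s2 s3 y" for y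
    unfolding \<rho>_def P_def s0_def s1_def s2_def s3_def by (rule stepf_map2[of "\<lambda>r q. r * entr cv r q"])
  have en': "distr_ge ?S (\<lambda>y. ?S y * v1 y) (\<lambda>y. ?S y * v2 y) ?Si"
    unfolding distr_ge_def
  proof (intro allI impI)
    fix \<phi> assume a: "test_fun \<phi> \<and> (\<forall>y. 0 \<le> \<phi> y)"
    then obtain R where tf: "test_C1 \<phi> (pd 0 \<phi>) (pd 1 \<phi>) (pd 2 \<phi>) R" using test_fun_C1 by blast
    interpret test_C1 \<phi> "pd 0 \<phi>" "pd 1 \<phi>" "pd 2 \<phi>" R by (rule tf)
    have T: "T \<mu> \<le> 0" for \<mu> by (rule upper_integrals(3)) (use a in blast)
    note fl = wild_flux[OF w w' tf, where k = s1 and k' = s2]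
    have AE: "AE y in lborel. y \<in> Hplus \<longrightarrow> ?S y = stepf \<mu>0 \<beta> \<mu>2 s0 s1 s2 s3 y + 0 \<and>
      ?S y * v1 y = stepf \<mu>0 \<beta> \<mu>2 0 0 0 0 y + (s1 * V1 (w y) + s2 * V1 (w' y)) \<and>
      ?S y * v2 y = stepf \<mu>0 \<beta> \<mu>2 (s0 * ul) (s1 * \<beta>) (s2 * \<beta>) (s3 * ur) y + (s1 * V2 (w y) + s2 * V2 (w' y))"
      unfolding S by (rule ae) (simp_all add: v1_def v2_def algebra_simps)
    have mS: "?S \<in> borel_measurable borel" unfolding S by measurable
    have "wf_integrable ?S (\<lambda>y. ?S y * v1 y) (\<lambda>y. ?S y * v2 y) ?Si \<phi>"
      "wf_value ?S (\<lambda>y. ?S y * v1 y) (\<lambda>y. ?S y * v2 y) ?Si \<phi> =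
      ((s1 * \<beta> - s0 * ul) - \<mu>0 * (s1 - s0)) * T \<mu>0 + ((s2 * \<beta> - s1 * \<beta>) - \<beta> * (s2 - s1)) * T \<beta>
      + ((s3 * ur - s2 * \<beta>) - \<mu>2 * (s3 - s2)) * T \<mu>2"
      by (rule wf_combine[OF tf ord _ _ _ AE _ fl(1,2)]; use ww mS in \<open>simp add: riem_def s0_def s3_def\<close>)+
    \<comment> \<open>Entropy production gives a nonnegative defect, and the integral T is
      nonpositive, which is the sign demanded in the weak entropy inequality.\<close>
    moreover have "((s1 * \<beta> - s0 * ul) - \<mu>0 * (s1 - s0)) * T \<mu>0 \<le> 0"
      using entl T by (intro mult_nonneg_nonpos) (simp_all add: s1_def s0_def)
    moreover have "((s2 * \<beta> - s1 * \<beta>) - \<beta> * (s2 - s1)) = 0" by (simp add: algebra_simps)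
    moreover have "((s3 * ur - s2 * \<beta>) - \<mu>2 * (s3 - s2)) * T \<mu>2 \<le> 0"
      using entr' T by (intro mult_nonneg_nonpos) (simp_all add: s3_def s2_def)
    ultimately show "wf_integrable ?S (\<lambda>y. ?S y * v1 y) (\<lambda>y. ?S y * v2 y) ?Si \<phi> \<and> wf_value ?S (\<lambda>y. ?S y * v1 y) (\<lambda>y. ?S y * v2 y) ?Si \<phi> \<le> 0"
      by simp
  qed
  obtain Bw where Bw: "\<And>y. \<bar>V1 (w y)\<bar> \<le> Bw" "\<And>y. \<bar>V2 (w y)\<bar> \<le> Bw" using wild_bound[OF w] by blast
  obtain Bw' where Bw': "\<And>y. \<bar>V1 (w' y)\<bar> \<le> Bw'" "\<And>y. \<bar>V2 (w' y)\<bar> \<le> Bw'" using wild_bound[OF w'] by blast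
  have sb: "\<bar>stepf \<mu>0 \<beta> \<mu>2 a b c d y\<bar> \<le> \<bar>a\<bar> + \<bar>b\<bar> + \<bar>c\<bar> + \<bar>d\<bar>" for a b c d y by (simp add: stepf_def)
  define Mr Mp Mu where "Mr = \<bar>rl\<bar> + \<bar>r1\<bar> + \<bar>r2\<bar> + \<bar>rr\<bar>" and "Mp = \<bar>pl\<bar> + \<bar>p\<bar> + \<bar>p\<bar> + \<bar>pr\<bar>" and "Mu = \<bar>ul\<bar> + \<bar>\<beta>\<bar> + \<bar>\<beta>\<bar> + \<bar>ur\<bar>"
  have nn: "Mr \<ge> 0" "Mp \<ge> 0" "Mu \<ge> 0" by (simp_all add: Mr_def Mp_def Mu_def)
  have nB: "Bw \<ge> 0" "Bw' \<ge> 0" using order_trans[OF abs_ge_zero Bw(1)] order_trans[OF abs_ge_zero Bw'(1)] by blast+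
  let ?M = "Mr + Mp + Mu + (Bw + Bw')"
  have bound: "\<bar>\<rho> y\<bar> \<le> ?M" "\<bar>v1 y\<bar> \<le> ?M" "\<bar>v2 y\<bar> \<le> ?M" "\<bar>P y\<bar> \<le> ?M" for y
  proof -
    have "\<bar>\<rho> y\<bar> \<le> Mr" "\<bar>P y\<bar> \<le> Mp" unfolding \<rho>_def P_def Mr_def Mp_def by (rule sb)+
    then show "\<bar>\<rho> y\<bar> \<le> ?M" "\<bar>P y\<bar> \<le> ?M" using nn nB by simp_all
    have "\<bar>v1 y\<bar> \<le> Bw + Bw'" unfolding v1_def by (rule order_trans[OF abs_triangle_ineq add_mono[OF Bw(1) Bw'(1)]])
    then show "\<bar>v1 y\<bar> \<le> ?M" using nn by simp
    have "\<bar>V2 (w y) + V2 (w' y)\<bar> \<le> Bw + Bw'" by (rule order_trans[OF abs_triangle_ineq add_mono[OF Bw(2) Bw'(2)]])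
    moreover have "\<bar>stepf \<mu>0 \<beta> \<mu>2 ul \<beta> \<beta> ur y\<bar> \<le> Mu" unfolding Mu_def by (rule sb)
    ultimately have "\<bar>v2 y\<bar> \<le> Mu + (Bw + Bw')" unfolding v2_def by (rule order_trans[OF abs_triangle_ineq add_mono, rotated])
    then show "\<bar>v2 y\<bar> \<le> ?M" using nn by simp
  qed
  have posi: "\<rho> y > 0" "P y > 0" for y using pos by (simp_all add: \<rho>_def P_def stepf_def)
  show "admissible_sol cv rl (0, ul) pl rr (0, ur) pr \<rho> v1 v2 P"
    unfolding admissible_sol_def Let_def fst_conv snd_conv
  proof (intro conjI)
    show "\<rho> \<in> borel_measurable lborel" "v1 \<in> borel_measurable lborel" "v2 \<in> borel_measurable lborel" "P \<in> borel_measurable lborel"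
      using m\<rho> mv mP by simp_all
    show "\<exists>M. \<forall>y\<in>Hplus. \<bar>\<rho> y\<bar> \<le> M \<and> \<bar>v1 y\<bar> \<le> M \<and> \<bar>v2 y\<bar> \<le> M \<and> \<bar>P y\<bar> \<le> M"
      using bound by blast
    show "\<forall>y\<in>Hplus. 0 < \<rho> y \<and> 0 < P y" using posi by blast
  qed (rule mass mom1 mom2 en en')+
  show "is_2fan rl (0, ul) pl rr (0, ur) pr \<rho> v1 v2 P"
    unfolding is_2fan_def fst_conv snd_conv
  proof (rule exI[of _ \<mu>0], rule exI[of _ \<beta>], rule exI[of _ \<mu>2], intro conjI ord allI impI)
    fix y :: pt
    show "\<rho> y = rl" "v1 y = 0" "v2 y = ul" "P y = pl" if y: "0 < fst y \<and> snd (snd y) < \<mu>0 * fst y"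
      using regions(1)[OF conjunct1[OF y] conjunct2[OF y]] W0[of y] W0'[of y] by (auto simp: \<rho>_def v1_def v2_def P_def)
    show "\<rho> y = rr" "v1 y = 0" "v2 y = ur" "P y = pr" if y: "0 < fst y \<and> \<mu>2 * fst y < snd (snd y)"
      using regions(4)[OF conjunct1[OF y] conjunct2[OF y]] W0[of y] W0'[of y] by (auto simp: \<rho>_def v1_def v2_def P_def)
  next
    show "\<exists>r q wa. \<forall>y\<in>fan_region \<mu>0 \<beta>. \<rho> y = r \<and> P y = q \<and> (v1 y)\<^sup>2 + (v2 y)\<^sup>2 = wa"
    proof (rule exI[of _ r1], rule exI[of _ p], rule exI[of _ C1'], rule ballI)
      fix y assume y: "y \<in> fan_region \<mu>0 \<beta>"
      then have "fst y > 0" "\<mu>0 * fst y < snd (snd y)" "snd (snd y) < \<beta> * fst y" by (auto simp: fan_region_def)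
      from regions(2)[OF this] W0'[of y] sq1(2)[OF y]
      show "\<rho> y = r1 \<and> P y = p \<and> (v1 y)\<^sup>2 + (v2 y)\<^sup>2 = C1'" by (simp add: \<rho>_def v1_def v2_def P_def)
    qed
    show "\<exists>r q wa. \<forall>y\<in>fan_region \<beta> \<mu>2. \<rho> y = r \<and> P y = q \<and> (v1 y)\<^sup>2 + (v2 y)\<^sup>2 = wa"
    proof (rule exI[of _ r2], rule exI[of _ p], rule exI[of _ C2'], rule ballI)
      fix y assume y: "y \<in> fan_region \<beta> \<mu>2"
      then have "fst y > 0" "\<beta> * fst y < snd (snd y)" "snd (snd y) < \<mu>2 * fst y" by (auto simp: fan_region_def)
      from regions(3)[OF this] W0[of y] sq2(2)[OF y]
      show "\<rho> y = r2 \<and> P y = p \<and> (v1 y)\<^sup>2 + (v2 y)\<^sup>2 = C2'" by (simp add: \<rho>_def v1_def v2_def P_def)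
    qed
  qed
qed

section \<open>Perturbed shocks\<close>

lemma entr_eq: "q > 0 \<Longrightarrow> r > 0 \<Longrightarrow> entr cv r q = cv * ln q - (cv + 1) * ln r"
  by (simp add: entr_def ln_div ln_powr)

text \<open>The entropy increase across a shock of pressure ratio \<open>x\<close>, the density ratio being
  \<open>(a x + 1) / (x + a)\<close> by the Hugoniot relation.\<close>

lemma hugoniot_entropy:
  fixes cv x :: real
  assumes cv: "cv > 0" and x: "x > 1"
  defines "a \<equiv> 2 * cv + 1"
  shows "(cv + 1) * (ln (a * x + 1) - ln (x + a)) < cv * ln x"
proof -
  define h where "h x = cv * ln x - (cv + 1) * (ln (a * x + 1) - ln (x + a))" for x
  have a: "a > 1" using cv by (simp add: a_def)
  have d: "(h has_real_derivative cv * a * (t - 1)\<^sup>2 / (t * (a * t + 1) * (t + a))) (at t)" if t: "t > 0" for t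
  proof -
    have p: "a * t + 1 > 0" "t + a > 0" using a t by (auto intro: add_pos_pos)
    have "(h has_real_derivative cv * (1 / t) - (cv + 1) * (a / (a * t + 1) - 1 / (t + a))) (at t)"
      unfolding h_def using p t by (auto intro!: derivative_eq_intros)
    moreover have "cv * (1 / t) - (cv + 1) * (a / (a * t + 1) - 1 / (t + a)) = cv * a * (t - 1)\<^sup>2 / (t * (a * t + 1) * (t + a))"
    proof -
      have c: "cv = (a - 1) / 2" by (simp add: a_def)
      \<comment> \<open>The value a = 2 cv + 1 makes the numerator a multiple of the square (t -
        1)^2, so the entropy is strictly increasing past the trivial shock t = 1.\<close>
      have "cv * (a * t + 1) * (t + a) - (cv + 1) * (a * (t + a) - (a * t + 1)) * t = cv * a * (t - 1)\<^sup>2"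
        unfolding c by (simp add: field_simps power2_eq_square)
      moreover have "cv * (1 / t) - (cv + 1) * (a / u - 1 / v) = (cv * u * v - (cv + 1) * (a * v - u) * t) / (t * u * v)"
        if "u > 0" "v > 0" for u v using that t by (simp add: field_simps)
      ultimately show ?thesis using p by simp
    qed
    ultimately show ?thesis by simp
  qed
  have "\<exists>z>1. z < x \<and> h x - h 1 = (x - 1) * (cv * a * (z - 1)\<^sup>2 / (z * (a * z + 1) * (z + a)))"
    using MVT2[of 1 x h "\<lambda>t. cv * a * (t - 1)\<^sup>2 / (t * (a * t + 1) * (t + a))"] x d by auto
  then obtain z where z: "z > 1" "h x - h 1 = (x - 1) * (cv * a * (z - 1)\<^sup>2 / (z * (a * z + 1) * (z + a)))" by auto
  have "a * z + 1 > 0" "z + a > 0" using a z by (auto intro: add_pos_pos)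
  then have "h x - h 1 > 0" using z x a cv by simp
  then show ?thesis by (simp add: h_def algebra_simps)
qed

text \<open>The jump conditions are rewritten in terms of the mass flux j > 0 and the specific
  volumes, where they become the Hugoniot relation. The Lax inequalities enter to show that the
  shock is compressive, from which the velocity drop and the strict entropy increase follow.\<close>

lemma shock1_relations:
  fixes cv rl ul pl ra um pm \<sigma> :: real
  assumes cv: "cv > 0" and pos: "rl > 0" "pl > 0" "ra > 0" "pm > 0" and sh: "shock1 cv (rl, ul, pl) (ra, um, pm) \<sigma>"
  shows "pl < pm" "um < ul" "1 / ra = 1 / rl - (ul - um)\<^sup>2 / (pm - pl)"
    "(ul - um)\<^sup>2 * (rl * ((2 * cv + 1) * pm + pl)) = 2 * cv * (pm - pl)\<^sup>2"
    "entr cv rl pl < entr cv ra pm"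
proof -
  define j where "j = ra * (um - \<sigma>)"
  define tl where "tl = 1 / rl"
  define ta where "ta = 1 / ra"
  have t: "tl > 0" "ta > 0" "rl * tl = 1" "ra * ta = 1" using pos by (simp_all add: tl_def ta_def)
  have j0: "j > 0" and sl: "sound cv rl pl < ul - \<sigma>" and sr: "um - \<sigma> < sound cv ra pm"
    using sh pos by (auto simp: shock1_def j_def)
  have ja: "um - \<sigma> = j * ta" using pos by (simp add: j_def ta_def)
  have mass: "\<sigma> * (ra - rl) = ra * um - rl * ul" and mom: "\<sigma> * (ra * um - rl * ul) = (ra * um\<^sup>2 + pm) - (rl * ul\<^sup>2 + pl)"
    and en: "\<sigma> * ((ra * um\<^sup>2 / 2 + cv * pm) - (rl * ul\<^sup>2 / 2 + cv * pl)) = (ra * um\<^sup>2 / 2 + cv * pm + pm) * um - (rl * ul\<^sup>2 / 2 + cv * pl + pl) * ul"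
    using sh by (simp_all add: shock1_def RH1D_def energy_def)
  have jl': "rl * (ul - \<sigma>) = j" using mass by (simp add: j_def algebra_simps)
  then have jl: "ul - \<sigma> = j * tl" using pos by (simp add: tl_def field_simps)
  have "pm - pl = rl * ul * (ul - \<sigma>) - ra * um * (um - \<sigma>)" using mom by (simp add: algebra_simps power2_eq_square)
  also have "\<dots> = (rl * (ul - \<sigma>)) * ul - (ra * (um - \<sigma>)) * um" by (simp add: algebra_simps)
  also have "\<dots> = j * (ul - um)" unfolding jl' by (simp add: j_def algebra_simps)
  finally have pj: "pm - pl = j * (ul - um)" .
  have dj: "ul - um = j * (tl - ta)" using ja jl by (simp add: algebra_simps)
  have pj2: "pm - pl = j\<^sup>2 * (tl - ta)" using pj dj by (simp add: power2_eq_square)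
  have halve: "X / 2 + a - b = c \<Longrightarrow> X + 2 * a - 2 * b = 2 * c" for X a b c :: real by (simp add: field_simps)
  have "j * (ul\<^sup>2 - um\<^sup>2) / 2 + cv * pl * (ul - \<sigma>) - cv * pm * (um - \<sigma>) = pm * um - pl * ul"
  proof -
    have "j * (ul\<^sup>2 - um\<^sup>2) / 2 = (rl * (ul - \<sigma>)) * ul\<^sup>2 / 2 - (ra * (um - \<sigma>)) * um\<^sup>2 / 2" unfolding jl' j_def[symmetric] by (simp add: algebra_simps diff_divide_distrib)
    then show ?thesis using en by (simp add: algebra_simps power2_eq_square diff_divide_distrib add_divide_distrib)
  qed
  moreover have "j * (ul\<^sup>2 - um\<^sup>2) = (pm - pl) * (ul + um)" unfolding pj by (simp add: algebra_simps power2_eq_square)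
  ultimately have "(pm - pl) * (ul + um) / 2 + cv * pl * (j * tl) - cv * pm * (j * ta) = pm * um - pl * ul"
    using ja jl by simp
  then have "(pm - pl) * (ul + um) + 2 * (cv * pl * (j * tl)) - 2 * (cv * pm * (j * ta)) = 2 * (pm * um - pl * ul)"
    by (rule halve)
  then have "(pm + pl) * (ul - um) = 2 * cv * j * (pm * ta - pl * tl)" by (simp add: algebra_simps)
  then have "j * ((pm + pl) * (tl - ta)) = j * (2 * cv * (pm * ta - pl * tl))" using dj by (simp add: algebra_simps)
  then have "(pm + pl) * (tl - ta) = 2 * cv * (pm * ta - pl * tl)" using j0 by simp
  then have hug: "ta * ((2 * cv + 1) * pm + pl) = tl * ((2 * cv + 1) * pl + pm)" by (simp add: algebra_simps)
  \<comment> \<open>The Lax inequalities squared: the flow is supersonic ahead of the shock and, in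
    \<open>sr2\<close>, subsonic behind it, relative to the shock.\<close>
  have sl2: "(1 + 1 / cv) * pl < j\<^sup>2 * tl"
  proof -
    have n: "0 \<le> (1 + 1 / cv) * pl / rl" using cv pos by simp
    have "(sqrt ((1 + 1 / cv) * pl / rl))\<^sup>2 < (ul - \<sigma>)\<^sup>2" by (rule power_strict_mono) (use sl n in \<open>auto simp: sound_def\<close>)
    then have "(1 + 1 / cv) * pl / rl < (ul - \<sigma>)\<^sup>2" using n by simp
    then have "tl * ((1 + 1 / cv) * pl) < tl * (j\<^sup>2 * tl)" by (simp add: jl power2_eq_square tl_def field_simps)
    then show ?thesis using t by simp
  qed
  have sr2: "j\<^sup>2 * ta < (1 + 1 / cv) * pm"
  proof -
    have n: "0 \<le> (1 + 1 / cv) * pm / ra" using cv pos by simp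
    have "(um - \<sigma>)\<^sup>2 < (sqrt ((1 + 1 / cv) * pm / ra))\<^sup>2"
      by (rule power_strict_mono) (use sr ja j0 t in \<open>auto simp: sound_def\<close>)
    then have "(um - \<sigma>)\<^sup>2 < (1 + 1 / cv) * pm / ra" using n by simp
    then have "ta * (j\<^sup>2 * ta) < ta * ((1 + 1 / cv) * pm)" by (simp add: ja power2_eq_square ta_def field_simps)
    then show ?thesis using t by simp
  qed
  have q: "(2 * cv + 1) * pm + pl > 0" "(2 * cv + 1) * pl + pm > 0" using cv pos by (auto intro!: add_pos_pos)
  show pp: "pl < pm"
  \<comment> \<open>If the pressure did not rise, the Hugoniot relation would make the volume not
    fall, and then the flow could not pass from supersonic to subsonic.\<close>
  proof (rule ccontr)
    assume c: "\<not> pl < pm"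
    then have "2 * cv * pm \<le> 2 * cv * pl" using cv by simp
    then have "tl * ((2 * cv + 1) * pm + pl) \<le> ta * ((2 * cv + 1) * pm + pl)" unfolding hug
      using t by (intro mult_left_mono) (auto simp: algebra_simps)
    then have "tl \<le> ta" using q by simp
    then have "j\<^sup>2 * tl \<le> j\<^sup>2 * ta" by (intro mult_left_mono) auto
    moreover have "(1 + 1 / cv) * pm \<le> (1 + 1 / cv) * pl" using c cv by (intro mult_left_mono) auto
    ultimately show False using sl2 sr2 by linarith
  qed
  have "j * (ul - um) > 0" using pj pp by simp
  then show dd: "um < ul" using j0 by (simp add: zero_less_mult_iff)
  have d2: "(ul - um)\<^sup>2 = (pm - pl) * (tl - ta)" unfolding pj2 dj by (simp add: power2_eq_square algebra_simps)
  then show "1 / ra = 1 / rl - (ul - um)\<^sup>2 / (pm - pl)" using pp by (simp add: tl_def ta_def)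
  have "(tl - ta) * ((2 * cv + 1) * pm + pl) = tl * (2 * cv * (pm - pl))" using hug by (simp add: algebra_simps)
  then have "rl * ((tl - ta) * ((2 * cv + 1) * pm + pl)) = (rl * tl) * (2 * cv * (pm - pl))" by (simp only: mult.assoc)
  then have Q: "rl * ((tl - ta) * ((2 * cv + 1) * pm + pl)) = 2 * cv * (pm - pl)" unfolding t(3) by simp
  show "(ul - um)\<^sup>2 * (rl * ((2 * cv + 1) * pm + pl)) = 2 * cv * (pm - pl)\<^sup>2"
  proof -
    have "(pm - pl) * (tl - ta) * (rl * ((2 * cv + 1) * pm + pl)) = (pm - pl) * (rl * ((tl - ta) * ((2 * cv + 1) * pm + pl)))"
      by (simp only: mult_ac)
    then show ?thesis unfolding d2 Q by (simp add: power2_eq_square)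
  qed
  define x where "x = pm / pl"
  define a where "a = 2 * cv + 1"
  have x: "x > 1" "pm = x * pl" using pp pos by (simp_all add: x_def)
  have a: "a > 0" using cv by (simp add: a_def)
  have px: "a * x + 1 > 0" "x + a > 0" using a x by (auto intro: add_pos_pos)
  have "ra * (x + a) = rl * (a * x + 1)"
  proof -
    have "pl * (ta * (a * x + 1)) = pl * (tl * (a + x))" using hug unfolding x(2) a_def by (simp add: algebra_simps)
    then have "ta * (a * x + 1) = tl * (a + x)" using pos by simp
    then show ?thesis using pos by (simp add: ta_def tl_def field_simps)
  qed
  then have "ln ra + ln (x + a) = ln rl + ln (a * x + 1)" using pos px by (metis ln_mult_pos)
  then have "(cv + 1) * (ln (a * x + 1) - ln (x + a)) = (cv + 1) * ln ra - (cv + 1) * ln rl"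
    by (simp flip: right_diff_distrib)
  moreover have "(cv + 1) * (ln (a * x + 1) - ln (x + a)) < cv * ln x" unfolding a_def by (rule hugoniot_entropy[OF cv x(1)])
  moreover have "ln pm = ln x + ln pl" unfolding x(2) using x pos by (simp add: ln_mult_pos)
  ultimately show "entr cv rl pl < entr cv ra pm" using pos by (simp add: entr_eq algebra_simps)
qed

text \<open>The jump conditions and the entropy inequality between the outer state and a fan region of density \<open>r\<close>
  and pressure \<open>p\<close> whose velocity has mean \<open>(0, \<beta>)\<close> and component variances \<open>A\<close>, \<open>B\<close>; the fluctuations act
  as an additional pressure \<open>\<delta> = r B\<close>, which must agree on both sides of the central wave.\<close>

definition fan_shock :: "real \<Rightarrow> real \<Rightarrow> real \<Rightarrow> real \<Rightarrow> real \<Rightarrow> real \<Rightarrow> real \<Rightarrow> real \<Rightarrow> real \<Rightarrow> real \<Rightarrow> real \<Rightarrow> bool" where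
  "fan_shock cv rl ul pl \<beta> p \<delta> r A B \<mu> \<longleftrightarrow> r > 0 \<and> A > 0 \<and> B > 0 \<and> r * B = \<delta> \<and> \<mu> < \<beta> \<and>
     \<mu> * (r - rl) = r * \<beta> - rl * ul \<and>
     \<mu> * (r * \<beta> - rl * ul) = (r * (\<beta>\<^sup>2 + B) + p) - (rl * ul\<^sup>2 + pl) \<and>
     \<mu> * ((r * (\<beta>\<^sup>2 + A + B) / 2 + cv * p) - (rl * ul\<^sup>2 / 2 + cv * pl)) = (r * (\<beta>\<^sup>2 + A + B) / 2 + cv * p + p) * \<beta> - (rl * ul\<^sup>2 / 2 + cv * pl + pl) * ul \<and>
     \<mu> * (r * entr cv r p - rl * entr cv rl pl) \<le> r * entr cv r p * \<beta> - rl * entr cv rl pl * ul"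

lemma fan_shockD:
  assumes "fan_shock cv rl ul pl \<beta> p \<delta> r A B \<mu>"
  shows "r > 0" "A > 0" "B > 0" "r * B = \<delta>" "\<mu> < \<beta>"
     "\<mu> * (r - rl) = r * \<beta> - rl * ul"
     "\<mu> * (r * \<beta> - rl * ul) = (r * (\<beta>\<^sup>2 + B) + p) - (rl * ul\<^sup>2 + pl)"
     "\<mu> * ((r * (\<beta>\<^sup>2 + A + B) / 2 + cv * p) - (rl * ul\<^sup>2 / 2 + cv * pl)) = (r * (\<beta>\<^sup>2 + A + B) / 2 + cv * p + p) * \<beta> - (rl * ul\<^sup>2 / 2 + cv * pl + pl) * ul"
     "\<mu> * (r * entr cv r p - rl * entr cv rl pl) \<le> r * entr cv r p * \<beta> - rl * entr cv rl pl * ul"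
  using assms unfolding fan_shock_def by simp_all

text \<open>The reflection of x2 changes the signs of normal velocities and speeds, so the right
  interface inherits everything from the left one.\<close>

lemma fan_shock_mirror:
  assumes "fan_shock cv rr (- ur) pr (- \<beta>) p \<delta> r A B (- \<mu>)"
  shows "\<mu> * (rr - r) = rr * ur - r * \<beta>"
    "\<mu> * (rr * ur - r * \<beta>) = (rr * ur\<^sup>2 + pr) - (r * (\<beta>\<^sup>2 + B) + p)"
    "\<mu> * ((rr * ur\<^sup>2 / 2 + cv * pr) - (r * (\<beta>\<^sup>2 + A + B) / 2 + cv * p)) = (rr * ur\<^sup>2 / 2 + cv * pr + pr) * ur - (r * (\<beta>\<^sup>2 + A + B) / 2 + cv * p + p) * \<beta>"
    "\<mu> * (rr * entr cv rr pr - r * entr cv r p) \<le> rr * entr cv rr pr * ur - r * entr cv r p * \<beta>"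
proof -
  note E = fan_shockD[OF assms]
  show "\<mu> * (rr - r) = rr * ur - r * \<beta>" using E(6) by (simp add: algebra_simps)
  show "\<mu> * (rr * ur - r * \<beta>) = (rr * ur\<^sup>2 + pr) - (r * (\<beta>\<^sup>2 + B) + p)" using E(7) by (simp add: algebra_simps)
  show "\<mu> * ((rr * ur\<^sup>2 / 2 + cv * pr) - (r * (\<beta>\<^sup>2 + A + B) / 2 + cv * p)) = (rr * ur\<^sup>2 / 2 + cv * pr + pr) * ur - (r * (\<beta>\<^sup>2 + A + B) / 2 + cv * p + p) * \<beta>"
  proof -
    have *: "- \<mu> * (X - Y) = (X + p) * (- \<beta>) - Z * (- ur) \<Longrightarrow> \<mu> * (Y - X) = Z * ur - (X + p) * \<beta>" for X Y Z
      by (simp add: algebra_simps)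
    show ?thesis by (rule *[OF E(8)[unfolded power2_minus]])
  qed
  show "\<mu> * (rr * entr cv rr pr - r * entr cv r p) \<le> rr * entr cv rr pr * ur - r * entr cv r p * \<beta>" using E(9) by (simp add: algebra_simps)
qed

text \<open>The total normal pressure p + \<delta> and the velocity jump determine the mass flux j
  by momentum, then r and the speed by mass. The energy equation is linear in A and is solved for
  it. What is left to be ensured is A > 0 and the entropy inequality.\<close>

lemma fan_shock_intro:
  fixes cv rl ul pl \<beta> p \<delta> r A B \<mu> :: real
  assumes r: "r > 0" "rl > 0" and P: "pl < p + \<delta>" and ul: "\<beta> < ul" and ir: "1 / r = 1 / rl - (ul - \<beta>)\<^sup>2 / (p + \<delta> - pl)"
    and d: "\<delta> > 0" and j: "j = (p + \<delta> - pl) / (ul - \<beta>)" and B: "B = \<delta> / r" and ent: "entr cv rl pl \<le> entr cv r p"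
    and A: "A > 0" "A = ul\<^sup>2 - \<beta>\<^sup>2 + 2 * cv * (pl / rl - p / r) + 2 * (pl * ul - p * \<beta>) / j - B"
  shows "fan_shock cv rl ul pl \<beta> p \<delta> r A B (ul - j / rl)"
proof -
  define \<mu> where "\<mu> = ul - j / rl"
  have j0: "j > 0" using P ul j by simp
  have jd: "p + \<delta> - pl = j * (ul - \<beta>)" using ul by (simp add: j)
  have jl: "rl * (ul - \<mu>) = j" using r by (simp add: \<mu>_def)
  have "(ul - \<beta>)\<^sup>2 / (p + \<delta> - pl) = (ul - \<beta>) / j" unfolding jd using ul by (simp add: power2_eq_square)
  then have "1 / r = 1 / rl - (ul - \<beta>) / j" using ir by simp
  then have "j * (1 / r) = j * (1 / rl) - j * ((ul - \<beta>) / j)" by (simp only: right_diff_distrib)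
  then have "j / r = j / rl - (ul - \<beta>)" using j0 by simp
  then have jr': "\<beta> - \<mu> = j / r" by (simp add: \<mu>_def)
  then have jr: "r * (\<beta> - \<mu>) = j" using r by simp
  have m: "\<mu> < \<beta>" using jr' j0 r by (metis diff_gt_0_iff_gt divide_pos_pos)
  have B': "B > 0" "r * B = \<delta>" using B d r by simp_all
  have mass: "\<mu> * (r - rl) = r * \<beta> - rl * ul" using jl jr by (simp add: algebra_simps)
  have mom: "\<mu> * (r * \<beta> - rl * ul) = (r * (\<beta>\<^sup>2 + B) + p) - (rl * ul\<^sup>2 + pl)"
  proof -
    have "(rl * (ul - \<mu>)) * ul - (r * (\<beta> - \<mu>)) * \<beta> = p + \<delta> - pl" unfolding jl jr jd by (simp add: algebra_simps)
    then show ?thesis using B'(2) by (simp add: algebra_simps power2_eq_square)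
  qed
  have en: "\<mu> * ((r * (\<beta>\<^sup>2 + A + B) / 2 + cv * p) - (rl * ul\<^sup>2 / 2 + cv * pl)) = (r * (\<beta>\<^sup>2 + A + B) / 2 + cv * p + p) * \<beta> - (rl * ul\<^sup>2 / 2 + cv * pl + pl) * ul"
  proof -
    define C where "C = \<beta>\<^sup>2 + A + B"
    have "j * C = j * ul\<^sup>2 + 2 * cv * (pl * (j / rl) - p * (j / r)) + 2 * (pl * ul - p * \<beta>)"
      unfolding C_def A(2) using j0 r by (simp add: field_simps)
    also have "j / rl = ul - \<mu>" by (simp add: \<mu>_def)
    also have "j / r = \<beta> - \<mu>" using jr' by simp
    finally have "r * (\<beta> - \<mu>) * C = rl * (ul - \<mu>) * ul\<^sup>2 + 2 * cv * (pl * (ul - \<mu>) - p * (\<beta> - \<mu>)) + 2 * (pl * ul - p * \<beta>)"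
      using jl jr by simp
    then show ?thesis unfolding C_def[symmetric] by (simp add: algebra_simps)
  qed
  have "j * entr cv rl pl \<le> j * entr cv r p" using ent j0 by simp
  then have "rl * (ul - \<mu>) * entr cv rl pl \<le> r * (\<beta> - \<mu>) * entr cv r p" using jl jr by simp
  then have "\<mu> * (r * entr cv r p - rl * entr cv rl pl) \<le> r * entr cv r p * \<beta> - rl * entr cv rl pl * ul" by (simp add: algebra_simps)
  then show ?thesis unfolding \<mu>_def[symmetric] fan_shock_def using r A(1) B' m mass mom en by blast
qed

text \<open>The two parameters are chosen one after the other. A positive \<epsilon> lowers the
  total normal pressure and makes A positive already at \<delta> = 0; the entropy inequality is
  strict at the unperturbed shock. Both are open conditions, so a small \<delta> > 0 can be traded
  for normal variance afterwards. The form with eventualities permits a common choice for both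
  shocks.\<close>

lemma fan_shock_exists:
  fixes cv rl ul pl ra um pm \<sigma> :: real
  assumes cv: "cv > 0" and pos: "rl > 0" "pl > 0" "ra > 0" "pm > 0" and sh: "shock1 cv (rl, ul, pl) (ra, um, pm) \<sigma>"
  shows "\<forall>\<^sub>F \<epsilon> in at_right 0. \<forall>\<^sub>F \<delta> in at_right 0. \<exists>r A B \<mu>. fan_shock cv rl ul pl um (pm - \<epsilon> - \<delta>) \<delta> r A B \<mu>"
proof -
  note R = shock1_relations[OF cv pos sh]
  define d where "d = ul - um"
  define \<tau> where "\<tau> \<epsilon> = 1 / rl - d\<^sup>2 / (pm - \<epsilon> - pl)" for \<epsilon>
  have d0: "d > 0" using R(2) by (simp add: d_def)
  have \<tau>0: "\<tau> 0 = 1 / ra" using R(3) by (simp add: \<tau>_def d_def)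
  have "isCont \<tau> 0" unfolding \<tau>_def using R(1) by (intro continuous_intros) auto
  then have lt: "(\<tau> \<longlongrightarrow> 1 / ra) (at_right 0)" unfolding \<tau>0[symmetric] isCont_def by (rule tendsto_within_subset) simp
  have lr: "((\<lambda>\<epsilon>. 1 / \<tau> \<epsilon>) \<longlongrightarrow> ra) (at_right 0)" using tendsto_divide[OF tendsto_const[of 1] lt] pos by simp
  have lim: "((\<lambda>\<epsilon>. cv * ln (pm - \<epsilon>) - (cv + 1) * ln (1 / \<tau> \<epsilon>)) \<longlongrightarrow> cv * ln (pm - 0) - (cv + 1) * ln ra) (at_right 0)"
    using pos by (intro tendsto_intros lr) auto
  have e1: "\<forall>\<^sub>F \<epsilon> in at_right 0. \<tau> \<epsilon> > 0" using order_tendstoD(1)[OF lt, of 0] pos by simp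
  have e2: "\<forall>\<^sub>F \<epsilon> in at_right 0. entr cv rl pl < cv * ln (pm - \<epsilon>) - (cv + 1) * ln (1 / \<tau> \<epsilon>)"
    using order_tendstoD(1)[OF lim] R(5) pos by (simp add: entr_eq)
  have e3: "\<forall>\<^sub>F \<epsilon> in at_right 0. \<epsilon> > 0 \<and> \<epsilon> < pm - pl" using R(1) by (auto simp: eventually_at_right[of 0 1] intro!: exI[of _ "pm - pl"])
  show ?thesis using e1 e2 e3
  proof eventually_elim
    case (elim \<epsilon>)
    define P where "P = pm - \<epsilon>"
    define r where "r = 1 / \<tau> \<epsilon>"
    define j where "j = (P - pl) / d"
    \<comment> \<open>The tangential variance forced by the energy equation. Density and mass flux
      depend on the total pressure P alone, so A is affine in \<delta>.\<close>
    define A where "A \<delta> = ul\<^sup>2 - um\<^sup>2 + 2 * cv * (pl / rl - (P - \<delta>) / r) + 2 * (pl * ul - (P - \<delta>) * um) / j - \<delta> / r" for \<delta>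
    have r0: "r > 0" using elim by (simp add: r_def)
    have Pp: "pl < P" "P < pm" using elim by (simp_all add: P_def)
    have j0: "j > 0" using Pp d0 by (simp add: j_def)
    \<comment> \<open>With x = P - pl, A at \<delta> = 0 is d^2 (a + b/x) - 2 cv x / rl, decreasing
      in x. At x = y, the unperturbed pressure jump, it is zero: \<open>a * y + b\<close> equals (2
      cv + 1) pm + pl, the factor in the velocity relation of the exact shock.\<close>
    have A0: "A 0 > 0"
    proof -
      define x where "x = P - pl"
      define y where "y = pm - pl"
      define a where "a = 2 * cv + 1"
      define b where "b = (a + 1) * pl"
      have x: "0 < x" "x < y" using Pp by (simp_all add: x_def y_def)
      have a: "a > 0" "b > 0" using cv pos by (simp_all add: a_def b_def)
      have ir: "1 / r = 1 / rl - d\<^sup>2 / x" by (simp add: r_def \<tau>_def x_def P_def)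
      have "A 0 = d * (ul + um) + 2 * cv * (pl * (1 / rl) - P * (1 / r)) + 2 * d * (pl * ul - P * um) / x"
        by (simp add: A_def j_def x_def d_def power2_eq_square algebra_simps)
      also have "d * (ul + um) + 2 * cv * (pl * (1 / rl) - P * (1 / r)) + 2 * d * (pl * ul - P * um) / x
          = d\<^sup>2 * (a * x + b) / x - 2 * cv * x / rl"
      proof -
        have *: "pl = P - x" "ul = um + d" by (simp_all add: x_def d_def)
        show ?thesis unfolding ir a_def b_def * using x pos by (simp add: field_simps power2_eq_square)
      qed
      finally have Ae: "A 0 = d\<^sup>2 * (a * x + b) / x - 2 * cv * x / rl" .
      have dd: "d\<^sup>2 * (rl * (a * y + b)) = 2 * cv * y\<^sup>2" using R(4) by (simp add: d_def a_def b_def y_def algebra_simps)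
      have yb: "a * y + b > 0" using a x by (intro add_pos_pos mult_pos_pos) auto
      \<comment> \<open>The monotonicity in x, cleared of denominators.\<close>
      have "x\<^sup>2 * (a * y + b) < y\<^sup>2 * (a * x + b)"
      proof -
        have "a * x * y * (y - x) > 0" using a x by simp
        moreover have "b * (y\<^sup>2 - x\<^sup>2) > 0" using a x by (simp add: power_strict_mono)
        ultimately show ?thesis by (simp add: algebra_simps power2_eq_square)
      qed
      then have "2 * cv * (x\<^sup>2 * (a * y + b)) < 2 * cv * (y\<^sup>2 * (a * x + b))" using cv by simp
      also have "\<dots> = (d\<^sup>2 * (rl * (a * y + b))) * (a * x + b)" unfolding dd by simp
      finally have "(2 * cv * x\<^sup>2) * (a * y + b) < (d\<^sup>2 * rl * (a * x + b)) * (a * y + b)" by (simp add: algebra_simps)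
      then have "2 * cv * x\<^sup>2 < d\<^sup>2 * rl * (a * x + b)" using yb by simp
      then show ?thesis unfolding Ae using x pos by (simp add: field_simps power2_eq_square)
    qed
    have lA: "(A \<longlongrightarrow> A 0) (at_right 0)" unfolding A_def using r0 j0 by (intro tendsto_eq_intros) auto
    have lE: "((\<lambda>\<delta>. cv * ln (P - \<delta>) - (cv + 1) * ln r) \<longlongrightarrow> cv * ln (P - 0) - (cv + 1) * ln r) (at_right 0)"
      using Pp pos by (intro tendsto_intros) auto
    have f1: "\<forall>\<^sub>F \<delta> in at_right 0. A \<delta> > 0" using order_tendstoD(1)[OF lA A0] .
    have f2: "\<forall>\<^sub>F \<delta> in at_right 0. entr cv rl pl < cv * ln (P - \<delta>) - (cv + 1) * ln r"
      using order_tendstoD(1)[OF lE] elim(2) by (simp add: P_def r_def)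
    have f3: "\<forall>\<^sub>F \<delta> in at_right 0. \<delta> > 0 \<and> \<delta> < P" using Pp pos by (auto simp: eventually_at_right[of 0 1] intro!: exI[of _ P])
    show ?case using f1 f2 f3
    proof eventually_elim
      case (elim \<delta>)
      have "fan_shock cv rl ul pl um (P - \<delta>) \<delta> r (A \<delta>) (\<delta> / r) (ul - j / rl)"
      proof (rule fan_shock_intro)
        show "1 / r = 1 / rl - (ul - um)\<^sup>2 / (P - \<delta> + \<delta> - pl)" by (simp add: r_def \<tau>_def P_def d_def)
        show "j = (P - \<delta> + \<delta> - pl) / (ul - um)" by (simp add: j_def d_def)
        show "entr cv rl pl \<le> entr cv r (P - \<delta>)" using elim r0 by (simp add: entr_eq)
      qed (use elim r0 pos Pp R(2) in \<open>auto simp: A_def\<close>)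
      then show ?case unfolding P_def by blast
    qed
  qed
qed

lemma shock3_mirror: "shock3 cv (rb, um, pm) (rr, ur, pr) \<sigma> \<Longrightarrow> shock1 cv (rr, - ur, pr) (rb, - um, pm) (- \<sigma>)"
  by (simp add: shock3_def shock1_def RH1D_def energy_def algebra_simps)

text \<open>Both shocks of the 1D solution end in the same velocity and pressure, even across a
  contact, so one pair \<epsilon>, \<delta> serves both; the 3-shock is treated as a reflected
  1-shock. Afterwards p and \<delta> agree on both sides while the densities may differ.\<close>

lemma fan_pair_exists:
  fixes cv rl pl rr pr :: real and vl vr :: "real \<times> real"
  assumes cv: "cv > 0" and pos: "rl > 0" "pl > 0" "rr > 0" "pr > 0" and R: "riemann_shock_shock cv rl vl pl rr vr pr"
  obtains \<beta> p \<delta> r1 A1 B1 \<mu>0 r2 A2 B2 \<mu>2 where "p > 0"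
    "fan_shock cv rl (snd vl) pl \<beta> p \<delta> r1 A1 B1 \<mu>0" "fan_shock cv rr (- snd vr) pr (- \<beta>) p \<delta> r2 A2 B2 (- \<mu>2)"
proof -
  obtain ra rb um pm \<sigma>1 \<sigma>3 where s: "ra > 0" "rb > 0" "pm > 0" "shock1 cv (rl, snd vl, pl) (ra, um, pm) \<sigma>1"
    "shock3 cv (rb, um, pm) (rr, snd vr, pr) \<sigma>3" using R by (auto simp: riemann_shock_shock_def)
  have "\<forall>\<^sub>F \<epsilon> in at_right 0. \<epsilon> < pm" using s by (auto simp: eventually_at_right[of 0 1] intro!: exI[of _ pm])
  then have "\<forall>\<^sub>F \<epsilon> in at_right 0. \<epsilon> < pm \<and> (\<forall>\<^sub>F \<delta> in at_right 0. \<exists>r A B \<mu>. fan_shock cv rl (snd vl) pl um (pm - \<epsilon> - \<delta>) \<delta> r A B \<mu>) \<and>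
     (\<forall>\<^sub>F \<delta> in at_right 0. \<exists>r A B \<mu>. fan_shock cv rr (- snd vr) pr (- um) (pm - \<epsilon> - \<delta>) \<delta> r A B \<mu>)"
    using fan_shock_exists[OF cv pos(1,2) s(1,3,4)] fan_shock_exists[OF cv pos(3,4) s(2,3) shock3_mirror[OF s(5)]]
    by eventually_elim simp
  from eventually_happens'[OF trivial_limit_at_right_real this] obtain \<epsilon> where e: "\<epsilon> < pm" "\<forall>\<^sub>F \<delta> in at_right 0. \<exists>r A B \<mu>. fan_shock cv rl (snd vl) pl um (pm - \<epsilon> - \<delta>) \<delta> r A B \<mu>"
    "\<forall>\<^sub>F \<delta> in at_right 0. \<exists>r A B \<mu>. fan_shock cv rr (- snd vr) pr (- um) (pm - \<epsilon> - \<delta>) \<delta> r A B \<mu>"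
    by (elim exE conjE)
  have "\<forall>\<^sub>F \<delta> in at_right 0. \<delta> < pm - \<epsilon>" using e(1) by (auto simp: eventually_at_right[of 0 1] intro!: exI[of _ "pm - \<epsilon>"])
  with e(2,3) have "\<forall>\<^sub>F \<delta> in at_right 0. \<delta> < pm - \<epsilon> \<and> (\<exists>r A B \<mu>. fan_shock cv rl (snd vl) pl um (pm - \<epsilon> - \<delta>) \<delta> r A B \<mu>) \<and>
     (\<exists>r A B \<mu>. fan_shock cv rr (- snd vr) pr (- um) (pm - \<epsilon> - \<delta>) \<delta> r A B \<mu>)"
    by eventually_elim simp
  from eventually_happens'[OF trivial_limit_at_right_real this] obtain \<delta> r1 A1 B1 \<mu>0 r2 A2 B2 \<mu> where f: "\<delta> < pm - \<epsilon>" "fan_shock cv rl (snd vl) pl um (pm - \<epsilon> - \<delta>) \<delta> r1 A1 B1 \<mu>0"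
     "fan_shock cv rr (- snd vr) pr (- um) (pm - \<epsilon> - \<delta>) \<delta> r2 A2 B2 \<mu>"
    by (elim exE conjE)
  show thesis by (rule that[of "pm - \<epsilon> - \<delta>" um \<delta> r1 A1 B1 \<mu>0 r2 A2 B2 "- \<mu>"]) (use f in auto)
qed

section \<open>A positive integrable weight on space-time\<close>

lemma integrable_prod_mult:
  fixes f :: "'a::euclidean_space \<Rightarrow> real" and g :: "'b::euclidean_space \<Rightarrow> real"
  assumes f: "integrable lborel f" and g: "integrable lborel g"
  shows "integrable lborel (\<lambda>y. f (fst y) * g (snd y))"
proof -
  have [measurable]: "f \<in> borel_measurable borel" "g \<in> borel_measurable borel" using f g by auto
  have "integrable (lborel \<Otimes>\<^sub>M lborel) (\<lambda>y. f (fst y) * g (snd y))"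
    by (rule lborel_pair.Fubini_integrable) (use f g in \<open>auto simp: abs_mult\<close>)
  then show ?thesis by (simp add: lborel_prod)
qed

lemma integrable_cauchy_density: "integrable lborel (\<lambda>x::real. 1 / (1 + x\<^sup>2))"
proof -
  have "set_integrable lborel (einterval (-\<infinity>) \<infinity>) (\<lambda>x. 1 / (1 + x\<^sup>2))"
  proof (rule interval_integral_FTC_nonneg(1)[where F = arctan and A = "-(pi/2)" and B = "pi/2"])
    show "((arctan \<circ> real_of_ereal) \<longlongrightarrow> - (pi / 2)) (at_right (- \<infinity>))"
      by (simp add: ereal_tendsto_simps tendsto_arctan_at_bot)
    show "((arctan \<circ> real_of_ereal) \<longlongrightarrow> pi / 2) (at_left \<infinity>)"
      by (simp add: ereal_tendsto_simps tendsto_arctan_at_top)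
    show "DERIV arctan x :> 1 / (1 + x\<^sup>2)" for x by (rule DERIV_arctan[THEN DERIV_cong]) (simp add: field_simps)
    show "isCont (\<lambda>x. 1 / (1 + x\<^sup>2)) x" for x :: real by (intro continuous_intros) (auto simp: add_nonneg_eq_0_iff)
  qed auto
  then show ?thesis by (simp add: set_integrable_def)
qed

text \<open>A product of Cauchy densities. It makes energies over the unbounded fan regions finite
  and, being positive, does not change null sets or almost everywhere limits.\<close>

definition weight :: "pt \<Rightarrow> real" where
  "weight y = 1 / (1 + (fst y)\<^sup>2) * (1 / (1 + (fst (snd y))\<^sup>2) * (1 / (1 + (snd (snd y))\<^sup>2)))"

lemma weight_props: "continuous_on UNIV weight" "integrable lborel weight" "weight y > 0"
proof -
  show "continuous_on UNIV weight" unfolding weight_def by (intro continuous_intros) (auto simp: add_nonneg_eq_0_iff)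
  show "integrable lborel weight" unfolding weight_def
    using integrable_prod_mult[OF integrable_cauchy_density integrable_prod_mult[OF integrable_cauchy_density integrable_cauchy_density]] by simp
  show "weight y > 0" unfolding weight_def by (intro mult_pos_pos divide_pos_pos add_pos_nonneg) auto
qed

section \<open>Infinitely many fan solutions\<close>

lemma vdot_integrable:
  assumes w: "wild \<Omega> zc C w" and g: "continuous_on UNIV g" "compact K" "\<And>y. y \<notin> K \<Longrightarrow> g y = 0"
  shows "integrable lborel (\<lambda>y. vdot (w y) (g y))"
proof -
  obtain B where B: "\<forall>y. \<bar>V1 (w y)\<bar> \<le> B \<and> \<bar>V2 (w y)\<bar> \<le> B \<and> \<bar>M1 (w y)\<bar> \<le> B \<and> \<bar>M2 (w y)\<bar> \<le> B" using wild_bound[OF w] by blast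
  note m = wild_measurable[OF w]
  have c: "continuous_on UNIV (\<lambda>y. fst (g y))" "continuous_on UNIV (\<lambda>y. snd (g y))" using g(1) by (intro continuous_intros; assumption)+
  have "integrable lborel (\<lambda>y. V1 (w y) * fst (g y))"
    by (rule tendsto_integral_mult_cc(2)[of "\<lambda>k y. V1 (w y)" _ B, OF m(1) m(1) _ _ c(1) g(2)]) (use B g(3) in auto)
  moreover have "integrable lborel (\<lambda>y. V2 (w y) * snd (g y))"
    by (rule tendsto_integral_mult_cc(2)[of "\<lambda>k y. V2 (w y)" _ B, OF m(2) m(2) _ _ c(2) g(2)]) (use B g(3) in auto)
  ultimately show ?thesis unfolding vdot_def by simp
qed

lemma vdot_diff: "vdot (v - w) f = vdot v f - vdot w f"
  by (simp add: vdot_def algebra_simps)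

lemma wild_near:
  assumes "C > 0" "open \<Omega>" "pwave \<Omega> w0" "\<And>y. y \<in> \<Omega> \<Longrightarrow> zc + w0 y \<in> subsol C"
    and "finite F" "\<And>f. f \<in> F \<Longrightarrow> continuous_on UNIV f" "\<And>f. f \<in> F \<Longrightarrow> \<exists>K. compact K \<and> (\<forall>y. y \<notin> K \<longrightarrow> f y = 0)"
    and "\<epsilon> > 0"
  shows "\<exists>w. wild \<Omega> zc C w \<and> (\<forall>f\<in>F. \<bar>LINT y|lborel. vdot (w y - w0 y) (f y)\<bar> \<le> \<epsilon>)"
  unfolding wild_def conj_assoc by (rule convex_integration[OF assms(1,2) weight_props assms(3-8)])

lemma wild_exists:
  assumes C: "C > 0" and op: "open \<Omega>" and zc: "zc \<in> subsol C"
  shows "\<exists>w. wild \<Omega> zc C w"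
  using convex_integration[OF C op weight_props pwave_zero, of zc "{}" 1] zc unfolding wild_def by auto

text \<open>Solution m starts from a copy \<open>Z m\<close> of one fixed wave, placed in the m-th
  ball, and convex integration preserves its pairings with \<open>g 0\<close>, ...,
  \<open>g m\<close> up to G/4. For n < m the pairing with \<open>g n\<close> is then close to G for
  solution n and close to 0 for solution m.\<close>

lemma wild_sequence:
  assumes C: "C > 0" and op: "open \<Omega>" and zc: "zc \<in> subsol C" and r: "r > 0"
    and sub: "\<And>n :: nat. ball (x n) r \<subseteq> \<Omega>" and disj: "\<And>n m. n \<noteq> m \<Longrightarrow> ball (x n) r \<inter> ball (x m) r = {}"
  shows "\<exists>w :: nat \<Rightarrow> pt \<Rightarrow> st. (\<forall>n. wild \<Omega> zc C (w n)) \<and>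
    (\<forall>n m. n \<noteq> m \<longrightarrow> \<not> (AE y in lborel. V1 (w n y) = V1 (w m y) \<and> V2 (w n y) = V2 (w m y)))"
proof -
  obtain \<beta> where \<beta>: "\<beta> > 0" and U: "\<forall>z0\<in>subsol C. \<exists>\<zeta> \<delta>. pwave (ball 0 1) \<zeta> \<and> \<delta> > 0 \<and>
    (\<forall>y z'. dist z' z0 < \<delta> \<longrightarrow> z' + \<zeta> y \<in> subsol C) \<and>
    (LINT y|lborel. (V1 (\<zeta> y))\<^sup>2 + (V2 (\<zeta> y))\<^sup>2) \<ge> \<beta> * (gap C z0)\<^sup>2 \<and>
    (\<forall>y. \<bar>V1 (\<zeta> y)\<bar> \<le> 1 + C \<and> \<bar>V2 (\<zeta> y)\<bar> \<le> 1 + C)"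
    using unit_wave[OF C] by (elim exE conjE)
  from U[rule_format, OF zc] obtain \<zeta> \<delta> where \<zeta>: "pwave (ball 0 1) \<zeta>" and d: "\<delta> > 0"
    and s: "\<forall>y z'. dist z' zc < \<delta> \<longrightarrow> z' + \<zeta> y \<in> subsol C"
    and L: "(LINT y|lborel. (V1 (\<zeta> y))\<^sup>2 + (V2 (\<zeta> y))\<^sup>2) \<ge> \<beta> * (gap C zc)\<^sup>2" by (elim exE conjE)
  have s': "zc + \<zeta> y \<in> subsol C" for y using s[THEN spec, THEN spec, of zc y] d by simp
  define G where "G = r^3 * (LINT y|lborel. (V1 (\<zeta> y))\<^sup>2 + (V2 (\<zeta> y))\<^sup>2)"
  have "\<beta> * (gap C zc)\<^sup>2 > 0" using \<beta> gap_pos[OF zc] by simp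
  then have G: "G > 0" unfolding G_def using L r by (intro mult_pos_pos) auto
  define Z where "Z n y = \<zeta> ((1/r) *\<^sub>R (y - x n))" for n y
  define g where "g n y = (V1 (Z n y), V2 (Z n y))" for n y
  have Zb: "pwave (ball (x n) r) (Z n)" for n
    unfolding Z_def by (rule pwave_affine[OF \<zeta> r]) (use r in \<open>auto simp: dist_norm\<close>)
  have Z: "pwave \<Omega> (Z n)" for n by (rule pwave_mono[OF Zb sub])
  have gc: "continuous_on UNIV (g n)" for n unfolding g_def by (intro continuous_intros pwave_cont[OF Z])
  have gK: "\<exists>K. compact K \<and> (\<forall>y. y \<notin> K \<longrightarrow> g n y = 0)" for n
  proof (intro exI conjI allI impI)
    show "compact (cball (x n) r)" by simp
    fix y assume "y \<notin> cball (x n) r"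
    then have "y \<notin> ball (x n) r" using ball_subset_cball by blast
    then show "g n y = 0" using pwave_outside[OF Zb] by (simp add: g_def zero_prod_def)
  qed
  have mZ: "(\<lambda>y. (V1 (Z n y))\<^sup>2 + (V2 (Z n y))\<^sup>2) \<in> borel_measurable borel" for n
    by (intro borel_measurable_continuous_onI continuous_intros pwave_cont[OF Z])
  have ZZ: "(LINT y|lborel. vdot (Z m y) (g n y)) = (if m = n then G else 0)" for m n
  proof (cases "m = n")
    case True
    have "(LINT y|lborel. (V1 (Z n y))\<^sup>2 + (V2 (Z n y))\<^sup>2) = G"
      unfolding integral_lborel_affine[OF mZ[of n] r, of "x n"] unfolding G_def Z_def using r by simp
    then show ?thesis using True by (simp add: vdot_def g_def power2_eq_square)
  next
    case False
    have "vdot (Z m y) (g n y) = 0" for y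
    proof (cases "y \<in> ball (x n) r")
      case True
      then have "y \<notin> ball (x m) r" using disj[OF False] by blast
      then show ?thesis using pwave_outside[OF Zb] by (simp add: vdot_def)
    next
      case False
      then show ?thesis using pwave_outside[OF Zb] by (simp add: vdot_def g_def)
    qed
    then show ?thesis using False by simp
  qed
  \<comment> \<open>Only finitely many fields can be controlled at once; those with index up to m
    suffice, since the smaller of two indices is the one tested.\<close>
  have "\<forall>m. \<exists>w. wild \<Omega> zc C w \<and> (\<forall>f\<in>g ` {..m}. \<bar>LINT y|lborel. vdot (w y - Z m y) (f y)\<bar> \<le> G / 4)"
  proof
    fix m
    show "\<exists>w. wild \<Omega> zc C w \<and> (\<forall>f\<in>g ` {..m}. \<bar>LINT y|lborel. vdot (w y - Z m y) (f y)\<bar> \<le> G / 4)"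
    proof (rule wild_near[OF C op Z])
      show "zc + Z m y \<in> subsol C" for y unfolding Z_def by (rule s')
      show "continuous_on UNIV f" if "f \<in> g ` {..m}" for f using that gc by auto
      show "\<exists>K. compact K \<and> (\<forall>y. y \<notin> K \<longrightarrow> f y = 0)" if "f \<in> g ` {..m}" for f using that gK by (elim imageE) simp
    qed (use G in simp_all)
  qed
  from choice[OF this] obtain w where W: "\<forall>m. wild \<Omega> zc C (w m) \<and> (\<forall>f\<in>g ` {..m}. \<bar>LINT y|lborel. vdot (w m y - Z m y) (f y)\<bar> \<le> G / 4)" ..
  have w: "wild \<Omega> zc C (w m)" for m by (rule W[THEN spec, THEN conjunct1])
  have near: "\<bar>LINT y|lborel. vdot (w m y - Z m y) (g n y)\<bar> \<le> G / 4" if "n \<le> m" for m n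
    by (rule W[THEN spec, THEN conjunct2, THEN bspec]) (use that in simp)
  have iw: "integrable lborel (\<lambda>y. vdot (w m y) (g n y))" for m n using gK[of n] vdot_integrable[OF w gc] by blast
  have iZ: "integrable lborel (\<lambda>y. vdot (Z m y) (g n y))" for m n
    unfolding vdot_def by (intro Bochner_Integration.integrable_add pwave_integrable[OF Z] continuous_intros gc)
  have ws: "\<bar>(LINT y|lborel. vdot (w m y) (g n y)) - (if m = n then G else 0)\<bar> \<le> G / 4" if "n \<le> m" for m n
    using near[OF that] unfolding vdot_diff Bochner_Integration.integral_diff[OF iw iZ] ZZ .
  have ne: "\<not> (AE y in lborel. V1 (w n y) = V1 (w m y) \<and> V2 (w n y) = V2 (w m y))" if nm: "n < m" for n m
  proof
    assume "AE y in lborel. V1 (w n y) = V1 (w m y) \<and> V2 (w n y) = V2 (w m y)"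
    then have "AE y in lborel. vdot (w n y) (g n y) = vdot (w m y) (g n y)" by eventually_elim (simp add: vdot_def)
    then have "(LINT y|lborel. vdot (w n y) (g n y)) = (LINT y|lborel. vdot (w m y) (g n y))"
      by (intro integral_cong_AE borel_measurable_integrable[OF iw])
    then show False using ws[of n n] ws[of n m] nm G by auto
  qed
  show ?thesis
  proof (intro exI[of _ w] conjI allI impI)
    fix n m :: nat assume "n \<noteq> m"
    then consider "n < m" | "m < n" by linarith
    then show "\<not> (AE y in lborel. V1 (w n y) = V1 (w m y) \<and> V2 (w n y) = V2 (w m y))"
      using ne[of n m] ne[of m n] by cases (auto simp: eq_commute)
  qed (rule w)
qed

lemma open_fan_region: "open (fan_region a b)"
  unfolding fan_region_def by (intro open_Collect_conj open_Collect_less continuous_intros)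

text \<open>The region is invariant in x1, so one ball inside it can be translated along x1 by
  multiples of its diameter.\<close>

lemma fan_region_disjoint_balls:
  assumes "a < b"
  shows "\<exists>r (x :: nat \<Rightarrow> pt). r > 0 \<and> (\<forall>n. ball (x n) r \<subseteq> fan_region a b) \<and> (\<forall>n m. n \<noteq> m \<longrightarrow> ball (x n) r \<inter> ball (x m) r = {})"
proof -
  have "(1, 0, (a + b) / 2) \<in> fan_region a b" using assms by (simp add: fan_region_def)
  then obtain r where r: "r > 0" "ball (1, 0, (a + b) / 2) r \<subseteq> fan_region a b" using open_fan_region openE by metis
  define x :: "nat \<Rightarrow> pt" where "x n = (1, 2 * r * real n, (a + b) / 2)" for n
  have "ball (x n) r \<subseteq> fan_region a b" for n
  proof
    fix y assume "y \<in> ball (x n) r"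
    then have "y - (0, 2 * r * real n, 0) \<in> ball (1, 0, (a + b) / 2) r" by (cases y) (simp add: dist_norm x_def)
    then have "y - (0, 2 * r * real n, 0) \<in> fan_region a b" using r(2) by blast
    then show "y \<in> fan_region a b" by (simp add: fan_region_def)
  qed
  moreover have "ball (x n) r \<inter> ball (x m) r = {}" if "n \<noteq> m" for n m
  proof (rule disjoint_ballI)
    have "1 \<le> \<bar>real n - real m\<bar>" using that by linarith
    then have "2 * r * 1 \<le> 2 * r * \<bar>real n - real m\<bar>" using r(1) by (intro mult_left_mono) auto
    also have "\<dots> = \<bar>2 * r * real n - 2 * r * real m\<bar>" using r(1) by (simp add: abs_mult flip: right_diff_distrib)
    also have "\<dots> = dist (x n) (x m)" by (simp add: x_def dist_Pair_Pair dist_real_def)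
    finally show "r + r \<le> dist (x n) (x m)" by simp
  qed
  ultimately show ?thesis using r(1) by (intro exI[of _ r] exI[of _ x]) simp
qed

theorem theorem3p1:
  fixes cv rl pl rr pr :: real and vl vr :: "real \<times> real"
  assumes "cv > 1/2"
    and "rl > 0" and "pl > 0" and "rr > 0" and "pr > 0"
    and "fst vl = 0" and "fst vr = 0"
    and "riemann_shock_shock cv rl vl pl rr vr pr"
  shows "\<exists>S. infinite S \<and>
     (\<forall>U\<in>S. case U of (\<rho>, v1, v2, p) \<Rightarrow>
        admissible_sol cv rl vl pl rr vr pr \<rho> v1 v2 p \<and> is_2fan rl vl pl rr vr pr \<rho> v1 v2 p) \<and>
     (\<forall>U\<in>S. \<forall>W\<in>S. U \<noteq> W \<longrightarrow> \<not> (AE y in lborel. y \<in> Hplus \<longrightarrow> qval U y = qval W y))"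
proof -
  have cv: "cv > 0" using assms(1) by simp
  have vlr: "vl = (0, snd vl)" "vr = (0, snd vr)" using assms(6,7) by (metis prod.collapse)+
  obtain \<beta> p \<delta> r1 A1 B1 \<mu>0 r2 A2 B2 \<mu>2 where p: "p > 0" and L: "fan_shock cv rl (snd vl) pl \<beta> p \<delta> r1 A1 B1 \<mu>0"
    and R: "fan_shock cv rr (- snd vr) pr (- \<beta>) p \<delta> r2 A2 B2 (- \<mu>2)"
    by (rule fan_pair_exists[OF cv assms(2-5,8)])
  have L': "r1 > 0" "A1 > 0" "B1 > 0" "r1 * B1 = \<delta>" "\<mu>0 < \<beta>" and R': "r2 > 0" "A2 > 0" "B2 > 0" "r2 * B2 = \<delta>" "\<beta> < \<mu>2"
    using L R by (simp_all add: fan_shock_def)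
  let ?C1 = "\<beta>\<^sup>2 + A1 + B1" and ?C2 = "\<beta>\<^sup>2 + A2 + B2"
  have C: "?C1 > 0" "?C2 > 0" using L' R' by (simp_all add: add_nonneg_pos)
  obtain r and x :: "nat \<Rightarrow> pt" where x: "r > 0" "\<forall>n. ball (x n) r \<subseteq> fan_region \<mu>0 \<beta>"
    "\<forall>n m. n \<noteq> m \<longrightarrow> ball (x n) r \<inter> ball (x m) r = {}"
    using fan_region_disjoint_balls[OF L'(5)] by (elim exE conjE)
  have "\<exists>w :: nat \<Rightarrow> pt \<Rightarrow> st. (\<forall>n. wild (fan_region \<mu>0 \<beta>) (fan_state \<beta> A1 B1) ?C1 (w n)) \<and>
    (\<forall>n m. n \<noteq> m \<longrightarrow> \<not> (AE y in lborel. V1 (w n y) = V1 (w m y) \<and> V2 (w n y) = V2 (w m y)))"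
    by (rule wild_sequence[OF C(1) open_fan_region fan_state_subsol[OF L'(2,3)] x(1) x(2)[rule_format]]) (rule x(3)[rule_format])
  then obtain w :: "nat \<Rightarrow> pt \<Rightarrow> st" where W: "(\<forall>n. wild (fan_region \<mu>0 \<beta>) (fan_state \<beta> A1 B1) ?C1 (w n)) \<and>
    (\<forall>n m. n \<noteq> m \<longrightarrow> \<not> (AE y in lborel. V1 (w n y) = V1 (w m y) \<and> V2 (w n y) = V2 (w m y)))" ..
  note w = W[THEN conjunct1, THEN spec] and ne = W[THEN conjunct2, THEN spec, THEN spec, THEN mp]
  \<comment> \<open>One wild field is kept fixed in the right region; the solutions differ only in
    the left one.\<close>
  obtain w' where w': "wild (fan_region \<beta> \<mu>2) (fan_state \<beta> A2 B2) ?C2 w'"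
    using wild_exists[OF C(2) open_fan_region fan_state_subsol[OF R'(2,3)]] ..
  define \<rho> where "\<rho> = stepf \<mu>0 \<beta> \<mu>2 rl r1 r2 rr"
  define P where "P = stepf \<mu>0 \<beta> \<mu>2 pl p p pr"
  define v1 where "v1 n = (\<lambda>y. V1 (w n y) + V1 (w' y))" for n
  define v2 where "v2 n = (\<lambda>y. stepf \<mu>0 \<beta> \<mu>2 (snd vl) \<beta> \<beta> (snd vr) y + (V2 (w n y) + V2 (w' y)))" for n
  define U where "U n = (\<rho>, v1 n, v2 n, P)" for n
  note sol = fan_solution[OF L'(5) R'(5) assms(2,4,3,5) L'(1) R'(1) p _ fan_shockD(6-9)[OF L] fan_shock_mirror[OF R] w w',
      folded \<rho>_def P_def v1_def v2_def vlr]
  have dis: "\<not> (AE y in lborel. y \<in> Hplus \<longrightarrow> qval (U n) y = qval (U m) y)" if nm: "n \<noteq> m" for n m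
  proof
    assume "AE y in lborel. y \<in> Hplus \<longrightarrow> qval (U n) y = qval (U m) y"
    then have "AE y in lborel. V1 (w n y) = V1 (w m y) \<and> V2 (w n y) = V2 (w m y)"
    proof eventually_elim
      case (elim y)
      show ?case
      proof (cases "y \<in> Hplus")
        case True with elim show ?thesis by (simp add: qval_def U_def v1_def v2_def)
      next
        case False
        \<comment> \<open>The fluctuations vanish for t \<le> 0, so agreement on the half-space
          extends to all of space-time, where the separation was proved.\<close>
        then have "y \<notin> fan_region \<mu>0 \<beta>" by (simp add: Hplus_def fan_region_def)
        then show ?thesis using wild_D(2)[OF w] by simp
      qed
    qed
    then show False using ne[OF nm] by blast
  qed
  have inj: "inj U"
  proof (rule injI, rule ccontr)
    fix n m assume "U n = U m" "n \<noteq> m"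
    then show False using dis[OF \<open>n \<noteq> m\<close>] by simp
  qed
  show ?thesis
  proof (intro exI conjI ballI impI)
    show "infinite (range U)" by (rule range_inj_infinite[OF inj])
    show "case V of (\<rho>, v1, v2, p) \<Rightarrow> admissible_sol cv rl vl pl rr vr pr \<rho> v1 v2 p \<and> is_2fan rl vl pl rr vr pr \<rho> v1 v2 p"
      if "V \<in> range U" for V
    proof -
      from that obtain n where V: "V = U n" by blast
      show ?thesis unfolding V U_def prod.case by (rule conjI[OF sol]) (simp_all add: L'(4) R'(4))
    qed
    show "\<not> (AE y in lborel. y \<in> Hplus \<longrightarrow> qval V y = qval W y)" if "V \<in> range U" "W \<in> range U" "V \<noteq> W" for V W
    proof -
      from that obtain n m where V: "V = U n" "W = U m" by blast
      with that(3) have "n \<noteq> m" by blast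
      then show ?thesis unfolding V by (rule dis)
    qed
  qed
qed

end
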